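(* Let $\Phi$ be the $L$-periodic solution of the Cahn-Hilliard problem $\partial_t\Phi=\Delta[F'(\Phi)-\epsilon^2\Delta\Phi]$ on $\Omega=(0,L)^2$, $0<t\le T$, with $F(\Phi)=\frac14(\Phi^2-1)^2$ and initial data $\Phi^0$. Assume that there are integers $m\ge 1$, $p\ge 1$ and a constant $C_0>0$ such that $$\|\Phi^0\|_{H^{m+4}}+\sum_{k=0}^{2}\|\partial_t^{(k)}\Phi(t)\|_{H^{m+4-k}}+\sum_{k=3}^{p+1}\|\partial_t^{(k)}\Phi(t)\|_{L^2}\le C_0\quad\text{for } 0<t<T.$$ Assume that the differentiation matrix $D_{\mathrm R}=(d^{(R)}_{ij})=A_{\mathrm E}^{-1}E_{s_{\mathrm I}}$ of the R-IERK method and its inverse $D_{\mathrm R}^{-1}$ are positive definite. Assume that, with constants $K_1,K_T$ independent of the meshes, the temporal stage defects satisfy $\|\zeta_{\mathrm R}^{n,i+1}\|_{L^2}\le K_1\tau_n$ for $1\le n\le N$, $1\le i\le s_{\mathrm I}$, and $N\tau\le K_TT$, where $\tau=\max_n\tau_n$. Let $\hat K_4^*:=K_\phi+\epsilon^2$, where $K_\phi$ is a constant independent of $\tau_n$ and $h$ with $\|P_MU^{n,i}\|_\infty\le K_\phi/\epsilon^2$ for all $1\le n\le N$, $1\le i\le s$. If the spatial length $h$ and the maximum step size $\tau$ are sufficiently small, and the stabilization parameter $\kappa$ is large enough that $$\kappa\ge\max_{\|\xi\|_\infty\le \hat K_4^*/\epsilon^2}\|F''(\xi)\|_\infty ,$$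 then the stage solutions $u_h^{n,i}$ of the fully discrete R-IERK method are bounded in the maximum norm (by a constant independent of $\tau_n$ and $h$, for all $1\le n\le N$, $1\le i\le s$), and they preserve the original energy dissipation law at all stages in the sense that $$E[u^{n,j+1}]-E[u^{n,1}]\le\frac1{\tau_n}\sum_{k=1}^{j}\Big\langle\Delta_h^{-1}\delta_\tau u^{n,k+1},\ \sum_{\ell=1}^{k}d^{(R)}_{k\ell}\,\delta_\tau u^{n,\ell+1}\Big\rangle\quad\text{for }1\le n\le N,\ 1\le j\le s_{\mathrm I}.$$
   Context: Let $\Omega=(0,L)^2$ and $0<\epsilon<1$; all functions are $L$-periodic in each direction, and $H^q$ denotes the periodic Sobolev space $H^q_{per}(\Omega)$. For $\kappa\ge0$ put $L_\kappa v=-\epsilon^2\Delta v+\kappa v$ and $f_\kappa(v)=\kappa v-F'(v)$. Space discretization (Fourier pseudo-spectral): $M$ is an even positive integer, $h=L/M$, $\Omega_h=\{(ih,jh):1\le i,j\le M\}$. For an $L$-periodic grid function $v$, let $\tilde v_{\ell,m}$, $-M/2\le\ell,m\le M/2-1$, be its discrete Fourier (trigonometric interpolation) coefficients with respect to $e_{\ell,m}(x,y)=e^{\mathrm i\nu(\ell x+my)}$, $\nu=2\pi/L$. Define $\mathcal D_xv_h=\sum_{\ell,m}(\mathrm i\nu\ell)\tilde v_{\ell,m}e_{\ell,m}(\boldsymbol x_h)$, $\mathcal D_x^2v_h=\sum_{\ell,m}(\mathrm i\nu\ell)^2\tilde v_{\ell,m}e_{\ell,m}(\boldsymbol x_h)$,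 similarly $\mathcal D_y,\mathcal D_y^2$, and $\nabla_h=(\mathcal D_x,\mathcal D_y)^T$, $\Delta_h=\mathcal D_x^2+\mathcal D_y^2$, $L_{\kappa,h}=-\epsilon^2\Delta_h+\kappa$. $\Delta_h^{-1}$ is the inverse of $\Delta_h$ on mean-zero grid functions. Discrete inner product $\langle v,w\rangle=h^2\sum_{\boldsymbol x_h\in\Omega_h}v_hw_h$, norm $\|v\|=\sqrt{\langle v,v\rangle}$, $\|v\|_\infty=\max_{\boldsymbol x_h\in\Omega_h}|v_h|$. The discrete energy is $E[v]=\frac{\epsilon^2}2\|\nabla_hv\|^2+\langle F(v),1\rangle$. $P_M$ is the $L^2(\Omega)$-orthogonal projection onto the span of the $e_{\ell,m}$, $-M/2\le\ell,m\le M/2-1$. Time mesh: $0=t_0<t_1<\dots<t_N=T$, $\tau_n=t_n-t_{n-1}$, $\tau=\max_n\tau_n$. Method: $s\ge2$ stages, $s_{\mathrm I}:=s-1$; real coefficients $\hat a_{i+1,j}$ ($1\le j\le i\le s_{\mathrm I}$) with $\hat a_{k+1,k}\ne0$; abscissas $c_1=0$, $c_{i+1}=\sum_{j=1}^{i}\hat a_{i+1,j}$, $c_i>0$ for $2\le i\le s-1$, $c_s=1$. $A_{\mathrm E}:=(\hat a_{i+1,j})_{i,j=1}^{s_{\mathrm I}}$ (lower triangular), and $E_{s_{\mathrm I}}$ is the lower triangular matrix with all entries on and below the diagonal equal to $1$. A (not necessarily symmetric) real matrix $D$ is positive definite if $(D+D^T)/2$ is positive definite. Write $\delta_\tau v^{n,\ell+1}=v^{n,\ell+1}-v^{n,\ell}$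 and $v^{n,j+\frac12}=\frac12(v^{n,j}+v^{n,j+1})$. Fully discrete R-IERK (refined implicit-explicit Runge-Kutta) method: $$u_h^{n,i+1}=u_h^{n,1}+\tau_n\sum_{j=1}^{i}\hat a_{i+1,j}\Delta_h\big[L_{\kappa,h}u_h^{n,j+\frac12}-f_\kappa(u_h^{n,j})\big],\quad 1\le n\le N,\ 1\le i\le s_{\mathrm I},$$ with $u_h^{1,1}=P_M\Phi^0$ on the grid and $u_h^{n+1,1}=u_h^{n,s}$. Time-discrete solutions $U^{n,i}$: defined by the same formula with $\Delta,L_\kappa$ in place of $\Delta_h,L_{\kappa,h}$, namely $U^{n,i+1}=U^{n,1}+\tau_n\sum_{j=1}^{i}\hat a_{i+1,j}\Delta[L_\kappa U^{n,j+\frac12}-f_\kappa(U^{n,j})]$, $U^{1,1}=\Phi^0$, $U^{n+1,1}=U^{n,s}$. Temporal defects $\zeta_{\mathrm R}^{n,i+1}$: with $\Phi^{n,i}:=\Phi(\cdot,t_{n-1}+c_i\tau_n)$, they are defined by $\Phi^{n,i+1}=\Phi^{n,1}+\tau_n\sum_{j=1}^{i}\hat a_{i+1,j}\Delta[L_\kappa\Phi^{n,j+\frac12}-f_\kappa(\Phi^{n,j})]+\tau_n\zeta_{\mathrm R}^{n,i+1}$. Constants, and the thresholds in "sufficiently small", may depend on $\epsilon,\kappa,T,\Omega$, the exact solution, the method coefficients, $K_1$ and $K_T$, but not on $h$, the time-steps $\tau_n$ or $N$. *)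

theory Defs
  imports "HOL-Analysis.Analysis" "Jordan_Normal_Form.Gauss_Jordan_Elimination"
begin

section \<open>Periodic functions on the square\<close>

text \<open>
  Functions on the torus are \<open>L\<close>-periodic functions on the plane. Elements of Lebesgue and Sobolev
  spaces are represented by Borel functions; equations between them are required almost everywhere.
\<close>

definition Omega :: "real \<Rightarrow> (real \<times> real) set" where
  "Omega L = {0<..<L} \<times> {0<..<L}"

definition periodic_fun :: "real \<Rightarrow> (real \<times> real \<Rightarrow> real) \<Rightarrow> bool" where
  "periodic_fun L v \<longleftrightarrow> (\<forall>x y. v (x + L, y) = v (x, y) \<and> v (x, y + L) = v (x, y))"

definition L2_per :: "real \<Rightarrow> (real \<times> real \<Rightarrow> real) set" where
  "L2_per L = {v. periodic_fun L v \<and> v \<in> borel_measurable borel \<and>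
                  set_integrable lborel (Omega L) (\<lambda>x. (v x)\<^sup>2)}"

definition L2_norm :: "real \<Rightarrow> (real \<times> real \<Rightarrow> real) \<Rightarrow> real" where
  "L2_norm L v = sqrt (LINT x:Omega L|lborel. (v x)\<^sup>2)"

definition freq :: "real \<Rightarrow> real" where
  "freq L = 2 * pi / L"

definition wave :: "real \<Rightarrow> int \<Rightarrow> int \<Rightarrow> real \<times> real \<Rightarrow> complex" where
  "wave L l m x = exp (\<i> * of_real (freq L * (of_int l * fst x + of_int m * snd x)))"

definition fourier_coeff :: "real \<Rightarrow> (real \<times> real \<Rightarrow> real) \<Rightarrow> int \<Rightarrow> int \<Rightarrow> complex" where
  "fourier_coeff L v l m =
     (LINT x:Omega L|lborel. of_real (v x) * cnj (wave L l m x)) / of_real (L\<^sup>2)"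

text \<open>
  The periodic Sobolev space of order \<open>q\<close>. The norm is normalised so that order \<open>0\<close> gives the
  \<open>L\<^sup>2\<close> norm. Since \<^const>\<open>infsum\<close> of a non-summable family is \<open>0\<close>, bounds on \<open>H_norm\<close> have to be
  accompanied by membership in \<open>H_per\<close>.
\<close>

definition sobolev_term :: "real \<Rightarrow> nat \<Rightarrow> (real \<times> real \<Rightarrow> real) \<Rightarrow> int \<times> int \<Rightarrow> real" where
  "sobolev_term L q v = (\<lambda>(l, m).
     (1 + (freq L)\<^sup>2 * (of_int l ^ 2 + of_int m ^ 2)) ^ q * (cmod (fourier_coeff L v l m))\<^sup>2)"

definition H_per :: "real \<Rightarrow> nat \<Rightarrow> (real \<times> real \<Rightarrow> real) set" where
  "H_per L q = {v \<in> L2_per L. sobolev_term L q v summable_on UNIV}"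

definition H_norm :: "real \<Rightarrow> nat \<Rightarrow> (real \<times> real \<Rightarrow> real) \<Rightarrow> real" where
  "H_norm L q v = L * sqrt (infsum (sobolev_term L q v) UNIV)"

text \<open>
  The Laplacian in the sense of periodic distributions: integration by parts against all
  exponentials. It exists for \<open>v \<in> H_per L 2\<close> and is then unique up to null sets.
\<close>

definition is_laplacian ::
    "real \<Rightarrow> (real \<times> real \<Rightarrow> real) \<Rightarrow> (real \<times> real \<Rightarrow> real) \<Rightarrow> bool" where
  "is_laplacian L v w \<longleftrightarrow> v \<in> L2_per L \<and> w \<in> L2_per L \<and>
     (\<forall>l m. fourier_coeff L w l m =
        - of_real ((freq L)\<^sup>2 * (of_int l ^ 2 + of_int m ^ 2)) * fourier_coeff L v l m)"

definition laplacian :: "real \<Rightarrow> (real \<times> real \<Rightarrow> real) \<Rightarrow> (real \<times> real \<Rightarrow> real)" where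
  "laplacian L v = (SOME w. is_laplacian L v w)"

text \<open>\<open>g\<close> is the derivative at time \<open>t\<close>, relative to the set \<open>S\<close> of times, of the \<open>L\<^sup>2\<close>-valued map \<open>f\<close>.\<close>

definition L2_has_time_derivative ::
    "real \<Rightarrow> (real \<Rightarrow> real \<times> real \<Rightarrow> real) \<Rightarrow> (real \<times> real \<Rightarrow> real) \<Rightarrow> real \<Rightarrow> real set \<Rightarrow> bool" where
  "L2_has_time_derivative L f g t S \<longleftrightarrow>
     g \<in> L2_per L \<and> (\<forall>s\<in>S. f s \<in> L2_per L) \<and>
     ((\<lambda>s. L2_norm L (\<lambda>x. (f s x - f t x) / (s - t) - g x)) \<longlongrightarrow> 0) (at t within S)"


section \<open>The Cahn--Hilliard problem\<close>

definition F :: "real \<Rightarrow> real" where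
  "F v = (v\<^sup>2 - 1)\<^sup>2 / 4"

definition f_stab :: "real \<Rightarrow> real \<Rightarrow> real" where
  "f_stab \<kappa> v = \<kappa> * v - deriv F v"

definition L_stab :: "real \<Rightarrow> real \<Rightarrow> real \<Rightarrow> (real \<times> real \<Rightarrow> real) \<Rightarrow> (real \<times> real \<Rightarrow> real)" where
  "L_stab L \<epsilon> \<kappa> v = (\<lambda>x. - \<epsilon>\<^sup>2 * laplacian L v x + \<kappa> * v x)"

text \<open>The initial datum is \<open>\<Phi> 0\<close>; at \<open>t = T\<close> the time derivative is one-sided.\<close>

definition cahn_hilliard_solution ::
    "real \<Rightarrow> real \<Rightarrow> real \<Rightarrow> (real \<Rightarrow> real \<times> real \<Rightarrow> real) \<Rightarrow> bool" where
  "cahn_hilliard_solution L \<epsilon> T \<Phi> \<longleftrightarrow>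
     (\<forall>t\<in>{0..T}. \<Phi> t \<in> L2_per L) \<and>
     ((\<lambda>s. L2_norm L (\<lambda>x. \<Phi> s x - \<Phi> 0 x)) \<longlongrightarrow> 0) (at 0 within {0..T}) \<and>
     (\<forall>t\<in>{0<..T}. \<Phi> t \<in> H_per L 4 \<and>
        L2_has_time_derivative L \<Phi>
          (laplacian L (\<lambda>x. deriv F (\<Phi> t x) - \<epsilon>\<^sup>2 * laplacian L (\<Phi> t) x)) t {0..T})"

text \<open>In the following, \<open>\<Psi> k\<close> is the \<open>k\<close>-th time derivative of \<open>\<Phi>\<close>.\<close>

definition regular_solution ::
    "real \<Rightarrow> real \<Rightarrow> nat \<Rightarrow> nat \<Rightarrow> real \<Rightarrow> (real \<Rightarrow> real \<times> real \<Rightarrow> real) \<Rightarrow> bool" where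
  "regular_solution L T m p C\<^sub>0 \<Phi> \<longleftrightarrow>
     \<Phi> 0 \<in> H_per L (m + 4) \<and>
     (\<exists>\<Psi>. \<Psi> 0 = \<Phi> \<and>
        (\<forall>k\<le>p. \<forall>t\<in>{0<..<T}. L2_has_time_derivative L (\<Psi> k) (\<Psi> (Suc k) t) t {0<..<T}) \<and>
        (\<forall>t\<in>{0<..<T}.
           (\<forall>k\<le>2. \<Psi> k t \<in> H_per L (m + 4 - k)) \<and>
           (\<forall>k\<in>{3..p+1}. \<Psi> k t \<in> L2_per L) \<and>
           H_norm L (m + 4) (\<Phi> 0) + (\<Sum>k\<le>2. H_norm L (m + 4 - k) (\<Psi> k t))
             + (\<Sum>k=3..p+1. L2_norm L (\<Psi> k t)) \<le> C\<^sub>0))"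


section \<open>The Runge--Kutta method\<close>

text \<open>
  \<open>a (i + 1) j\<close> for \<open>1 \<le> j \<le> i \<le> s - 1\<close> are the coefficients of the method; other values of \<open>a\<close>
  are irrelevant.
\<close>

definition abscissa :: "(nat \<Rightarrow> nat \<Rightarrow> real) \<Rightarrow> nat \<Rightarrow> real" where
  "abscissa a i = (\<Sum>j=1..i-1. a i j)"

definition rierk_method :: "nat \<Rightarrow> (nat \<Rightarrow> nat \<Rightarrow> real) \<Rightarrow> bool" where
  "rierk_method s a \<longleftrightarrow> 2 \<le> s \<and> (\<forall>k\<in>{1..s-1}. a (k + 1) k \<noteq> 0) \<and>
     (\<forall>i\<in>{2..s-1}. abscissa a i > 0) \<and> abscissa a s = 1"

text \<open>Matrix indices start at \<open>0\<close>: the entry \<open>(i, j)\<close> of \<open>A_E s a\<close> is \<open>a (i + 2) (j + 1)\<close>.\<close>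

definition A_E :: "nat \<Rightarrow> (nat \<Rightarrow> nat \<Rightarrow> real) \<Rightarrow> real mat" where
  "A_E s a = Matrix.mat (s - 1) (s - 1) (\<lambda>(i, j). if j \<le> i then a (i + 2) (j + 1) else 0)"

definition E_low :: "nat \<Rightarrow> real mat" where
  "E_low n = Matrix.mat n n (\<lambda>(i, j). if j \<le> i then 1 else 0)"

definition D_R :: "nat \<Rightarrow> (nat \<Rightarrow> nat \<Rightarrow> real) \<Rightarrow> real mat" where
  "D_R s a = the (mat_inverse (A_E s a)) * E_low (s - 1)"

definition d_R :: "nat \<Rightarrow> (nat \<Rightarrow> nat \<Rightarrow> real) \<Rightarrow> nat \<Rightarrow> nat \<Rightarrow> real" where
  "d_R s a k l = D_R s a $$ (k - 1, l - 1)"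

definition sym_pos_def :: "real mat \<Rightarrow> bool" where
  "sym_pos_def S \<longleftrightarrow> square_mat S \<and> transpose_mat S = S \<and>
     (\<forall>x\<in>carrier_vec (dim_row S). x \<noteq> 0\<^sub>v (dim_row S) \<longrightarrow> scalar_prod x (S *\<^sub>v x) > 0)"

definition pos_def :: "real mat \<Rightarrow> bool" where
  "pos_def D \<longleftrightarrow> square_mat D \<and> sym_pos_def ((1/2) \<cdot>\<^sub>m (D + transpose_mat D))"


section \<open>Time discretization\<close>

definition time_mesh :: "real \<Rightarrow> nat \<Rightarrow> (nat \<Rightarrow> real) \<Rightarrow> bool" where
  "time_mesh T N t \<longleftrightarrow> N \<ge> 1 \<and> t 0 = 0 \<and> t N = T \<and> (\<forall>n\<in>{1..N}. t (n - 1) < t n)"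

definition tau :: "(nat \<Rightarrow> real) \<Rightarrow> nat \<Rightarrow> real" where
  "tau t n = t n - t (n - 1)"

definition max_tau :: "(nat \<Rightarrow> real) \<Rightarrow> nat \<Rightarrow> real" where
  "max_tau t N = Max (tau t ` {1..N})"

definition stage_rhs ::
    "real \<Rightarrow> real \<Rightarrow> real \<Rightarrow> (nat \<Rightarrow> real \<times> real \<Rightarrow> real) \<Rightarrow> nat \<Rightarrow> (real \<times> real \<Rightarrow> real)" where
  "stage_rhs L \<epsilon> \<kappa> V j =
     laplacian L (\<lambda>x. L_stab L \<epsilon> \<kappa> (\<lambda>y. (V j y + V (j + 1) y) / 2) x - f_stab \<kappa> (V j x))"

definition time_discrete_solution ::
    "real \<Rightarrow> real \<Rightarrow> real \<Rightarrow> nat \<Rightarrow> (nat \<Rightarrow> nat \<Rightarrow> real) \<Rightarrow> nat \<Rightarrow> (nat \<Rightarrow> real) \<Rightarrow>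
     (real \<times> real \<Rightarrow> real) \<Rightarrow> (nat \<Rightarrow> nat \<Rightarrow> real \<times> real \<Rightarrow> real) \<Rightarrow> bool" where
  "time_discrete_solution L \<epsilon> \<kappa> s a N t \<Phi>\<^sub>0 U \<longleftrightarrow>
     (\<forall>n\<in>{1..N}. \<forall>i\<in>{1..s}. U n i \<in> H_per L 4) \<and>
     (AE x in lborel. U 1 1 x = \<Phi>\<^sub>0 x) \<and>
     (\<forall>n\<in>{1..<N}. AE x in lborel. U (n + 1) 1 x = U n s x) \<and>
     (\<forall>n\<in>{1..N}. \<forall>i\<in>{1..s-1}. AE x in lborel.
        U n (i + 1) x = U n 1 x + tau t n * (\<Sum>j=1..i. a (i + 1) j * stage_rhs L \<epsilon> \<kappa> (U n) j x))"

definition stage_value ::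
    "(nat \<Rightarrow> nat \<Rightarrow> real) \<Rightarrow> (nat \<Rightarrow> real) \<Rightarrow> (real \<Rightarrow> real \<times> real \<Rightarrow> real) \<Rightarrow> nat \<Rightarrow> nat \<Rightarrow>
     (real \<times> real \<Rightarrow> real)" where
  "stage_value a t \<Phi> n i = \<Phi> (t (n - 1) + abscissa a i * tau t n)"

definition defect ::
    "real \<Rightarrow> real \<Rightarrow> real \<Rightarrow> (nat \<Rightarrow> nat \<Rightarrow> real) \<Rightarrow> (nat \<Rightarrow> real) \<Rightarrow> (real \<Rightarrow> real \<times> real \<Rightarrow> real) \<Rightarrow>
     nat \<Rightarrow> nat \<Rightarrow> (real \<times> real \<Rightarrow> real)" where
  "defect L \<epsilon> \<kappa> a t \<Phi> n k = (\<lambda>x.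
     (stage_value a t \<Phi> n k x - stage_value a t \<Phi> n 1 x
        - tau t n * (\<Sum>j=1..k-1. a k j * stage_rhs L \<epsilon> \<kappa> (stage_value a t \<Phi> n) j x)) / tau t n)"

text \<open>
  An abscissa may exceed \<open>1\<close>, so that stage times may lie beyond \<open>T\<close>; the defects are then formed
  with the values of \<open>\<Phi>\<close> there, which have to be regular enough for the Laplacians to exist.
\<close>

definition defects_bounded ::
    "real \<Rightarrow> real \<Rightarrow> real \<Rightarrow> nat \<Rightarrow> (nat \<Rightarrow> nat \<Rightarrow> real) \<Rightarrow> nat \<Rightarrow> (nat \<Rightarrow> real) \<Rightarrow>
     (real \<Rightarrow> real \<times> real \<Rightarrow> real) \<Rightarrow> real \<Rightarrow> bool" where
  "defects_bounded L \<epsilon> \<kappa> s a N t \<Phi> K\<^sub>1 \<longleftrightarrow>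
     (\<forall>n\<in>{1..N}. \<forall>i\<in>{1..s}. stage_value a t \<Phi> n i \<in> H_per L 4) \<and>
     (\<forall>n\<in>{1..N}. \<forall>i\<in>{1..s-1}. L2_norm L (defect L \<epsilon> \<kappa> a t \<Phi> n (i + 1)) \<le> K\<^sub>1 * tau t n)"


section \<open>Fourier pseudo-spectral discretization\<close>

text \<open>
  A grid function is a doubly \<open>M\<close>-periodic function of the integer indices \<open>(i, j)\<close> of the points
  \<open>(i h, j h)\<close>, where \<open>h = L / M\<close>.
\<close>

definition grid_fun :: "nat \<Rightarrow> (int \<Rightarrow> int \<Rightarrow> real) set" where
  "grid_fun M = {v. \<forall>i j. v (i + int M) j = v i j \<and> v i (j + int M) = v i j}"

definition grid_point :: "real \<Rightarrow> nat \<Rightarrow> int \<Rightarrow> int \<Rightarrow> real \<times> real" where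
  "grid_point L M i j = (of_int i * (L / real M), of_int j * (L / real M))"

definition modes :: "nat \<Rightarrow> int set" where
  "modes M = {- (int M div 2) .. int M div 2 - 1}"

definition dft :: "real \<Rightarrow> nat \<Rightarrow> (int \<Rightarrow> int \<Rightarrow> real) \<Rightarrow> int \<Rightarrow> int \<Rightarrow> complex" where
  "dft L M v l m =
     (\<Sum>i=1..int M. \<Sum>j=1..int M. of_real (v i j) * cnj (wave L l m (grid_point L M i j)))
       / of_nat (M\<^sup>2)"

definition Dx :: "real \<Rightarrow> nat \<Rightarrow> (int \<Rightarrow> int \<Rightarrow> real) \<Rightarrow> int \<Rightarrow> int \<Rightarrow> complex" where
  "Dx L M v i j = (\<Sum>l\<in>modes M. \<Sum>m\<in>modes M.
     (\<i> * of_real (freq L) * of_int l) * dft L M v l m * wave L l m (grid_point L M i j))"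

definition Dy :: "real \<Rightarrow> nat \<Rightarrow> (int \<Rightarrow> int \<Rightarrow> real) \<Rightarrow> int \<Rightarrow> int \<Rightarrow> complex" where
  "Dy L M v i j = (\<Sum>l\<in>modes M. \<Sum>m\<in>modes M.
     (\<i> * of_real (freq L) * of_int m) * dft L M v l m * wave L l m (grid_point L M i j))"

definition Dxx :: "real \<Rightarrow> nat \<Rightarrow> (int \<Rightarrow> int \<Rightarrow> real) \<Rightarrow> int \<Rightarrow> int \<Rightarrow> complex" where
  "Dxx L M v i j = (\<Sum>l\<in>modes M. \<Sum>m\<in>modes M.
     (\<i> * of_real (freq L) * of_int l)\<^sup>2 * dft L M v l m * wave L l m (grid_point L M i j))"

definition Dyy :: "real \<Rightarrow> nat \<Rightarrow> (int \<Rightarrow> int \<Rightarrow> real) \<Rightarrow> int \<Rightarrow> int \<Rightarrow> complex" where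
  "Dyy L M v i j = (\<Sum>l\<in>modes M. \<Sum>m\<in>modes M.
     (\<i> * of_real (freq L) * of_int m)\<^sup>2 * dft L M v l m * wave L l m (grid_point L M i j))"

text \<open>
  For even \<open>M\<close>, taking real parts loses nothing, see \<open>of_real_lap_h\<close> below. This is not so for
  \<open>Dx\<close> and \<open>Dy\<close>, whose values at real grid functions are complex because the mode \<open>- M / 2\<close>
  has no partner \<open>M / 2\<close>.
\<close>

definition lap_h :: "real \<Rightarrow> nat \<Rightarrow> (int \<Rightarrow> int \<Rightarrow> real) \<Rightarrow> int \<Rightarrow> int \<Rightarrow> real" where
  "lap_h L M v i j = Re (Dxx L M v i j + Dyy L M v i j)"

lemma sum_modes_uminus:
  fixes g :: "int \<Rightarrow> complex"
  assumes M: "even M" "M > 0" and g: "g (int M div 2) = g (- (int M div 2))"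
  shows "(\<Sum>l\<in>modes M. g (- l)) = (\<Sum>l\<in>modes M. g l)"
proof -
  define K where "K = int M div 2"
  have K: "K > 0" using M unfolding K_def by presburger
  have modes: "modes M = insert (- K) {- K + 1..K - 1}"
    using K unfolding modes_def K_def by auto
  have "(\<Sum>l\<in>{- K + 1..K - 1}. g (- l)) = (\<Sum>l\<in>{- K + 1..K - 1}. g l)"
    by (rule sum.reindex_bij_witness[of _ uminus uminus]) auto
  then show ?thesis
    unfolding modes using g by (simp add: K_def)
qed

lemma wave_shift:
  assumes "L \<noteq> 0" "M > 0"
  shows "wave L (l + int M) m (grid_point L M i j) = wave L l m (grid_point L M i j)"
    and "wave L l (m + int M) (grid_point L M i j) = wave L l m (grid_point L M i j)"
proof -
  have *: "exp (\<i> * of_real (x + of_int k * (2 * pi))) = exp (\<i> * of_real x)" for x :: real and k :: int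
    using exp_plus_2pin[of "\<i> * of_real x" k] by (simp add: algebra_simps)
  have "freq L * (of_int (l + int M) * (of_int i * (L / real M)) + of_int m * (of_int j * (L / real M)))
      = freq L * (of_int l * (of_int i * (L / real M)) + of_int m * (of_int j * (L / real M)))
        + of_int i * (2 * pi)"
    using assms by (simp add: freq_def field_simps)
  then show "wave L (l + int M) m (grid_point L M i j) = wave L l m (grid_point L M i j)"
    unfolding wave_def grid_point_def by (simp only: fst_conv snd_conv *)
  have "freq L * (of_int l * (of_int i * (L / real M)) + of_int (m + int M) * (of_int j * (L / real M)))
      = freq L * (of_int l * (of_int i * (L / real M)) + of_int m * (of_int j * (L / real M)))
        + of_int j * (2 * pi)"
    using assms by (simp add: freq_def field_simps)
  then show "wave L l (m + int M) (grid_point L M i j) = wave L l m (grid_point L M i j)"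
    unfolding wave_def grid_point_def by (simp only: fst_conv snd_conv *)
qed

lemma cnj_wave: "cnj (wave L l m x) = wave L (- l) (- m) x"
  by (simp add: wave_def exp_cnj algebra_simps)

lemma cnj_dft: "cnj (dft L M v l m) = dft L M v (- l) (- m)"
  by (simp add: dft_def cnj_wave)

lemma sum_modes_real:
  assumes M: "even M" "M > 0" and L: "L \<noteq> 0"
    and c: "\<And>l m. c (- l) (- m) = c l m" "c (int M div 2) = c (- (int M div 2))"
      "\<And>l. c l (int M div 2) = c l (- (int M div 2))"
  shows "(\<Sum>l\<in>modes M. \<Sum>m\<in>modes M.
           of_real (c l m) * dft L M v l m * wave L l m (grid_point L M i j)) \<in> \<real>" (is "?S \<in> _")
proof -
  define g where "g l m = of_real (c l m) * dft L M v l m * wave L l m (grid_point L M i j)" for l m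
  define K where "K = int M div 2"
  have K: "K = - K + int M" using M unfolding K_def by presburger
  have d1: "dft L M v K m = dft L M v (- K) m" for m
    by (subst K) (simp only: dft_def wave_shift[OF L M(2)])
  have d2: "dft L M v l K = dft L M v l (- K)" for l
    by (subst K) (simp only: dft_def wave_shift[OF L M(2)])
  have w1: "wave L K m (grid_point L M i j) = wave L (- K) m (grid_point L M i j)" for m
    by (subst K) (simp only: wave_shift[OF L M(2)])
  have w2: "wave L l K (grid_point L M i j) = wave L l (- K) (grid_point L M i j)" for l
    by (subst K) (simp only: wave_shift[OF L M(2)])
  have g1: "g K m = g (- K) m" for m
    using c(2) by (simp add: g_def d1 w1 K_def[symmetric])
  have g2: "g l K = g l (- K)" for l
    using c(3) by (simp add: g_def d2 w2 K_def[symmetric])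
  have "cnj ?S = (\<Sum>l\<in>modes M. \<Sum>m\<in>modes M. g (- l) (- m))"
    by (simp add: g_def cnj_dft cnj_wave c(1))
  also have "\<dots> = (\<Sum>l\<in>modes M. \<Sum>m\<in>modes M. g (- l) m)"
    by (intro sum.cong refl sum_modes_uminus M) (use g2 K_def in auto)
  also have "\<dots> = (\<Sum>l\<in>modes M. \<Sum>m\<in>modes M. g l m)"
    by (intro sum_modes_uminus[of M "\<lambda>l. \<Sum>m\<in>modes M. g l m"] M) (use g1 K_def in auto)
  finally have "cnj ?S = ?S" by (simp add: g_def)
  then show ?thesis by (simp add: Reals_cnj_iff)
qed

lemma of_real_lap_h:
  assumes "even M" "M > 0" "L \<noteq> 0"
  shows "of_real (lap_h L M v i j) = Dxx L M v i j + Dyy L M v i j"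
proof -
  have "Dxx L M v i j \<in> \<real>"
    using sum_modes_real[OF assms, of "\<lambda>l m. - (freq L * of_int l)\<^sup>2" v i j]
    by (simp add: Dxx_def power_mult_distrib)
  moreover have "Dyy L M v i j \<in> \<real>"
    using sum_modes_real[OF assms, of "\<lambda>l m. - (freq L * of_int m)\<^sup>2" v i j]
    by (simp add: Dyy_def power_mult_distrib)
  ultimately show ?thesis
    unfolding lap_h_def by simp
qed

definition lap_h_inv :: "real \<Rightarrow> nat \<Rightarrow> (int \<Rightarrow> int \<Rightarrow> real) \<Rightarrow> int \<Rightarrow> int \<Rightarrow> real" where
  "lap_h_inv L M = inv_into {w \<in> grid_fun M. (\<Sum>i=1..int M. \<Sum>j=1..int M. w i j) = 0} (lap_h L M)"

definition L_stab_h ::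
    "real \<Rightarrow> nat \<Rightarrow> real \<Rightarrow> real \<Rightarrow> (int \<Rightarrow> int \<Rightarrow> real) \<Rightarrow> int \<Rightarrow> int \<Rightarrow> real" where
  "L_stab_h L M \<epsilon> \<kappa> v i j = - \<epsilon>\<^sup>2 * lap_h L M v i j + \<kappa> * v i j"

definition inner_h ::
    "real \<Rightarrow> nat \<Rightarrow> (int \<Rightarrow> int \<Rightarrow> real) \<Rightarrow> (int \<Rightarrow> int \<Rightarrow> real) \<Rightarrow> real" where
  "inner_h L M v w = (L / real M)\<^sup>2 * (\<Sum>i=1..int M. \<Sum>j=1..int M. v i j * w i j)"

definition max_norm_h :: "nat \<Rightarrow> (int \<Rightarrow> int \<Rightarrow> real) \<Rightarrow> real" where
  "max_norm_h M v = Max ((\<lambda>(i, j). \<bar>v i j\<bar>) ` ({1..int M} \<times> {1..int M}))"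

definition grad_norm_h :: "real \<Rightarrow> nat \<Rightarrow> (int \<Rightarrow> int \<Rightarrow> real) \<Rightarrow> real" where
  "grad_norm_h L M v = sqrt ((L / real M)\<^sup>2 *
     (\<Sum>i=1..int M. \<Sum>j=1..int M. (cmod (Dx L M v i j))\<^sup>2 + (cmod (Dy L M v i j))\<^sup>2))"

definition energy_h :: "real \<Rightarrow> nat \<Rightarrow> real \<Rightarrow> (int \<Rightarrow> int \<Rightarrow> real) \<Rightarrow> real" where
  "energy_h L M \<epsilon> v =
     \<epsilon>\<^sup>2 / 2 * (grad_norm_h L M v)\<^sup>2 + inner_h L M (\<lambda>i j. F (v i j)) (\<lambda>i j. 1)"

text \<open>
  The exponentials are orthogonal, so the \<open>L\<^sup>2\<close> projection onto their span is the truncated Fourier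
  series. It need not be real for real \<open>v\<close>, again because of the unpaired modes \<open>- M / 2\<close>; for grid
  values the real part is taken.
\<close>

definition P_M :: "real \<Rightarrow> nat \<Rightarrow> (real \<times> real \<Rightarrow> real) \<Rightarrow> real \<times> real \<Rightarrow> complex" where
  "P_M L M v x = (\<Sum>l\<in>modes M. \<Sum>m\<in>modes M. fourier_coeff L v l m * wave L l m x)"

definition P_M_grid :: "real \<Rightarrow> nat \<Rightarrow> (real \<times> real \<Rightarrow> real) \<Rightarrow> int \<Rightarrow> int \<Rightarrow> real" where
  "P_M_grid L M v i j = Re (P_M L M v (grid_point L M i j))"

definition stage_rhs_h ::
    "real \<Rightarrow> nat \<Rightarrow> real \<Rightarrow> real \<Rightarrow> (nat \<Rightarrow> int \<Rightarrow> int \<Rightarrow> real) \<Rightarrow> nat \<Rightarrow> int \<Rightarrow> int \<Rightarrow> real" where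
  "stage_rhs_h L M \<epsilon> \<kappa> V k =
     lap_h L M (\<lambda>i j. L_stab_h L M \<epsilon> \<kappa> (\<lambda>i j. (V k i j + V (k + 1) i j) / 2) i j
                        - f_stab \<kappa> (V k i j))"

definition fully_discrete_solution ::
    "real \<Rightarrow> nat \<Rightarrow> real \<Rightarrow> real \<Rightarrow> nat \<Rightarrow> (nat \<Rightarrow> nat \<Rightarrow> real) \<Rightarrow> nat \<Rightarrow> (nat \<Rightarrow> real) \<Rightarrow>
     (real \<times> real \<Rightarrow> real) \<Rightarrow> (nat \<Rightarrow> nat \<Rightarrow> int \<Rightarrow> int \<Rightarrow> real) \<Rightarrow> bool" where
  "fully_discrete_solution L M \<epsilon> \<kappa> s a N t \<Phi>\<^sub>0 u \<longleftrightarrow>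
     (\<forall>n\<in>{1..N}. \<forall>k\<in>{1..s}. u n k \<in> grid_fun M) \<and>
     u 1 1 = P_M_grid L M \<Phi>\<^sub>0 \<and>
     (\<forall>n\<in>{1..<N}. u (n + 1) 1 = u n s) \<and>
     (\<forall>n\<in>{1..N}. \<forall>k\<in>{1..s-1}. \<forall>i j.
        u n (k + 1) i j = u n 1 i j
          + tau t n * (\<Sum>q=1..k. a (k + 1) q * stage_rhs_h L M \<epsilon> \<kappa> (u n) q i j))"

definition delta_stage :: "(nat \<Rightarrow> int \<Rightarrow> int \<Rightarrow> real) \<Rightarrow> nat \<Rightarrow> int \<Rightarrow> int \<Rightarrow> real" where
  "delta_stage V k i j = V k i j - V (k - 1) i j"

end

theory Submission imports Defs "Jordan_Normal_Form.Determinant" begin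

text \<open>
  Everything takes place on the level of Fourier coefficients. A solution of the R-IERK scheme, whether
  its frequencies are all of the lattice (time-discrete) or a finite window with differences taken modulo
  \<open>M\<close> (fully discrete), satisfies the same recursion with a convolution cube as nonlinearity. Expressing
  the stage increments through the differentiation matrix and testing with them, mode by mode, the
  positive definiteness of \<open>D_R\<close> absorbs the nonlinear terms and yields, with Gronwall's inequality and the
  algebra property of \<open>H\<^sup>2\<close>, stability in the weighted \<open>\<ell>\<^sup>2\<close> norm of \<open>H\<^sup>2\<close>. Both solutions are compared with
  one reference solution built from \<open>\<Phi>\<close> and \<open>\<partial>\<^sub>t\<Phi>\<close>; the defects are of order \<open>\<tau>\<close> plus the aliasing error
  \<open>h\<^sup>2\<close>. Hence \<open>u - P_M U\<close> is at most \<open>1\<close> in the maximum norm, so \<open>u\<close> stays below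
  \<open>(K\<^sub>\<phi> + \<epsilon>\<^sup>2) / \<epsilon>\<^sup>2\<close>, where \<open>F'' \<le> \<kappa>\<close>. The energy law then follows by testing the stage equations
  with \<open>\<Delta>\<^sub>h\<^sup>-\<^sup>1 \<delta>u\<close>.
\<close>

section \<open>Weighted square-summable families and convolutions\<close>

text \<open>The obstacle is a nonlinearity that is only locally Lipschitz, while no bound for
  \<open>U\<close> or \<open>u\<close> that is uniform in the meshes and strong enough for aliasing
  estimates is known beforehand. The exact solution has one, so consistency and aliasing errors are
  evaluated at its affine reference, and neither numerical solution is inserted into the scheme of
  the other. Order \<open>H^2\<close> fits from two sides: in two dimensions it is an algebra of
  bounded functions, and testing with stage increments controls the square root of
  \<open>lam (\<epsilon>^2 lam + \<kappa>)\<close>, a norm in which the forcing, the Laplacian of a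
  cube, is square summable. As the forcing of a stage uses earlier stages only, closeness to the
  reference propagates from stage to stage. The error only has to fall below a fixed threshold,
  since \<open>(K\<^sub>\<phi> + \<epsilon>\<^sup>2) / \<epsilon>\<^sup>2\<close> leaves room 1
  around the bound for \<open>P_M U\<close>. Norms occur as bounds on finite partial sums, which
  treats finite windows and the full lattice alike.\<close>

definition wbound :: "('k \<Rightarrow> real) \<Rightarrow> 'k set \<Rightarrow> ('k \<Rightarrow> complex) \<Rightarrow> real \<Rightarrow> bool" where
  "wbound w K c B \<longleftrightarrow> (\<forall>S. finite S \<longrightarrow> S \<subseteq> K \<longrightarrow> L2_set (\<lambda>k. w k * cmod (c k)) S \<le> B)"

lemma wboundI: "(\<And>S. finite S \<Longrightarrow> S \<subseteq> K \<Longrightarrow> L2_set (\<lambda>k. w k * cmod (c k)) S \<le> B) \<Longrightarrow> wbound w K c B"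
  by (simp add: wbound_def)

lemma wboundD: "wbound w K c B \<Longrightarrow> finite S \<Longrightarrow> S \<subseteq> K \<Longrightarrow> L2_set (\<lambda>k. w k * cmod (c k)) S \<le> B"
  by (simp add: wbound_def)

lemma wbound_nonneg: "wbound w K c B \<Longrightarrow> B \<ge> 0"
  using wboundD[of w K c B "{}"] by simp

lemma wbound_subset: "wbound w K c B \<Longrightarrow> K' \<subseteq> K \<Longrightarrow> wbound w K' c B"
  by (auto simp: wbound_def)

lemma wbound_mono:
  assumes "wbound w K c B" "B \<le> B'" and le: "\<And>k. k \<in> K \<Longrightarrow> 0 \<le> w' k * cmod (c' k)"
    "\<And>k. k \<in> K \<Longrightarrow> w' k * cmod (c' k) \<le> w k * cmod (c k)"
  shows "wbound w' K c' B'"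
proof (rule wboundI)
  fix S assume S: "finite S" "S \<subseteq> K"
  have "L2_set (\<lambda>k. w' k * cmod (c' k)) S \<le> L2_set (\<lambda>k. w k * cmod (c k)) S"
    using S le by (intro L2_set_mono) auto
  then show "L2_set (\<lambda>k. w' k * cmod (c' k)) S \<le> B'"
    using wboundD[OF assms(1) S] assms(2) by linarith
qed

lemma wbound_cong:
  assumes "\<And>k. k \<in> K \<Longrightarrow> c k = c' k"
  shows "wbound w K c B \<longleftrightarrow> wbound w K c' B"
proof -
  have "L2_set (\<lambda>k. w k * cmod (c k)) S = L2_set (\<lambda>k. w k * cmod (c' k)) S" if "S \<subseteq> K" for S
    using assms that by (intro L2_set_cong) auto
  then show ?thesis by (auto simp: wbound_def)
qed

lemma wbound_le: "wbound w K c B \<Longrightarrow> B \<le> B' \<Longrightarrow> wbound w K c B'"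
  by (auto simp: wbound_def)

lemma wbound_add:
  assumes "wbound w K c B" "wbound w K d B'" and w: "\<And>k. k \<in> K \<Longrightarrow> 0 \<le> w k"
  shows "wbound w K (\<lambda>k. c k + d k) (B + B')"
proof (rule wboundI)
  fix S assume S: "finite S" "S \<subseteq> K"
  have "L2_set (\<lambda>k. w k * cmod (c k + d k)) S
      \<le> L2_set (\<lambda>k. w k * cmod (c k) + w k * cmod (d k)) S"
    using S w by (intro L2_set_mono)
      (auto simp: distrib_left[symmetric] intro!: mult_left_mono norm_triangle_ineq mult_nonneg_nonneg)
  also have "\<dots> \<le> L2_set (\<lambda>k. w k * cmod (c k)) S + L2_set (\<lambda>k. w k * cmod (d k)) S"
    by (rule L2_set_triangle_ineq)
  also have "\<dots> \<le> B + B'"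
    using wboundD[OF assms(1) S] wboundD[OF assms(2) S] by linarith
  finally show "L2_set (\<lambda>k. w k * cmod (c k + d k)) S \<le> B + B'" .
qed

lemma wbound_scale:
  assumes "wbound w K c B"
  shows "wbound w K (\<lambda>k. z * c k) (cmod z * B)"
proof (rule wboundI)
  fix S assume S: "finite S" "S \<subseteq> K"
  have "L2_set (\<lambda>k. w k * cmod (z * c k)) S = L2_set (\<lambda>k. cmod z * (w k * cmod (c k))) S"
    by (simp add: norm_mult mult_ac)
  also have "\<dots> = cmod z * L2_set (\<lambda>k. w k * cmod (c k)) S"
    by (simp add: L2_set_right_distrib)
  also have "\<dots> \<le> cmod z * B"
    using wboundD[OF assms S] by (simp add: mult_left_mono)
  finally show "L2_set (\<lambda>k. w k * cmod (z * c k)) S \<le> cmod z * B" .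
qed

lemma wbound_diff:
  assumes "wbound w K c B" "wbound w K d B'" and "\<And>k. k \<in> K \<Longrightarrow> 0 \<le> w k"
  shows "wbound w K (\<lambda>k. c k - d k) (B + B')"
  using wbound_add[OF assms(1) wbound_scale[OF assms(2), of "-1"] assms(3)] by simp

lemma wbound_minus_commute:
  "wbound w K (\<lambda>k. c k - d k) B \<longleftrightarrow> wbound w K (\<lambda>k. d k - c k) B"
  by (simp add: wbound_def norm_minus_commute)

lemma wbound_sum_le_sq:
  assumes "wbound w K c B" "finite S" "S \<subseteq> K"
  shows "(\<Sum>k\<in>S. (w k * cmod (c k))\<^sup>2) \<le> B\<^sup>2"
proof -
  have "(L2_set (\<lambda>k. w k * cmod (c k)) S)\<^sup>2 \<le> B\<^sup>2"
    using wboundD[OF assms] by (intro power_mono) (auto simp: L2_set_nonneg)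
  then show ?thesis by (simp add: L2_set_def sum_nonneg)
qed

lemma wbound_sq_intro:
  assumes "\<And>S. finite S \<Longrightarrow> S \<subseteq> K \<Longrightarrow> (\<Sum>k\<in>S. (w k * cmod (c k))\<^sup>2) \<le> B\<^sup>2" "B \<ge> 0"
  shows "wbound w K c B"
  unfolding wbound_def L2_set_def using assms by (auto intro!: real_le_lsqrt sum_nonneg)

section \<open>Sobolev weights on the frequency lattice and absolute summability of
  coefficients\<close>

definition lam :: "real \<Rightarrow> int \<times> int \<Rightarrow> real" where
  "lam L k = (freq L)\<^sup>2 * ((of_int (fst k))\<^sup>2 + (of_int (snd k))\<^sup>2)"

definition bw :: "real \<Rightarrow> int \<times> int \<Rightarrow> real" where
  "bw L k = 1 + lam L k"

text \<open>\<open>bw L k\<close> is the symbol of the identity minus the Laplacian, so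
  \<open>hb L r\<close> bounds the periodic Sobolev norm of order \<open>2 r\<close> up to the
  factor \<open>L\<close>. Order 1 is \<open>H^2\<close>, the norm of the stability theory.\<close>

abbreviation hb :: "real \<Rightarrow> nat \<Rightarrow> (int \<times> int) set \<Rightarrow> (int \<times> int \<Rightarrow> complex) \<Rightarrow> real \<Rightarrow> bool" where
  "hb L r \<equiv> wbound (\<lambda>k. bw L k ^ r)"

lemma lam_nonneg [simp]: "lam L k \<ge> 0"
  by (simp add: lam_def)

lemma bw_ge_1 [simp]: "bw L k \<ge> 1"
  by (simp add: bw_def)

lemma bw_pos [simp]: "bw L k > 0"
  using bw_ge_1[of L k] by linarith

lemma bw_nonneg [simp]: "bw L k \<ge> 0"
  using bw_ge_1[of L k] by linarith

lemma lam_le_bw: "lam L k \<le> bw L k"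
  by (simp add: bw_def)

lemma hb_lower:
  assumes "hb L r K c B" "q \<le> r"
  shows "hb L q K c B"
  by (rule wbound_mono[OF assms(1) order_refl]) (auto intro!: mult_right_mono power_increasing assms)

lemma inverse_one_plus_square_summable:
  assumes "\<nu> \<noteq> (0::real)"
  obtains A where "A \<ge> 0" "\<And>S. finite S \<Longrightarrow> (\<Sum>l\<in>S. 1 / (1 + \<nu>\<^sup>2 * (of_int l)\<^sup>2)) \<le> A"
proof -
  have s: "summable (\<lambda>n. 1 / (1 + \<nu>\<^sup>2 * (real n)\<^sup>2))"
  proof (rule summable_comparison_test')
    show "summable (\<lambda>n. 1 / \<nu>\<^sup>2 * (1 / (real n)\<^sup>2))"
      using inverse_power_summable[of 2, where 'a=real] by (intro summable_mult) (simp add: field_simps)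
    show "norm (1 / (1 + \<nu>\<^sup>2 * (real n)\<^sup>2)) \<le> 1 / \<nu>\<^sup>2 * (1 / (real n)\<^sup>2)" if "n \<ge> 1" for n
    proof -
      have "0 < \<nu>\<^sup>2 * (real n)\<^sup>2" using assms that by simp
      then have "1 / (1 + \<nu>\<^sup>2 * (real n)\<^sup>2) \<le> 1 / (\<nu>\<^sup>2 * (real n)\<^sup>2)"
        by (intro frac_le) auto
      then show ?thesis using that by simp
    qed
  qed
  define B where "B = (\<Sum>n. 1 / (1 + \<nu>\<^sup>2 * (real n)\<^sup>2))"
  have pos: "0 < 1 + \<nu>\<^sup>2 * (real n)\<^sup>2" for n
    by (simp add: add_pos_nonneg)
  have B: "(\<Sum>n\<in>S. 1 / (1 + \<nu>\<^sup>2 * (real n)\<^sup>2)) \<le> B" if "finite S" for S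
    unfolding B_def using pos by (intro sum_le_suminf[OF s that]) (auto intro: less_imp_le)
  have "(\<Sum>l\<in>S. 1 / (1 + \<nu>\<^sup>2 * (of_int l)\<^sup>2)) \<le> B + B" if S: "finite S" for S :: "int set"
  proof -
    let ?f = "\<lambda>l::int. 1 / (1 + \<nu>\<^sup>2 * (of_int l)\<^sup>2)"
    \<comment> \<open>The modulus is injective on the nonnegative and on the negative integers, so
      each half is bounded by the series over the naturals.\<close>
    have half: "sum ?f (S \<inter> T) \<le> B" if T: "inj_on (\<lambda>l. nat \<bar>l\<bar>) T" for T
    proof -
      have "sum ?f (S \<inter> T) = (\<Sum>l\<in>S \<inter> T. 1 / (1 + \<nu>\<^sup>2 * (real (nat \<bar>l\<bar>))\<^sup>2))"
        by (intro sum.cong) auto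
      also have "\<dots> = (\<Sum>n\<in>(\<lambda>l. nat \<bar>l\<bar>) ` (S \<inter> T). 1 / (1 + \<nu>\<^sup>2 * (real n)\<^sup>2))"
        using T by (subst sum.reindex) (auto intro: inj_on_subset)
      also have "\<dots> \<le> B" using S by (intro B) auto
      finally show ?thesis .
    qed
    have "sum ?f S = sum ?f (S \<inter> {0..}) + sum ?f (S \<inter> {..<0})"
      using S by (subst sum.union_disjoint[symmetric]) (auto intro!: sum.cong)
    also have "\<dots> \<le> B + B"
      by (intro add_mono half) (auto simp: inj_on_def)
    finally show ?thesis .
  qed
  moreover have "B + B \<ge> 0" using B[of "{}"] by simp
  ultimately show ?thesis using that by blast
qed

text \<open>The square of \<open>1 + x + y\<close> dominates \<open>(1 + x) (1 + y)\<close>, so the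
  lattice sum factors into two one-dimensional series. This is where dimension two meets the weight
  of order one.\<close>

lemma inverse_bw_square_le:
  "(1 / bw L k)\<^sup>2 \<le> 1 / (1 + (freq L)\<^sup>2 * (of_int (fst k))\<^sup>2) * (1 / (1 + (freq L)\<^sup>2 * (of_int (snd k))\<^sup>2))"
proof -
  have *: "(1 / (1 + (x + y)))\<^sup>2 \<le> 1 / (1 + x) * (1 / (1 + y))" if "x \<ge> 0" "y \<ge> 0" for x y :: real
  proof -
    have "(1 + (x + y))\<^sup>2 = (1 + x) * (1 + y) + (x + y + x * x + y * y + x * y)"
      by (simp add: power2_eq_square algebra_simps)
    then have "(1 + x) * (1 + y) \<le> (1 + (x + y))\<^sup>2" using that by simp
    moreover have "0 < (1 + x) * (1 + y)" using that by simp
    ultimately have "1 / (1 + (x + y))\<^sup>2 \<le> 1 / ((1 + x) * (1 + y))"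
      by (intro frac_le) auto
    then show ?thesis by (simp only: power_one_over) simp
  qed
  show ?thesis unfolding bw_def lam_def distrib_left by (rule *) auto
qed

lemma inverse_bw_square_summable:
  assumes "L > 0"
  shows "\<exists>A\<ge>0. \<forall>S. finite S \<longrightarrow> (\<Sum>k\<in>S. (1 / bw L k)\<^sup>2) \<le> A\<^sup>2"
proof -
  have "freq L \<noteq> 0" using assms by (simp add: freq_def)
  from inverse_one_plus_square_summable[OF this]
  obtain A where A: "A \<ge> 0" "\<And>S. finite S \<Longrightarrow> (\<Sum>l\<in>S. 1 / (1 + (freq L)\<^sup>2 * (of_int l)\<^sup>2)) \<le> A"
    by blast
  define f where "f = (\<lambda>l::int. 1 / (1 + (freq L)\<^sup>2 * (of_int l)\<^sup>2))"
  have f0: "f l \<ge> 0" for l by (simp add: f_def add_nonneg_nonneg)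
  have fA: "sum f S \<le> A" if "finite S" for S using A(2)[OF that] by (simp add: f_def)
  have "(\<Sum>k\<in>S. (1 / bw L k)\<^sup>2) \<le> A\<^sup>2" if S: "finite S" for S
  proof -
    have "(\<Sum>k\<in>S. (1 / bw L k)\<^sup>2) \<le> (\<Sum>k\<in>S. f (fst k) * f (snd k))"
      unfolding f_def by (intro sum_mono inverse_bw_square_le)
    also have "\<dots> \<le> (\<Sum>k\<in>fst ` S \<times> snd ` S. f (fst k) * f (snd k))"
    proof (rule sum_mono2)
      show "S \<subseteq> fst ` S \<times> snd ` S" by force
    qed (use S f0 in auto)
    also have "\<dots> = (\<Sum>l\<in>fst ` S. f l) * (\<Sum>l\<in>snd ` S. f l)"
      by (simp add: sum_product sum.cartesian_product case_prod_beta)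
    also have "\<dots> \<le> A * A"
      using S by (intro mult_mono fA sum_nonneg f0 A finite_imageI)
    finally show ?thesis by (simp add: power2_eq_square)
  qed
  then show ?thesis using A(1) by blast
qed

text \<open>Bound for the embedding of \<open>H^2\<close> into the absolutely convergent Fourier
  series, fixed by choice.\<close>

definition l1c :: "real \<Rightarrow> real" where
  "l1c L = (SOME A. A \<ge> 0 \<and> (\<forall>S. finite S \<longrightarrow> (\<Sum>k\<in>S. (1 / bw L k)\<^sup>2) \<le> A\<^sup>2))"

lemma l1c:
  assumes "L > 0"
  shows "l1c L \<ge> 0" "finite S \<Longrightarrow> (\<Sum>k\<in>S. (1 / bw L k)\<^sup>2) \<le> (l1c L)\<^sup>2"
  using someI_ex[OF inverse_bw_square_summable[OF assms, unfolded Bex_def]] unfolding l1c_def by blast+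

text \<open>Cauchy-Schwarz with the weights \<open>1 / bw\<close> and \<open>bw\<close>. It supplies
  the \<open>l^1\<close> factor in Young's inequality and, at the end, the passage from coefficients
  to maximum norms.\<close>

lemma hb_l1:
  assumes L: "L > 0" and c: "hb L 1 K c B" and S: "finite S" "S \<subseteq> K"
  shows "(\<Sum>k\<in>S. cmod (c k)) \<le> l1c L * B"
proof -
  have "(\<Sum>k\<in>S. cmod (c k)) = (\<Sum>k\<in>S. \<bar>1 / bw L k\<bar> * \<bar>bw L k * cmod (c k)\<bar>)"
    using bw_pos[of L] by (intro sum.cong refl) (simp add: abs_mult less_imp_neq[symmetric])
  also have "\<dots> \<le> L2_set (\<lambda>k. 1 / bw L k) S * L2_set (\<lambda>k. bw L k * cmod (c k)) S"
    by (rule L2_set_mult_ineq)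
  also have "\<dots> \<le> l1c L * B"
  proof (intro mult_mono)
    show "L2_set (\<lambda>k. 1 / bw L k) S \<le> l1c L"
      unfolding L2_set_def using l1c[OF L] S by (intro real_le_lsqrt) (auto intro: sum_nonneg)
    show "L2_set (\<lambda>k. bw L k * cmod (c k)) S \<le> B"
      using wboundD[OF c S] by simp
  qed (use l1c[OF L] L2_set_nonneg in auto)
  finally show ?thesis .
qed

lemma hb_pointwise:
  assumes "hb L r K c B" "k \<in> K"
  shows "cmod (c k) \<le> B"
proof -
  have "L2_set (\<lambda>k. bw L k ^ r * cmod (c k)) {k} \<le> B"
    using assms(2) by (intro wboundD[OF assms(1)]) auto
  then have 1: "\<bar>bw L k ^ r * cmod (c k)\<bar> \<le> B"
    by (simp add: L2_set_def)
  have "1 \<le> bw L k ^ r"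
    by (rule one_le_power[OF bw_ge_1])
  from mult_right_mono[OF this norm_ge_zero[of "c k"]]
  have "cmod (c k) \<le> bw L k ^ r * cmod (c k)" by simp
  also have "\<dots> \<le> B" using 1 by linarith
  finally show ?thesis .
qed

lemma tendsto_L2_set:
  assumes "\<And>k. k \<in> S \<Longrightarrow> ((\<lambda>x. f x k) \<longlongrightarrow> g k) A"
  shows "((\<lambda>x. L2_set (f x) S) \<longlongrightarrow> L2_set g S) A"
  unfolding L2_set_def by (intro tendsto_intros assms)

text \<open>The power of 4 comes from moving the weight onto one of two frequencies in
  \<open>bw_sg_power\<close>, the 2 from the two resulting terms, and \<open>l1c L\<close> from the
  factor measured in \<open>l^1\<close>.\<close>

definition conv_const :: "real \<Rightarrow> nat \<Rightarrow> real" where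
  "conv_const L r = 2 * 4 ^ r * l1c L"

lemma conv_const_nonneg: "L > 0 \<Longrightarrow> conv_const L r \<ge> 0"
  by (simp add: conv_const_def l1c)

text \<open>
  Both the product of functions on the torus (all frequencies, \<open>sg k l = k - l\<close>) and that of grid
  functions (finitely many frequencies, \<open>sg k l\<close> the representative of \<open>k - l\<close> modulo \<open>M\<close>) become
  convolutions of this shape.
\<close>

locale spectral =
  fixes L :: real and K :: "(int \<times> int) set" and sg :: "int \<times> int \<Rightarrow> int \<times> int \<Rightarrow> int \<times> int"
  assumes L: "L > 0"
    and sg_in: "\<And>k l. k \<in> K \<Longrightarrow> l \<in> K \<Longrightarrow> sg k l \<in> K"
    and inj_left: "\<And>l. l \<in> K \<Longrightarrow> inj_on (\<lambda>k. sg k l) K"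
    and inj_right: "\<And>k. k \<in> K \<Longrightarrow> inj_on (sg k) K"
    and bw_sg: "\<And>k l. k \<in> K \<Longrightarrow> l \<in> K \<Longrightarrow> bw L k \<le> 2 * (bw L l + bw L (sg k l))"
begin

definition conv :: "(int \<times> int \<Rightarrow> complex) \<Rightarrow> (int \<times> int \<Rightarrow> complex) \<Rightarrow> int \<times> int \<Rightarrow> complex" where
  "conv c d k = (\<Sum>\<^sub>\<infinity>l\<in>K. c l * d (sg k l))"

lemma conv_abs_summable:
  assumes c: "hb L 1 K c A" and d: "hb L 1 K d B" and k: "k \<in> K"
  shows "(\<lambda>l. cmod (c l * d (sg k l))) summable_on K"
proof (rule nonneg_bdd_above_summable_on)
  show "bdd_above (sum (\<lambda>l. cmod (c l * d (sg k l))) ` {S. S \<subseteq> K \<and> finite S})"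
  proof (rule bdd_aboveI2)
    fix S assume S: "S \<in> {S. S \<subseteq> K \<and> finite S}"
    have "(\<Sum>l\<in>S. cmod (c l * d (sg k l))) \<le> (\<Sum>l\<in>S. cmod (c l) * B)"
      using S k by (intro sum_mono) (auto simp: norm_mult intro!: mult_left_mono hb_pointwise[OF d] sg_in)
    also have "\<dots> \<le> l1c L * A * B"
      using S wbound_nonneg[OF d] unfolding sum_distrib_right[symmetric]
      by (intro mult_right_mono hb_l1[OF L c]) auto
    finally show "(\<Sum>l\<in>S. cmod (c l * d (sg k l))) \<le> l1c L * A * B" .
  qed
qed simp

lemma conv_summable:
  assumes "hb L 1 K c A" "hb L 1 K d B" "k \<in> K"
  shows "(\<lambda>l. c l * d (sg k l)) summable_on K"
  using abs_summable_summable[OF conv_abs_summable[OF assms]] .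

lemma conv_diff_left:
  assumes "hb L 1 K c A" "hb L 1 K c' A'" "hb L 1 K d B" "k \<in> K"
  shows "conv (\<lambda>l. c l - c' l) d k = conv c d k - conv c' d k"
proof -
  have "conv (\<lambda>l. c l - c' l) d k = (\<Sum>\<^sub>\<infinity>l\<in>K. c l * d (sg k l) + - (c' l * d (sg k l)))"
    unfolding conv_def by (simp add: algebra_simps)
  also have "\<dots> = conv c d k + (\<Sum>\<^sub>\<infinity>l\<in>K. - (c' l * d (sg k l)))"
    unfolding conv_def
    by (intro infsum_add conv_summable[OF assms(1,3,4)]) (simp add: conv_summable[OF assms(2-4)] summable_on_uminus)
  also have "\<dots> = conv c d k - conv c' d k"
    unfolding conv_def by (simp add: infsum_uminus)
  finally show ?thesis .
qed

lemma conv_diff_right: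
  assumes "hb L 1 K c A" "hb L 1 K d B" "hb L 1 K d' B'" "k \<in> K"
  shows "conv c (\<lambda>l. d l - d' l) k = conv c d k - conv c d' k"
proof -
  have "conv c (\<lambda>l. d l - d' l) k = (\<Sum>\<^sub>\<infinity>l\<in>K. c l * d (sg k l) + - (c l * d' (sg k l)))"
    unfolding conv_def by (simp add: algebra_simps)
  also have "\<dots> = conv c d k + (\<Sum>\<^sub>\<infinity>l\<in>K. - (c l * d' (sg k l)))"
    unfolding conv_def
    by (intro infsum_add conv_summable[OF assms(1,2,4)]) (simp add: conv_summable[OF assms(1,3,4)] summable_on_uminus)
  also have "\<dots> = conv c d k - conv c d' k"
    unfolding conv_def by (simp add: infsum_uminus)
  finally show ?thesis .
qed

lemma conv_cong:
  assumes "\<And>l. l \<in> K \<Longrightarrow> c l = c' l" "\<And>l. l \<in> K \<Longrightarrow> d l = d' l" "k \<in> K"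
  shows "conv c d k = conv c' d' k"
  unfolding conv_def using assms sg_in by (intro infsum_cong) auto

text \<open>Young's inequality for finite sums over \<open>l\<close>, which pass to the limit in the convolution bound.\<close>

lemma young_left:
  assumes x: "\<And>S. finite S \<Longrightarrow> S \<subseteq> K \<Longrightarrow> (\<Sum>l\<in>S. x l) \<le> A"
    and y: "\<And>S. finite S \<Longrightarrow> S \<subseteq> K \<Longrightarrow> L2_set y S \<le> B"
    and x0: "\<And>l. l \<in> K \<Longrightarrow> x l \<ge> 0"
    and S: "finite S" "S \<subseteq> K" and T: "finite T" "T \<subseteq> K"
  shows "L2_set (\<lambda>k. \<Sum>l\<in>T. x l * y (sg k l)) S \<le> A * B"
proof -
  have A0: "A \<ge> 0" and B0: "B \<ge> 0" using x[of "{}"] y[of "{}"] by auto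
  have inner: "(\<Sum>k\<in>S. (y (sg k l))\<^sup>2) \<le> B\<^sup>2" if "l \<in> T" for l
  proof -
    have inj: "inj_on (\<lambda>k. sg k l) S"
      using inj_left[of l] that T S by (auto intro: inj_on_subset)
    have "(\<Sum>k\<in>S. (y (sg k l))\<^sup>2) = (\<Sum>k\<in>(\<lambda>k. sg k l) ` S. (y k)\<^sup>2)"
      using inj by (simp add: sum.reindex)
    also have "\<dots> = (L2_set y ((\<lambda>k. sg k l) ` S))\<^sup>2"
      by (simp add: L2_set_def sum_nonneg)
    also have "\<dots> \<le> B\<^sup>2"
    proof (intro power_mono y L2_set_nonneg)
      show "(\<lambda>k. sg k l) ` S \<subseteq> K"
        using S T that by (intro image_subsetI sg_in) auto
    qed (use S in simp)
    finally show ?thesis .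
  qed
  have "(\<Sum>k\<in>S. (\<Sum>l\<in>T. x l * y (sg k l))\<^sup>2) \<le> (\<Sum>k\<in>S. A * (\<Sum>l\<in>T. x l * (y (sg k l))\<^sup>2))"
  proof (rule sum_mono)
    fix k assume "k \<in> S"
    \<comment> \<open>One square root of \<open>x\<close> carries the \<open>l^1\<close> norm, the
      other stays with \<open>y\<close>. The later sum over \<open>k\<close> is bounded by that of
      \<open>y\<close> because translation by \<open>l\<close> is injective.\<close>
    have "(\<Sum>l\<in>T. x l * y (sg k l)) = (\<Sum>l\<in>T. sqrt (x l) * (sqrt (x l) * y (sg k l)))"
      using T x0 by (intro sum.cong refl) (auto simp: mult.assoc[symmetric])
    also have "(\<dots>)\<^sup>2 \<le> (\<Sum>l\<in>T. (sqrt (x l))\<^sup>2) * (\<Sum>l\<in>T. (sqrt (x l) * y (sg k l))\<^sup>2)"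
      by (rule Cauchy_Schwarz_ineq_sum)
    also have "\<dots> = (\<Sum>l\<in>T. x l) * (\<Sum>l\<in>T. x l * (y (sg k l))\<^sup>2)"
      using T x0 by (intro arg_cong2[where f = "(*)"] sum.cong refl) (auto simp: power_mult_distrib)
    also have "\<dots> \<le> A * (\<Sum>l\<in>T. x l * (y (sg k l))\<^sup>2)"
      using T x0 by (intro mult_right_mono x sum_nonneg mult_nonneg_nonneg) auto
    finally show "(\<Sum>l\<in>T. x l * y (sg k l))\<^sup>2 \<le> A * (\<Sum>l\<in>T. x l * (y (sg k l))\<^sup>2)" .
  qed
  also have "\<dots> = A * (\<Sum>l\<in>T. x l * (\<Sum>k\<in>S. (y (sg k l))\<^sup>2))"
    by (simp add: sum_distrib_left sum.swap[of _ S T])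
  also have "\<dots> \<le> A * (\<Sum>l\<in>T. x l * B\<^sup>2)"
    using T x0 A0 by (intro mult_left_mono sum_mono inner) auto
  also have "\<dots> \<le> A * (A * B\<^sup>2)"
    using x[OF T] A0 by (intro mult_left_mono) (auto simp: sum_distrib_right[symmetric] intro!: mult_right_mono)
  also have "\<dots> = (A * B)\<^sup>2"
    by (simp add: power2_eq_square)
  finally show ?thesis
    unfolding L2_set_def using A0 B0 by (intro real_le_lsqrt sum_nonneg) auto
qed

text \<open>Mirror image of \<open>young_left\<close>: the \<open>l^1\<close> factor is now
  \<open>y\<close>, whose sums over \<open>l\<close> at fixed \<open>k\<close> and over
  \<open>k\<close> at fixed \<open>l\<close> both enter, each by one of the two injectivity
  assumptions.\<close>

lemma young_right:
  assumes x: "\<And>S. finite S \<Longrightarrow> S \<subseteq> K \<Longrightarrow> L2_set x S \<le> A"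
    and y: "\<And>S. finite S \<Longrightarrow> S \<subseteq> K \<Longrightarrow> (\<Sum>l\<in>S. y l) \<le> B"
    and y0: "\<And>l. l \<in> K \<Longrightarrow> y l \<ge> 0"
    and S: "finite S" "S \<subseteq> K" and T: "finite T" "T \<subseteq> K"
  shows "L2_set (\<lambda>k. \<Sum>l\<in>T. x l * y (sg k l)) S \<le> A * B"
proof -
  have A0: "A \<ge> 0" and B0: "B \<ge> 0" using x[of "{}"] y[of "{}"] by auto
  have sg_in': "sg k l \<in> K" if "k \<in> S" "l \<in> T" for k l
    using that S T sg_in by blast
  have inner1: "(\<Sum>l\<in>T. y (sg k l)) \<le> B" if "k \<in> S" for k
  proof -
    have inj: "inj_on (sg k) T"
      using inj_right[of k] that T S by (auto intro: inj_on_subset)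
    have "(\<Sum>l\<in>T. y (sg k l)) = (\<Sum>l\<in>sg k ` T. y l)"
      using inj by (simp add: sum.reindex)
    also have "\<dots> \<le> B"
    proof (rule y)
      show "sg k ` T \<subseteq> K"
        using that by (intro image_subsetI sg_in')
    qed (use T in simp)
    finally show ?thesis .
  qed
  have inner2: "(\<Sum>k\<in>S. y (sg k l)) \<le> B" if "l \<in> T" for l
  proof -
    have inj: "inj_on (\<lambda>k. sg k l) S"
      using inj_left[of l] that T S by (auto intro: inj_on_subset)
    have "(\<Sum>k\<in>S. y (sg k l)) = (\<Sum>k\<in>(\<lambda>k. sg k l) ` S. y k)"
      using inj by (simp add: sum.reindex)
    also have "\<dots> \<le> B"
    proof (rule y)
      show "(\<lambda>k. sg k l) ` S \<subseteq> K"
        using that by (intro image_subsetI sg_in')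
    qed (use S in simp)
    finally show ?thesis .
  qed
  have "(\<Sum>k\<in>S. (\<Sum>l\<in>T. x l * y (sg k l))\<^sup>2) \<le> (\<Sum>k\<in>S. B * (\<Sum>l\<in>T. (x l)\<^sup>2 * y (sg k l)))"
  proof (rule sum_mono)
    fix k assume k: "k \<in> S"
    have y0': "y (sg k l) \<ge> 0" if "l \<in> T" for l
      using y0 sg_in' that k by blast
    have "(\<Sum>l\<in>T. x l * y (sg k l)) = (\<Sum>l\<in>T. sqrt (y (sg k l)) * (x l * sqrt (y (sg k l))))"
      using y0' by (intro sum.cong refl) (auto simp: mult_ac)
    also have "(\<dots>)\<^sup>2 \<le> (\<Sum>l\<in>T. (sqrt (y (sg k l)))\<^sup>2) * (\<Sum>l\<in>T. (x l * sqrt (y (sg k l)))\<^sup>2)"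
      by (rule Cauchy_Schwarz_ineq_sum)
    also have "\<dots> = (\<Sum>l\<in>T. y (sg k l)) * (\<Sum>l\<in>T. (x l)\<^sup>2 * y (sg k l))"
      using y0' by (intro arg_cong2[where f = "(*)"] sum.cong refl) (auto simp: power_mult_distrib)
    also have "\<dots> \<le> B * (\<Sum>l\<in>T. (x l)\<^sup>2 * y (sg k l))"
      using y0' by (intro mult_right_mono inner1 k sum_nonneg mult_nonneg_nonneg) auto
    finally show "(\<Sum>l\<in>T. x l * y (sg k l))\<^sup>2 \<le> B * (\<Sum>l\<in>T. (x l)\<^sup>2 * y (sg k l))" .
  qed
  also have "\<dots> = B * (\<Sum>l\<in>T. (x l)\<^sup>2 * (\<Sum>k\<in>S. y (sg k l)))"
    by (simp add: sum_distrib_left sum.swap[of _ S T])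
  also have "\<dots> \<le> B * (\<Sum>l\<in>T. (x l)\<^sup>2 * B)"
    using B0 by (intro mult_left_mono sum_mono inner2) auto
  also have "\<dots> = B * ((L2_set x T)\<^sup>2 * B)"
    by (simp add: L2_set_def sum_nonneg sum_distrib_right)
  also have "\<dots> \<le> B * (A\<^sup>2 * B)"
    using x[OF T] B0 by (intro mult_left_mono mult_right_mono power_mono L2_set_nonneg) auto
  also have "\<dots> = (A * B)\<^sup>2"
    by (simp add: power2_eq_square)
  finally show ?thesis
    unfolding L2_set_def using A0 B0 by (intro real_le_lsqrt sum_nonneg) auto
qed

lemma bw_sg_power:
  assumes "k \<in> K" "l \<in> K"
  shows "bw L k ^ r \<le> 4 ^ r * (bw L l ^ r + bw L (sg k l) ^ r)"
proof -
  let ?m = "max (bw L l) (bw L (sg k l))"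
  have "bw L k \<le> 4 * ?m"
    using bw_sg[OF assms] by (simp add: max_def)
  then have "bw L k ^ r \<le> (4 * ?m) ^ r"
    by (intro power_mono) auto
  also have "\<dots> = 4 ^ r * ?m ^ r" by (simp add: power_mult_distrib)
  also have "?m ^ r \<le> bw L l ^ r + bw L (sg k l) ^ r"
    by (auto simp: max_def)
  finally show ?thesis by simp
qed

text \<open>Algebra property of the Sobolev spaces: the weight at \<open>k\<close> is charged to
  \<open>l\<close> or to \<open>sg k l\<close>, and in each case the unweighted factor is absolutely
  summable. Both Young inequalities occur since convolution is not assumed commutative.\<close>

lemma conv_hb:
  assumes r: "r \<ge> 1" and c: "hb L r K c A" and d: "hb L r K d B"
  shows "hb L r K (conv c d) (conv_const L r * A * B)"
proof (rule wboundI)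
  fix S assume S: "finite S" "S \<subseteq> K"
  have c1: "hb L 1 K c A" and d1: "hb L 1 K d B"
    using hb_lower[OF c r] hb_lower[OF d r] by auto
  define b where "b k = bw L k ^ r" for k
  have b0: "b k \<ge> 0" for k by (simp add: b_def)
  \<comment> \<open>The bound is uniform over the finite sets \<open>T\<close> of inner frequencies
    and so survives the limit that defines the infinite sum.\<close>
  have fin: "L2_set (\<lambda>k. b k * cmod (\<Sum>l\<in>T. c l * d (sg k l))) S \<le> conv_const L r * A * B"
    if T: "finite T" "T \<subseteq> K" for T
  proof -
    let ?f = "\<lambda>k. \<Sum>l\<in>T. b l * cmod (c l) * cmod (d (sg k l))"
    let ?g = "\<lambda>k. \<Sum>l\<in>T. cmod (c l) * (b (sg k l) * cmod (d (sg k l)))"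
    have "L2_set (\<lambda>k. b k * cmod (\<Sum>l\<in>T. c l * d (sg k l))) S \<le> L2_set (\<lambda>k. 4 ^ r * (?f k + ?g k)) S"
    proof (rule L2_set_mono)
      fix k assume k: "k \<in> S"
      have "b k * cmod (\<Sum>l\<in>T. c l * d (sg k l)) \<le> b k * (\<Sum>l\<in>T. cmod (c l) * cmod (d (sg k l)))"
        using b0 by (intro mult_left_mono order_trans[OF norm_sum]) (auto simp: norm_mult)
      also have "\<dots> = (\<Sum>l\<in>T. b k * (cmod (c l) * cmod (d (sg k l))))"
        by (simp add: sum_distrib_left)
      also have "\<dots> \<le> (\<Sum>l\<in>T. 4 ^ r * (b l + b (sg k l)) * (cmod (c l) * cmod (d (sg k l))))"
        unfolding b_def using k S T by (intro sum_mono mult_right_mono bw_sg_power) auto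
      also have "\<dots> = 4 ^ r * (?f k + ?g k)"
        by (simp add: sum_distrib_left sum.distrib[symmetric] algebra_simps)
      finally show "b k * cmod (\<Sum>l\<in>T. c l * d (sg k l)) \<le> 4 ^ r * (?f k + ?g k)" .
    qed (use b0 in auto)
    also have "\<dots> = 4 ^ r * L2_set (\<lambda>k. ?f k + ?g k) S"
      by (simp add: L2_set_right_distrib)
    also have "\<dots> \<le> 4 ^ r * (L2_set ?f S + L2_set ?g S)"
      by (intro mult_left_mono L2_set_triangle_ineq) auto
    also have "\<dots> \<le> 4 ^ r * (A * (l1c L * B) + l1c L * A * B)"
    proof (intro mult_left_mono add_mono)
      show "L2_set ?f S \<le> A * (l1c L * B)"
        using hb_l1[OF L d1] wboundD[OF c] by (intro young_right S T) (auto simp: b_def)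
      show "L2_set ?g S \<le> l1c L * A * B"
        using hb_l1[OF L c1] wboundD[OF d]
        by (intro young_left[where y = "\<lambda>k. b k * cmod (d k)"] S T) (auto simp: b_def)
    qed auto
    also have "\<dots> = conv_const L r * A * B"
      by (simp add: conv_const_def)
    finally show ?thesis .
  qed
  have "((\<lambda>T. L2_set (\<lambda>k. b k * cmod (\<Sum>l\<in>T. c l * d (sg k l))) S)
      \<longlongrightarrow> L2_set (\<lambda>k. b k * cmod (conv c d k)) S) (finite_subsets_at_top K)"
    using has_sum_infsum[OF conv_summable[OF c1 d1]] S
    by (intro tendsto_L2_set tendsto_intros) (auto simp: has_sum_def conv_def)
  then show "L2_set (\<lambda>k. bw L k ^ r * cmod (conv c d k)) S \<le> conv_const L r * A * B"
    unfolding b_def[symmetric]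
    by (rule tendsto_upperbound) (auto intro!: eventually_finite_subsets_at_top_weakI fin)
qed

end

section \<open>The cubic nonlinearity and aliasing\<close>

context spectral
begin

definition cube :: "(int \<times> int \<Rightarrow> complex) \<Rightarrow> int \<times> int \<Rightarrow> complex" where
  "cube c = conv c (conv c c)"

text \<open>Fourier symbol of \<open>\<Delta>[L_\<kappa> (c + d) / 2 - f_\<kappa>(c)]\<close> with
  \<open>c\<close> the current and \<open>d\<close> the next stage, where
  \<open>f_\<kappa>(v) = (\<kappa> + 1) v - v^3\<close>. For \<open>d = c\<close> the stabilisation
  cancels and the Cahn-Hilliard right-hand side remains.\<close>

definition rhs :: "real \<Rightarrow> real \<Rightarrow> (int \<times> int \<Rightarrow> complex) \<Rightarrow> (int \<times> int \<Rightarrow> complex) \<Rightarrow> int \<times> int \<Rightarrow> complex" where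
  "rhs \<epsilon> \<kappa> c d k = - of_real (lam L k) *
     (of_real (\<epsilon>\<^sup>2 * lam L k + \<kappa>) * ((c k + d k) / 2) - of_real (\<kappa> + 1) * c k + cube c k)"

lemma cube_hb:
  assumes "r \<ge> 1" "hb L r K c A"
  shows "hb L r K (cube c) ((conv_const L r)\<^sup>2 * A ^ 3)"
  unfolding cube_def
  using conv_hb[OF assms(1) assms(2) conv_hb[OF assms assms(2)]]
  by (simp add: power2_eq_square power3_eq_cube mult_ac)

text \<open>The difference telescopes as \<open>e (c c) + d (e c) + d (d e)\<close> with
  \<open>e = c - d\<close>. This order of the factors uses bilinearity alone; commutativity and
  associativity are not part of the abstract setting.\<close>

lemma cube_diff_hb:
  assumes r: "r \<ge> 1" and c: "hb L r K c A" and d: "hb L r K d A"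
    and e: "hb L r K (\<lambda>k. c k - d k) B"
  shows "hb L r K (\<lambda>k. cube c k - cube d k) (3 * (conv_const L r)\<^sup>2 * A\<^sup>2 * B)"
proof -
  note c1 = hb_lower[OF c r] and d1 = hb_lower[OF d r] and e1 = hb_lower[OF e r]
  note rr = conv_hb[OF r]
  let ?e = "\<lambda>k. c k - d k"
  have eq: "cube c k - cube d k
      = conv ?e (conv c c) k + (conv d (conv ?e c) k + conv d (conv d ?e) k)" if k: "k \<in> K" for k
  proof -
    note cc1 = hb_lower[OF rr[OF c c] r] and dd1 = hb_lower[OF rr[OF d d] r]
      and dc1 = hb_lower[OF rr[OF d c] r]
    have "conv ?e (conv c c) k = conv c (conv c c) k - conv d (conv c c) k"
      by (rule conv_diff_left[OF c1 d1 cc1 k])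
    moreover have "conv d (conv ?e c) k = conv d (\<lambda>l. conv c c l - conv d c l) k"
      by (intro conv_cong refl k conv_diff_left[OF c1 d1 c1])
    moreover have "\<dots> = conv d (conv c c) k - conv d (conv d c) k"
      by (rule conv_diff_right[OF d1 cc1 dc1 k])
    moreover have "conv d (conv d ?e) k = conv d (\<lambda>l. conv d c l - conv d d l) k"
      by (intro conv_cong refl k conv_diff_right[OF d1 c1 d1])
    moreover have "\<dots> = conv d (conv d c) k - conv d (conv d d) k"
      by (rule conv_diff_right[OF d1 dc1 dd1 k])
    ultimately show ?thesis by (simp add: cube_def)
  qed
  let ?C = "conv_const L r"
  have "hb L r K (\<lambda>k. conv ?e (conv c c) k + (conv d (conv ?e c) k + conv d (conv d ?e) k))
      (?C * B * (?C * A * A) + (?C * A * (?C * B * A) + ?C * A * (?C * A * B)))"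
    by (intro wbound_add rr c d e) auto
  also have "?C * B * (?C * A * A) + (?C * A * (?C * B * A) + ?C * A * (?C * A * B))
      = 3 * ?C\<^sup>2 * A\<^sup>2 * B"
    by (simp add: power2_eq_square algebra_simps)
  finally show ?thesis
    by (rule wbound_cong[THEN iffD2, rotated]) (rule eq)
qed

end

lemma hb_lam:
  assumes "hb L (Suc r) K c A"
  shows "hb L r K (\<lambda>k. of_real (lam L k) * c k) A"
proof (rule wbound_mono[OF assms order_refl])
  fix k
  have "bw L k ^ r * cmod (of_real (lam L k) * c k) = lam L k * (bw L k ^ r * cmod (c k))"
    by (simp add: norm_mult)
  also have "\<dots> \<le> bw L k * (bw L k ^ r * cmod (c k))"
    by (intro mult_right_mono lam_le_bw) simp
  finally show "bw L k ^ r * cmod (of_real (lam L k) * c k) \<le> bw L k ^ Suc r * cmod (c k)"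
    by simp
qed simp

lemma bw_diff_le: "bw L k \<le> 2 * (bw L l + bw L (k - l))"
proof -
  have *: "x\<^sup>2 \<le> 2 * (y\<^sup>2 + (x - y)\<^sup>2)" for x y :: real
  proof -
    have "2 * (y\<^sup>2 + (x - y)\<^sup>2) = x\<^sup>2 + (x - 2 * y)\<^sup>2"
      by (simp add: power2_eq_square algebra_simps)
    then show ?thesis by simp
  qed
  have gen: "1 + f * (a + b) \<le> 2 * (1 + f * (c + d) + (1 + f * (e + g)))"
    if "a \<le> 2 * (c + e)" "b \<le> 2 * (d + g)" "f \<ge> 0" for a b c d e f g :: real
  proof -
    have "a + b \<le> 2 * (c + d + (e + g))"
      using that(1,2) by simp
    from mult_left_mono[OF this that(3)]
    have "f * (a + b) \<le> 2 * (f * (c + d)) + 2 * (f * (e + g))"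
      by (simp only: distrib_left mult.left_commute)
    then show ?thesis unfolding distrib_left[of 2] by linarith
  qed
  show ?thesis
    unfolding bw_def lam_def fst_diff snd_diff of_int_diff
    by (rule gen[OF * * zero_le_power2])
qed

lemma spectral_UNIV: "L > 0 \<Longrightarrow> spectral L UNIV (-)"
  by (intro spectral.intro inj_onI bw_diff_le UNIV_I) simp_all

text \<open>
  Comparison of the convolution on a finite frequency window with that on all frequencies: every
  summand in which they differ contains a frequency outside or close to the boundary of the window.
\<close>

locale aliasing = spectral +
  fixes \<rho> :: real
  assumes \<rho>: "\<rho> > 0"
    and sg_eq: "\<And>k l. k \<in> K \<Longrightarrow> l \<in> K \<Longrightarrow> k - l \<in> K \<Longrightarrow> sg k l = k - l"
    and wrap: "\<And>k l. k \<in> K \<Longrightarrow> l \<in> K \<Longrightarrow> sg k l \<noteq> k - l \<Longrightarrow> \<rho> \<le> bw L l * bw L (sg k l)"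
    and tail: "\<And>k l. k \<in> K \<Longrightarrow> l \<notin> K \<or> k - l \<notin> K \<Longrightarrow> \<rho> \<le> bw L l * bw L (k - l)"
begin

sublocale full: spectral L UNIV "(-)"
  by (rule spectral_UNIV[OF L])

text \<open>On \<open>A\<close> the two weights together are at least \<open>\<rho>\<close>, so
  inserting them gains \<open>1 / \<rho>\<close>. The bound is phrased as a complex sum in order to
  match a convolution of the weighted moduli.\<close>

lemma norm_infsum_tail_le:
  assumes sub: "A \<subseteq> B"
    and big: "\<And>l. l \<in> A \<Longrightarrow> \<rho> \<le> bw L l * bw L (g l)"
    and s: "(\<lambda>l. of_real (bw L l * cmod (c l)) * of_real (bw L (g l) * cmod (d (g l))) :: complex) summable_on B"
  shows "cmod (\<Sum>\<^sub>\<infinity>l\<in>A. c l * d (g l))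
    \<le> (1 / \<rho>) * cmod (\<Sum>\<^sub>\<infinity>l\<in>B. of_real (bw L l * cmod (c l)) * of_real (bw L (g l) * cmod (d (g l))))"
proof -
  define h where "h l = bw L l * cmod (c l) * (bw L (g l) * cmod (d (g l)))" for l
  have h0: "h l \<ge> 0" for l by (simp add: h_def)
  have "(\<lambda>l. of_real (h l) :: complex) summable_on B"
    using s by (simp add: h_def)
  then have hB: "h summable_on B"
    by (drule_tac summable_on_Re) simp
  then have hA: "(\<lambda>l. 1 / \<rho> * h l) summable_on A"
    by (intro summable_on_cmult_right summable_on_subset_banach[OF _ sub])
  have le: "cmod (c l * d (g l)) \<le> 1 / \<rho> * h l" if "l \<in> A" for l
  proof -
    have "\<rho> * cmod (c l * d (g l)) \<le> bw L l * bw L (g l) * cmod (c l * d (g l))"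
      using big[OF that] by (intro mult_right_mono) auto
    also have "\<dots> = h l" by (simp add: h_def norm_mult)
    finally show ?thesis using \<rho> by (simp add: field_simps)
  qed
  have sA: "(\<lambda>l. cmod (c l * d (g l))) summable_on A"
    by (rule summable_on_comparison_test[OF hA]) (use le in auto)
  have "cmod (\<Sum>\<^sub>\<infinity>l\<in>A. c l * d (g l)) \<le> (\<Sum>\<^sub>\<infinity>l\<in>A. cmod (c l * d (g l)))"
    by (rule norm_infsum_bound[OF sA])
  also have "\<dots> \<le> (\<Sum>\<^sub>\<infinity>l\<in>A. 1 / \<rho> * h l)"
    by (rule infsum_mono[OF sA hA le])
  also have "\<dots> = 1 / \<rho> * infsum h A"
    by (rule infsum_cmult_right') 
  also have "infsum h A \<le> infsum h B"
    using h0 by (intro infsum_mono_neutral hB summable_on_subset_banach[OF hB sub]) (use sub in auto)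
  also have "infsum h B = cmod (of_real (infsum h B) :: complex)"
    using h0 by (simp add: infsum_nonneg)
  also have "of_real (infsum h B) = (\<Sum>\<^sub>\<infinity>l\<in>B. of_real (h l) :: complex)"
    by (rule infsumI[symmetric]) (simp only: has_sum_of_real_iff has_sum_infsum hB)
  finally show ?thesis
    using \<rho> unfolding h_def of_real_mult by (simp add: divide_right_mono)
qed

text \<open>Both convolutions agree where no wrapping occurs. In every other term the product of the
  weights is at least \<open>\<rho>\<close>, and spending one weight of each factor pays for
  \<open>1 / \<rho>\<close>; hence the drop from order 2 to order 1.\<close>

lemma conv_aliasing:
  assumes c: "hb L 2 UNIV c A" and d: "hb L 2 UNIV d B"
  shows "hb L 1 K (\<lambda>k. conv c d k - full.conv c d k) (2 * conv_const L 1 * A * B / \<rho>)"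
proof -
  define c' d' where "c' = (\<lambda>k. of_real (bw L k * cmod (c k)) :: complex)"
    and "d' = (\<lambda>k. of_real (bw L k * cmod (d k)) :: complex)"
  have bb: "hb L 1 UNIV (\<lambda>k. of_real (bw L k * cmod (c k)) :: complex) A" if "hb L 2 UNIV c A" for c A
    by (rule wbound_mono[OF that order_refl]) (auto simp: norm_mult power2_eq_square)
  have c': "hb L 1 UNIV c' A" and d': "hb L 1 UNIV d' B"
    unfolding c'_def d'_def by (intro bb c d)+
  have c1: "hb L 1 UNIV c A" and d1: "hb L 1 UNIV d B"
    by (rule hb_lower[OF c], simp, rule hb_lower[OF d], simp)
  note sub = wbound_subset[OF _ subset_UNIV]
  have pt: "cmod (conv c d k - full.conv c d k)
      \<le> cmod (of_real (1 / \<rho>) * (of_real (cmod (conv c' d' k)) + of_real (cmod (full.conv c' d' k))) :: complex)"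
    if k: "k \<in> K" for k
  proof -
    \<comment> \<open>\<open>G\<close> collects the terms common to both sums. Outside it the window
      sum is controlled by \<open>wrap\<close>, and the full sum by \<open>tail\<close>, because
      \<open>sg_eq\<close> puts every \<open>l\<close> with \<open>l\<close> and
      \<open>k - l\<close> in \<open>K\<close> into \<open>G\<close>.\<close>
    define G where "G = {l \<in> K. sg k l = k - l}"
    have s1: "(\<lambda>l. c l * d (sg k l)) summable_on K"
      by (rule conv_summable[OF sub[OF c1] sub[OF d1] k])
    have s2: "(\<lambda>l. c l * d (k - l)) summable_on UNIV"
      by (rule full.conv_summable[OF c1 d1]) simp
    have "conv c d k = (\<Sum>\<^sub>\<infinity>l\<in>G \<union> (K - G). c l * d (sg k l))"
      unfolding conv_def by (intro infsum_cong_neutral) (auto simp: G_def)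
    also have "\<dots> = (\<Sum>\<^sub>\<infinity>l\<in>G. c l * d (sg k l)) + (\<Sum>\<^sub>\<infinity>l\<in>K - G. c l * d (sg k l))"
      by (intro infsum_Un_disjoint summable_on_subset_banach[OF s1]) (auto simp: G_def)
    also have "(\<Sum>\<^sub>\<infinity>l\<in>G. c l * d (sg k l)) = (\<Sum>\<^sub>\<infinity>l\<in>G. c l * d (k - l))"
      by (intro infsum_cong) (auto simp: G_def)
    finally have e1: "conv c d k = (\<Sum>\<^sub>\<infinity>l\<in>G. c l * d (k - l)) + (\<Sum>\<^sub>\<infinity>l\<in>K - G. c l * d (sg k l))" .
    have "full.conv c d k = (\<Sum>\<^sub>\<infinity>l\<in>G \<union> - G. c l * d (k - l))"
      unfolding full.conv_def by simp
    also have "\<dots> = (\<Sum>\<^sub>\<infinity>l\<in>G. c l * d (k - l)) + (\<Sum>\<^sub>\<infinity>l\<in>- G. c l * d (k - l))"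
      by (intro infsum_Un_disjoint summable_on_subset_banach[OF s2]) auto
    finally have "cmod (conv c d k - full.conv c d k)
        = cmod ((\<Sum>\<^sub>\<infinity>l\<in>K - G. c l * d (sg k l)) - (\<Sum>\<^sub>\<infinity>l\<in>- G. c l * d (k - l)))"
      unfolding e1 by simp
    also have "\<dots> \<le> cmod (\<Sum>\<^sub>\<infinity>l\<in>K - G. c l * d (sg k l)) + cmod (\<Sum>\<^sub>\<infinity>l\<in>- G. c l * d (k - l))"
      by (rule norm_triangle_ineq4)
    also have "cmod (\<Sum>\<^sub>\<infinity>l\<in>K - G. c l * d (sg k l)) \<le> 1 / \<rho> * cmod (conv c' d' k)"
      unfolding conv_def c'_def d'_def
    proof (rule norm_infsum_tail_le)
      show "(\<lambda>l. of_real (bw L l * cmod (c l)) * of_real (bw L (sg k l) * cmod (d (sg k l))) :: complex) summable_on K"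
        using conv_summable[OF sub[OF c'] sub[OF d'] k] by (simp add: c'_def d'_def)
    qed (use k wrap in \<open>auto simp: G_def\<close>)
    also have "cmod (\<Sum>\<^sub>\<infinity>l\<in>- G. c l * d (k - l)) \<le> 1 / \<rho> * cmod (full.conv c' d' k)"
      unfolding full.conv_def c'_def d'_def
    proof (rule norm_infsum_tail_le)
      show "(\<lambda>l. of_real (bw L l * cmod (c l)) * of_real (bw L (k - l) * cmod (d (k - l))) :: complex) summable_on UNIV"
        using full.conv_summable[OF c' d'] by (simp add: c'_def d'_def)
      show "\<rho> \<le> bw L l * bw L (k - l)" if "l \<in> - G" for l
        using that k tail[OF k, of l] sg_eq[OF k, of l] by (auto simp: G_def)
    qed simp
    finally have "cmod (conv c d k - full.conv c d k)
        \<le> 1 / \<rho> * cmod (conv c' d' k) + 1 / \<rho> * cmod (full.conv c' d' k)" by simp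
    also have "\<dots> = cmod (of_real (1 / \<rho> * (cmod (conv c' d' k) + cmod (full.conv c' d' k))) :: complex)"
      using \<rho> by (subst norm_of_real) (simp add: distrib_left)
    finally show ?thesis by simp
  qed
  have "hb L 1 K (\<lambda>k. of_real (1 / \<rho>) * (of_real (cmod (conv c' d' k)) + of_real (cmod (full.conv c' d' k))))
     (cmod (of_real (1 / \<rho>)) * (conv_const L 1 * A * B + conv_const L 1 * A * B))"
  proof (intro wbound_scale wbound_add)
    have norm_hb: "hb L 1 K (\<lambda>k. of_real (cmod (f k))) X" if "hb L 1 K f X" for f X
      using that unfolding wbound_def norm_of_real abs_norm_cancel .
    show "hb L 1 K (\<lambda>k. of_real (cmod (conv c' d' k))) (conv_const L 1 * A * B)"
      by (rule norm_hb[OF conv_hb[OF order_refl sub[OF c'] sub[OF d']]])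
    show "hb L 1 K (\<lambda>k. of_real (cmod (full.conv c' d' k))) (conv_const L 1 * A * B)"
      by (rule norm_hb[OF sub[OF full.conv_hb[OF order_refl c' d']]])
  qed simp
  then show ?thesis
  proof (rule wbound_mono)
    show "cmod (of_real (1 / \<rho>)) * (conv_const L 1 * A * B + conv_const L 1 * A * B)
        \<le> 2 * conv_const L 1 * A * B / \<rho>"
      using \<rho> by (simp only: norm_of_real) (simp add: mult_ac)
  next
    fix k assume "k \<in> K"
    from mult_left_mono[OF pt[OF this], of "bw L k"]
    show "bw L k ^ 1 * cmod (conv c d k - full.conv c d k)
        \<le> bw L k ^ 1 * cmod (of_real (1 / \<rho>) * (of_real (cmod (conv c' d' k)) + of_real (cmod (full.conv c' d' k))) :: complex)"
      unfolding power_one_right by simp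
  qed simp
qed

text \<open>The error of the inner product is carried through the window convolution; the error of
  the outer product is \<open>conv_aliasing\<close> for the exact square, which stays of order 2.
  Hence both \<open>conv_const L 1\<close> and \<open>conv_const L 2\<close>.\<close>

lemma cube_aliasing:
  assumes c: "hb L 2 UNIV c A"
  shows "hb L 1 K (\<lambda>k. cube c k - full.cube c k)
    (2 * conv_const L 1 * (conv_const L 1 + conv_const L 2) * A ^ 3 / \<rho>)"
proof -
  note sub = wbound_subset[OF _ subset_UNIV]
  have c1: "hb L 1 UNIV c A"
    by (rule hb_lower[OF c]) simp
  have cc: "hb L 2 UNIV (full.conv c c) (conv_const L 2 * A * A)"
    by (intro full.conv_hb c) simp
  have cc1: "hb L 1 UNIV (full.conv c c) (conv_const L 2 * A * A)"
    by (rule hb_lower[OF cc]) simp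
  have eq: "cube c k - full.cube c k
     = conv c (\<lambda>k. conv c c k - full.conv c c k) k
       + (conv c (full.conv c c) k - full.conv c (full.conv c c) k)" if k: "k \<in> K" for k
    unfolding cube_def full.cube_def
    by (subst conv_diff_right[OF sub[OF c1] conv_hb[OF order_refl sub[OF c1] sub[OF c1]] sub[OF cc1] k]) simp
  have "hb L 1 K (\<lambda>k. conv c (\<lambda>k. conv c c k - full.conv c c k) k
       + (conv c (full.conv c c) k - full.conv c (full.conv c c) k))
     (conv_const L 1 * A * (2 * conv_const L 1 * A * A / \<rho>)
       + 2 * conv_const L 1 * A * (conv_const L 2 * A * A) / \<rho>)"
    by (intro wbound_add conv_hb conv_aliasing sub[OF c1] c cc) auto
  also have "conv_const L 1 * A * (2 * conv_const L 1 * A * A / \<rho>)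
       + 2 * conv_const L 1 * A * (conv_const L 2 * A * A) / \<rho>
     = 2 * conv_const L 1 * (conv_const L 1 + conv_const L 2) * A ^ 3 / \<rho>"
    using \<rho> by (simp add: field_simps power3_eq_cube)
  finally show ?thesis
    by (rule wbound_cong[THEN iffD2, rotated]) (rule eq)
qed

end

lemma wave_mult: "wave L l m x * wave L l' m' x = wave L (l + l') (m + m') x"
  by (simp add: wave_def exp_add[symmetric] algebra_simps)

lemma norm_wave [simp]: "cmod (wave L l m x) = 1"
  by (simp add: wave_def)

section \<open>The differentiation matrix\<close>

text \<open>Stands in for matrix inversion: it yields the zero pattern of \<open>D_R\<close> and,
  for vector-valued unknowns, the passage from cumulative stage equations to local ones. Row
  \<open>i\<close> determines \<open>y i\<close> once the earlier values vanish.\<close>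

lemma forward_substitution:
  fixes y :: "nat \<Rightarrow> 'a::real_vector"
  assumes diag: "\<And>k. k \<in> {1..n} \<Longrightarrow> a (k + 1) k \<noteq> (0::real)"
    and eq: "\<And>i. i \<in> {1..n} \<Longrightarrow> (\<Sum>j=1..i. a (i + 1) j *\<^sub>R y j) = 0"
    and k: "k \<in> {1..n}"
  shows "y k = 0"
  using k
proof (induction k rule: less_induct)
  case (less k)
  have "(\<Sum>j=1..k. a (k + 1) j *\<^sub>R y j) = (\<Sum>j\<in>{1..k} - {k}. a (k + 1) j *\<^sub>R y j) + a (k + 1) k *\<^sub>R y k"
    using less.prems by (subst sum.remove[of _ k]) auto
  also have "(\<Sum>j\<in>{1..k} - {k}. a (k + 1) j *\<^sub>R y j) = 0"
    using less by (intro sum.neutral) auto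
  finally show ?case
    using eq[OF less.prems] diag[OF less.prems] by simp
qed

text \<open>Compactness of the unit sphere and homogeneity of degree two. A constant instead of mere
  positivity is what lets the increments absorb the forcing in
  \<open>mode_stability\<close>.\<close>

lemma quad_form_coercive:
  fixes q :: "nat \<Rightarrow> nat \<Rightarrow> real"
  assumes pos: "\<And>x. \<exists>k<n. x k \<noteq> 0 \<Longrightarrow> 0 < (\<Sum>k<n. \<Sum>l<n. q k l * x k * x l)"
  shows "\<exists>c>0. \<forall>x. c * (\<Sum>k<n. (x k)\<^sup>2) \<le> (\<Sum>k<n. \<Sum>l<n. q k l * x k * x l)"
proof (cases "n = 0")
  case True
  then show ?thesis by (intro exI[of _ 1]) auto
next
  case False
  define Q where "Q x = (\<Sum>k<n. \<Sum>l<n. q k l * x k * x l)" for x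
  \<comment> \<open>Vectors are functions on all naturals; pinning the coordinates from
    \<open>n\<close> on to 0 makes the cube compact in the product topology.\<close>
  define B where "B = PiE UNIV (\<lambda>i. if i < n then {-1..1::real} else {0})"
  define S where "S = B \<inter> {x. (\<Sum>k<n. (x k)\<^sup>2) = 1}"
  have contc: "continuous_on UNIV (\<lambda>x::nat \<Rightarrow> real. x k)" for k
    by simp
  have "compactin (product_topology (\<lambda>i. euclidean) UNIV) B"
    unfolding B_def by (subst compactin_PiE) auto
  then have "compact B"
    by (simp add: euclidean_product_topology)
  moreover have "closed {x::nat \<Rightarrow> real. (\<Sum>k<n. (x k)\<^sup>2) = 1}"
    by (intro closed_Collect_eq continuous_intros contc)
  ultimately have "compact S"
    unfolding S_def by (rule compact_Int_closed)
  moreover have "S \<noteq> {}"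
  proof -
    have "(\<Sum>k<n. ((if k = 0 then 1 else 0)::real)\<^sup>2) = (\<Sum>k<n. if k = 0 then 1 else 0)"
      by (intro sum.cong) auto
    also have "\<dots> = 1" using False by simp
    finally have "(\<lambda>k. if k = 0 then 1 else 0) \<in> S"
      using False by (auto simp: S_def B_def PiE_def)
    then show ?thesis by blast
  qed
  moreover have "continuous_on S Q"
    unfolding Q_def by (intro continuous_intros continuous_on_subset[OF contc]) auto
  ultimately obtain x0 where x0: "x0 \<in> S" "\<And>x. x \<in> S \<Longrightarrow> Q x0 \<le> Q x"
    using continuous_attains_inf by metis
  have "\<exists>k<n. x0 k \<noteq> 0"
  proof (rule ccontr)
    assume "\<not> ?thesis"
    then have "(\<Sum>k<n. (x0 k)\<^sup>2) = 0" by (intro sum.neutral) auto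
    then show False using x0(1) by (auto simp: S_def)
  qed
  then have Q0: "Q x0 > 0" unfolding Q_def by (rule pos)
  have "Q x0 * (\<Sum>k<n. (x k)\<^sup>2) \<le> Q x" for x
  proof (cases "(\<Sum>k<n. (x k)\<^sup>2) = 0")
    case True
    then have "x k = 0" if "k < n" for k
      using that by (simp add: sum_nonneg_eq_0_iff)
    then have "Q x = 0" unfolding Q_def by (intro sum.neutral ballI) auto
    then show ?thesis using True by simp
  next
    case False
    define r where "r = sqrt (\<Sum>k<n. (x k)\<^sup>2)"
    have r2: "r\<^sup>2 = (\<Sum>k<n. (x k)\<^sup>2)" by (simp add: r_def sum_nonneg)
    have r: "r > 0" using False sum_nonneg[of "{..<n}" "\<lambda>k. (x k)\<^sup>2"] by (simp add: r_def less_le)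
    define y where "y k = (if k < n then x k / r else 0)" for k
    have "(\<Sum>k<n. (y k)\<^sup>2) = (\<Sum>k<n. (x k)\<^sup>2 / r\<^sup>2)"
      by (intro sum.cong) (auto simp: y_def power_divide)
    also have "\<dots> = (\<Sum>k<n. (x k)\<^sup>2) / r\<^sup>2" by (rule sum_divide_distrib[symmetric])
    also have "\<dots> = 1" using r unfolding r2[symmetric] by simp
    finally have y1: "(\<Sum>k<n. (y k)\<^sup>2) = 1" .
    have "\<bar>y k\<bar> \<le> 1" if "k < n" for k
    proof -
      have "(y k)\<^sup>2 \<le> 1"
        unfolding y1[symmetric] using that by (intro member_le_sum) auto
      then show ?thesis by (simp add: abs_square_le_1)
    qed
    then have "y \<in> B" by (auto simp: B_def PiE_def abs_le_iff) (auto simp: y_def)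
    then have "Q x0 \<le> Q y" using x0(2) y1 by (auto simp: S_def)
    also have "Q y = (\<Sum>k<n. \<Sum>l<n. q k l * x k * x l / r\<^sup>2)"
      unfolding Q_def by (intro sum.cong) (auto simp: y_def power2_eq_square)
    also have "\<dots> = Q x / r\<^sup>2"
      by (simp add: Q_def sum_divide_distrib)
    finally show ?thesis using r by (simp add: r2[symmetric] field_simps)
  qed
  then show ?thesis using Q0 by (auto simp: Q_def)
qed

lemma A_E_carrier: "A_E s a \<in> carrier_mat (s - 1) (s - 1)"
  by (simp add: A_E_def)

text \<open>\<open>A_E\<close> is triangular with the coefficients \<open>a (k + 1) k\<close> on its
  diagonal, so the determinant is nonzero and \<open>the (mat_inverse (A_E s a))\<close> is a
  genuine inverse, not an unspecified value.\<close>

lemma D_R_eq: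
  assumes "rierk_method s a"
  shows "D_R s a \<in> carrier_mat (s - 1) (s - 1)" "A_E s a * D_R s a = E_low (s - 1)"
proof -
  let ?n = "s - 1"
  have diag: "a (k + 1) k \<noteq> 0" if "k \<in> {1..?n}" for k
    using assms that by (auto simp: rierk_method_def)
  have "det (A_E s a) = prod_list (diag_mat (A_E s a))"
    by (rule det_lower_triangular[OF _ A_E_carrier]) (auto simp: A_E_def)
  also have "\<dots> \<noteq> 0"
    using diag[of "Suc _"] by (auto simp: prod_list_zero_iff diag_mat_def A_E_def)
  finally have "A_E s a \<in> Units (ring_mat TYPE(real) ?n ())"
    by (rule det_non_zero_imp_unit[OF A_E_carrier])
  then obtain B where B: "mat_inverse (A_E s a) = Some B"
    using mat_inverse(1)[OF A_E_carrier, of s a "()"] by (cases "mat_inverse (A_E s a)") auto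
  from mat_inverse(2)[OF A_E_carrier B]
  have AB: "A_E s a * B = 1\<^sub>m ?n" and Bc: "B \<in> carrier_mat ?n ?n" by auto
  have E: "E_low ?n \<in> carrier_mat ?n ?n" by (simp add: E_low_def)
  show "D_R s a \<in> carrier_mat ?n ?n"
    using Bc E by (simp add: D_R_def B)
  have "A_E s a * (B * E_low ?n) = A_E s a * B * E_low ?n"
    by (rule assoc_mult_mat[symmetric, OF A_E_carrier Bc E])
  then show "A_E s a * D_R s a = E_low ?n"
    using E by (simp add: D_R_def B AB)
qed

text \<open>Entrywise form of \<open>A_E * D_R = E_low\<close> with indices starting at 1, so that
  stage equations can be handled without matrices.\<close>

lemma sum_a_d_R:
  assumes r: "rierk_method s a" and i: "i \<in> {1..s - 1}" and l: "l \<in> {1..s - 1}"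
  shows "(\<Sum>j=1..i. a (i + 1) j * d_R s a j l) = (if l \<le> i then 1 else 0)"
proof -
  let ?n = "s - 1"
  note D = D_R_eq[OF r]
  have "(A_E s a * D_R s a) $$ (i - 1, l - 1) = (\<Sum>j<?n. A_E s a $$ (i - 1, j) * D_R s a $$ (j, l - 1))"
  proof -
    have "(A_E s a * D_R s a) $$ (i - 1, l - 1) = scalar_prod (Matrix.row (A_E s a) (i - 1)) (col (D_R s a) (l - 1))"
      using D(1) i l A_E_carrier[of s a] by (intro index_mult_mat(1)) auto
    then show ?thesis
      using D(1) i l A_E_carrier[of s a] by (auto simp: scalar_prod_def atLeast0LessThan intro!: sum.cong)
  qed
  also have "\<dots> = (\<Sum>j<i. a (i + 1) (j + 1) * D_R s a $$ (j, l - 1))"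
    using i l by (intro sum.mono_neutral_cong_right) (auto simp: A_E_def)
  also have "\<dots> = (\<Sum>j=1..i. a (i + 1) j * d_R s a j l)"
    unfolding d_R_def by (rule sum.reindex_bij_witness[of _ "\<lambda>j. j - 1" "\<lambda>j. j + 1"]) auto
  finally have "E_low ?n $$ (i - 1, l - 1) = (\<Sum>j=1..i. a (i + 1) j * d_R s a j l)"
    unfolding D(2) .
  moreover have "E_low ?n $$ (i - 1, l - 1) = (if l - 1 \<le> i - 1 then 1 else 0)"
    unfolding E_low_def using i l by (subst index_mat(1)) auto
  moreover have "l - 1 \<le> i - 1 \<longleftrightarrow> l \<le> i" using i l by auto
  ultimately show ?thesis by simp
qed

text \<open>The first \<open>l - 1\<close> entries of column \<open>l\<close> of
  \<open>E_low\<close> vanish, so the corresponding entries of \<open>D_R\<close> solve a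
  homogeneous triangular system.\<close>

lemma d_R_upper:
  assumes r: "rierk_method s a" and kl: "k < l" "k \<in> {1..s - 1}" "l \<in> {1..s - 1}"
  shows "d_R s a k l = 0"
proof (rule forward_substitution[where n = "l - 1" and a = a and y = "\<lambda>j. d_R s a j l"])
  show "(\<Sum>j=1..i. a (i + 1) j *\<^sub>R d_R s a j l) = 0" if "i \<in> {1..l - 1}" for i
    using sum_a_d_R[OF r, of i l] that kl by auto
qed (use r kl in \<open>auto simp: rierk_method_def\<close>)

text \<open>Passes from equations summed up to stage \<open>i\<close> to one equation per stage: the
  error of the claimed identity solves a homogeneous triangular system. It is applied to complex
  Fourier modes in \<open>mode_stability\<close> and to real grid values in
  \<open>energy_law\<close>.\<close>

lemma stage_differences:
  fixes x g :: "nat \<Rightarrow> 'a::real_vector"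
  assumes r: "rierk_method s a"
    and eq: "\<And>i. i \<in> {1..s - 1} \<Longrightarrow> (\<Sum>l=1..i. x l) = (\<Sum>j=1..i. a (i + 1) j *\<^sub>R g j)"
    and k: "k \<in> {1..s - 1}"
  shows "(\<Sum>l=1..k. d_R s a k l *\<^sub>R x l) = g k"
proof -
  let ?y = "\<lambda>k. (\<Sum>l=1..k. d_R s a k l *\<^sub>R x l)"
  have "?y k - g k = 0"
  proof (rule forward_substitution[where n = "s - 1" and a = a and y = "\<lambda>k. ?y k - g k", OF _ _ k])
    fix i assume i: "i \<in> {1..s - 1}"
    have "(\<Sum>j=1..i. a (i + 1) j *\<^sub>R ?y j) = (\<Sum>j=1..i. \<Sum>l=1..i. (a (i + 1) j * d_R s a j l) *\<^sub>R x l)"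
    proof (rule sum.cong[OF refl])
      fix j assume j: "j \<in> {1..i}"
      have "?y j = (\<Sum>l=1..i. d_R s a j l *\<^sub>R x l)"
      proof (rule sum.mono_neutral_left)
        show "\<forall>l\<in>{1..i} - {1..j}. d_R s a j l *\<^sub>R x l = 0"
          using i j by (auto intro!: d_R_upper[OF r])
      qed (use j in auto)
      then show "a (i + 1) j *\<^sub>R ?y j = (\<Sum>l=1..i. (a (i + 1) j * d_R s a j l) *\<^sub>R x l)"
        by (simp add: scaleR_sum_right)
    qed
    also have "\<dots> = (\<Sum>l=1..i. (\<Sum>j=1..i. a (i + 1) j * d_R s a j l) *\<^sub>R x l)"
      by (subst sum.swap) (simp add: scaleR_sum_left)
    also have "\<dots> = (\<Sum>l=1..i. x l)"
      using i by (intro sum.cong refl) (simp add: sum_a_d_R[OF r i, simplified])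
    also have "\<dots> = (\<Sum>j=1..i. a (i + 1) j *\<^sub>R g j)" by (rule eq[OF i])
    finally show "(\<Sum>j=1..i. a (i + 1) j *\<^sub>R (?y j - g j)) = 0"
      by (simp add: scaleR_diff_right sum_subtractf)
  qed (use r in \<open>auto simp: rierk_method_def\<close>)
  then show ?thesis by simp
qed

text \<open>Symmetrisation leaves the quadratic form unchanged.\<close>

lemma pos_def_quad_form:
  assumes D: "D \<in> carrier_mat n n" and p: "pos_def D" and x: "\<exists>k<n. x k \<noteq> 0"
  shows "0 < (\<Sum>k<n. \<Sum>l<n. D $$ (k, l) * x k * x l)"
proof -
  let ?S = "(1/2) \<cdot>\<^sub>m (D + transpose_mat D)" and ?v = "Matrix.vec n x"
  have S: "?S \<in> carrier_mat n n" using D by simp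
  have "?v \<noteq> 0\<^sub>v n"
    using x by (metis index_vec index_zero_vec(1))
  then have "0 < scalar_prod ?v (?S *\<^sub>v ?v)"
    using p S D by (auto simp: pos_def_def sym_pos_def_def)
  also have "scalar_prod ?v (?S *\<^sub>v ?v) = (\<Sum>k<n. \<Sum>l<n. (D $$ (k, l) + D $$ (l, k)) / 2 * x k * x l)"
    using D by (simp add: scalar_prod_def mult_mat_vec_def atLeast0LessThan sum_distrib_left)
      (intro sum.cong refl, simp add: algebra_simps)
  also have "\<dots> = (\<Sum>k<n. \<Sum>l<n. D $$ (k, l) * x k * x l) / 2 + (\<Sum>k<n. \<Sum>l<n. D $$ (l, k) * x k * x l) / 2"
    by (simp add: sum_divide_distrib sum.distrib[symmetric] field_simps)
  also have "(\<Sum>k<n. \<Sum>l<n. D $$ (l, k) * x k * x l) = (\<Sum>k<n. \<Sum>l<n. D $$ (k, l) * x k * x l)"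
    by (subst sum.swap) (simp add: mult_ac)
  finally show ?thesis by simp
qed

text \<open>One constant serves all leading blocks, as shorter vectors extend by zeros, and complex
  vectors, as the form splits into real and imaginary parts. Blocks are needed because the stages
  are estimated one after the other.\<close>

lemma d_R_coercive:
  assumes r: "rierk_method s a" and p: "pos_def (D_R s a)"
  shows "\<exists>c>0. \<forall>j\<in>{1..s - 1}. \<forall>x::nat \<Rightarrow> complex.
     c * (\<Sum>k=1..j. (cmod (x k))\<^sup>2) \<le> (\<Sum>k=1..j. inner (\<Sum>l=1..k. d_R s a k l *\<^sub>R x l) (x k))"
proof -
  let ?n = "s - 1"
  obtain c where c: "c > 0"
    "\<And>x. c * (\<Sum>k<?n. (x k)\<^sup>2) \<le> (\<Sum>k<?n. \<Sum>l<?n. D_R s a $$ (k, l) * x k * x l)"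
    using quad_form_coercive[OF pos_def_quad_form[OF D_R_eq(1)[OF r] p]] by blast
  have real: "c * (\<Sum>k=1..j. (x k)\<^sup>2) \<le> (\<Sum>k=1..j. \<Sum>l=1..k. d_R s a k l * x l * x k)"
    if j: "j \<in> {1..?n}" for j and x :: "nat \<Rightarrow> real"
  proof -
    define y where "y k = (if k < j then x (k + 1) else 0)" for k
    have "(\<Sum>k=1..j. (x k)\<^sup>2) = (\<Sum>k<j. (x (k + 1))\<^sup>2)"
      by (rule sum.reindex_bij_witness[of _ "\<lambda>j. j + 1" "\<lambda>j. j - 1"]) auto
    also have "\<dots> = (\<Sum>k<?n. (y k)\<^sup>2)"
      using j by (intro sum.mono_neutral_cong_left) (auto simp: y_def)
    finally have "c * (\<Sum>k=1..j. (x k)\<^sup>2) \<le> (\<Sum>k<?n. \<Sum>l<?n. D_R s a $$ (k, l) * y k * y l)"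
      using c(2)[of y] by simp
    also have "\<dots> = (\<Sum>k<j. \<Sum>l<j. D_R s a $$ (k, l) * y k * y l)"
    proof -
      have "(\<Sum>k<?n. \<Sum>l<?n. D_R s a $$ (k, l) * y k * y l) = (\<Sum>k<j. \<Sum>l<?n. D_R s a $$ (k, l) * y k * y l)"
        using j by (intro sum.mono_neutral_right) (auto simp: y_def)
      also have "\<dots> = (\<Sum>k<j. \<Sum>l<j. D_R s a $$ (k, l) * y k * y l)"
        using j by (intro sum.cong refl sum.mono_neutral_right) (auto simp: y_def)
      finally show ?thesis .
    qed
    also have "\<dots> = (\<Sum>k<j. \<Sum>l=1..j. d_R s a (k + 1) l * x (k + 1) * x l)"
      unfolding d_R_def
      by (intro sum.cong refl sum.reindex_bij_witness[of _ "\<lambda>j. j - 1" "\<lambda>j. j + 1"]) (auto simp: y_def)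
    also have "\<dots> = (\<Sum>k=1..j. \<Sum>l=1..j. d_R s a k l * x k * x l)"
      by (rule sum.reindex_bij_witness[of _ "\<lambda>j. j - 1" "\<lambda>j. j + 1"]) auto
    also have "\<dots> = (\<Sum>k=1..j. \<Sum>l=1..k. d_R s a k l * x l * x k)"
    proof (rule sum.cong[OF refl])
      fix k assume k: "k \<in> {1..j}"
      have "(\<Sum>l=1..j. d_R s a k l * x k * x l) = (\<Sum>l=1..k. d_R s a k l * x k * x l)"
        using k j d_R_upper[OF r, of k] by (intro sum.mono_neutral_right) auto
      then show "(\<Sum>l=1..j. d_R s a k l * x k * x l) = (\<Sum>l=1..k. d_R s a k l * x l * x k)"
        by (simp add: mult_ac)
    qed
    finally show ?thesis .
  qed
  have "c * (\<Sum>k=1..j. (cmod (x k))\<^sup>2) \<le> (\<Sum>k=1..j. inner (\<Sum>l=1..k. d_R s a k l *\<^sub>R x l) (x k))"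
    if j: "j \<in> {1..?n}" for j and x :: "nat \<Rightarrow> complex"
  proof -
    have "c * (\<Sum>k=1..j. (cmod (x k))\<^sup>2) = c * (\<Sum>k=1..j. (Re (x k))\<^sup>2) + c * (\<Sum>k=1..j. (Im (x k))\<^sup>2)"
      by (simp add: cmod_power2 sum.distrib distrib_left)
    also have "\<dots> \<le> (\<Sum>k=1..j. \<Sum>l=1..k. d_R s a k l * Re (x l) * Re (x k))
       + (\<Sum>k=1..j. \<Sum>l=1..k. d_R s a k l * Im (x l) * Im (x k))"
      by (intro add_mono real j)
    also have "\<dots> = (\<Sum>k=1..j. inner (\<Sum>l=1..k. d_R s a k l *\<^sub>R x l) (x k))"
      by (simp add: inner_complex_def sum.distrib sum_distrib_left mult_ac)
    finally show ?thesis .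
  qed
  then show ?thesis using c(1) by blast
qed

text \<open>The scheme is tested with the increments \<open>x k\<close>: the implicit average
  becomes the telescoping differences \<open>q k\<close> of squared moduli, and coercivity of
  \<open>D_R\<close> provides \<open>c |x k|^2\<close>, which pays for the forcing. The factor
  \<open>\<tau>\<close> left in front of the forcing is what Gronwall needs.\<close>

lemma mode_stability:
  fixes e g :: "nat \<Rightarrow> complex" and \<mu> \<tau> c :: real
  assumes r: "rierk_method s a" and c: "c > 0"
    and coer: "\<And>j x. j \<in> {1..s - 1} \<Longrightarrow>
     c * (\<Sum>k=1..j. (cmod (x k))\<^sup>2) \<le> (\<Sum>k=1..j. inner (\<Sum>l=1..k. d_R s a k l *\<^sub>R x l) (x k :: complex))"
    and \<tau>: "\<tau> > 0"
    and eq: "\<And>i. i \<in> {1..s - 1} \<Longrightarrow>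
      e (i + 1) = e 1 + \<tau> *\<^sub>R (\<Sum>j=1..i. a (i + 1) j *\<^sub>R (g j - \<mu> *\<^sub>R ((e j + e (j + 1)) /\<^sub>R 2)))"
    and i: "i \<in> {1..s - 1}"
  shows "\<mu> * (cmod (e (i + 1)))\<^sup>2 \<le> \<mu> * (cmod (e 1))\<^sup>2 + \<tau> / (2 * c) * (\<Sum>j=1..i. (cmod (g j))\<^sup>2)"
proof -
  define x where "x l = e (l + 1) - e l" for l
  define m where "m j = (e j + e (j + 1)) /\<^sub>R 2" for j
  define G where "G j = g j - \<mu> *\<^sub>R m j" for j
  define q where "q k = (cmod (e (k + 1)))\<^sup>2 - (cmod (e k))\<^sup>2" for k
  have tel: "(\<Sum>l=1..i. x l) = e (i + 1) - e 1" for i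
    by (induction i) (auto simp: x_def)
  have "(\<Sum>l=1..i. x l) = (\<Sum>j=1..i. a (i + 1) j *\<^sub>R (\<tau> *\<^sub>R G j))" if "i \<in> {1..s - 1}" for i
    unfolding tel eq[OF that] G_def m_def add_diff_cancel_left'
    by (simp only: scaleR_sum_right scaleR_left_commute[of \<tau>])
  from stage_differences[OF r this]
  have D: "(\<Sum>l=1..k. d_R s a k l *\<^sub>R x l) = \<tau> *\<^sub>R G k" if "k \<in> {1..s - 1}" for k
    using that by blast
  \<comment> \<open>The weights are balanced so that the term in \<open>x k\<close> is exactly the
    coercive one and cancels below.\<close>
  have young: "\<tau> * inner (g k) (x k) \<le> c * (cmod (x k))\<^sup>2 + \<tau>\<^sup>2 / (4 * c) * (cmod (g k))\<^sup>2" for k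
  proof -
    have "\<tau> * inner (g k) (x k) \<le> \<tau> * (cmod (g k) * cmod (x k))"
      using \<tau> by (intro mult_left_mono norm_cauchy_schwarz) auto
    also have "\<dots> \<le> c * (cmod (x k))\<^sup>2 + \<tau>\<^sup>2 / (4 * c) * (cmod (g k))\<^sup>2"
    proof -
      have "0 \<le> (2 * c * cmod (x k) - \<tau> * cmod (g k))\<^sup>2" by simp
      also have "\<dots> = 4 * c * (c * (cmod (x k))\<^sup>2 + \<tau>\<^sup>2 / (4 * c) * (cmod (g k))\<^sup>2 - \<tau> * (cmod (g k) * cmod (x k)))"
        using c by (simp add: power2_eq_square field_simps)
      finally show ?thesis using c by (simp add: zero_le_mult_iff)
    qed
    finally show ?thesis .
  qed
  have par: "inner (m k) (x k) = q k / 2" for k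
    by (simp add: m_def q_def x_def power2_norm_eq_inner inner_add_left inner_add_right
        inner_diff_left inner_diff_right inner_commute)
  have "c * (\<Sum>k=1..i. (cmod (x k))\<^sup>2) \<le> (\<Sum>k=1..i. inner (\<Sum>l=1..k. d_R s a k l *\<^sub>R x l) (x k))"
    by (rule coer[OF i])
  also have "\<dots> = (\<Sum>k=1..i. \<tau> * inner (g k) (x k) - \<tau> * \<mu> / 2 * q k)"
  proof (rule sum.cong[OF refl])
    fix k assume "k \<in> {1..i}"
    then have "k \<in> {1..s - 1}" using i by auto
    from D[OF this] show "inner (\<Sum>l=1..k. d_R s a k l *\<^sub>R x l) (x k)
       = \<tau> * inner (g k) (x k) - \<tau> * \<mu> / 2 * q k"
      by (simp only: G_def inner_scaleR_left inner_diff_left par) (simp add: right_diff_distrib)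
  qed
  also have "\<dots> \<le> (\<Sum>k=1..i. c * (cmod (x k))\<^sup>2 + \<tau>\<^sup>2 / (4 * c) * (cmod (g k))\<^sup>2
       - \<tau> * \<mu> / 2 * q k)"
    by (intro sum_mono diff_right_mono young)
  also have "\<dots> = c * (\<Sum>k=1..i. (cmod (x k))\<^sup>2) + \<tau>\<^sup>2 / (4 * c) * (\<Sum>k=1..i. (cmod (g k))\<^sup>2)
       - \<tau> * \<mu> / 2 * (\<Sum>k=1..i. q k)"
    by (simp only: sum_subtractf sum.distrib sum_distrib_left)
  also have "(\<Sum>k=1..i. q k) = (cmod (e (i + 1)))\<^sup>2 - (cmod (e 1))\<^sup>2"
    unfolding q_def by (induction i) auto
  finally have "\<tau> * (\<mu> / 2 * ((cmod (e (i + 1)))\<^sup>2 - (cmod (e 1))\<^sup>2)) \<le> \<tau> * (\<tau> / (4 * c) * (\<Sum>k=1..i. (cmod (g k))\<^sup>2))"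
    by (simp add: power2_eq_square mult_ac)
  from mult_left_le_imp_le[OF this \<tau>]
  have "\<mu> / 2 * ((cmod (e (i + 1)))\<^sup>2 - (cmod (e 1))\<^sup>2) \<le> \<tau> / (4 * c) * (\<Sum>k=1..i. (cmod (g k))\<^sup>2)" .
  moreover have "\<tau> / (2 * c) * S = 2 * (\<tau> / (4 * c) * S)" for S :: real
    by simp
  ultimately show ?thesis by (simp add: right_diff_distrib)
qed

section \<open>Stability of the scheme in the energy norm\<close>

lemma wbound_weight:
  assumes "wbound w K c B" "\<And>k. k \<in> K \<Longrightarrow> 0 \<le> w' k" "\<And>k. k \<in> K \<Longrightarrow> w' k \<le> C * w k" "C \<ge> 0"
  shows "wbound w' K c (C * B)"
proof -
  have "wbound w' K c (cmod (of_real C) * B)"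
  proof (rule wbound_mono[OF wbound_scale[OF assms(1), of "of_real C"] order_refl])
    fix k assume k: "k \<in> K"
    show "0 \<le> w' k * cmod (c k)" using assms(2)[OF k] by simp
    have "w' k * cmod (c k) \<le> C * w k * cmod (c k)"
      by (intro mult_right_mono assms(3) k norm_ge_zero)
    then show "w' k * cmod (c k) \<le> w k * cmod (of_real C * c k)"
      using assms(4) by (simp add: norm_mult mult_ac)
  qed
  then show ?thesis using assms(4) by simp
qed

text \<open>The last summand controls the mode \<open>0\<close>, whose coefficient the scheme conserves.\<close>

definition ew :: "real \<Rightarrow> real \<Rightarrow> real \<Rightarrow> int \<times> int \<Rightarrow> real" where
  "ew L \<epsilon> \<kappa> k = lam L k * (\<epsilon>\<^sup>2 * lam L k + \<kappa>) + (if lam L k = 0 then 1 else 0)"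

abbreviation eb :: "real \<Rightarrow> real \<Rightarrow> real \<Rightarrow> (int \<times> int) set \<Rightarrow> (int \<times> int \<Rightarrow> complex) \<Rightarrow> real \<Rightarrow> bool" where
  "eb L \<epsilon> \<kappa> \<equiv> wbound (\<lambda>k. sqrt (ew L \<epsilon> \<kappa> k))"

lemma ew_nonneg: "\<kappa> \<ge> 0 \<Longrightarrow> ew L \<epsilon> \<kappa> k \<ge> 0"
  by (auto simp: ew_def intro!: add_nonneg_nonneg mult_nonneg_nonneg)

text \<open>Spectral gap of the periodic Laplacian; it lets \<open>lam\<close> alone dominate
  \<open>bw\<close> away from the mode 0.\<close>

lemma lam_cases:
  assumes "L > 0"
  shows "lam L k = 0 \<or> lam L k \<ge> (freq L)\<^sup>2"
proof (cases "k = 0")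
  case False
  then have "1 \<le> (fst k)\<^sup>2 + (snd k)\<^sup>2"
    by (metis add_nonneg_nonneg add_nonneg_eq_0_iff int_one_le_iff_zero_less less_le prod_eqI
        fst_zero snd_zero power_eq_0_iff zero_le_power2)
  then have "1 \<le> (of_int (fst k))\<^sup>2 + (of_int (snd k) :: real)\<^sup>2"
    by (metis of_int_1 of_int_add of_int_le_iff of_int_power)
  from mult_left_mono[OF this, of "(freq L)\<^sup>2"] show ?thesis
    by (simp add: lam_def)
qed (simp add: lam_def)

lemma ew_le_bw:
  assumes "\<kappa> \<ge> 0"
  shows "sqrt (ew L \<epsilon> \<kappa> k) \<le> sqrt (\<epsilon>\<^sup>2 + \<kappa> + 1) * bw L k"
proof -
  define x where "x = lam L k"
  have x: "x \<ge> 0" by (simp add: x_def)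
  have "x * (\<epsilon>\<^sup>2 * x + \<kappa>) + 1 \<le> (\<epsilon>\<^sup>2 + \<kappa> + 1) * (1 + x)\<^sup>2"
  proof -
    have "(\<epsilon>\<^sup>2 + \<kappa> + 1) * (1 + x)\<^sup>2 = x * (\<epsilon>\<^sup>2 * x + \<kappa>) + 1
        + (\<epsilon>\<^sup>2 * (1 + 2 * x) + \<kappa> * (1 + x + x * x) + 2 * x + x * x)"
      by (simp add: power2_eq_square algebra_simps)
    moreover have "\<epsilon>\<^sup>2 * (1 + 2 * x) + \<kappa> * (1 + x + x * x) + 2 * x + x * x \<ge> 0"
      using x assms by (intro add_nonneg_nonneg mult_nonneg_nonneg) auto
    ultimately show ?thesis by simp
  qed
  then have "ew L \<epsilon> \<kappa> k \<le> (\<epsilon>\<^sup>2 + \<kappa> + 1) * (bw L k)\<^sup>2"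
    unfolding ew_def bw_def x_def by (auto split: if_splits)
  then have "sqrt (ew L \<epsilon> \<kappa> k) \<le> sqrt ((\<epsilon>\<^sup>2 + \<kappa> + 1) * (bw L k)\<^sup>2)"
    by (rule real_sqrt_le_mono)
  then show ?thesis by (simp add: real_sqrt_mult)
qed

text \<open>Away from the mode 0, \<open>bw\<close> is at most
  \<open>(1 + 1 / (freq L)^2) lam\<close> by the spectral gap, and \<open>\<epsilon> lam\<close> is
  at most the energy weight; the added 1 covers the mode 0. The constant is uniform in
  \<open>\<kappa>\<close>.\<close>

definition Cb :: "real \<Rightarrow> real \<Rightarrow> real" where
  "Cb L \<epsilon> = (1 + 1 / (freq L)\<^sup>2) / \<epsilon> + 1"

lemma bw_le_ew:
  assumes "L > 0" "\<epsilon> > 0" "\<kappa> \<ge> 0"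
  shows "bw L k \<le> Cb L \<epsilon> * sqrt (ew L \<epsilon> \<kappa> k)"
proof (cases "lam L k = 0")
  case True
  then show ?thesis using assms by (simp add: ew_def bw_def Cb_def)
next
  case False
  define x where "x = lam L k"
  define f where "f = (freq L)\<^sup>2"
  have f: "f > 0" using assms by (simp add: f_def freq_def)
  have x: "x \<ge> f" using lam_cases[OF assms(1), of k] False by (simp add: x_def f_def)
  have "(\<epsilon> * x)\<^sup>2 \<le> ew L \<epsilon> \<kappa> k"
    using assms False by (simp add: ew_def x_def power2_eq_square algebra_simps)
  then have 1: "\<epsilon> * x \<le> sqrt (ew L \<epsilon> \<kappa> k)"
    by (rule real_le_rsqrt)
  have "1 + x \<le> (1 + 1 / f) * x"
    using x f by (simp add: field_simps)
  also have "\<dots> = (1 + 1 / f) / \<epsilon> * (\<epsilon> * x)"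
    using assms by simp
  also have "\<dots> \<le> (1 + 1 / f) / \<epsilon> * sqrt (ew L \<epsilon> \<kappa> k)"
    using f assms by (intro mult_left_mono 1) auto
  also have "\<dots> \<le> Cb L \<epsilon> * sqrt (ew L \<epsilon> \<kappa> k)"
    using ew_nonneg[OF assms(3)] by (intro mult_right_mono) (auto simp: Cb_def f_def)
  finally show ?thesis by (simp add: bw_def x_def)
qed

lemma Cb_ge_1: "\<epsilon> > 0 \<Longrightarrow> Cb L \<epsilon> \<ge> 1"
  by (simp add: Cb_def)

lemma hb_imp_eb:
  assumes "\<kappa> \<ge> 0" "hb L 1 K c B"
  shows "eb L \<epsilon> \<kappa> K c (sqrt (\<epsilon>\<^sup>2 + \<kappa> + 1) * B)"
  by (rule wbound_weight[OF assms(2)]) (use assms ew_nonneg ew_le_bw in auto)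

lemma eb_imp_hb:
  assumes "L > 0" "\<epsilon> > 0" "\<kappa> \<ge> 0" "eb L \<epsilon> \<kappa> K c B"
  shows "hb L 1 K c (Cb L \<epsilon> * B)"
  by (rule wbound_weight[OF assms(4)]) (use assms bw_le_ew Cb_ge_1[of \<epsilon> L] in auto)

text \<open>Lipschitz constant of the explicit forcing on the ball of radius \<open>R + 1\<close>,
  from the energy norm (hence \<open>Cb\<close>) to \<open>l^2\<close>: \<open>\<kappa> + 1\<close>
  from the linear part, the middle term from \<open>cube_diff_hb\<close>, the final 1 from the
  defect.\<close>

definition gain :: "real \<Rightarrow> real \<Rightarrow> real \<Rightarrow> real \<Rightarrow> real" where
  "gain L \<epsilon> \<kappa> R = Cb L \<epsilon> * (\<kappa> + 1 + 3 * (conv_const L 1)\<^sup>2 * (R + 1)\<^sup>2) + 1"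

context spectral
begin

text \<open>The condition \<open>Cb L \<epsilon> * B \<le> 1\<close> keeps \<open>c\<close> within
  distance 1 of \<open>w\<close> in \<open>H^2\<close>, so the cube is Lipschitz with a constant
  depending only on \<open>R\<close>. The factor \<open>lam\<close> costs one order of
  \<open>hb\<close> and leaves \<open>l^2\<close>.\<close>

lemma forcing_bound:
  assumes par: "\<epsilon> > 0" "\<kappa> \<ge> 0"
    and e: "eb L \<epsilon> \<kappa> K (\<lambda>k. c k - w k) B" "Cb L \<epsilon> * B \<le> 1"
    and w: "hb L 1 K w R" and z: "hb L 0 K z B"
  shows "hb L 0 K (\<lambda>k. of_real (lam L k) * (of_real (\<kappa> + 1) * (c k - w k) - (cube c k - cube w k)) - z k)
    (gain L \<epsilon> \<kappa> R * B)"
proof -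
  have e1: "hb L 1 K (\<lambda>k. c k - w k) (Cb L \<epsilon> * B)"
    by (rule eb_imp_hb[OF L par e(1)])
  have w1: "hb L 1 K w (R + 1)"
    by (rule wbound_le[OF w]) simp
  have "hb L 1 K (\<lambda>k. w k + (c k - w k)) (R + 1)"
    by (rule wbound_add[OF w wbound_le[OF e1 e(2)]]) simp
  then have c1: "hb L 1 K c (R + 1)" by simp
  let ?D = "3 * (conv_const L 1)\<^sup>2 * (R + 1)\<^sup>2"
  have "hb L 1 K (\<lambda>k. of_real (\<kappa> + 1) * (c k - w k) - (cube c k - cube w k))
     (cmod (of_real (\<kappa> + 1)) * (Cb L \<epsilon> * B) + ?D * (Cb L \<epsilon> * B))"
    by (intro wbound_diff wbound_scale e1 cube_diff_hb[OF order_refl c1 w1 e1]) simp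
  then have "hb L (Suc 0) K (\<lambda>k. of_real (\<kappa> + 1) * (c k - w k) - (cube c k - cube w k))
     ((\<kappa> + 1) * (Cb L \<epsilon> * B) + ?D * (Cb L \<epsilon> * B))"
    unfolding One_nat_def norm_of_real using par by simp
  from wbound_diff[OF hb_lam[OF this] z]
  have "hb L 0 K (\<lambda>k. of_real (lam L k) * (of_real (\<kappa> + 1) * (c k - w k) - (cube c k - cube w k)) - z k)
    ((\<kappa> + 1) * (Cb L \<epsilon> * B) + ?D * (Cb L \<epsilon> * B) + B)" by simp
  moreover have "(\<kappa> + 1) * (Cb L \<epsilon> * B) + ?D * (Cb L \<epsilon> * B) + B = gain L \<epsilon> \<kappa> R * B"
    by (simp add: gain_def algebra_simps)
  ultimately show ?thesis by simp
qed

text \<open>Induction over the stages of one step. The forcing of a stage involves only errors of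
  earlier stages, whose smallness is already secured, so the Lipschitz bound is available when it is
  used.\<close>

lemma step_stability:
  fixes c w z :: "nat \<Rightarrow> int \<times> int \<Rightarrow> complex" and c0 \<tau> \<rho> R :: real
  assumes par: "\<epsilon> > 0" "\<kappa> \<ge> 0"
    and r: "rierk_method s a" and c0: "c0 > 0"
    and coer: "\<And>j x. j \<in> {1..s - 1} \<Longrightarrow>
     c0 * (\<Sum>k=1..j. (cmod (x k))\<^sup>2) \<le> (\<Sum>k=1..j. inner (\<Sum>l=1..k. d_R s a k l *\<^sub>R x l) (x k :: complex))"
    and \<tau>: "\<tau> > 0"
    and c: "\<And>i k. i \<in> {1..s - 1} \<Longrightarrow> k \<in> K \<Longrightarrow>
      c (i + 1) k = c 1 k + of_real \<tau> * (\<Sum>j=1..i. of_real (a (i + 1) j) * rhs \<epsilon> \<kappa> (c j) (c (j + 1)) k)"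
    and w: "\<And>i k. i \<in> {1..s - 1} \<Longrightarrow> k \<in> K \<Longrightarrow>
      w (i + 1) k = w 1 k + of_real \<tau> * (\<Sum>j=1..i. of_real (a (i + 1) j) * (rhs \<epsilon> \<kappa> (w j) (w (j + 1)) k + z j k))"
    and wR: "\<And>i. i \<in> {1..s} \<Longrightarrow> hb L 1 K (w i) R"
    and z: "\<And>j. j \<in> {1..s - 1} \<Longrightarrow> hb L 0 K (z j) \<rho>"
    and z0: "\<And>j k. j \<in> {1..s - 1} \<Longrightarrow> k \<in> K \<Longrightarrow> lam L k = 0 \<Longrightarrow> z j k = 0"
    and init: "eb L \<epsilon> \<kappa> K (\<lambda>k. c 1 k - w 1 k) \<rho>"
    and q: "q = real s * (gain L \<epsilon> \<kappa> R)\<^sup>2 / (2 * c0)"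
    and small: "Cb L \<epsilon> * (\<rho> * exp (q * real s * \<tau>)) \<le> 1"
    and i: "i \<in> {1..s}"
  shows "eb L \<epsilon> \<kappa> K (\<lambda>k. c i k - w i k) (\<rho> * exp (q * real s * \<tau>))"
proof -
  define e where "e i k = c i k - w i k" for i k
  \<comment> \<open>Discrete Gronwall profile: the squared error grows by at most the factor
    \<open>1 + q * \<tau>\<close> per stage.\<close>
  define B where "B i = \<rho> * sqrt ((1 + q * \<tau>) ^ (i - 1))" for i
  have \<rho>: "\<rho> \<ge> 0" by (rule wbound_nonneg[OF init])
  have q0: "q \<ge> 0" using c0 by (simp add: q)
  have qt: "q * \<tau> \<ge> 0" using q0 \<tau> by simp
  have B0: "B i \<ge> 0" for i using \<rho> qt by (simp add: B_def)
  have Bsq: "(B i)\<^sup>2 = \<rho>\<^sup>2 * (1 + q * \<tau>) ^ (i - 1)" for i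
    using qt by (simp add: B_def power_mult_distrib)
  have B_mono: "B i \<le> B j" if "i \<le> j" for i j
    unfolding B_def using that \<rho> qt
    by (intro mult_left_mono real_sqrt_le_mono power_increasing) auto
  have B_ge: "\<rho> \<le> B i" for i
  proof -
    have "1 \<le> (1 + q * \<tau>) ^ (i - 1)" using qt by (intro one_le_power) simp
    then show ?thesis unfolding B_def using \<rho> mult_left_mono[of 1 "sqrt ((1 + q * \<tau>) ^ (i - 1))" \<rho>] by simp
  qed
  have B_le: "B i \<le> \<rho> * exp (q * real s * \<tau>)" if "i \<le> s" for i
  proof -
    have "(1 + q * \<tau>) ^ (i - 1) \<le> (exp (q * \<tau>)) ^ (i - 1)"
      using qt exp_ge_add_one_self[of "q * \<tau>"] by (intro power_mono) auto
    also have "\<dots> \<le> (exp (q * \<tau>)) ^ s"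
      using qt that by (intro power_increasing) auto
    also have "\<dots> = exp (q * real s * \<tau>)"
      by (simp add: exp_of_nat_mult[symmetric] mult_ac)
    also have "\<dots> \<le> (exp (q * real s * \<tau>))\<^sup>2"
      using q0 \<tau> by (intro self_le_power) auto
    finally have "sqrt ((1 + q * \<tau>) ^ (i - 1)) \<le> exp (q * real s * \<tau>)"
      by (intro real_le_lsqrt) auto
    then show ?thesis unfolding B_def using \<rho> by (intro mult_left_mono) auto
  qed
  have main: "eb L \<epsilon> \<kappa> K (e i) (B i)" if "i \<in> {1..s}" for i
    using that
  proof (induction i rule: less_induct)
    case (less i)
    show ?case
    proof (cases "i = 1")
      case True
      then show ?thesis using init by (simp add: e_def[abs_def] B_def)
    next
      case False
      define i' where "i' = i - 1"
      have i': "i = i' + 1" "i' \<in> {1..s - 1}" using less.prems False by (auto simp: i'_def)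
      \<comment> \<open>Everything explicit, together with the defect, goes into \<open>g\<close>;
        what remains of \<open>rhs\<close> is the multiplier
        \<open>lam (\<epsilon>^2 lam + \<kappa>)\<close> acting on the average, as
        \<open>mode_stability\<close> requires.\<close>
      define g where "g j k = of_real (lam L k) * (of_real (\<kappa> + 1) * e j k - (cube (c j) k - cube (w j) k)) - z j k" for j k
      have g: "hb L 0 K (g j) (gain L \<epsilon> \<kappa> R * B j)" if j: "j \<in> {1..i'}" for j
        unfolding g_def e_def
      proof (rule forcing_bound[OF par])
        have js: "j \<in> {1..s}" "j < i" "j \<in> {1..s - 1}" using j i' by auto
        show "eb L \<epsilon> \<kappa> K (\<lambda>k. c j k - w j k) (B j)"
          using less.IH[OF js(2) js(1)] by (simp add: e_def[abs_def])
        have "Cb L \<epsilon> * B j \<le> Cb L \<epsilon> * (\<rho> * exp (q * real s * \<tau>))"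
          using Cb_ge_1[OF par(1), of L] B_le js by (intro mult_left_mono) auto
        then show "Cb L \<epsilon> * B j \<le> 1" using small by linarith
        show "hb L 1 K (w j) R" by (rule wR[OF js(1)])
        show "hb L 0 K (z j) (B j)" by (rule wbound_le[OF z[OF js(3)] B_ge])
      qed
      have eq: "e (m + 1) k = e 1 k + \<tau> *\<^sub>R (\<Sum>j=1..m. a (m + 1) j *\<^sub>R
            (g j k - (lam L k * (\<epsilon>\<^sup>2 * lam L k + \<kappa>)) *\<^sub>R ((e j k + e (j + 1) k) /\<^sub>R 2)))"
        if m: "m \<in> {1..s - 1}" and k: "k \<in> K" for m k
      proof -
        have "e (m + 1) k = e 1 k + of_real \<tau> * ((\<Sum>j=1..m. of_real (a (m + 1) j) * rhs \<epsilon> \<kappa> (c j) (c (j + 1)) k)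
           - (\<Sum>j=1..m. of_real (a (m + 1) j) * (rhs \<epsilon> \<kappa> (w j) (w (j + 1)) k + z j k)))"
          unfolding e_def c[OF m k] w[OF m k] by (simp add: algebra_simps)
        also have "(\<Sum>j=1..m. of_real (a (m + 1) j) * rhs \<epsilon> \<kappa> (c j) (c (j + 1)) k)
           - (\<Sum>j=1..m. of_real (a (m + 1) j) * (rhs \<epsilon> \<kappa> (w j) (w (j + 1)) k + z j k))
          = (\<Sum>j=1..m. a (m + 1) j *\<^sub>R
            (g j k - (lam L k * (\<epsilon>\<^sup>2 * lam L k + \<kappa>)) *\<^sub>R ((e j k + e (j + 1) k) /\<^sub>R 2)))"
          unfolding sum_subtractf[symmetric]
        proof (rule sum.cong[OF refl])
          fix j
          have "rhs \<epsilon> \<kappa> (c j) (c (j + 1)) k - (rhs \<epsilon> \<kappa> (w j) (w (j + 1)) k + z j k)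
             = g j k - of_real (lam L k * (\<epsilon>\<^sup>2 * lam L k + \<kappa>)) * ((e j k + e (j + 1) k) / 2)"
            unfolding rhs_def g_def e_def by (simp add: field_simps)
          then have *: "of_real (a (m + 1) j) * rhs \<epsilon> \<kappa> (c j) (c (j + 1)) k
             - of_real (a (m + 1) j) * (rhs \<epsilon> \<kappa> (w j) (w (j + 1)) k + z j k)
             = of_real (a (m + 1) j) * (g j k - of_real (lam L k * (\<epsilon>\<^sup>2 * lam L k + \<kappa>)) * ((e j k + e (j + 1) k) / 2))"
            by (simp only: right_diff_distrib[symmetric])
          have half: "x /\<^sub>R 2 = x / 2" for x :: complex
            by (simp add: scaleR_conv_of_real)
          show "of_real (a (m + 1) j) * rhs \<epsilon> \<kappa> (c j) (c (j + 1)) k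
             - of_real (a (m + 1) j) * (rhs \<epsilon> \<kappa> (w j) (w (j + 1)) k + z j k)
            = a (m + 1) j *\<^sub>R (g j k - (lam L k * (\<epsilon>\<^sup>2 * lam L k + \<kappa>)) *\<^sub>R ((e j k + e (j + 1) k) /\<^sub>R 2))"
            unfolding half unfolding scaleR_conv_of_real by (rule *)
        qed
        finally show ?thesis by (simp add: scaleR_conv_of_real)
      qed
      have mode: "ew L \<epsilon> \<kappa> k * (cmod (e i k))\<^sup>2
          \<le> ew L \<epsilon> \<kappa> k * (cmod (e 1 k))\<^sup>2 + \<tau> / (2 * c0) * (\<Sum>j=1..i'. (cmod (g j k))\<^sup>2)"
        if k: "k \<in> K" for k
      \<comment> \<open>At the mode 0 the multiplier vanishes and gives no control; there the
        right-hand sides vanish as well and the error is conserved.\<close>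
      proof (cases "lam L k = 0")
        case True
        have "e i k = e 1 k"
          unfolding i'(1) eq[OF i'(2) k]
        proof -
          have "g j k = 0" if "j \<in> {1..i'}" for j
            using z0[of j k] that i' k True by (auto simp: g_def)
          then have "(\<Sum>j=1..i'. a (i' + 1) j *\<^sub>R (g j k - (lam L k * (\<epsilon>\<^sup>2 * lam L k + \<kappa>)) *\<^sub>R ((e j k + e (j + 1) k) /\<^sub>R 2))) = 0"
            using True by (intro sum.neutral) auto
          then show "e 1 k + \<tau> *\<^sub>R (\<Sum>j=1..i'. a (i' + 1) j *\<^sub>R (g j k - (lam L k * (\<epsilon>\<^sup>2 * lam L k + \<kappa>)) *\<^sub>R ((e j k + e (j + 1) k) /\<^sub>R 2))) = e 1 k"
            by simp
        qed
        moreover have "0 \<le> \<tau> / (2 * c0) * (\<Sum>j=1..i'. (cmod (g j k))\<^sup>2)"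
          using \<tau> c0 by (intro mult_nonneg_nonneg sum_nonneg) auto
        ultimately show ?thesis by simp
      next
        case False
        then show ?thesis
          using mode_stability[where e = "\<lambda>j. e j k" and g = "\<lambda>j. g j k", OF r c0 coer \<tau> eq[OF _ k] i'(2)]
          by (simp add: ew_def i'(1))
      qed
      show ?thesis
      proof (rule wbound_sq_intro[OF _ B0])
        fix S assume S: "finite S" "S \<subseteq> K"
        have ws: "(sqrt (ew L \<epsilon> \<kappa> k) * cmod x)\<^sup>2 = ew L \<epsilon> \<kappa> k * (cmod x)\<^sup>2" for k x
          using ew_nonneg[OF par(2)] by (simp add: power_mult_distrib)
        have "(\<Sum>k\<in>S. (sqrt (ew L \<epsilon> \<kappa> k) * cmod (e i k))\<^sup>2)
            \<le> (\<Sum>k\<in>S. ew L \<epsilon> \<kappa> k * (cmod (e 1 k))\<^sup>2 + \<tau> / (2 * c0) * (\<Sum>j=1..i'. (cmod (g j k))\<^sup>2))"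
          unfolding ws using S by (intro sum_mono mode) auto
        also have "\<dots> = (\<Sum>k\<in>S. (sqrt (ew L \<epsilon> \<kappa> k) * cmod (e 1 k))\<^sup>2)
            + \<tau> / (2 * c0) * (\<Sum>j=1..i'. \<Sum>k\<in>S. (cmod (g j k))\<^sup>2)"
          unfolding ws sum.distrib sum_distrib_left by (subst (2) sum.swap) simp
        also have "\<dots> \<le> \<rho>\<^sup>2 + \<tau> / (2 * c0) * (\<Sum>j=1..i'. (gain L \<epsilon> \<kappa> R * B i')\<^sup>2)"
        proof (intro add_mono mult_left_mono sum_mono)
          show "(\<Sum>k\<in>S. (sqrt (ew L \<epsilon> \<kappa> k) * cmod (e 1 k))\<^sup>2) \<le> \<rho>\<^sup>2"
            using wbound_sum_le_sq[OF init S] by (simp add: e_def)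
          fix j assume j: "j \<in> {1..i'}"
          have "(\<Sum>k\<in>S. (cmod (g j k))\<^sup>2) \<le> (gain L \<epsilon> \<kappa> R * B j)\<^sup>2"
            using wbound_sum_le_sq[OF g[OF j] S] by simp
          also have "\<dots> \<le> (gain L \<epsilon> \<kappa> R * B i')\<^sup>2"
            unfolding power_mult_distrib using j B_mono[of j i'] B0
            by (intro mult_left_mono power_mono) auto
          finally show "(\<Sum>k\<in>S. (cmod (g j k))\<^sup>2) \<le> (gain L \<epsilon> \<kappa> R * B i')\<^sup>2" .
        qed (use \<tau> c0 in auto)
        also have "\<dots> = \<rho>\<^sup>2 + real i' * (gain L \<epsilon> \<kappa> R)\<^sup>2 / (2 * c0) * \<tau> * (B i')\<^sup>2"
          by (simp add: power_mult_distrib)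
        \<comment> \<open>\<open>q\<close> carries the factor \<open>s\<close>, which bounds the
          number \<open>i'\<close> of earlier stages.\<close>
        also have "\<dots> \<le> (B i')\<^sup>2 + q * \<tau> * (B i')\<^sup>2"
          unfolding q using i'(2) \<tau> c0 \<rho> B_ge[of i']
          by (intro add_mono mult_right_mono power_mono divide_right_mono) auto
        also have "\<dots> = (B i)\<^sup>2"
          using i' unfolding Bsq by (cases i') (auto simp: algebra_simps)
        finally show "(\<Sum>k\<in>S. (sqrt (ew L \<epsilon> \<kappa> k) * cmod (e i k))\<^sup>2) \<le> (B i)\<^sup>2" .
      qed
    qed
  qed
  from wbound_le[OF main[OF i] B_le] i show ?thesis
    by (simp add: e_def[abs_def])
qed

end

section \<open>From a single step to the whole mesh: Gronwall's inequality\<close>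

lemma time_mesh_le:
  assumes m: "time_mesh T N t" and n: "n \<le> n'" "n' \<le> N"
  shows "t n \<le> t n'"
  using n
proof (induction n' rule: dec_induct)
  case (step k)
  have "t k < t (Suc k)"
    using m step by (auto simp: time_mesh_def dest!: bspec[of _ _ "Suc k"])
  then show ?case using step by simp
qed simp

lemma tau_pos: "time_mesh T N t \<Longrightarrow> n \<in> {1..N} \<Longrightarrow> tau t n > 0"
  by (auto simp: time_mesh_def tau_def)

abbreviation rk_stages :: "(int \<times> int) set \<Rightarrow> nat \<Rightarrow> (nat \<Rightarrow> nat \<Rightarrow> real) \<Rightarrow> nat \<Rightarrow> (nat \<Rightarrow> real) \<Rightarrow>
    (nat \<Rightarrow> nat \<Rightarrow> int \<times> int \<Rightarrow> complex) \<Rightarrow> (nat \<Rightarrow> nat \<Rightarrow> int \<times> int \<Rightarrow> complex) \<Rightarrow> bool" where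
  "rk_stages K s a N t c f \<equiv> \<forall>n\<in>{1..N}. \<forall>i\<in>{1..s - 1}. \<forall>k\<in>K.
     c n (i + 1) k = c n 1 k + of_real (tau t n) * (\<Sum>j=1..i. of_real (a (i + 1) j) * f n j k)"

text \<open>The constant depends neither on the window nor on the mesh, which allows one application
  to \<open>U\<close> and one to \<open>u\<close>. While \<open>c\<close> is continuous across
  steps, the comparison \<open>w\<close> may jump by \<open>\<eta> * tau t n\<close>; over the whole
  interval these errors add up to order \<open>\<eta>\<close>.\<close>

lemma stability:
  assumes L: "L > 0" and par: "\<epsilon> > 0" "\<kappa> \<ge> 0"
    and r: "rierk_method s a" and pd: "pos_def (D_R s a)"
  shows "\<exists>C>0. \<forall>K sg N t c w z \<eta>. spectral L K sg \<longrightarrow> time_mesh T N t \<longrightarrow>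
    rk_stages K s a N t c (\<lambda>n j. spectral.rhs L K sg \<epsilon> \<kappa> (c n j) (c n (j + 1))) \<longrightarrow>
    rk_stages K s a N t w (\<lambda>n j k. spectral.rhs L K sg \<epsilon> \<kappa> (w n j) (w n (j + 1)) k + z n j k) \<longrightarrow>
    (\<forall>n\<in>{1..<N}. \<forall>k\<in>K. c (n + 1) 1 k = c n s k) \<longrightarrow>
    (\<forall>n\<in>{1..N}. \<forall>i\<in>{1..s}. hb L 1 K (w n i) R) \<longrightarrow>
    (\<forall>n\<in>{1..N}. \<forall>j\<in>{1..s - 1}. hb L 0 K (z n j) \<eta> \<and> (\<forall>k\<in>K. lam L k = 0 \<longrightarrow> z n j k = 0)) \<longrightarrow>
    hb L 1 K (\<lambda>k. c 1 1 k - w 1 1 k) \<eta> \<longrightarrow>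
    (\<forall>n\<in>{1..<N}. hb L 1 K (\<lambda>k. w n s k - w (n + 1) 1 k) (\<eta> * tau t n)) \<longrightarrow>
    C * \<eta> \<le> 1 \<longrightarrow>
    (\<forall>n\<in>{1..N}. \<forall>i\<in>{1..s}. hb L 1 K (\<lambda>k. c n i k - w n i k) (C * \<eta>))"
proof -
  obtain c0 where c0: "c0 > 0" and coer: "\<And>j x. j \<in> {1..s - 1} \<Longrightarrow>
     c0 * (\<Sum>k=1..j. (cmod (x k))\<^sup>2) \<le> (\<Sum>k=1..j. inner (\<Sum>l=1..k. d_R s a k l *\<^sub>R x l) (x k :: complex))"
    using d_R_coercive[OF r pd] by blast
  define q where "q = real s * (gain L \<epsilon> \<kappa> R)\<^sup>2 / (2 * c0)"
  \<comment> \<open>\<open>q * real s\<close> is the growth rate within a step; the extra 1 absorbs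
    the jumps of \<open>w\<close> between steps.\<close>
  define p where "p = q * real s + 1"
  define Ce where "Ce = sqrt (\<epsilon>\<^sup>2 + \<kappa> + 1)"
  define C where "C = Cb L \<epsilon> * ((Ce + 1) * exp (p * T))"
  have q0: "q \<ge> 0" using c0 by (simp add: q_def)
  have p0: "p \<ge> 0" using q0 by (simp add: p_def)
  have Ce0: "Ce \<ge> 0" using par by (simp add: Ce_def)
  have Cb0: "Cb L \<epsilon> \<ge> 1" by (rule Cb_ge_1[OF par(1)])
  have C0: "C > 0" unfolding C_def using Cb0 Ce0 by (intro mult_pos_pos) auto
  have s2: "s \<ge> 2" using r by (simp add: rierk_method_def)
  show ?thesis
  proof (intro exI[of _ C] conjI C0 allI impI ballI)
    fix K sg N t \<eta> n i
      and c w z :: "nat \<Rightarrow> nat \<Rightarrow> int \<times> int \<Rightarrow> complex"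
    assume sp: "spectral L K sg" and mesh: "time_mesh T N t"
      and c: "rk_stages K s a N t c (\<lambda>n j. spectral.rhs L K sg \<epsilon> \<kappa> (c n j) (c n (j + 1)))"
      and w: "\<forall>n\<in>{1..N}. \<forall>i\<in>{1..s - 1}. \<forall>k\<in>K. w n (i + 1) k = w n 1 k + of_real (tau t n) *
        (\<Sum>j=1..i. of_real (a (i + 1) j) * (spectral.rhs L K sg \<epsilon> \<kappa> (w n j) (w n (j + 1)) k + z n j k))"
      and cj: "\<forall>n\<in>{1..<N}. \<forall>k\<in>K. c (n + 1) 1 k = c n s k"
      and wR: "\<forall>n\<in>{1..N}. \<forall>i\<in>{1..s}. hb L 1 K (w n i) R"
      and z: "\<forall>n\<in>{1..N}. \<forall>j\<in>{1..s - 1}. hb L 0 K (z n j) \<eta> \<and> (\<forall>k\<in>K. lam L k = 0 \<longrightarrow> z n j k = 0)"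
      and init: "hb L 1 K (\<lambda>k. c 1 1 k - w 1 1 k) \<eta>"
      and wj: "\<forall>n\<in>{1..<N}. hb L 1 K (\<lambda>k. w n s k - w (n + 1) 1 k) (\<eta> * tau t n)"
      and small: "C * \<eta> \<le> 1"
      and n: "n \<in> {1..N}" and i: "i \<in> {1..s}"
    interpret spectral L K sg by (rule sp)
    have \<eta>: "\<eta> \<ge> 0" by (rule wbound_nonneg[OF init])
    \<comment> \<open>Error bound at the beginning of step \<open>n\<close>. \<open>Ce\<close>
      converts \<open>H^2\<close> into the energy norm, and the extra 1 makes
      \<open>\<rho> n\<close> dominate \<open>\<eta>\<close>, hence the defects.\<close>
    define \<rho> where "\<rho> n = (Ce + 1) * \<eta> * exp (p * t (n - 1))" for n
    have t0: "t 0 = 0" and tN: "t N = T" using mesh by (auto simp: time_mesh_def)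
    have \<rho>\<eta>: "(Ce + 1) * \<eta> \<le> \<rho> n" if "n \<in> {1..N}" for n
    proof -
      have "0 \<le> t (n - 1)" using time_mesh_le[OF mesh, of 0 "n - 1"] that t0 by auto
      then have "1 \<le> exp (p * t (n - 1))" using p0 by simp
      then show ?thesis unfolding \<rho>_def using Ce0 \<eta> mult_left_mono[of 1 _ "(Ce + 1) * \<eta>"] by simp
    qed
    have \<eta>\<rho>: "\<eta> \<le> \<rho> n" if "n \<in> {1..N}" for n
      using \<rho>\<eta>[OF that] mult_nonneg_nonneg[OF Ce0 \<eta>] by (simp add: distrib_right del: zero_le_mult_iff)
    have \<rho>_le: "Cb L \<epsilon> * (\<rho> n * exp (q * real s * tau t n)) \<le> C * \<eta>" if "n \<in> {1..N}" for n
    proof -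
      have "p * t (n - 1) + q * real s * tau t n \<le> p * t (n - 1) + p * tau t n"
        using tau_pos[OF mesh that] by (simp add: p_def distrib_right)
      also have "\<dots> = p * t n" by (simp add: tau_def right_diff_distrib)
      also have "\<dots> \<le> p * T"
        using time_mesh_le[OF mesh, of n N] that tN p0 by (intro mult_left_mono) auto
      finally have "exp (p * t (n - 1)) * exp (q * real s * tau t n) \<le> exp (p * T)"
        by (simp add: exp_add[symmetric])
      then have "Cb L \<epsilon> * ((Ce + 1) * \<eta> * (exp (p * t (n - 1)) * exp (q * real s * tau t n)))
          \<le> Cb L \<epsilon> * ((Ce + 1) * \<eta> * exp (p * T))"
        using Cb0 Ce0 \<eta> by (intro mult_left_mono) auto
      then show ?thesis by (simp add: \<rho>_def C_def mult_ac)
    qed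
    have step: "eb L \<epsilon> \<kappa> K (\<lambda>k. c n i k - w n i k) (\<rho> n * exp (q * real s * tau t n))"
      if n: "n \<in> {1..N}" and i: "i \<in> {1..s}" and e: "eb L \<epsilon> \<kappa> K (\<lambda>k. c n 1 k - w n 1 k) (\<rho> n)" for n i
    proof (rule step_stability[where c = "c n" and w = "w n" and z = "z n", OF par r c0 coer tau_pos[OF mesh n] _ _ _ _ _ e q_def _ i])
      show "Cb L \<epsilon> * (\<rho> n * exp (q * real s * tau t n)) \<le> 1"
        using \<rho>_le[OF n] small by linarith
      show "hb L 0 K (z n j) (\<rho> n)" if "j \<in> {1..s - 1}" for j
        using z n that \<eta>\<rho>[OF n] wbound_le by blast
    qed (use n c w wR z in blast)+
    have "eb L \<epsilon> \<kappa> K (\<lambda>k. c n 1 k - w n 1 k) (\<rho> n)" if "n \<in> {1..N}" for n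
      using that
    proof (induction n)
      case (Suc n)
      show ?case
      proof (cases "n = 0")
        case True
        have "eb L \<epsilon> \<kappa> K (\<lambda>k. c 1 1 k - w 1 1 k) (Ce * \<eta>)"
          unfolding Ce_def by (rule hb_imp_eb[OF par(2) init])
        moreover have "Ce * \<eta> \<le> \<rho> 1"
          using \<eta> t0 by (simp add: \<rho>_def distrib_right)
        ultimately show ?thesis using True wbound_le by simp
      next
        case False
        then have n: "n \<in> {1..N}" "n \<in> {1..<N}" using Suc.prems by auto
        have \<tau>: "tau t n > 0" by (rule tau_pos[OF mesh n(1)])
        have 1: "eb L \<epsilon> \<kappa> K (\<lambda>k. c n s k - w n s k) (\<rho> n * exp (q * real s * tau t n))"
          using s2 by (intro step n Suc.IH) auto
        have 2: "eb L \<epsilon> \<kappa> K (\<lambda>k. w n s k - w (n + 1) 1 k) (Ce * (\<eta> * tau t n))"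
          unfolding Ce_def using wj n by (intro hb_imp_eb[OF par(2)]) blast
        have 3: "eb L \<epsilon> \<kappa> K (\<lambda>k. (c n s k - w n s k) + (w n s k - w (n + 1) 1 k))
            (\<rho> n * exp (q * real s * tau t n) + Ce * (\<eta> * tau t n))"
          by (rule wbound_add[OF 1 2]) (simp add: ew_nonneg par)
        have eq: "c (Suc n) 1 k - w (Suc n) 1 k = (c n s k - w n s k) + (w n s k - w (n + 1) 1 k)"
          if "k \<in> K" for k using cj n that by simp
        \<comment> \<open>The jump is at most \<open>\<rho> n * tau t n\<close>, so the new error
          gains the factor \<open>1 + tau t n \<le> exp (tau t n)\<close>, accounted for by the 1 in
          \<open>p\<close>.\<close>
        have "\<rho> n * exp (q * real s * tau t n) + Ce * (\<eta> * tau t n) \<le> \<rho> (Suc n)"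
        proof -
          let ?x = "exp (q * real s * tau t n)"
          have "1 \<le> ?x" using q0 \<tau> by simp
          have r0: "\<rho> n \<ge> 0" using \<eta>\<rho>[OF n(1)] \<eta> by simp
          have "Ce * \<eta> \<le> \<rho> n"
            using \<rho>\<eta>[OF n(1)] \<eta> by (simp add: distrib_right)
          then have "Ce * (\<eta> * tau t n) \<le> \<rho> n * tau t n * 1"
            using \<tau> by (simp add: mult.assoc[symmetric] mult_right_mono)
          also have "\<dots> \<le> \<rho> n * tau t n * ?x"
            using r0 \<tau> \<open>1 \<le> ?x\<close> by (intro mult_left_mono) auto
          finally have "\<rho> n * ?x + Ce * (\<eta> * tau t n) \<le> \<rho> n * ?x * (1 + tau t n)"
            by (simp add: algebra_simps)
          also have "\<dots> \<le> \<rho> n * ?x * exp (tau t n)"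
            using r0 exp_ge_add_one_self[of "tau t n"] by (intro mult_left_mono) auto
          also have "\<dots> = (Ce + 1) * \<eta> * exp (p * t (n - 1) + (q * real s * tau t n + tau t n))"
            by (simp add: \<rho>_def exp_add mult_ac)
          also have "p * t (n - 1) + (q * real s * tau t n + tau t n) = p * t n"
            by (simp add: p_def tau_def algebra_simps)
          finally show ?thesis by (simp add: \<rho>_def)
        qed
        from wbound_le[OF 3 this] show ?thesis
          by (rule wbound_cong[THEN iffD2, rotated]) (rule eq)
      qed
    qed simp
    from step[OF n i this[OF n]]
    have "hb L 1 K (\<lambda>k. c n i k - w n i k) (Cb L \<epsilon> * (\<rho> n * exp (q * real s * tau t n)))"
      by (rule eb_imp_hb[OF L par])
    then show "hb L 1 K (\<lambda>k. c n i k - w n i k) (C * \<eta>)"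
      using \<rho>_le[OF n] wbound_le by blast
  qed
qed

section \<open>The discrete Fourier transform\<close>

text \<open>On the grid a wave is a product of two such roots of unity, which reduces all grid sums
  to one dimension.\<close>

definition rou :: "nat \<Rightarrow> int \<Rightarrow> complex" where
  "rou M n = cis (2 * pi * of_int n / real M)"

lemma rou_add: "rou M (a + b) = rou M a * rou M b"
  by (simp add: rou_def cis_mult add_divide_distrib distrib_left)

lemma cnj_rou: "cnj (rou M a) = rou M (- a)"
  by (simp add: rou_def cis_cnj)

lemma rou_mult_M: "M > 0 \<Longrightarrow> rou M (int M * a) = 1"
proof -
  assume "M > 0"
  then have "2 * pi * of_int (int M * a) / real M = 2 * pi * of_int a" by simp
  then show ?thesis
    unfolding rou_def by (simp only: cis_multiple_2pi[OF Ints_of_int])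
qed

lemma rou_eq_1_iff:
  assumes "M > 0"
  shows "rou M n = 1 \<longleftrightarrow> int M dvd n"
proof
  assume "rou M n = 1"
  then have "cos (2 * pi * of_int n / real M) = 1"
    by (metis rou_def cis.simps(1) one_complex.simps(1))
  then obtain x :: int where "2 * pi * of_int n / real M = of_int x * 2 * pi"
    using cos_one_2pi_int by auto
  then have "of_int n = (of_int (int M * x) :: real)"
    using assms by (simp add: field_simps)
  then show "int M dvd n" by (simp only: of_int_eq_iff dvd_triv_left)
next
  assume "int M dvd n"
  then show "rou M n = 1" using rou_mult_M[OF assms] by (auto elim!: dvdE)
qed

text \<open>Multiplication by \<open>rou M n\<close> shifts the summation range by one, which
  periodicity undoes, so the sum vanishes unless that factor is 1. The free start \<open>b\<close>
  covers both the grid indices and the centred modes.\<close>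

lemma sum_rou:
  assumes M: "M > 0"
  shows "(\<Sum>x=b..b + int M - 1. rou M (n * x)) = (if int M dvd n then of_nat M else 0)"
proof (cases "int M dvd n")
  case True
  then have "rou M (n * x) = 1" for x
    by (simp add: rou_eq_1_iff[OF M])
  then show ?thesis using True by simp
next
  case False
  let ?S = "\<Sum>x=b..b + int M - 1. rou M (n * x)"
  have "rou M n * ?S = (\<Sum>x=b..b + int M - 1. rou M (n * (x + 1)))"
    by (simp add: sum_distrib_left distrib_left rou_add mult.commute)
  also have "\<dots> = (\<Sum>x=b + 1..b + int M. rou M (n * x))"
    by (rule sum.reindex_bij_witness[of _ "\<lambda>x. x - 1" "\<lambda>x. x + 1"]) auto
  also have "\<dots> = (\<Sum>x\<in>insert (b + int M) {b + 1..b + int M - 1}. rou M (n * x))"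
    using M by (intro sum.cong) auto
  also have "\<dots> = rou M (n * (b + int M)) + (\<Sum>x=b + 1..b + int M - 1. rou M (n * x))"
    by simp
  also have "rou M (n * (b + int M)) = rou M (n * b)"
    by (simp add: distrib_left rou_add mult.commute[of n "int M"] rou_mult_M[OF M])
  also have "rou M (n * b) + (\<Sum>x=b + 1..b + int M - 1. rou M (n * x))
     = (\<Sum>x\<in>insert b {b + 1..b + int M - 1}. rou M (n * x))"
    by simp
  also have "\<dots> = ?S"
    using M by (intro sum.cong) auto
  finally have "(rou M n - 1) * ?S = 0" by (simp add: algebra_simps)
  then show ?thesis using False rou_eq_1_iff[OF M] by auto
qed

lemma wave_grid:
  assumes "L \<noteq> 0"
  shows "wave L l m (grid_point L M i j) = rou M (l * i) * rou M (m * j)"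
proof -
  have eq: "freq L * (of_int l * (of_int i * (L / real M)) + of_int m * (of_int j * (L / real M)))
     = 2 * pi * of_int (l * i) / real M + 2 * pi * of_int (m * j) / real M"
    using assms by (simp add: freq_def field_simps add_divide_distrib)
  show ?thesis
    unfolding wave_def grid_point_def fst_conv snd_conv rou_def cis_mult eq
    by (simp only: cis_conv_exp)
qed

locale periodic_grid =
  fixes M :: nat and L :: real
  assumes M: "even M" "M > 0" and L: "L > 0"
begin

lemma L_nz: "L \<noteq> 0" using L by simp

lemma modes_eq: "modes M = {- (int M div 2)..- (int M div 2) + int M - 1}"
  using M unfolding modes_def by (auto elim!: evenE)

lemma finite_modes [simp]: "finite (modes M)"
  by (simp add: modes_def)

lemma sum_modes_rou: "(\<Sum>l\<in>modes M. rou M (n * l)) = (if int M dvd n then of_nat M else 0)"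
  unfolding modes_eq by (rule sum_rou[OF M(2)])

lemma sum_grid_rou: "(\<Sum>i=1..int M. rou M (n * i)) = (if int M dvd n then of_nat M else 0)"
  using sum_rou[OF M(2), of n 1] by simp

lemma modes_cong_iff: "l \<in> modes M \<Longrightarrow> l' \<in> modes M \<Longrightarrow> int M dvd l - l' \<longleftrightarrow> l = l'"
proof -
  assume l: "l \<in> modes M" "l' \<in> modes M"
  then have "\<bar>l - l'\<bar> < int M" unfolding modes_eq by (simp add: abs_less_iff)
  then have "l - l' = 0" if "int M dvd l - l'"
    using dvd_imp_le_int[of "l - l'" "int M"] that by fastforce
  then show ?thesis by auto
qed

definition modes2 :: "(int \<times> int) set" where
  "modes2 = modes M \<times> modes M"

definition dft2 :: "(int \<Rightarrow> int \<Rightarrow> real) \<Rightarrow> int \<times> int \<Rightarrow> complex" where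
  "dft2 v k = dft L M v (fst k) (snd k)"

definition wave2 :: "int \<times> int \<Rightarrow> int \<Rightarrow> int \<Rightarrow> complex" where
  "wave2 k i j = wave L (fst k) (snd k) (grid_point L M i j)"

lemma finite_modes2 [simp]: "finite modes2"
  by (simp add: modes2_def)

lemma sum_modes2: "(\<Sum>l\<in>modes M. \<Sum>m\<in>modes M. f l m) = (\<Sum>k\<in>modes2. f (fst k) (snd k))"
  by (simp add: modes2_def sum.cartesian_product case_prod_beta)

lemma wave2_eq: "wave2 k i j = rou M (fst k * i) * rou M (snd k * j)"
  by (simp add: wave2_def wave_grid[OF L_nz])

lemma wave2_mult_cnj: "wave2 k i j * cnj (wave2 l i j) = cnj (wave2 (l - k) i j)"
  by (simp add: wave2_def cnj_wave wave_mult)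

lemma dft2_eq:
  "dft2 v k = (\<Sum>i=1..int M. \<Sum>j=1..int M. of_real (v i j) * cnj (wave2 k i j)) / of_nat (M\<^sup>2)"
  by (simp add: dft2_def dft_def wave2_def)

lemma sum_grid_wave2:
  "(\<Sum>i=1..int M. \<Sum>j=1..int M. wave2 k i j)
     = (if int M dvd fst k \<and> int M dvd snd k then of_nat (M\<^sup>2) else 0)"
proof -
  have "(\<Sum>i=1..int M. \<Sum>j=1..int M. wave2 k i j)
      = (\<Sum>i=1..int M. rou M (fst k * i)) * (\<Sum>j=1..int M. rou M (snd k * j))"
    by (simp add: wave2_eq sum_product)
  then show ?thesis by (simp add: sum_grid_rou power2_eq_square)
qed

text \<open>Waves with frequencies congruent modulo \<open>M\<close> coincide on the grid, hence
  congruence in place of equality. The reindexing \<open>g\<close> is the identity for ordinary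
  syntheses and \<open>uminus\<close> for their conjugates.\<close>

lemma sum_grid_synth:
  "(\<Sum>i=1..int M. \<Sum>j=1..int M. (\<Sum>k\<in>S. c k * wave2 (g k) i j) * cnj (wave2 l i j)) / of_nat (M\<^sup>2)
     = (\<Sum>k\<in>S. if int M dvd fst (g k) - fst l \<and> int M dvd snd (g k) - snd l then c k else 0)"
proof -
  have "(\<Sum>i=1..int M. \<Sum>j=1..int M. (\<Sum>k\<in>S. c k * wave2 (g k) i j) * cnj (wave2 l i j))
     = (\<Sum>i=1..int M. \<Sum>j=1..int M. \<Sum>k\<in>S. c k * wave2 (g k - l) i j)"
    by (intro sum.cong refl)
      (simp add: sum_distrib_right mult.assoc wave2_def cnj_wave wave_mult)
  also have "\<dots> = (\<Sum>i=1..int M. \<Sum>k\<in>S. \<Sum>j=1..int M. c k * wave2 (g k - l) i j)"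
    by (intro sum.cong refl sum.swap)
  also have "\<dots> = (\<Sum>k\<in>S. \<Sum>i=1..int M. \<Sum>j=1..int M. c k * wave2 (g k - l) i j)"
    by (rule sum.swap)
  also have "\<dots> = (\<Sum>k\<in>S. c k * (\<Sum>i=1..int M. \<Sum>j=1..int M. wave2 (g k - l) i j))"
    by (simp add: sum_distrib_left)
  also have "\<dots> = (\<Sum>k\<in>S. (if int M dvd fst (g k) - fst l \<and> int M dvd snd (g k) - snd l then c k else 0) * of_nat (M\<^sup>2))"
    by (intro sum.cong refl) (simp add: sum_grid_wave2)
  finally show ?thesis
    using M by (simp add: sum_distrib_right[symmetric] del: of_nat_power)
qed

lemma dft2_synth:
  assumes v: "\<And>i j. of_real (v i j) = (\<Sum>k\<in>modes2. c k * wave2 k i j)" and l: "l \<in> modes2"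
  shows "dft2 v l = c l"
proof -
  have "dft2 v l = (\<Sum>k\<in>modes2. if int M dvd fst k - fst l \<and> int M dvd snd k - snd l then c k else 0)"
    unfolding dft2_eq v by (rule sum_grid_synth)
  also have "\<dots> = (\<Sum>k\<in>modes2. if k = l then c k else 0)"
    using l by (intro sum.cong refl) (auto simp: modes2_def modes_cong_iff prod_eq_iff)
  finally show ?thesis using l by simp
qed

text \<open>Summed over the modes, the roots of unity form a discrete delta. Since \<open>i\<close>
  is any integer, the delta selects its representative \<open>i0\<close> in \<open>1..M\<close>, and
  periodicity of \<open>g\<close> leads back to \<open>i\<close>.\<close>

lemma sum_delta_periodic:
  assumes g: "\<And>i. g (i + int M) = g i"
  shows "(\<Sum>l\<in>modes M. \<Sum>i'=1..int M. g i' * rou M (l * (i - i'))) = of_nat M * (g i :: complex)"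
proof -
  define i0 where "i0 = (i - 1) mod int M + 1"
  have i0: "i0 \<in> {1..int M}" using M pos_mod_bound[of "int M" "i - 1"] pos_mod_sign[of "int M" "i - 1"]
    unfolding i0_def atLeastAtMost_iff of_nat_0_less_iff by linarith
  have d: "int M dvd i - i' \<longleftrightarrow> i' = i0" if "i' \<in> {1..int M}" for i'
  proof -
    have "int M dvd i - i' \<longleftrightarrow> (i - 1) mod int M = (i' - 1) mod int M"
      by (simp add: mod_eq_dvd_iff)
    also have "(i' - 1) mod int M = i' - 1" using that by (intro mod_pos_pos_trivial) auto
    finally show ?thesis by (auto simp: i0_def)
  qed
  have gm: "g (i + int n * int M) = g i" for n i
  proof (induction n)
    case (Suc n)
    have "g (i + int (Suc n) * int M) = g (i + int n * int M + int M)" by (simp add: algebra_simps)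
    then show ?case using g Suc by simp
  qed simp
  have gz: "g (i + q * int M) = g i" for q i
  proof (cases "q \<ge> 0")
    case True
    then show ?thesis using gm[of i "nat q"] by simp
  next
    case False
    then show ?thesis using gm[of "i + q * int M" "nat (- q)"] by simp
  qed
  have gi: "g i0 = g i"
  proof -
    have "i = i0 + ((i - 1) div int M) * int M"
      by (simp add: i0_def mult.commute[of _ "int M"])
    then show ?thesis using gz by metis
  qed
  have "(\<Sum>l\<in>modes M. \<Sum>i'=1..int M. g i' * rou M (l * (i - i')))
     = (\<Sum>i'=1..int M. g i' * (\<Sum>l\<in>modes M. rou M ((i - i') * l)))"
    by (subst sum.swap) (simp add: sum_distrib_left mult.commute[of _ "i - _"])
  also have "\<dots> = (\<Sum>i'=1..int M. if i' = i0 then of_nat M * g i' else 0)"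
    by (intro sum.cong refl) (auto simp: sum_modes_rou d)
  also have "\<dots> = of_nat M * g i" using i0 gi by simp
  finally show ?thesis .
qed

lemma dft2_inversion:
  assumes u: "u \<in> grid_fun M"
  shows "of_real (u i j) = (\<Sum>k\<in>modes2. dft2 u k * wave2 k i j)"
proof -
  have per: "u (i + int M) j = u i j" "u i (j + int M) = u i j" for i j
    using u by (auto simp: grid_fun_def)
  define G where "G l m = (\<Sum>i'=1..int M. \<Sum>j'=1..int M.
          of_real (u i' j') * (rou M (l * (i - i')) * rou M (m * (j - j'))))" for l m
  have rd: "rou M (x * (y - z)) = rou M (x * y) * rou M (- (x * z))" for x y z
    by (simp add: rou_add[symmetric] right_diff_distrib)
  have summand: "of_real x * cnj (wave2 k i' j') * wave2 k i j
       = of_real x * (rou M (fst k * (i - i')) * rou M (snd k * (j - j')))" for x i' j' k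
    unfolding rd by (simp add: wave2_eq cnj_rou)
  have each: "dft2 u k * wave2 k i j = G (fst k) (snd k) / of_nat (M\<^sup>2)" for k
    by (simp only: dft2_eq G_def times_divide_eq_left sum_distrib_right summand)
  have "(\<Sum>k\<in>modes2. dft2 u k * wave2 k i j) = (\<Sum>l\<in>modes M. \<Sum>m\<in>modes M. G l m) / of_nat (M\<^sup>2)"
    unfolding sum_modes2 each by (rule sum_divide_distrib[symmetric])
  also have "(\<Sum>l\<in>modes M. \<Sum>m\<in>modes M. G l m)
     = (\<Sum>l\<in>modes M. \<Sum>i'=1..int M. (\<Sum>m\<in>modes M. \<Sum>j'=1..int M.
          of_real (u i' j') * rou M (m * (j - j'))) * rou M (l * (i - i')))"
    unfolding G_def
    by (rule sum.cong[OF refl], subst sum.swap) (simp add: sum_distrib_right sum_distrib_left mult_ac)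
  also have "\<dots> = (\<Sum>l\<in>modes M. \<Sum>i'=1..int M. (of_nat M * of_real (u i' j)) * rou M (l * (i - i')))"
    by (intro sum.cong refl arg_cong2[where f = "(*)"] sum_delta_periodic) (simp add: per)
  also have "\<dots> = of_nat M * (of_nat M * of_real (u i j))"
    by (rule sum_delta_periodic) (simp add: per)
  finally show ?thesis using M by (simp add: power2_eq_square)
qed

lemma dft2_add: "dft2 (\<lambda>i j. u i j + v i j) k = dft2 u k + dft2 v k"
  by (simp add: dft2_eq distrib_right sum.distrib add_divide_distrib)

lemma dft2_cmult: "dft2 (\<lambda>i j. x * v i j) k = of_real x * dft2 v k"
  by (simp add: dft2_eq sum_distrib_left mult.assoc)

lemma dft2_diff: "dft2 (\<lambda>i j. u i j - v i j) k = dft2 u k - dft2 v k"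
  using dft2_add[of u "\<lambda>i j. (-1) * v i j" k] dft2_cmult[of "-1" v k] by simp

lemma dft2_sum: "dft2 (\<lambda>i j. \<Sum>q\<in>S. x q * v q i j) k = (\<Sum>q\<in>S. of_real (x q) * dft2 (v q) k)"
proof (induction S rule: infinite_finite_induct)
  case (insert q S)
  then show ?case by (simp add: dft2_add dft2_cmult)
qed (auto simp: dft2_eq)

lemma lap_h_eq: "of_real (lap_h L M v i j) = (\<Sum>k\<in>modes2. (- of_real (lam L k) * dft2 v k) * wave2 k i j)"
proof -
  have "of_real (lap_h L M v i j) = Dxx L M v i j + Dyy L M v i j"
    by (rule of_real_lap_h[OF M L_nz])
  also have "\<dots> = (\<Sum>k\<in>modes2. (- of_real (lam L k) * dft2 v k) * wave2 k i j)"
    unfolding Dxx_def Dyy_def sum_modes2 sum.distrib[symmetric]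
    by (intro sum.cong refl)
      (simp add: lam_def dft2_def wave2_def power_mult_distrib algebra_simps)
  finally show ?thesis .
qed

lemma dft2_lap_h: "k \<in> modes2 \<Longrightarrow> dft2 (lap_h L M v) k = - of_real (lam L k) * dft2 v k"
  by (rule dft2_synth[OF lap_h_eq])

text \<open>Stated for a synthesis \<open>v\<close>, since \<open>lap_h_eq\<close> gives the
  discrete Laplacian in this form; pairing with the waves produces the coefficients of
  \<open>w\<close>.\<close>

lemma parseval:
  assumes v: "\<And>i j. of_real (v i j) = (\<Sum>k\<in>modes2. c k * wave2 k i j)"
  shows "of_real (inner_h L M v w) = of_real (L\<^sup>2) * (\<Sum>k\<in>modes2. c k * cnj (dft2 w k))"
proof -
  have "of_real (\<Sum>i=1..int M. \<Sum>j=1..int M. v i j * w i j)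
     = (\<Sum>i=1..int M. \<Sum>j=1..int M. (\<Sum>k\<in>modes2. c k * wave2 k i j) * of_real (w i j))"
    by (simp add: v[symmetric])
  also have "\<dots> = (\<Sum>i=1..int M. \<Sum>j=1..int M. \<Sum>k\<in>modes2. c k * (wave2 k i j * of_real (w i j)))"
    by (simp add: sum_distrib_right mult.assoc)
  also have "\<dots> = (\<Sum>i=1..int M. \<Sum>k\<in>modes2. \<Sum>j=1..int M. c k * (wave2 k i j * of_real (w i j)))"
    by (intro sum.cong refl sum.swap)
  also have "\<dots> = (\<Sum>k\<in>modes2. \<Sum>i=1..int M. \<Sum>j=1..int M. c k * (wave2 k i j * of_real (w i j)))"
    by (rule sum.swap)
  also have "\<dots> = of_nat (M\<^sup>2) * (\<Sum>k\<in>modes2. c k * cnj (dft2 w k))"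
    unfolding sum_distrib_left
  proof (rule sum.cong[OF refl])
    fix k
    have "cnj (dft2 w k) = (\<Sum>i=1..int M. \<Sum>j=1..int M. wave2 k i j * of_real (w i j)) / of_nat (M\<^sup>2)"
      by (simp add: dft2_eq mult.commute)
    then have "of_nat (M\<^sup>2) * cnj (dft2 w k) = (\<Sum>i=1..int M. \<Sum>j=1..int M. wave2 k i j * of_real (w i j))"
      using M by (simp del: of_nat_power)
    then show "(\<Sum>i=1..int M. \<Sum>j=1..int M. c k * (wave2 k i j * of_real (w i j))) = of_nat (M\<^sup>2) * (c k * cnj (dft2 w k))"
      by (simp only: sum_distrib_left[symmetric] mult.left_commute)
  qed
  finally have S: "of_real (\<Sum>i=1..int M. \<Sum>j=1..int M. v i j * w i j)
     = of_nat (M\<^sup>2) * (\<Sum>k\<in>modes2. c k * cnj (dft2 w k))" .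
  show ?thesis
    unfolding inner_h_def of_real_mult[of "(L / real M)\<^sup>2"] S using M
    by (simp add: power_divide)
qed

text \<open>\<open>Dx\<close> and \<open>Dy\<close> may be complex because of the unpaired mode, so
  the identity for real grid functions does not apply and the squared moduli are expanded
  directly.\<close>

lemma grad_norm_h_eq: "(grad_norm_h L M v)\<^sup>2 = L\<^sup>2 * (\<Sum>k\<in>modes2. lam L k * (cmod (dft2 v k))\<^sup>2)"
proof -
  have sq: "of_real (\<Sum>i=1..int M. \<Sum>j=1..int M. (cmod (\<Sum>k\<in>modes2. c k * wave2 k i j))\<^sup>2)
      = (of_real (real (M\<^sup>2) * (\<Sum>k\<in>modes2. (cmod (c k))\<^sup>2)) :: complex)" for c
  proof -
    have "of_real (\<Sum>i=1..int M. \<Sum>j=1..int M. (cmod (\<Sum>k\<in>modes2. c k * wave2 k i j))\<^sup>2)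
      = (\<Sum>i=1..int M. \<Sum>j=1..int M. \<Sum>l\<in>modes2. cnj (c l) * ((\<Sum>k\<in>modes2. c k * wave2 k i j) * cnj (wave2 l i j)))"
      by (simp only: of_real_sum complex_norm_square cnj_sum complex_cnj_mult sum_distrib_left mult_ac)
    also have "\<dots> = (\<Sum>i=1..int M. \<Sum>l\<in>modes2. \<Sum>j=1..int M. cnj (c l) * ((\<Sum>k\<in>modes2. c k * wave2 k i j) * cnj (wave2 l i j)))"
      by (intro sum.cong refl sum.swap)
    also have "\<dots> = (\<Sum>l\<in>modes2. \<Sum>i=1..int M. \<Sum>j=1..int M. cnj (c l) * ((\<Sum>k\<in>modes2. c k * wave2 k i j) * cnj (wave2 l i j)))"
      by (rule sum.swap)
    also have "\<dots> = (\<Sum>l\<in>modes2. cnj (c l) * (of_nat (M\<^sup>2) * ((\<Sum>i=1..int M. \<Sum>j=1..int M. (\<Sum>k\<in>modes2. c k * wave2 k i j) * cnj (wave2 l i j)) / of_nat (M\<^sup>2))))"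
    proof (rule sum.cong[OF refl])
      fix l
      define Z where "Z = (\<Sum>i=1..int M. \<Sum>j=1..int M. (\<Sum>k\<in>modes2. c k * wave2 k i j) * cnj (wave2 l i j))"
      have "of_nat (M\<^sup>2) * (Z / of_nat (M\<^sup>2)) = Z" using M by simp
      then show "(\<Sum>i=1..int M. \<Sum>j=1..int M. cnj (c l) * ((\<Sum>k\<in>modes2. c k * wave2 k i j) * cnj (wave2 l i j)))
        = cnj (c l) * (of_nat (M\<^sup>2) * ((\<Sum>i=1..int M. \<Sum>j=1..int M. (\<Sum>k\<in>modes2. c k * wave2 k i j) * cnj (wave2 l i j)) / of_nat (M\<^sup>2)))"
        by (simp only: sum_distrib_left[symmetric] Z_def)
    qed
    also have "\<dots> = (\<Sum>l\<in>modes2. cnj (c l) * (of_nat (M\<^sup>2) * c l))"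
    proof (rule sum.cong[OF refl])
      fix l assume l: "l \<in> modes2"
      have "(\<Sum>k\<in>modes2. if int M dvd fst k - fst l \<and> int M dvd snd k - snd l then c k else 0)
         = (\<Sum>k\<in>modes2. if k = l then c k else 0)"
        using l by (intro sum.cong refl) (auto simp: modes2_def modes_cong_iff prod_eq_iff)
      then show "cnj (c l) * (of_nat (M\<^sup>2) * ((\<Sum>i=1..int M. \<Sum>j=1..int M. (\<Sum>k\<in>modes2. c k * wave2 k i j) * cnj (wave2 l i j)) / of_nat (M\<^sup>2)))
         = cnj (c l) * (of_nat (M\<^sup>2) * c l)"
        unfolding sum_grid_synth[where g = "\<lambda>k. k"] using l by simp
    qed
    also have "\<dots> = of_real (real (M\<^sup>2) * (\<Sum>k\<in>modes2. (cmod (c k))\<^sup>2))"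
      by (simp only: of_real_mult of_real_sum of_real_of_nat_eq complex_norm_square sum_distrib_left mult_ac)
    finally show ?thesis .
  qed
  note sq' = sq[unfolded of_real_eq_iff]
  have Dx: "Dx L M v i j = (\<Sum>k\<in>modes2. (\<i> * of_real (freq L) * of_int (fst k) * dft2 v k) * wave2 k i j)" for i j
    unfolding Dx_def sum_modes2 by (simp add: dft2_def wave2_def)
  have Dy: "Dy L M v i j = (\<Sum>k\<in>modes2. (\<i> * of_real (freq L) * of_int (snd k) * dft2 v k) * wave2 k i j)" for i j
    unfolding Dy_def sum_modes2 by (simp add: dft2_def wave2_def)
  have "(grad_norm_h L M v)\<^sup>2 = (L / real M)\<^sup>2 *
      ((\<Sum>i=1..int M. \<Sum>j=1..int M. (cmod (Dx L M v i j))\<^sup>2) + (\<Sum>i=1..int M. \<Sum>j=1..int M. (cmod (Dy L M v i j))\<^sup>2))"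
    unfolding grad_norm_h_def sum.distrib
    by (intro real_sqrt_pow2 mult_nonneg_nonneg add_nonneg_nonneg sum_nonneg) auto
  also have "\<dots> = (L / real M)\<^sup>2 * (real (M\<^sup>2) * (\<Sum>k\<in>modes2. lam L k * (cmod (dft2 v k))\<^sup>2))"
    unfolding Dx Dy sq' distrib_left[symmetric] sum.distrib[symmetric]
    by (intro arg_cong2[where f = "(*)"] refl sum.cong)
      (simp add: norm_mult lam_def power_mult_distrib algebra_simps)
  finally show ?thesis using M by (simp add: power_divide)
qed

section \<open>Frequencies modulo \<open>M\<close>: the window as an instance of the convolution
  setting\<close>

definition rep :: "int \<Rightarrow> int" where
  "rep x = (x + int M div 2) mod int M - int M div 2"

definition sgM :: "int \<times> int \<Rightarrow> int \<times> int \<Rightarrow> int \<times> int" where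
  "sgM k l = (rep (fst k - fst l), rep (snd k - snd l))"

lemma half_M: "int M = 2 * (int M div 2)" "int M div 2 > 0"
  using M by (auto elim!: evenE)

lemma modes_iff: "x \<in> modes M \<longleftrightarrow> - (int M div 2) \<le> x \<and> x < int M div 2"
  by (auto simp: modes_def)

lemma rep_in: "rep x \<in> modes M"
  using pos_mod_bound[of "int M" "x + int M div 2"] pos_mod_sign[of "int M" "x + int M div 2"] half_M
  unfolding modes_iff rep_def by linarith

lemma rep_dvd: "int M dvd x - rep x"
proof -
  have "x - rep x = (x + int M div 2) - (x + int M div 2) mod int M"
    by (simp add: rep_def)
  then show ?thesis by (simp only: dvd_minus_mod)
qed

lemma rep_eqI: "y \<in> modes M \<Longrightarrow> int M dvd x - y \<Longrightarrow> rep x = y"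
  using modes_cong_iff[OF rep_in[of x], of y] dvd_diff[OF _ rep_dvd[of x], of "x - y"] by simp

lemma rep_id: "x \<in> modes M \<Longrightarrow> rep x = x"
  by (rule rep_eqI) auto

text \<open>A difference of two window elements is less than \<open>M\<close> in modulus, so
  reduction shifts it by at most one period.\<close>

lemma rep_diff_cases:
  assumes "x \<in> modes M" "y \<in> modes M"
  shows "rep (x - y) = x - y \<or>
    rep (x - y) = x - y - int M \<and> int M div 2 \<le> x - y \<or> rep (x - y) = x - y + int M \<and> x - y < - (int M div 2)"
proof (cases "x - y \<in> modes M")
  case False
  show ?thesis
  proof (cases "x - y \<ge> int M div 2")
    case True
    have "rep (x - y) = x - y - int M"
      using assms True half_M by (intro rep_eqI) (auto simp: modes_iff)
    then show ?thesis using True by simp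
  next
    case neg: False
    have "rep (x - y) = x - y + int M"
      using assms False neg half_M by (intro rep_eqI) (auto simp: modes_iff)
    then show ?thesis using False neg by (auto simp: modes_iff)
  qed
qed (simp add: rep_id)

lemma rep_inj:
  assumes "x \<in> modes M" "x' \<in> modes M" "rep (x - y) = rep (x' - y)"
  shows "x = x'"
proof -
  have "int M dvd (x - y - rep (x - y)) - (x' - y - rep (x' - y))"
    by (intro dvd_diff rep_dvd)
  then show ?thesis using assms modes_cong_iff[of x x'] by simp
qed

lemma rep_inj':
  assumes "x \<in> modes M" "x' \<in> modes M" "rep (y - x) = rep (y - x')"
  shows "x = x'"
proof -
  have "int M dvd (y - x - rep (y - x)) - (y - x' - rep (y - x'))"
    by (intro dvd_diff rep_dvd)
  then show ?thesis using assms modes_cong_iff[of x' x] by simp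
qed

text \<open>\<open>y + rep (x - y)\<close> is congruent to \<open>x\<close> modulo \<open>M\<close>,
  and window elements have the least modulus in their residue class; wrapping thus cannot spoil the
  quasi-triangle inequality.\<close>

lemma rep_square:
  assumes "x \<in> modes M" "y \<in> modes M"
  shows "(of_int x)\<^sup>2 \<le> 2 * ((of_int y)\<^sup>2 + (of_int (rep (x - y)) :: real)\<^sup>2)"
proof -
  have "\<bar>x\<bar> \<le> \<bar>y + rep (x - y)\<bar>"
    using rep_diff_cases[OF assms] assms half_M by (auto simp: modes_iff)
  then have "\<bar>of_int x\<bar> \<le> \<bar>of_int y + of_int (rep (x - y)) :: real\<bar>"
    by linarith
  then have "(of_int x)\<^sup>2 \<le> (of_int y + of_int (rep (x - y)) :: real)\<^sup>2"
    by (simp only: abs_le_square_iff)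
  also have "\<dots> \<le> 2 * ((of_int y)\<^sup>2 + (of_int (rep (x - y)))\<^sup>2)"
  proof -
    have "2 * (a\<^sup>2 + b\<^sup>2) = (a + b)\<^sup>2 + (a - b)\<^sup>2" for a b :: real
      by (simp add: power2_eq_square algebra_simps)
    then show ?thesis by simp
  qed
  finally show ?thesis .
qed

lemma spectral_modes2: "spectral L modes2 sgM"
proof (rule spectral.intro)
  show "sgM k l \<in> modes2" if "k \<in> modes2" "l \<in> modes2" for k l
    by (simp add: sgM_def modes2_def rep_in)
  show "inj_on (\<lambda>k. sgM k l) modes2" if "l \<in> modes2" for l
    by (rule inj_onI) (auto simp: sgM_def modes2_def prod_eq_iff intro: rep_inj)
  show "inj_on (sgM k) modes2" if "k \<in> modes2" for k
    by (rule inj_onI) (auto simp: sgM_def modes2_def prod_eq_iff intro: rep_inj')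
  have gen: "1 + f * (a + b) \<le> 2 * (1 + f * (c + d) + (1 + f * (e + g)))"
    if "a \<le> 2 * (c + e)" "b \<le> 2 * (d + g)" "f \<ge> 0" for a b c d e f g :: real
  proof -
    have "a + b \<le> 2 * (c + d + (e + g))"
      using that(1,2) by simp
    from mult_left_mono[OF this that(3)]
    have "f * (a + b) \<le> 2 * (f * (c + d)) + 2 * (f * (e + g))"
      by (simp only: distrib_left mult.left_commute)
    then show ?thesis unfolding distrib_left[of 2] by linarith
  qed
  show "bw L k \<le> 2 * (bw L l + bw L (sgM k l))" if "k \<in> modes2" "l \<in> modes2" for k l
    unfolding bw_def lam_def sgM_def fst_conv snd_conv
    using that by (intro gen rep_square) (auto simp: modes2_def)
qed (rule L)

lemma bw_ge:
  assumes "int M \<le> 4 * \<bar>fst k\<bar> \<or> int M \<le> 4 * \<bar>snd k\<bar>"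
  shows "(freq L)\<^sup>2 * (real M)\<^sup>2 / 16 \<le> bw L k"
proof -
  have sq: "(real M)\<^sup>2 / 16 \<le> (of_int x :: real)\<^sup>2" if "int M \<le> 4 * \<bar>x\<bar>" for x
  proof -
    have "real M / 4 \<le> \<bar>of_int x\<bar>" using that by linarith
    then have "(real M / 4)\<^sup>2 \<le> \<bar>of_int x :: real\<bar>\<^sup>2" by (intro power_mono) auto
    then show ?thesis by (simp add: power_divide)
  qed
  have "(real M)\<^sup>2 / 16 \<le> (of_int (fst k))\<^sup>2 + (of_int (snd k))\<^sup>2"
    using assms
  proof
    assume "int M \<le> 4 * \<bar>fst k\<bar>"
    from sq[OF this] show ?thesis by (rule order_trans) simp
  next
    assume "int M \<le> 4 * \<bar>snd k\<bar>"
    from sq[OF this] show ?thesis by (rule order_trans) simp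
  qed
  from mult_left_mono[OF this, of "(freq L)\<^sup>2"]
  show ?thesis by (simp add: bw_def lam_def)
qed

lemma bw_prod_ge:
  assumes "b \<le> bw L k \<or> b \<le> bw L l" "b \<ge> 0"
  shows "b \<le> bw L k * bw L l"
  using assms(1)
proof
  assume "b \<le> bw L k"
  also have "bw L k * 1 \<le> bw L k * bw L l" by (intro mult_left_mono) auto
  finally show ?thesis by simp
next
  assume "b \<le> bw L l"
  also have "1 * bw L l \<le> bw L k * bw L l" by (intro mult_right_mono) auto
  finally show ?thesis by simp
qed

text \<open>Lower bound for the weight once a component reaches \<open>M / 4\<close> in modulus.
  With \<open>h = L / M\<close> it equals \<open>pi^2 / (4 h^2)\<close>, so dividing by it produces
  the aliasing order \<open>h^2\<close>.\<close>

definition rhoM :: real where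
  "rhoM = (freq L)\<^sup>2 * (real M)\<^sup>2 / 16"

lemma rhoM_pos: "rhoM > 0"
  using M L by (simp add: rhoM_def freq_def)

lemma not_modes: "x \<notin> modes M \<Longrightarrow> int M \<le> 4 * \<bar>x\<bar>"
  using half_M by (auto simp: modes_iff)

lemma aliasing_modes2: "aliasing L modes2 sgM rhoM"
proof (intro aliasing.intro aliasing_axioms.intro spectral_modes2 rhoM_pos)
  show "sgM k l = k - l" if "k - l \<in> modes2" for k l
    using that by (auto simp: sgM_def modes2_def prod_eq_iff rep_id)
  show "rhoM \<le> bw L l * bw L (sgM k l)" if kl: "k \<in> modes2" "l \<in> modes2" and ne: "sgM k l \<noteq> k - l" for k l
  proof (rule bw_prod_ge)
    \<comment> \<open>If \<open>y\<close> and \<open>rep (x - y)\<close> were both below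
      \<open>M / 4\<close> in modulus, their sum would lie inside the window and, being congruent to
      \<open>x\<close>, equal it; then no wrapping would have occurred.\<close>
    have w: "int M \<le> 4 * \<bar>y\<bar> \<or> int M \<le> 4 * \<bar>rep (x - y)\<bar>"
      if "x \<in> modes M" "y \<in> modes M" "rep (x - y) \<noteq> x - y" for x y
      using rep_diff_cases[OF that(1,2)] that half_M by (auto simp: modes_iff)
    have "rep (fst k - fst l) \<noteq> fst k - fst l \<or> rep (snd k - snd l) \<noteq> snd k - snd l"
      using ne by (auto simp: sgM_def prod_eq_iff)
    then show "rhoM \<le> bw L l \<or> rhoM \<le> bw L (sgM k l)"
      using w[of "fst k" "fst l"] w[of "snd k" "snd l"] kl bw_ge[of l] bw_ge[of "sgM k l"]
      unfolding rhoM_def by (auto simp: modes2_def sgM_def)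
  qed (use rhoM_pos in simp)
  show "rhoM \<le> bw L l * bw L (k - l)" if "k \<in> modes2" "l \<notin> modes2 \<or> k - l \<notin> modes2" for k l
  proof (rule bw_prod_ge)
    have "rhoM \<le> bw L x" if "x \<notin> modes2" for x
      unfolding rhoM_def using that not_modes[of "fst x"] not_modes[of "snd x"]
      by (intro bw_ge) (auto simp: modes2_def mem_Times_iff)
    then show "rhoM \<le> bw L l \<or> rhoM \<le> bw L (k - l)" using that by blast
  qed (use rhoM_pos in simp)
qed

sublocale aliasing L modes2 sgM rhoM
  by (rule aliasing_modes2)

section \<open>Products of grid functions as cyclic convolutions\<close>

lemma dft2_periodic:
  assumes "int M dvd fst k - fst l" "int M dvd snd k - snd l"
  shows "dft2 v k = dft2 v l"
proof -
  have "wave2 k i j = wave2 l i j" for i j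
  proof -
    have r: "rou M (x * i) = rou M (y * i)" if "int M dvd x - y" for x y i
    proof -
      from that obtain q where "x = y + int M * q" by (metis dvdE add.commute diff_add_cancel)
      then show ?thesis
        by (simp add: distrib_right rou_add mult.assoc rou_mult_M[OF M(2)])
    qed
    show ?thesis unfolding wave2_eq using r assms by metis
  qed
  then show ?thesis by (simp add: dft2_eq)
qed

text \<open>Only \<open>u\<close> is expanded into waves, which moves the frequency at which
  \<open>v\<close> is transformed to \<open>k - l\<close>; periodicity of the transform brings it
  back into the window.\<close>

lemma dft2_mult:
  assumes u: "u \<in> grid_fun M"
  shows "dft2 (\<lambda>i j. u i j * v i j) k = conv (dft2 u) (dft2 v) k"
proof -
  have sg: "dft2 v (sgM k l) = dft2 v (k - l)" for l
    using rep_dvd by (intro dft2_periodic) (auto simp: sgM_def dvd_diff_commute)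
  have "dft2 (\<lambda>i j. u i j * v i j) k
     = (\<Sum>i=1..int M. \<Sum>j=1..int M. \<Sum>l\<in>modes2. dft2 u l * (of_real (v i j) * cnj (wave2 (k - l) i j))) / of_nat (M\<^sup>2)"
    unfolding dft2_eq[of "\<lambda>i j. u i j * v i j"] of_real_mult dft2_inversion[OF u]
    by (intro arg_cong2[where f = "(/)"] sum.cong refl)
      (simp add: sum_distrib_right sum_distrib_left wave2_mult_cnj[symmetric] mult_ac)
  also have "(\<Sum>i=1..int M. \<Sum>j=1..int M. \<Sum>l\<in>modes2. dft2 u l * (of_real (v i j) * cnj (wave2 (k - l) i j)))
     = (\<Sum>i=1..int M. \<Sum>l\<in>modes2. \<Sum>j=1..int M. dft2 u l * (of_real (v i j) * cnj (wave2 (k - l) i j)))"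
    by (intro sum.cong refl sum.swap)
  also have "\<dots> = (\<Sum>l\<in>modes2. \<Sum>i=1..int M. \<Sum>j=1..int M. dft2 u l * (of_real (v i j) * cnj (wave2 (k - l) i j)))"
    by (rule sum.swap)
  also have "\<dots> / of_nat (M\<^sup>2) = (\<Sum>l\<in>modes2. dft2 u l * dft2 v (k - l))"
    by (simp only: dft2_eq[of v] sum_divide_distrib sum_distrib_left times_divide_eq_right)
  also have "\<dots> = conv (dft2 u) (dft2 v) k"
    by (simp add: conv_def sg)
  finally show ?thesis .
qed

lemma dft2_cube:
  assumes u: "u \<in> grid_fun M" and k: "k \<in> modes2"
  shows "dft2 (\<lambda>i j. u i j ^ 3) k = cube (dft2 u) k"
proof -
  have "dft2 (\<lambda>i j. u i j * (u i j * u i j)) k = conv (dft2 u) (dft2 (\<lambda>i j. u i j * u i j)) k"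
    by (rule dft2_mult[OF u])
  also have "\<dots> = cube (dft2 u) k"
    unfolding cube_def by (intro conv_cong refl dft2_mult u k)
  finally show ?thesis by (simp add: power3_eq_cube mult.assoc)
qed

end

section \<open>Energy dissipation\<close>

lemma deriv_F: "deriv F x = x ^ 3 - x"
proof (rule DERIV_imp_deriv)
  have "((\<lambda>v. (v\<^sup>2 - 1)\<^sup>2 / 4) has_real_derivative x ^ 3 - x) (at x)"
    by (auto intro!: derivative_eq_intros simp: power2_eq_square power3_eq_cube field_simps)
  then show "(F has_real_derivative x ^ 3 - x) (at x)"
    by (simp add: F_def[abs_def])
qed

lemma deriv_deriv_F: "deriv (deriv F) x = 3 * x\<^sup>2 - 1"
proof (rule DERIV_imp_deriv)
  have "deriv F = (\<lambda>x. x ^ 3 - x)" by (rule ext) (rule deriv_F)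
  then show "(deriv F has_real_derivative 3 * x\<^sup>2 - 1) (at x)"
    by (auto intro!: derivative_eq_intros)
qed

text \<open>For the quartic \<open>F\<close> the expansion at \<open>a\<close> is an identity with
  quadratic coefficient \<open>((a + b)^2 + 2 a^2 - 2) / 4\<close>. On \<open>[-B, B]\<close> this
  is at most half of \<open>F''(B) = 3 B^2 - 1\<close>, the bound demanded of
  \<open>\<kappa>\<close>.\<close>

lemma F_convex_split:
  assumes "\<bar>a\<bar> \<le> B" "\<bar>b\<bar> \<le> B" "3 * B\<^sup>2 - 1 \<le> \<kappa>"
  shows "F b - F a \<le> (b - a) * (\<kappa> * ((a + b) / 2) - f_stab \<kappa> a)"
proof -
  have B: "x\<^sup>2 \<le> B\<^sup>2" if "\<bar>x\<bar> \<le> B" for x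
    using that power_mono[of "\<bar>x\<bar>" B 2] by simp
  have "(a + b)\<^sup>2 \<le> 2 * (a\<^sup>2 + b\<^sup>2)"
  proof -
    have "2 * (a\<^sup>2 + b\<^sup>2) = (a + b)\<^sup>2 + (a - b)\<^sup>2"
      by (simp add: power2_eq_square algebra_simps)
    then show ?thesis by simp
  qed
  then have "(a + b)\<^sup>2 + 2 * a\<^sup>2 - 2 \<le> 2 * \<kappa>"
    using B[OF assms(1)] B[OF assms(2)] assms(3) by simp
  then have "(b - a)\<^sup>2 / 4 * ((a + b)\<^sup>2 + 2 * a\<^sup>2 - 2) \<le> (b - a)\<^sup>2 / 4 * (2 * \<kappa>)"
    by (intro mult_left_mono) auto
  moreover have "F b - F a = (b - a) * (a ^ 3 - a) + (b - a)\<^sup>2 / 4 * ((a + b)\<^sup>2 + 2 * a\<^sup>2 - 2)"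
    unfolding F_def by (simp add: power2_eq_square power3_eq_cube field_simps)
  moreover have "(b - a) * (\<kappa> * ((a + b) / 2) - f_stab \<kappa> a) = (b - a) * (a ^ 3 - a) + (b - a)\<^sup>2 / 4 * (2 * \<kappa>)"
    unfolding f_stab_def deriv_F by (simp add: power2_eq_square field_simps)
  ultimately show ?thesis by linarith
qed

context periodic_grid
begin

section \<open>The discrete Laplacian: linearity, inverse and symmetry\<close>

lemma grid_fun_lap_h: "lap_h L M v \<in> grid_fun M"
proof -
  have p: "rou M (a * (b + int M)) = rou M (a * b)" for a b
    by (simp add: distrib_left rou_add mult.commute[of a "int M"] rou_mult_M[OF M(2)])
  have "of_real (lap_h L M v (i + int M) j) = (of_real (lap_h L M v i j) :: complex)"
    "of_real (lap_h L M v i (j + int M)) = (of_real (lap_h L M v i j) :: complex)" for i j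
    unfolding lap_h_eq wave2_eq p by simp_all
  then show ?thesis by (auto simp: grid_fun_def)
qed

lemma lap_h_sum: "lap_h L M (\<lambda>i j. \<Sum>q\<in>S. x q * v q i j) i j = (\<Sum>q\<in>S. x q * lap_h L M (v q) i j)"
proof -
  have "of_real (lap_h L M (\<lambda>i j. \<Sum>q\<in>S. x q * v q i j) i j)
      = (\<Sum>k\<in>modes2. \<Sum>q\<in>S. of_real (x q) * ((- of_real (lam L k) * dft2 (v q) k) * wave2 k i j))"
    unfolding lap_h_eq dft2_sum by (simp add: sum_distrib_left sum_distrib_right mult_ac)
  also have "\<dots> = (\<Sum>q\<in>S. \<Sum>k\<in>modes2. of_real (x q) * ((- of_real (lam L k) * dft2 (v q) k) * wave2 k i j))"
    by (rule sum.swap)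
  also have "\<dots> = of_real (\<Sum>q\<in>S. x q * lap_h L M (v q) i j)"
    by (simp only: sum_distrib_left[symmetric] lap_h_eq[symmetric] of_real_mult[symmetric] of_real_sum[symmetric])
  finally show ?thesis by (simp only: of_real_eq_iff)
qed

lemma lap_h_diff: "lap_h L M (\<lambda>i j. v i j - w i j) i j = lap_h L M v i j - lap_h L M w i j"
proof -
  have "of_real (lap_h L M (\<lambda>i j. v i j - w i j) i j) = (of_real (lap_h L M v i j) - of_real (lap_h L M w i j) :: complex)"
    unfolding lap_h_eq dft2_diff sum_subtractf[symmetric] by (simp add: algebra_simps)
  then show ?thesis by (simp only: of_real_diff[symmetric] of_real_eq_iff)
qed

lemma lap_h_const: "lap_h L M (\<lambda>i j. x) i j = 0"
proof -
  have "lam L k * dft2 (\<lambda>i j. x) k = 0" if k: "k \<in> modes2" for k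
  proof (cases "k = 0")
    case False
    have z: "(0::int) \<in> modes M" using half_M by (simp add: modes_iff)
    have "cnj (dft2 (\<lambda>i j. x) k) = of_real x * (\<Sum>i=1..int M. \<Sum>j=1..int M. wave2 k i j) / of_nat (M\<^sup>2)"
      by (simp add: dft2_eq sum_distrib_left)
    also have "\<dots> = 0"
      using False k modes_cong_iff[OF _ z, of "fst k"] modes_cong_iff[OF _ z, of "snd k"]
      by (auto simp: sum_grid_wave2 modes2_def prod_eq_iff)
    finally show ?thesis by simp
  qed (simp add: lam_def)
  then have "of_real (lap_h L M (\<lambda>i j. x) i j) = (0 :: complex)"
    unfolding lap_h_eq by (intro sum.neutral) auto
  then show ?thesis by simp
qed

text \<open>Subtracting the mean from \<open>y\<close> exhibits a mean-zero preimage, so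
  \<open>inv_into\<close> selects an actual preimage. In this form \<open>lap_h_inv\<close> enters
  the energy law.\<close>

lemma lap_h_inv_lap_h:
  assumes y: "y \<in> grid_fun M"
  shows "lap_h L M (lap_h_inv L M (lap_h L M y)) = lap_h L M y"
  unfolding lap_h_inv_def
proof (rule f_inv_into_f[where f = "lap_h L M"])
  define m where "m = (\<Sum>i=1..int M. \<Sum>j=1..int M. y i j) / (real M)\<^sup>2"
  define w where "w = (\<lambda>i j. y i j - m)"
  have "(\<Sum>i=1..int M. \<Sum>j=1..int M. w i j) = 0"
    using M by (simp add: w_def m_def sum_subtractf power2_eq_square)
  moreover have "w \<in> grid_fun M" using y by (simp add: w_def grid_fun_def)
  moreover have "lap_h L M w = lap_h L M y"
    unfolding w_def by (intro ext) (simp add: lap_h_diff[of y "\<lambda>i j. m"] lap_h_const)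
  ultimately show "lap_h L M y \<in> lap_h L M ` {w \<in> grid_fun M. (\<Sum>i=1..int M. \<Sum>j=1..int M. w i j) = 0}"
    by (metis (mono_tags, lifting) image_eqI mem_Collect_eq)
qed

lemma inner_h_commute: "inner_h L M v w = inner_h L M w v"
  by (simp add: inner_h_def mult.commute)

lemma inner_h_cmult_right: "inner_h L M v (\<lambda>i j. x * w i j) = x * inner_h L M v w"
  by (simp add: inner_h_def sum_distrib_left mult_ac)

lemma inner_lap_h: "inner_h L M (lap_h L M v) w = - L\<^sup>2 * (\<Sum>k\<in>modes2. lam L k * Re (dft2 v k * cnj (dft2 w k)))"
proof -
  have "inner_h L M (lap_h L M v) w = Re (of_real (inner_h L M (lap_h L M v) w))" by simp
  also have "\<dots> = Re (of_real (L\<^sup>2) * (\<Sum>k\<in>modes2. (- of_real (lam L k) * dft2 v k) * cnj (dft2 w k)))"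
    unfolding parseval[OF lap_h_eq] by (rule refl)
  also have "\<dots> = L\<^sup>2 * (\<Sum>k\<in>modes2. Re (of_real (- lam L k) * (dft2 v k * cnj (dft2 w k))))"
    by (simp only: Re_complex_of_real times_complex.simps(1) Im_complex_of_real mult_zero_left diff_zero Re_sum of_real_minus mult.assoc)
  also have "\<dots> = - L\<^sup>2 * (\<Sum>k\<in>modes2. lam L k * Re (dft2 v k * cnj (dft2 w k)))"
    by (simp only: Re_complex_of_real times_complex.simps(1)[of "of_real _"] Im_complex_of_real mult_zero_left diff_zero
       mult_minus_left sum_negf mult_minus_right)
  finally show ?thesis .
qed

lemma lap_h_symmetric: "inner_h L M (lap_h L M v) w = inner_h L M v (lap_h L M w)"
proof -
  have "Re (dft2 v k * cnj (dft2 w k)) = Re (dft2 w k * cnj (dft2 v k))" for k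
    by (simp add: mult.commute)
  then show ?thesis
    unfolding inner_h_commute[of v] inner_lap_h by (intro arg_cong2[where f = "(*)"] refl sum.cong)
qed

text \<open>Polarisation, mode by mode: the average against the increment makes the gradient energy
  telescope without remainder.\<close>

lemma inner_lap_h_avg:
  "inner_h L M (lap_h L M (\<lambda>i j. (v i j + w i j) / 2)) (\<lambda>i j. w i j - v i j)
     = - ((grad_norm_h L M w)\<^sup>2 - (grad_norm_h L M v)\<^sup>2) / 2"
proof -
  have avg: "dft2 (\<lambda>i j. (v i j + w i j) / 2) k = (dft2 v k + dft2 w k) / 2" for k
    using dft2_cmult[of "1/2" "\<lambda>i j. v i j + w i j" k] by (simp add: dft2_add)
  have R: "Re ((p + q) / 2 * cnj (q - p)) = ((cmod q)\<^sup>2 - (cmod p)\<^sup>2) / 2" for p q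
    unfolding cmod_power2 by (simp add: power2_eq_square algebra_simps add_divide_distrib diff_divide_distrib)
  have "(\<Sum>k\<in>modes2. lam L k * (((cmod (dft2 w k))\<^sup>2 - (cmod (dft2 v k))\<^sup>2) / 2))
      = ((\<Sum>k\<in>modes2. lam L k * (cmod (dft2 w k))\<^sup>2) - (\<Sum>k\<in>modes2. lam L k * (cmod (dft2 v k))\<^sup>2)) / 2"
    unfolding sum_subtractf[symmetric] sum_divide_distrib right_diff_distrib[symmetric] by simp
  note eq = this
  show ?thesis
    unfolding inner_lap_h avg dft2_diff grad_norm_h_eq R eq by (simp add: right_diff_distrib diff_divide_distrib)
qed

text \<open>The gradient part is an identity by \<open>inner_lap_h_avg\<close>, the potential part
  an inequality by \<open>F_convex_split\<close>; both arise from pairing the stabilised chemical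
  potential with the increment.\<close>

lemma energy_step:
  assumes B: "\<And>i j. i \<in> {1..int M} \<Longrightarrow> j \<in> {1..int M} \<Longrightarrow> \<bar>v i j\<bar> \<le> B"
      "\<And>i j. i \<in> {1..int M} \<Longrightarrow> j \<in> {1..int M} \<Longrightarrow> \<bar>w i j\<bar> \<le> B" "3 * B\<^sup>2 - 1 \<le> \<kappa>"
  shows "energy_h L M \<epsilon> w - energy_h L M \<epsilon> v
    \<le> inner_h L M (\<lambda>i j. w i j - v i j)
        (\<lambda>i j. L_stab_h L M \<epsilon> \<kappa> (\<lambda>i j. (v i j + w i j) / 2) i j - f_stab \<kappa> (v i j))"
proof -
  let ?a = "\<lambda>i j. (v i j + w i j) / 2"
  have "inner_h L M (\<lambda>i j. F (w i j)) (\<lambda>i j. 1) - inner_h L M (\<lambda>i j. F (v i j)) (\<lambda>i j. 1)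
     = (L / real M)\<^sup>2 * (\<Sum>i=1..int M. \<Sum>j=1..int M. F (w i j) - F (v i j))"
    by (simp add: inner_h_def sum_subtractf right_diff_distrib)
  also have "\<dots> \<le> (L / real M)\<^sup>2 * (\<Sum>i=1..int M. \<Sum>j=1..int M. (w i j - v i j) * (\<kappa> * ?a i j - f_stab \<kappa> (v i j)))"
    by (intro mult_left_mono sum_mono F_convex_split[OF B(1) B(2) B(3)]) simp_all
  finally have "energy_h L M \<epsilon> w - energy_h L M \<epsilon> v
     \<le> \<epsilon>\<^sup>2 * (((grad_norm_h L M w)\<^sup>2 - (grad_norm_h L M v)\<^sup>2) / 2)
       + inner_h L M (\<lambda>i j. w i j - v i j) (\<lambda>i j. \<kappa> * ?a i j - f_stab \<kappa> (v i j))"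
    by (simp add: energy_h_def inner_h_def right_diff_distrib diff_divide_distrib)
  also have "((grad_norm_h L M w)\<^sup>2 - (grad_norm_h L M v)\<^sup>2) / 2
     = - inner_h L M (\<lambda>i j. w i j - v i j) (lap_h L M ?a)"
    using inner_lap_h_avg[of v w] by (simp add: inner_h_commute[of "\<lambda>i j. w i j - v i j"])
  also have "\<epsilon>\<^sup>2 * - inner_h L M (\<lambda>i j. w i j - v i j) (lap_h L M ?a)
       + inner_h L M (\<lambda>i j. w i j - v i j) (\<lambda>i j. \<kappa> * ?a i j - f_stab \<kappa> (v i j))
     = inner_h L M (\<lambda>i j. w i j - v i j) (\<lambda>i j. - \<epsilon>\<^sup>2 * lap_h L M ?a i j)
       + inner_h L M (\<lambda>i j. w i j - v i j) (\<lambda>i j. \<kappa> * ?a i j - f_stab \<kappa> (v i j))"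
    unfolding inner_h_cmult_right by simp
  also have "\<dots> = inner_h L M (\<lambda>i j. w i j - v i j)
        (\<lambda>i j. L_stab_h L M \<epsilon> \<kappa> ?a i j - f_stab \<kappa> (v i j))"
  proof -
    have "inner_h L M d p + inner_h L M d q = inner_h L M d (\<lambda>i j. p i j + q i j)" for d p q
      by (simp add: inner_h_def distrib_left sum.distrib)
    then show ?thesis by (simp add: L_stab_h_def add_diff_eq)
  qed
  finally show ?thesis .
qed

text \<open>By \<open>stage_differences\<close> the \<open>d_R\<close>-combination of increments at
  stage \<open>k\<close> equals \<open>\<tau>\<close> times the discrete Laplacian of the chemical
  potential \<open>\<mu> k\<close>. Testing with the inverse Laplacian of the increment and moving
  \<open>lap_h\<close> across by symmetry leaves the pairing of \<open>energy_step\<close>.\<close>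

lemma energy_law:
  assumes r: "rierk_method s a" and \<tau>: "\<tau> > 0"
    and V: "\<And>k. k \<in> {1..s} \<Longrightarrow> V k \<in> grid_fun M"
    and scheme: "\<And>k i j. k \<in> {1..s - 1} \<Longrightarrow>
      V (k + 1) i j = V 1 i j + \<tau> * (\<Sum>q=1..k. a (k + 1) q * stage_rhs_h L M \<epsilon> \<kappa> V q i j)"
    and B: "\<And>k i j. k \<in> {1..s} \<Longrightarrow> i \<in> {1..int M} \<Longrightarrow> j \<in> {1..int M} \<Longrightarrow> \<bar>V k i j\<bar> \<le> B" "3 * B\<^sup>2 - 1 \<le> \<kappa>"
    and j: "j \<in> {1..s - 1}"
  shows "energy_h L M \<epsilon> (V (j + 1)) - energy_h L M \<epsilon> (V 1)
    \<le> 1 / \<tau> * (\<Sum>k=1..j. inner_h L M (lap_h_inv L M (delta_stage V (k + 1)))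
                 (\<lambda>x y. \<Sum>l=1..k. d_R s a k l * delta_stage V (l + 1) x y))"
proof -
  define \<mu> where "\<mu> k = (\<lambda>i j. L_stab_h L M \<epsilon> \<kappa> (\<lambda>i j. (V k i j + V (k + 1) i j) / 2) i j - f_stab \<kappa> (V k i j))" for k
  have rhs: "stage_rhs_h L M \<epsilon> \<kappa> V k = lap_h L M (\<mu> k)" for k
    by (simp add: stage_rhs_h_def \<mu>_def)
  have \<mu>_grid: "\<mu> k \<in> grid_fun M" if "k \<in> {1..s - 1}" for k
  proof -
    have "V k \<in> grid_fun M" "V (k + 1) \<in> grid_fun M" using that V by auto
    then show ?thesis
      using grid_fun_lap_h[of "\<lambda>i j. (V k i j + V (k + 1) i j) / 2"]
      by (auto simp: \<mu>_def L_stab_h_def grid_fun_def)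
  qed
  have d: "(\<Sum>l=1..k. d_R s a k l * delta_stage V (l + 1) x y) = \<tau> * lap_h L M (\<mu> k) x y"
    if k: "k \<in> {1..s - 1}" for k x y
  proof -
    have "(\<Sum>l=1..k. d_R s a k l *\<^sub>R delta_stage V (l + 1) x y) = \<tau> * lap_h L M (\<mu> k) x y"
    proof (rule stage_differences[OF r _ k])
      fix i assume i: "i \<in> {1..s - 1}"
      have "(\<Sum>l=1..i. delta_stage V (l + 1) x y) = V (i + 1) x y - V 1 x y"
        by (induction i) (auto simp: delta_stage_def)
      also have "\<dots> = (\<Sum>q=1..i. a (i + 1) q *\<^sub>R (\<tau> * lap_h L M (\<mu> q) x y))"
        unfolding scheme[OF i] rhs by (simp add: sum_distrib_left mult_ac)
      finally show "(\<Sum>l=1..i. delta_stage V (l + 1) x y) = (\<Sum>q=1..i. a (i + 1) q *\<^sub>R (\<tau> * lap_h L M (\<mu> q) x y))" .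
    qed
    then show ?thesis by simp
  qed
  \<comment> \<open>\<open>lap_h_inv\<close> inverts only on the range of \<open>lap_h\<close>, so
    the increment is exhibited as a discrete Laplacian: both stages differ from \<open>V 1\<close>
    by the Laplacian of some \<open>y m\<close>, the sum being empty for
    \<open>m = 0\<close>.\<close>
  have rng: "lap_h L M (lap_h_inv L M (delta_stage V (k + 1))) = delta_stage V (k + 1)"
    if k: "k \<in> {1..s - 1}" for k
  proof -
    define y where "y m = (\<lambda>i j. \<Sum>q=1..m. (\<tau> * a (m + 1) q) * \<mu> q i j)" for m
    have y_grid: "y m \<in> grid_fun M" if "m \<le> s - 1" for m
      using \<mu>_grid that by (auto simp: y_def grid_fun_def intro!: sum.cong)
    have Vy: "V (m + 1) i j = V 1 i j + lap_h L M (y m) i j" if "m \<le> s - 1" for m i j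
    proof (cases "m = 0")
      case True
      then show ?thesis using lap_h_const[of 0] by (simp add: y_def)
    next
      case False
      then have "m \<in> {1..s - 1}" using that by auto
      from scheme[OF this, of i j] show ?thesis
        unfolding y_def lap_h_sum rhs by (simp add: sum_distrib_left mult.assoc)
    qed
    have "delta_stage V (k + 1) i j = lap_h L M (\<lambda>i j. y k i j - y (k - 1) i j) i j" for i j
    proof -
      have "k - 1 + 1 = k" "k \<le> s - 1" "k - 1 \<le> s - 1" using k by auto
      with Vy[of k i j] Vy[of "k - 1" i j]
      have "V (k + 1) i j = V 1 i j + lap_h L M (y k) i j" "V k i j = V 1 i j + lap_h L M (y (k - 1)) i j"
        by simp_all
      then show ?thesis unfolding lap_h_diff delta_stage_def add_diff_cancel_right' by linarith
    qed
    then have eq: "delta_stage V (k + 1) = lap_h L M (\<lambda>i j. y k i j - y (k - 1) i j)"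
      by (intro ext)
    have "(\<lambda>i j. y k i j - y (k - 1) i j) \<in> grid_fun M"
      using y_grid[of k] y_grid[of "k - 1"] k by (auto simp: grid_fun_def)
    from lap_h_inv_lap_h[OF this] show ?thesis unfolding eq .
  qed
  have step: "energy_h L M \<epsilon> (V (k + 1)) - energy_h L M \<epsilon> (V k)
     \<le> 1 / \<tau> * inner_h L M (lap_h_inv L M (delta_stage V (k + 1)))
                 (\<lambda>x y. \<Sum>l=1..k. d_R s a k l * delta_stage V (l + 1) x y)"
    if k: "k \<in> {1..s - 1}" for k
  proof -
    have "energy_h L M \<epsilon> (V (k + 1)) - energy_h L M \<epsilon> (V k) \<le> inner_h L M (\<lambda>i j. V (k + 1) i j - V k i j) (\<mu> k)"
      unfolding \<mu>_def using k by (intro energy_step[OF B(1) B(1) B(2)]) auto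
    also have "(\<lambda>i j. V (k + 1) i j - V k i j) = lap_h L M (lap_h_inv L M (delta_stage V (k + 1)))"
      unfolding rng[OF k] by (simp add: delta_stage_def[abs_def])
    also have "inner_h L M (lap_h L M (lap_h_inv L M (delta_stage V (k + 1)))) (\<mu> k)
       = inner_h L M (lap_h_inv L M (delta_stage V (k + 1))) (lap_h L M (\<mu> k))"
      by (rule lap_h_symmetric)
    also have "\<dots> = 1 / \<tau> * inner_h L M (lap_h_inv L M (delta_stage V (k + 1))) (\<lambda>x y. \<tau> * lap_h L M (\<mu> k) x y)"
      unfolding inner_h_cmult_right using \<tau> by simp
    also have "(\<lambda>x y. \<tau> * lap_h L M (\<mu> k) x y) = (\<lambda>x y. \<Sum>l=1..k. d_R s a k l * delta_stage V (l + 1) x y)"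
      by (intro ext) (rule d[OF k, symmetric])
    finally show ?thesis .
  qed
  have "energy_h L M \<epsilon> (V (j + 1)) - energy_h L M \<epsilon> (V 1)
     = (\<Sum>k=1..j. energy_h L M \<epsilon> (V (k + 1)) - energy_h L M \<epsilon> (V k))"
    by (induction j) auto
  also have "\<dots> \<le> (\<Sum>k=1..j. 1 / \<tau> * inner_h L M (lap_h_inv L M (delta_stage V (k + 1)))
                 (\<lambda>x y. \<Sum>l=1..k. d_R s a k l * delta_stage V (l + 1) x y))"
    using j by (intro sum_mono step) auto
  also have "\<dots> = 1 / \<tau> * (\<Sum>k=1..j. inner_h L M (lap_h_inv L M (delta_stage V (k + 1)))
                 (\<lambda>x y. \<Sum>l=1..k. d_R s a k l * delta_stage V (l + 1) x y))"
    by (rule sum_distrib_left[symmetric])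
  finally show ?thesis .
qed

end

section \<open>Uniqueness of Fourier coefficients\<close>

abbreviation mu :: "real \<Rightarrow> (real \<times> real) measure" where
  "mu L \<equiv> restrict_space lborel (Omega L)"

lemma Omega_box: "Omega L = box (0, 0) (L, L)"
  by (auto simp: Omega_def box_def Basis_prod_def)

lemma Omega_sets [measurable]: "Omega L \<in> sets borel" "Omega L \<in> sets lborel"
  by (auto simp: Omega_box)

lemma open_Omega: "open (Omega L)"
  by (simp add: Omega_box open_box)

lemma space_mu [simp]: "space (mu L) = Omega L"
  by (simp add: space_restrict_space)

lemma finite_measure_mu: "finite_measure (mu L)"
  by (rule finite_measureI) (simp add: emeasure_restrict_space Omega_box emeasure_lborel_box_eq)

lemma measure_mu:
  assumes "L > 0"
  shows "measure (mu L) (Omega L) = L\<^sup>2"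
proof -
  have "measure (mu L) (Omega L) = measure lborel (box (0, 0) (L, L))"
    by (simp add: measure_restrict_space Omega_box)
  also have "\<dots> = L\<^sup>2"
    using assms by (subst measure_lborel_box_eq) (auto simp: Basis_prod_def power2_eq_square prod.union_disjoint)
  finally show ?thesis .
qed

lemma set_integral_mu:
  fixes f :: "real \<times> real \<Rightarrow> 'b::{banach, second_countable_topology}"
  shows "(LINT x:Omega L|lborel. f x) = integral\<^sup>L (mu L) f"
  unfolding set_lebesgue_integral_def by (rule integral_restrict_space[symmetric]) simp

lemma set_integrable_mu:
  fixes f :: "real \<times> real \<Rightarrow> 'b::{banach, second_countable_topology}"
  shows "set_integrable lborel (Omega L) f \<longleftrightarrow> integrable (mu L) f"
  unfolding set_integrable_def by (rule integrable_restrict_space[symmetric]) simp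

lemma measurable_mu: "f \<in> borel_measurable borel \<Longrightarrow> f \<in> borel_measurable (mu L)"
  by (intro measurable_restrict_space1) simp

lemma AE_mu: "(AE x in lborel. P x) \<Longrightarrow> (AE x in mu L. P x)"
proof -
  assume "AE x in lborel. P x"
  then have "AE x in lborel. x \<in> Omega L \<longrightarrow> P x" by eventually_elim simp
  then show ?thesis by (simp add: AE_restrict_space_iff)
qed

lemma continuous_wave: "continuous_on S (wave L l m)"
  unfolding wave_def[abs_def] by (intro continuous_intros)

lemma measurable_wave [measurable]: "wave L l m \<in> borel_measurable borel"
  by (rule borel_measurable_continuous_onI[OF continuous_wave])

lemma integrable_mult_bounded_mu:
  fixes f p :: "real \<times> real \<Rightarrow> complex"
  assumes f: "integrable (mu L) f" and p: "p \<in> borel_measurable borel" "\<And>x. x \<in> Omega L \<Longrightarrow> cmod (p x) \<le> B"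
  shows "integrable (mu L) (\<lambda>x. f x * p x)"
proof (rule Bochner_Integration.integrable_bound)
  show "integrable (mu L) (\<lambda>x. f x * of_real B)" by (intro integrable_mult_left f)
  show "(\<lambda>x. f x * p x) \<in> borel_measurable (mu L)"
    by (intro borel_measurable_times borel_measurable_integrable[OF f] measurable_mu[OF p(1)])
  show "AE x in mu L. norm (f x * p x) \<le> norm (f x * of_real B)"
  proof (rule AE_I2)
    fix x assume "x \<in> space (mu L)"
    then have "cmod (p x) \<le> \<bar>B\<bar>" using p(2)[of x] by simp
    then show "norm (f x * p x) \<le> norm (f x * of_real B)"
      by (simp add: norm_mult mult_left_mono)
  qed
qed

definition torus :: "real \<Rightarrow> real \<times> real \<Rightarrow> complex \<times> complex" where
  "torus L x = (cis (freq L * fst x), cis (freq L * snd x))"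

lemma continuous_torus: "continuous_on S (torus L)"
  unfolding torus_def[abs_def] by (intro continuous_intros)

text \<open>One point is interior, the other ranges over the closed square, because
  \<open>open_zero\<close> also has to separate interior points from the image of the
  boundary.\<close>

lemma torus_inj:
  assumes L: "L > 0" and x: "x \<in> Omega L" and y: "y \<in> cbox (0, 0) (L, L)" and eq: "torus L x = torus L y"
  shows "x = y"
proof -
  have 1: "a = b" if "0 < a" "a < L" "0 \<le> b" "b \<le> L" "cis (freq L * a) = cis (freq L * b)" for a b
  proof -
    have "cis (freq L * a - freq L * b) = 1"
      using that(5) by (simp add: cis_divide[symmetric])
    then have "cos (freq L * a - freq L * b) = 1"
      by (metis cis.simps(1) one_complex.simps(1))
    then obtain n :: int where "freq L * a - freq L * b = of_int n * 2 * pi"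
      using cos_one_2pi_int by auto
    then have "2 * pi * (a - b - of_int n * L) = 0"
      using L by (simp add: freq_def field_simps)
    then have n: "a - b = of_int n * L" by simp
    have "\<bar>of_int n * L\<bar> < 1 * L" using that unfolding n[symmetric] by auto
    then have "\<bar>of_int n\<bar> < (1::real)" using L by (simp add: abs_mult)
    then have "n = 0" by linarith
    then show ?thesis using n by simp
  qed
  have "0 < fst x" "fst x < L" "0 < snd x" "snd x < L"
    using x by (auto simp: Omega_def)
  moreover have "0 \<le> fst y" "fst y \<le> L" "0 \<le> snd y" "snd y \<le> L"
    using y by (auto simp: cbox_Pair_eq)
  moreover have "cis (freq L * fst x) = cis (freq L * fst y)" "cis (freq L * snd x) = cis (freq L * snd y)"
    using eq by (auto simp: torus_def)
  ultimately show ?thesis using 1 by (metis prod_eqI)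
qed

text \<open>
  Uniqueness of Fourier coefficients: the polynomials in the torus coordinates are trigonometric
  polynomials, so Stone--Weierstrass carries the vanishing of all coefficients over to integrals
  against continuous functions on the torus, and from there to integrals over open sets.
\<close>

locale zero_coeffs =
  fixes L :: real and f :: "real \<times> real \<Rightarrow> complex"
  assumes L: "L > 0" and f: "integrable (mu L) f"
    and zero: "\<And>l m. integral\<^sup>L (mu L) (\<lambda>x. f x * wave L l m x) = 0"
begin

text \<open>Asking for vanishing integrals against all waves makes the class stable under
  multiplication by waves, hence by polynomials in the torus coordinates.\<close>

definition Z :: "(real \<times> real \<Rightarrow> complex) \<Rightarrow> bool" where
  "Z p \<longleftrightarrow> p \<in> borel_measurable borel \<and> bounded (range p) \<and>
     (\<forall>l m. integral\<^sup>L (mu L) (\<lambda>x. f x * (p x * wave L l m x)) = 0)"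

lemma Z_integrable:
  assumes "Z p"
  shows "integrable (mu L) (\<lambda>x. f x * (p x * wave L l m x))"
proof -
  from assms obtain B where B: "\<And>x. cmod (p x) \<le> B" by (auto simp: Z_def bounded_iff)
  show ?thesis
    using assms B by (intro integrable_mult_bounded_mu[OF f, of _ B] borel_measurable_times measurable_wave)
      (auto simp: Z_def norm_mult)
qed

lemma Z_one: "Z (\<lambda>x. 1)"
  using zero by (simp add: Z_def)

lemma Z_add: "Z p \<Longrightarrow> Z q \<Longrightarrow> Z (\<lambda>x. p x + q x)"
  using Z_integrable[of p] Z_integrable[of q]
  by (auto simp: Z_def distrib_left distrib_right bounded_plus_comp)

lemma Z_cmult: "Z p \<Longrightarrow> Z (\<lambda>x. p x * c)"
proof -
  assume p: "Z p"
  then obtain B where B: "\<And>x. cmod (p x) \<le> B" by (auto simp: Z_def bounded_iff)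
  have "bounded (range (\<lambda>x. p x * c))"
    using B by (auto simp: bounded_iff norm_mult intro!: exI[of _ "B * cmod c"] mult_right_mono)
  moreover have "(\<lambda>x. f x * (p x * c * wave L l m x)) = (\<lambda>x. f x * (p x * wave L l m x) * c)" for l m
    by (auto simp: mult_ac)
  ultimately show ?thesis using p by (auto simp: Z_def)
qed

lemma Z_wave: "Z p \<Longrightarrow> Z (\<lambda>x. p x * wave L l m x)"
  by (auto simp: Z_def bounded_iff norm_mult wave_mult mult.assoc)

text \<open>The real coordinates of the torus map are cosines and sines, that is, combinations of
  waves of frequency 1 and -1. Keeping \<open>p\<close> arbitrary lets the product case apply the
  two induction hypotheses in succession.\<close>

lemma Z_poly:
  assumes "real_polynomial_function q"
  shows "Z p \<Longrightarrow> Z (\<lambda>x. p x * of_real (q (torus L x)))"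
  using assms
proof (induction q arbitrary: p)
  case (linear h)
  interpret bounded_linear h by (rule linear)
  have c: "of_real (cos t) = (cis t + cis (- t)) * (1 / 2)" "of_real (sin t) = (cis t - cis (- t)) * (- \<i> / 2)" for t
    by (auto simp: complex_eq_iff)
  have w: "wave L 1 0 x = cis (freq L * fst x)" "wave L (- 1) 0 x = cis (- (freq L * fst x))"
    "wave L 0 1 x = cis (freq L * snd x)" "wave L 0 (- 1) x = cis (- (freq L * snd x))" for x
    by (auto simp: wave_def cis_conv_exp)
  have "h (torus L x) = cos (freq L * fst x) * h (1, 0) + sin (freq L * fst x) * h (\<i>, 0)
     + (cos (freq L * snd x) * h (0, 1) + sin (freq L * snd x) * h (0, \<i>))" for x
  proof -
    have "torus L x = (cos (freq L * fst x) *\<^sub>R (1, 0) + sin (freq L * fst x) *\<^sub>R (\<i>, 0))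
     + (cos (freq L * snd x) *\<^sub>R (0, 1) + sin (freq L * snd x) *\<^sub>R (0, \<i>))"
      by (auto simp: torus_def complex_eq_iff)
    then show ?thesis by (simp only: add scaleR real_scaleR_def)
  qed
  then have "(\<lambda>x. p x * of_real (h (torus L x))) = (\<lambda>x.
      (p x * wave L 1 0 x * (1 / 2 * of_real (h (1, 0))) + p x * wave L (- 1) 0 x * (1 / 2 * of_real (h (1, 0)))
      + (p x * wave L 1 0 x * (- \<i> / 2 * of_real (h (\<i>, 0))) + p x * wave L (- 1) 0 x * (\<i> / 2 * of_real (h (\<i>, 0)))))
      + (p x * wave L 0 1 x * (1 / 2 * of_real (h (0, 1))) + p x * wave L 0 (- 1) x * (1 / 2 * of_real (h (0, 1)))
      + (p x * wave L 0 1 x * (- \<i> / 2 * of_real (h (0, \<i>))) + p x * wave L 0 (- 1) x * (\<i> / 2 * of_real (h (0, \<i>))))))"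
    unfolding w by (simp only: of_real_add of_real_mult c) (simp add: algebra_simps)
  moreover have "Z \<dots>"
    by (intro Z_add Z_cmult Z_wave linear.prems)
  ultimately show ?case by simp
next
  case (const c)
  show ?case by (rule Z_cmult[OF const])
next
  case (add q1 q2)
  then show ?case using Z_add[OF add.IH] by (simp add: distrib_left)
next
  case (mult q1 q2)
  then show ?case using mult.IH(2)[OF mult.IH(1)[OF mult.prems]] by (simp add: mult.assoc)
qed

lemma continuous_zero:
  fixes D :: "complex \<times> complex \<Rightarrow> real"
  assumes D: "continuous_on UNIV D"
  shows "integral\<^sup>L (mu L) (\<lambda>x. f x * of_real (D (torus L x))) = 0"
proof -
  let ?T = "torus L ` cbox (0, 0) (L, L)"
  have cT: "compact ?T" by (intro compact_continuous_image continuous_torus compact_cbox)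
  have sub: "torus L x \<in> ?T" if "x \<in> Omega L" for x
    using that box_subset_cbox[of "(0, 0)" "(L, L)"] by (auto simp: Omega_box)
  have mD: "(\<lambda>x. of_real (D (torus L x)) :: complex) \<in> borel_measurable borel"
    by (intro borel_measurable_continuous_onI continuous_intros continuous_on_compose2[OF D continuous_torus]) auto
  have "bounded (D ` ?T)"
    by (intro compact_imp_bounded compact_continuous_image continuous_on_subset[OF D] cT) auto
  then obtain B where "\<forall>z\<in>D ` ?T. norm z \<le> B" unfolding bounded_iff by blast
  then have B: "\<And>y. y \<in> ?T \<Longrightarrow> \<bar>D y\<bar> \<le> B" by (metis imageI real_norm_def)
  have iD: "integrable (mu L) (\<lambda>x. f x * of_real (D (torus L x)))"
    using B sub by (intro integrable_mult_bounded_mu[OF f mD, of B]) auto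
  have bound: "cmod (integral\<^sup>L (mu L) (\<lambda>x. f x * of_real (D (torus L x)))) \<le> e * integral\<^sup>L (mu L) (\<lambda>x. cmod (f x))"
    if e: "e > 0" for e
  proof -
    obtain q where q: "real_polynomial_function q" "\<And>y. y \<in> ?T \<Longrightarrow> \<bar>D y - q y\<bar> < e"
      using Stone_Weierstrass_real_polynomial_function[OF cT continuous_on_subset[OF D] e] by auto
    have Zq: "Z (\<lambda>x. 1 * of_real (q (torus L x)))" by (rule Z_poly[OF q(1) Z_one])
    have w0: "wave L 0 0 x = 1" for x by (simp add: wave_def)
    have iq: "integrable (mu L) (\<lambda>x. f x * of_real (q (torus L x)))"
      using Z_integrable[OF Zq, of 0 0] by (simp add: w0)
    have zq: "integral\<^sup>L (mu L) (\<lambda>x. f x * of_real (q (torus L x))) = 0"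
      using Zq unfolding Z_def by (metis (no_types, lifting) Bochner_Integration.integral_cong mult.left_neutral mult.right_neutral w0)
    have "integral\<^sup>L (mu L) (\<lambda>x. f x * of_real (D (torus L x)))
        = integral\<^sup>L (mu L) (\<lambda>x. f x * of_real (D (torus L x)) - f x * of_real (q (torus L x)))"
      using iD iq zq by simp
    also have "cmod \<dots> \<le> integral\<^sup>L (mu L) (\<lambda>x. cmod (f x * of_real (D (torus L x)) - f x * of_real (q (torus L x))))"
      by (rule integral_norm_bound)
    also have "\<dots> \<le> integral\<^sup>L (mu L) (\<lambda>x. e * cmod (f x))"
    proof (rule integral_mono)
      fix x assume "x \<in> space (mu L)"
      then have "\<bar>D (torus L x) - q (torus L x)\<bar> \<le> e" using q(2) sub by (simp add: less_imp_le)
      then have "cmod (f x) * \<bar>D (torus L x) - q (torus L x)\<bar> \<le> cmod (f x) * e"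
        by (intro mult_left_mono) auto
      then show "cmod (f x * of_real (D (torus L x)) - f x * of_real (q (torus L x))) \<le> e * cmod (f x)"
        by (simp add: right_diff_distrib[symmetric] norm_mult of_real_diff[symmetric] mult.commute del: of_real_diff)
    qed (use iD iq f in auto)
    finally show ?thesis by simp
  qed
  let ?I = "integral\<^sup>L (mu L) (\<lambda>x. cmod (f x))"
  have I0: "?I \<ge> 0" by simp
  have "cmod (integral\<^sup>L (mu L) (\<lambda>x. f x * of_real (D (torus L x)))) \<le> 0"
  proof (rule field_le_epsilon)
    fix e :: real assume e: "e > 0"
    have "e / (?I + 1) * ?I \<le> e / (?I + 1) * (?I + 1)"
      using e I0 by (intro mult_left_mono) auto
    also have "\<dots> = e"
    proof -
      have "?I + 1 \<noteq> 0" using I0 by linarith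
      then show ?thesis by (simp only: times_divide_eq_left nonzero_mult_div_cancel_right not_False_eq_True)
    qed
    finally show "cmod (integral\<^sup>L (mu L) (\<lambda>x. f x * of_real (D (torus L x)))) \<le> 0 + e"
      using bound[of "e / (?I + 1)"] e I0 by simp
  qed
  then show ?thesis by simp
qed

lemma open_zero:
  assumes S: "open S"
  shows "integral\<^sup>L (mu L) (\<lambda>x. f x * indicator S x) = 0"
proof -
  \<comment> \<open>\<open>C\<close> is the closed image of the closed square without
    \<open>S \<inter> Omega L\<close>. The distance to \<open>C\<close>, scaled and cut off at 1,
    approximates the indicator of \<open>S\<close> on the open square by continuous functions on the
    torus.\<close>
  define C where "C = torus L ` (cbox (0, 0) (L, L) - (S \<inter> Omega L))"
  have "compact C"
    unfolding C_def by (intro compact_continuous_image continuous_torus compact_diff compact_cbox open_Int S open_Omega)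
  then have cl: "closed C" by (rule compact_imp_closed)
  have ne: "C \<noteq> {}"
  proof -
    have "(0, 0) \<in> cbox (0, 0) (L, L)" "(0, 0) \<notin> Omega L"
      using L by (simp_all add: Omega_def cbox_Pair_eq)
    then have "torus L (0, 0) \<in> C" unfolding C_def by (intro imageI) blast
    then show ?thesis by blast
  qed
  define D where "D n y = min 1 (real n * infdist y C)" for n y
  have D01: "0 \<le> D n y" "D n y \<le> 1" for n y by (auto simp: D_def infdist_nonneg)
  have contD: "continuous_on UNIV (D n)" for n
    unfolding D_def[abs_def] by (intro continuous_intros)
  have lim: "(\<lambda>n. D n (torus L x)) \<longlonglongrightarrow> indicator S x" if x: "x \<in> Omega L" for x
  proof (cases "x \<in> S")
    case True
    have "torus L x \<notin> C"
      using torus_inj[OF L x] True x by (auto simp: C_def)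
    then have pos: "infdist (torus L x) C > 0"
      using cl ne infdist_pos_not_in_closed by blast
    obtain N where N: "1 \<le> real N * infdist (torus L x) C"
      using pos by (metis reals_Archimedean3 less_imp_le)
    have "D n (torus L x) = 1" if "n \<ge> N" for n
    proof -
      have "1 \<le> real n * infdist (torus L x) C"
        using that pos by (intro order_trans[OF N] mult_right_mono) auto
      then show ?thesis by (simp add: D_def)
    qed
    then show ?thesis using True by (intro tendsto_eventually) (auto simp: eventually_sequentially)
  next
    case False
    have "x \<in> cbox (0, 0) (L, L)" using x box_subset_cbox[of "(0, 0)" "(L, L)"] by (auto simp: Omega_box)
    then have "torus L x \<in> C" using False by (auto simp: C_def)
    then show ?thesis using False by (simp add: D_def)
  qed
  have "(\<lambda>n. integral\<^sup>L (mu L) (\<lambda>x. f x * of_real (D n (torus L x)))) \<longlonglongrightarrow> integral\<^sup>L (mu L) (\<lambda>x. f x * indicator S x)"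
  proof (rule integral_dominated_convergence)
    show "integrable (mu L) (\<lambda>x. cmod (f x))" using f by simp
    show "(\<lambda>x. f x * indicator S x) \<in> borel_measurable (mu L)"
      using S f by (intro borel_measurable_times measurable_mu borel_measurable_integrable borel_measurable_indicator) auto
    show "(\<lambda>x. f x * of_real (D n (torus L x))) \<in> borel_measurable (mu L)" for n
      using f by (intro borel_measurable_times measurable_mu borel_measurable_integrable
        borel_measurable_continuous_onI continuous_intros continuous_on_compose2[OF contD continuous_torus]) auto
    show "AE x in mu L. (\<lambda>n. f x * of_real (D n (torus L x))) \<longlonglongrightarrow> f x * indicator S x"
    proof (rule AE_I2)
      fix x assume "x \<in> space (mu L)"
      then have "(\<lambda>n. f x * of_real (D n (torus L x))) \<longlonglongrightarrow> f x * of_real (indicator S x)"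
        by (intro tendsto_intros lim) simp
      moreover have "of_real (indicator S x) = (indicator S x :: complex)"
        by (cases "x \<in> S") auto
      ultimately show "(\<lambda>n. f x * of_real (D n (torus L x))) \<longlonglongrightarrow> f x * indicator S x"
        by simp
    qed
    show "AE x in mu L. cmod (f x * of_real (D n (torus L x))) \<le> cmod (f x)" for n
      using D01 by (intro AE_I2) (simp add: norm_mult mult_left_le)
  qed
  then show ?thesis
    by (simp add: continuous_zero[OF contD] LIMSEQ_const_iff)
qed

end

text \<open>The positive and negative parts, viewed as densities, give finite measures that agree on
  open sets and hence on all Borel sets, so the densities agree almost everywhere.\<close>

lemma AE_zero_if_open_zero:
  fixes g :: "real \<times> real \<Rightarrow> real"
  assumes g: "integrable (mu L) g" and gm: "g \<in> borel_measurable borel"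
    and zero: "\<And>S. open S \<Longrightarrow> integral\<^sup>L (mu L) (\<lambda>x. g x * indicator S x) = 0"
  shows "AE x in mu L. g x = 0"
proof -
  define p q where "p x = ennreal (g x) * indicator (Omega L) x"
    and "q x = ennreal (- g x) * indicator (Omega L) x" for x
  have [measurable]: "g \<in> borel_measurable borel" by (rule gm)
  have pm [measurable]: "p \<in> borel_measurable lborel" "q \<in> borel_measurable lborel"
    unfolding p_def[abs_def] q_def[abs_def] by measurable
  have nn: "(\<integral>\<^sup>+x. ennreal (h x) * indicator (Omega L) x * indicator S x \<partial>lborel) = ennreal (integral\<^sup>L (mu L) (\<lambda>x. max 0 (h x) * indicator S x))"
    if h: "integrable (mu L) h" "h \<in> borel_measurable borel" and S: "open S" for h :: "real \<times> real \<Rightarrow> real" and S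
  proof -
    have [measurable]: "h \<in> borel_measurable borel" "S \<in> sets borel" using h S by auto
    have "(\<integral>\<^sup>+x. ennreal (h x) * indicator (Omega L) x * indicator S x \<partial>lborel)
       = (\<integral>\<^sup>+x. ennreal (max 0 (h x) * indicator S x) * indicator (Omega L) x \<partial>lborel)"
      by (intro nn_integral_cong) (auto simp: indicator_def max_def ennreal_neg)
    also have "\<dots> = (\<integral>\<^sup>+x. ennreal (max 0 (h x) * indicator S x) \<partial>mu L)"
      by (rule nn_integral_restrict_space[symmetric]) simp
    also have "\<dots> = ennreal (integral\<^sup>L (mu L) (\<lambda>x. max 0 (h x) * indicator S x))"
    proof (rule nn_integral_eq_integral)
      show "integrable (mu L) (\<lambda>x. max 0 (h x) * indicator S x)"
      proof (rule Bochner_Integration.integrable_bound[OF h(1)])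
        show "(\<lambda>x. max 0 (h x) * indicator S x) \<in> borel_measurable (mu L)"
          by (intro measurable_mu) measurable
      qed (auto simp: indicator_def max_def)
    qed auto
    finally show ?thesis .
  qed
  have eqS: "emeasure (density lborel p) S = emeasure (density lborel q) S"
    and fin: "emeasure (density lborel p) S \<noteq> \<infinity>" if S: "open S" for S
  proof -
    have Sm: "S \<in> sets lborel" using S by auto
    have ng: "integrable (mu L) (\<lambda>x. - g x)" "(\<lambda>x. - g x) \<in> borel_measurable borel" using g by auto
    have int: "integrable (mu L) (\<lambda>x. max 0 (h x) * indicator S x)"
      if "integrable (mu L) h" "h \<in> borel_measurable borel" for h :: "real \<times> real \<Rightarrow> real"
    proof (rule Bochner_Integration.integrable_bound[OF that(1)])
      have [measurable]: "h \<in> borel_measurable borel" "S \<in> sets borel" using that S by auto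
      show "(\<lambda>x. max 0 (h x) * indicator S x) \<in> borel_measurable (mu L)"
        by (intro measurable_mu) measurable
    qed (auto simp: indicator_def max_def)
    have "integral\<^sup>L (mu L) (\<lambda>x. max 0 (g x) * indicator S x) - integral\<^sup>L (mu L) (\<lambda>x. max 0 (- g x) * indicator S x)
       = integral\<^sup>L (mu L) (\<lambda>x. g x * indicator S x)"
      by (subst Bochner_Integration.integral_diff[symmetric, OF int[OF g gm] int[OF ng]])
        (auto intro!: Bochner_Integration.integral_cong simp: indicator_def max_def)
    also have "\<dots> = 0" by (rule zero[OF S])
    finally show "emeasure (density lborel p) S = emeasure (density lborel q) S"
      unfolding emeasure_density[OF pm(1) Sm] emeasure_density[OF pm(2) Sm] p_def q_def
      by (simp add: nn[OF g gm S] nn[OF ng S])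
    show "emeasure (density lborel p) S \<noteq> \<infinity>"
      unfolding emeasure_density[OF pm(1) Sm] p_def by (simp add: nn[OF g gm S])
  qed
  have "density lborel p = density lborel q"
  proof (rule measure_eqI_generator_eq[where E = "{S. open S}" and \<Omega> = UNIV and A = "\<lambda>_. UNIV"])
    show "Int_stable {S :: (real \<times> real) set. open S}" by (auto simp: Int_stable_def)
  qed (use fin[of UNIV] in \<open>auto simp: borel_def intro: eqS\<close>)
  then have "AE x in lborel. p x = q x"
    by (subst (asm) sigma_finite_measure.density_unique_iff[OF sigma_finite_lborel pm])
  then have "AE x in lborel. x \<in> Omega L \<longrightarrow> g x = 0"
  proof eventually_elim
    case (elim x)
    show ?case
    proof
      assume "x \<in> Omega L"
      then have "ennreal (g x) = ennreal (- g x)" using elim by (simp add: p_def q_def)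
      then show "g x = 0" by (cases "g x \<ge> 0") (auto simp: ennreal_neg ennreal_eq_0_iff)
    qed
  qed
  then show ?thesis by (simp add: AE_restrict_space_iff)
qed

lemma fourier_uniqueness:
  assumes L: "L > 0" and f: "integrable (mu L) f" and fm: "f \<in> borel_measurable borel"
    and zero: "\<And>l m. integral\<^sup>L (mu L) (\<lambda>x. f x * wave L l m x) = 0"
  shows "AE x in mu L. f x = 0"
proof -
  interpret zero_coeffs L f using assms by unfold_locales auto
  have int: "integrable (mu L) (\<lambda>x. f x * indicator S x)" if "open S" for S
    using that by (intro integrable_mult_bounded_mu[OF f, of _ 1] borel_measurable_indicator)
      (auto simp: indicator_def)
  have "AE x in mu L. Re (f x) = 0"
  proof (rule AE_zero_if_open_zero)
    fix S :: "(real \<times> real) set" assume S: "open S"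
    have "integral\<^sup>L (mu L) (\<lambda>x. Re (f x) * indicator S x) = integral\<^sup>L (mu L) (\<lambda>x. Re (f x * indicator S x))"
      by (intro Bochner_Integration.integral_cong) (auto simp: indicator_def)
    also have "\<dots> = Re (integral\<^sup>L (mu L) (\<lambda>x. f x * indicator S x))"
      by (rule integral_Re[OF int[OF S]])
    finally show "integral\<^sup>L (mu L) (\<lambda>x. Re (f x) * indicator S x) = 0"
      by (simp add: open_zero[OF S])
  qed (use f fm in auto)
  moreover have "AE x in mu L. Im (f x) = 0"
  proof (rule AE_zero_if_open_zero)
    fix S :: "(real \<times> real) set" assume S: "open S"
    have "integral\<^sup>L (mu L) (\<lambda>x. Im (f x) * indicator S x) = integral\<^sup>L (mu L) (\<lambda>x. Im (f x * indicator S x))"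
      by (intro Bochner_Integration.integral_cong) (auto simp: indicator_def)
    also have "\<dots> = Im (integral\<^sup>L (mu L) (\<lambda>x. f x * indicator S x))"
      by (rule integral_Im[OF int[OF S]])
    finally show "integral\<^sup>L (mu L) (\<lambda>x. Im (f x) * indicator S x) = 0"
      by (simp add: open_zero[OF S])
  qed (use f fm in auto)
  ultimately show ?thesis
    by eventually_elim (simp add: complex_eq_iff)
qed

section \<open>Fourier coefficients of periodic functions\<close>

definition cfc :: "real \<Rightarrow> (real \<times> real \<Rightarrow> complex) \<Rightarrow> int \<times> int \<Rightarrow> complex" where
  "cfc L f k = integral\<^sup>L (mu L) (\<lambda>x. f x * cnj (wave L (fst k) (snd k) x)) / of_real (L\<^sup>2)"

definition fc :: "real \<Rightarrow> (real \<times> real \<Rightarrow> real) \<Rightarrow> int \<times> int \<Rightarrow> complex" where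
  "fc L v k = fourier_coeff L v (fst k) (snd k)"

lemma fc_eq_cfc: "fc L v = cfc L (\<lambda>x. of_real (v x))"
  by (rule ext) (simp add: fc_def cfc_def fourier_coeff_def set_integral_mu)

lemma integral_cis_interval:
  assumes L: "L > 0"
  shows "integral\<^sup>L lborel (\<lambda>x. indicator {0<..<L} x *\<^sub>R cis (freq L * of_int l * x))
    = (if l = 0 then of_real L else 0)"
proof -
  define w where "w = freq L * of_int l"
  have "integral\<^sup>L lborel (\<lambda>x. indicator {0<..<L} x *\<^sub>R cis (w * x))
      = integral\<^sup>L lborel (\<lambda>x. indicator {0..L} x *\<^sub>R cis (w * x))"
  proof (rule integral_cong_AE)
    show "AE x in lborel. indicator {0<..<L} x *\<^sub>R cis (w * x) = indicator {0..L} x *\<^sub>R cis (w * x)"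
      using AE_lborel_singleton[of "0::real"] AE_lborel_singleton[of L]
      by eventually_elim (auto simp: indicator_def)
    have [measurable]: "(\<lambda>x. cis (w * x)) \<in> borel_measurable borel"
      by (intro borel_measurable_continuous_onI continuous_intros)
    show "(\<lambda>x. indicator {0<..<L} x *\<^sub>R cis (w * x)) \<in> borel_measurable lborel"
      "(\<lambda>x. indicator {0..L} x *\<^sub>R cis (w * x)) \<in> borel_measurable lborel"
      by measurable
  qed
  also have "\<dots> = (if l = 0 then of_real L else 0)"
  proof (cases "l = 0")
    case True
    then have "integral\<^sup>L lborel (\<lambda>x. indicator {0..L} x *\<^sub>R cis (w * x)) = complex_of_real L - complex_of_real 0"
      using L by (intro integral_FTC_Icc) (auto simp: w_def intro!: derivative_eq_intros continuous_intros)
    then show ?thesis using True by simp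
  next
    case False
    then have w: "w \<noteq> 0" using L by (simp add: w_def freq_def)
    have "integral\<^sup>L lborel (\<lambda>x. indicator {0..L} x *\<^sub>R cis (w * x))
       = (\<lambda>x. cis (w * x) * (- \<i> / of_real w)) L - (\<lambda>x. cis (w * x) * (- \<i> / of_real w)) 0"
    proof (rule integral_FTC_Icc)
      fix x
      have d: "((\<lambda>x. cis (w * x)) has_vector_derivative (\<i> * of_real w * cis (w * x))) (at x within {0..L})"
      proof -
        have "((\<lambda>x. exp (\<i> * of_real (w * x))) has_vector_derivative (\<i> * of_real w * exp (\<i> * of_real (w * x)))) (at x within {0..L})"
          unfolding of_real_mult
          by (rule has_vector_derivative_real_field) (auto intro!: derivative_eq_intros simp: mult_ac)
        then show ?thesis by (simp add: cis_conv_exp)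
      qed
      have "((\<lambda>x. cis (w * x) * (- \<i> / of_real w)) has_vector_derivative (\<i> * of_real w * cis (w * x) * (- \<i> / of_real w))) (at x within {0..L})"
        by (rule has_vector_derivative_mult_left[OF d])
      moreover have "\<i> * of_real w * cis (w * x) * (- \<i> / of_real w) = cis (w * x)"
        using w by (simp add: field_simps)
      ultimately show "((\<lambda>x. cis (w * x) * (- \<i> / of_real w)) has_vector_derivative cis (w * x)) (at x within {0..L})"
        by simp
    qed (use L in \<open>auto intro!: continuous_intros\<close>)
    also have "\<dots> = 0"
    proof -
      have "w * L = 2 * pi * of_int l" using L by (simp add: w_def freq_def)
      then show ?thesis by (simp only: cis_multiple_2pi[OF Ints_of_int]) simp
    qed
    finally show ?thesis using False by simp
  qed
  finally show ?thesis by (simp add: w_def)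
qed

lemma integrable_wave: "integrable (mu L) (wave L l m)"
  by (rule finite_measure.integrable_const_bound[OF finite_measure_mu, where B = 1])
    (auto intro!: measurable_mu)

lemma integral_wave:
  assumes L: "L > 0"
  shows "integral\<^sup>L (mu L) (wave L l m) = (if l = 0 \<and> m = 0 then of_real (L\<^sup>2) else 0)"
proof -
  define g where "g l x = indicator {0<..<L} x *\<^sub>R cis (freq L * of_int l * x)" for l :: int and x :: real
  have gg: "indicator (Omega L) z *\<^sub>R wave L l m z = g l (fst z) * g m (snd z)" for z
    by (auto simp: g_def Omega_def indicator_def wave_def cis_conv_exp exp_add[symmetric] algebra_simps mem_Times_iff)
  have int: "integrable lborel (\<lambda>z. g l (fst z) * g m (snd z))"
    using integrable_wave[of L l m] unfolding gg[symmetric] set_integrable_mu[symmetric] set_integrable_def .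
  have "integral\<^sup>L (mu L) (wave L l m) = integral\<^sup>L lborel (\<lambda>z. g l (fst z) * g m (snd z))"
    unfolding set_integral_mu[symmetric] set_lebesgue_integral_def gg ..
  also have "\<dots> = integral\<^sup>L (lborel \<Otimes>\<^sub>M lborel) (\<lambda>z. g l (fst z) * g m (snd z))"
    by (simp only: lborel_prod)
  also have "\<dots> = (\<integral>x. (\<integral>y. g l (fst (x, y)) * g m (snd (x, y)) \<partial>lborel) \<partial>lborel)"
    using int by (intro lborel_pair.integral_fst'[symmetric]) (simp add: lborel_prod)
  also have "\<dots> = integral\<^sup>L lborel (g l) * integral\<^sup>L lborel (g m)"
    by simp
  also have "\<dots> = (if l = 0 \<and> m = 0 then of_real (L\<^sup>2) else 0)"
    unfolding g_def integral_cis_interval[OF L] by (simp add: power2_eq_square)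
  finally show ?thesis .
qed

lemma cfc_integrable:
  assumes "integrable (mu L) f"
  shows "integrable (mu L) (\<lambda>x. f x * cnj (wave L l m x))"
  unfolding cnj_wave by (rule integrable_mult_bounded_mu[OF assms, where B = 1]) auto

lemma cfc_add:
  assumes "integrable (mu L) f" "integrable (mu L) g"
  shows "cfc L (\<lambda>x. f x + g x) k = cfc L f k + cfc L g k"
  unfolding cfc_def distrib_right
  by (subst Bochner_Integration.integral_add[OF cfc_integrable cfc_integrable])
    (use assms in \<open>auto simp: add_divide_distrib\<close>)

lemma cfc_cmult: "cfc L (\<lambda>x. c * f x) k = c * cfc L f k"
  by (simp add: cfc_def mult.assoc)

lemma cfc_cong_AE:
  assumes "AE x in mu L. f x = g x" "f \<in> borel_measurable borel" "g \<in> borel_measurable borel"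
  shows "cfc L f k = cfc L g k"
proof -
  have "integral\<^sup>L (mu L) (\<lambda>x. f x * cnj (wave L (fst k) (snd k) x)) = integral\<^sup>L (mu L) (\<lambda>x. g x * cnj (wave L (fst k) (snd k) x))"
    unfolding cnj_wave using assms
    by (intro integral_cong_AE measurable_mu borel_measurable_times measurable_wave) auto
  then show ?thesis by (simp add: cfc_def)
qed

lemma cfc_one:
  assumes "L > 0"
  shows "cfc L (\<lambda>x. 1) k = (if k = 0 then 1 else 0)"
  using assms by (simp add: cfc_def cnj_wave integral_wave prod_eq_iff)

lemma cfc_wave_mult: "cfc L (\<lambda>x. f x * wave L (fst l) (snd l) x) k = cfc L f (k - l)"
  by (simp add: cfc_def cnj_wave mult.assoc wave_mult)

lemma norm_cfc_le:
  assumes L: "L > 0" and f: "integrable (mu L) f"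
  shows "cmod (cfc L f k) \<le> integral\<^sup>L (mu L) (\<lambda>x. cmod (f x)) / L\<^sup>2"
proof -
  have "cmod (integral\<^sup>L (mu L) (\<lambda>x. f x * cnj (wave L (fst k) (snd k) x)))
      \<le> integral\<^sup>L (mu L) (\<lambda>x. cmod (f x * cnj (wave L (fst k) (snd k) x)))"
    by (rule integral_norm_bound)
  then show ?thesis
    by (simp add: cfc_def norm_divide norm_mult norm_power divide_right_mono)
qed

section \<open>Absolutely convergent Fourier series and their products\<close>

definition idx :: "nat \<Rightarrow> int \<times> int" where
  "idx = from_nat_into UNIV"

lemma bij_idx: "bij idx"
  unfolding idx_def by (rule bij_betw_from_nat_into) (auto simp: finite_prod)

lemma summable_l1:
  assumes L: "L > 0" and c: "hb L 1 UNIV c B"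
  shows "summable (\<lambda>n. cmod (c (idx n)))" "(\<Sum>n. cmod (c (idx n))) \<le> l1c L * B"
proof -
  have le: "(\<Sum>n<N. cmod (c (idx n))) \<le> l1c L * B" for N
  proof -
    have "(\<Sum>n<N. cmod (c (idx n))) = (\<Sum>k\<in>idx ` {..<N}. cmod (c k))"
      by (subst sum.reindex) (auto intro: inj_on_subset[OF bij_is_inj[OF bij_idx]])
    also have "\<dots> \<le> l1c L * B" by (rule hb_l1[OF L c]) auto
    finally show ?thesis .
  qed
  show s: "summable (\<lambda>n. cmod (c (idx n)))"
    by (rule summableI_nonneg_bounded[where x = "l1c L * B"]) (use le in auto)
  show "(\<Sum>n. cmod (c (idx n))) \<le> l1c L * B"
    by (rule suminf_le_const[OF s le])
qed

text \<open>Summing along the enumeration \<open>idx\<close> makes this an ordinary series, open to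
  the theorems on measurability and termwise integration; it is used only where convergence is
  absolute.\<close>

definition synth :: "real \<Rightarrow> (int \<times> int \<Rightarrow> complex) \<Rightarrow> real \<times> real \<Rightarrow> complex" where
  "synth L c x = (\<Sum>n. c (idx n) * wave L (fst (idx n)) (snd (idx n)) x)"

lemma measurable_synth [measurable]: "synth L c \<in> borel_measurable borel"
  unfolding synth_def[abs_def] by measurable

lemma norm_synth_le:
  assumes L: "L > 0" and c: "hb L 1 UNIV c B"
  shows "cmod (synth L c x) \<le> l1c L * B"
proof -
  have "cmod (synth L c x) \<le> (\<Sum>n. cmod (c (idx n) * wave L (fst (idx n)) (snd (idx n)) x))"
    unfolding synth_def by (rule summable_norm) (simp add: norm_mult summable_l1(1)[OF L c])
  also have "\<dots> \<le> l1c L * B" using summable_l1(2)[OF L c] by (simp add: norm_mult)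
  finally show ?thesis .
qed

text \<open>Convolution theorem with one merely integrable factor \<open>f\<close>: absolute
  summability of \<open>c\<close> permits termwise integration. Two applications give the
  coefficients of a cube.\<close>

lemma cfc_mult_synth:
  assumes L: "L > 0" and c: "hb L 1 UNIV c B" and f: "integrable (mu L) f"
  shows "cfc L (\<lambda>x. f x * synth L c x) k = spectral.conv UNIV (-) c (cfc L f) k"
proof -
  interpret spectral L UNIV "(-)" by (rule spectral_UNIV[OF L])
  define h where "h n x = f x * (c (idx n) * wave L (fst (idx n)) (snd (idx n)) x) * cnj (wave L (fst k) (snd k) x)" for n x
  have h: "h n = (\<lambda>x. c (idx n) * (f x * wave L (fst (idx n)) (snd (idx n)) x * cnj (wave L (fst k) (snd k) x)))" for n
    by (auto simp: h_def)
  have hn: "cmod (h n x) = cmod (c (idx n)) * cmod (f x)" for n x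
    by (simp add: h_def norm_mult)
  have hi: "integrable (mu L) (h n)" for n
    unfolding h by (intro integrable_mult_right cfc_integrable integrable_mult_bounded_mu[OF f, where B = 1]) auto
  have s: "summable (\<lambda>n. integral\<^sup>L (mu L) (\<lambda>x. cmod (h n x)))"
    unfolding hn by (simp add: summable_mult2 summable_l1(1)[OF L c])
  have ae: "AE x in mu L. summable (\<lambda>n. cmod (h n x))"
    unfolding hn by (simp add: summable_mult2 summable_l1(1)[OF L c])
  have int: "integral\<^sup>L (mu L) (h n) = of_real (L\<^sup>2) * (c (idx n) * cfc L f (k - idx n))" for n
    using L cfc_wave_mult[of L f "idx n" k] by (simp add: h cfc_def)
  have "f x * synth L c x * cnj (wave L (fst k) (snd k) x) = (\<Sum>n. h n x)" for x
  proof -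
    have sm: "summable (\<lambda>n. c (idx n) * wave L (fst (idx n)) (snd (idx n)) x)"
      by (rule summable_norm_cancel) (simp add: norm_mult summable_l1(1)[OF L c])
    show ?thesis
      unfolding synth_def h_def
      by (simp only: suminf_mult[OF sm, symmetric] suminf_mult2[OF summable_mult[OF sm]])
  qed
  then have "(\<lambda>n. of_real (L\<^sup>2) * (c (idx n) * cfc L f (k - idx n))) sums integral\<^sup>L (mu L) (\<lambda>x. f x * synth L c x * cnj (wave L (fst k) (snd k) x))"
    using sums_integral[OF hi ae s] by (simp add: int)
  then have sm: "(\<lambda>n. c (idx n) * cfc L f (k - idx n)) sums cfc L (\<lambda>x. f x * synth L c x) k"
    using L by (simp add: cfc_def) (metis (no_types, lifting) nonzero_mult_div_cancel_left of_real_eq_0_iff of_real_power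
       power_eq_0_iff less_irrefl sums_divide[of _ _ "of_real L ^ 2"] sums_cong)
  have "summable (\<lambda>n. cmod (c (idx n) * cfc L f (k - idx n)))"
  proof (rule summable_comparison_test')
    show "summable (\<lambda>n. cmod (c (idx n)) * (integral\<^sup>L (mu L) (\<lambda>x. cmod (f x)) / L\<^sup>2))"
      by (intro summable_mult2 summable_l1(1)[OF L c])
    show "norm (cmod (c (idx n) * cfc L f (k - idx n))) \<le> cmod (c (idx n)) * (integral\<^sup>L (mu L) (\<lambda>x. cmod (f x)) / L\<^sup>2)" for n
      by (simp add: norm_mult del: times_divide_eq_right) (intro mult_left_mono norm_cfc_le[OF L f], simp)
  qed
  from norm_summable_imp_has_sum[OF this sm]
  have "((\<lambda>l. c l * cfc L f (k - l)) has_sum cfc L (\<lambda>x. f x * synth L c x) k) UNIV"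
    using has_sum_reindex_bij_betw[OF bij_idx, of "\<lambda>l. c l * cfc L f (k - l)"] by simp
  then show ?thesis
    unfolding conv_def by (simp add: infsumI)
qed

text \<open>The convolution theorem for the constant 1, whose coefficients are a unit mass at
  frequency 0.\<close>

lemma cfc_synth:
  assumes L: "L > 0" and c: "hb L 1 UNIV c B"
  shows "cfc L (synth L c) k = c k"
proof -
  interpret spectral L UNIV "(-)" by (rule spectral_UNIV[OF L])
  have "integrable (mu L) (\<lambda>x. 1 :: complex)"
    by (rule finite_measure.integrable_const[OF finite_measure_mu])
  from cfc_mult_synth[OF L c this, of k]
  have "cfc L (synth L c) k = (\<Sum>\<^sub>\<infinity>l\<in>UNIV. c l * (if k - l = 0 then 1 else 0))"
    by (simp add: conv_def cfc_one[OF L])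
  also have "\<dots> = (\<Sum>\<^sub>\<infinity>l\<in>{k}. c l)"
    by (rule infsum_cong_neutral) auto
  finally show ?thesis by simp
qed

lemma AE_eq_synth:
  assumes L: "L > 0" and f: "integrable (mu L) f" "f \<in> borel_measurable borel"
    and c: "hb L 1 UNIV (cfc L f) B"
  shows "AE x in mu L. f x = synth L (cfc L f) x"
proof -
  let ?g = "\<lambda>x. f x + (-1) * synth L (cfc L f) x"
  have si: "integrable (mu L) (\<lambda>x. synth L (cfc L f) x)"
    by (rule finite_measure.integrable_const_bound[OF finite_measure_mu, where B = "l1c L * B"])
      (auto intro!: measurable_mu norm_synth_le[OF L c])
  have si': "integrable (mu L) (\<lambda>x. (-1) * synth L (cfc L f) x)" using si by simp
  have z: "cfc L ?g k = 0" for k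
    unfolding cfc_add[OF f(1) si'] cfc_cmult cfc_synth[OF L c] by simp
  have "AE x in mu L. ?g x = 0"
  proof (rule fourier_uniqueness[OF L])
    show "integral\<^sup>L (mu L) (\<lambda>x. ?g x * wave L l m x) = 0" for l m
      using z[of "(- l, - m)"] L by (simp add: cfc_def cnj_wave)
    show "?g \<in> borel_measurable borel" using f(2) by measurable
  qed (use f si in auto)
  then show ?thesis by eventually_elim simp
qed

section \<open>Real periodic square-integrable functions and their coefficients\<close>

lemma L2_perD:
  assumes "v \<in> L2_per L"
  shows "periodic_fun L v" "v \<in> borel_measurable borel" "integrable (mu L) (\<lambda>x. (v x)\<^sup>2)" "integrable (mu L) v"
proof -
  show p: "periodic_fun L v" "v \<in> borel_measurable borel" "integrable (mu L) (\<lambda>x. (v x)\<^sup>2)"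
    using assms by (auto simp: L2_per_def set_integrable_mu)
  interpret finite_measure "mu L" by (rule finite_measure_mu)
  have "integrable (mu L) (\<lambda>x. 1 + (v x)\<^sup>2)" using p(3) by simp
  then show "integrable (mu L) v"
  proof (rule Bochner_Integration.integrable_bound)
    have "\<bar>y\<bar> \<le> 1 + y\<^sup>2" for y :: real
    proof -
      have "0 \<le> (\<bar>y\<bar> - 1)\<^sup>2" by simp
      then have "2 * \<bar>y\<bar> \<le> 1 + y\<^sup>2" by (simp add: power2_diff)
      then show ?thesis by linarith
    qed
    then show "AE x in mu L. norm (v x) \<le> norm (1 + (v x)\<^sup>2)"
      by (intro AE_I2) (simp add: order_trans[OF _ abs_ge_self])
  qed (use p in \<open>auto intro: measurable_mu\<close>)
qed

lemma L2_perI: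
  assumes "periodic_fun L v" "v \<in> borel_measurable borel" "integrable (mu L) (\<lambda>x. (v x)\<^sup>2)"
  shows "v \<in> L2_per L"
  using assms by (simp add: L2_per_def set_integrable_mu)

lemma L2_per_lincomb:
  assumes v: "v \<in> L2_per L" and w: "w \<in> L2_per L"
  shows "(\<lambda>x. a * v x + b * w x) \<in> L2_per L"
proof (rule L2_perI)
  note V = L2_perD[OF v] and W = L2_perD[OF w]
  show "periodic_fun L (\<lambda>x. a * v x + b * w x)" using V(1) W(1) by (simp add: periodic_fun_def)
  show m: "(\<lambda>x. a * v x + b * w x) \<in> borel_measurable borel"
    using V(2) W(2) by (intro borel_measurable_add borel_measurable_times borel_measurable_const)
  have "integrable (mu L) (\<lambda>x. 2 * a\<^sup>2 * (v x)\<^sup>2 + 2 * b\<^sup>2 * (w x)\<^sup>2)"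
    by (intro Bochner_Integration.integrable_add integrable_mult_right V(3) W(3))
  then show "integrable (mu L) (\<lambda>x. (a * v x + b * w x)\<^sup>2)"
  proof (rule Bochner_Integration.integrable_bound)
    have "(p + q)\<^sup>2 \<le> 2 * p\<^sup>2 + 2 * q\<^sup>2" for p q :: real
    proof -
      have "2 * p\<^sup>2 + 2 * q\<^sup>2 = (p + q)\<^sup>2 + (p - q)\<^sup>2" by (simp add: power2_eq_square algebra_simps)
      then show ?thesis by simp
    qed
    from this[of "a * v _" "b * w _"]
    show "AE x in mu L. norm ((a * v x + b * w x)\<^sup>2) \<le> norm (2 * a\<^sup>2 * (v x)\<^sup>2 + 2 * b\<^sup>2 * (w x)\<^sup>2)"
      by (intro AE_I2) (simp add: power_mult_distrib order_trans[OF _ abs_ge_self] mult.assoc)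
    show "(\<lambda>x. (a * v x + b * w x)\<^sup>2) \<in> borel_measurable (mu L)"
      using m by (intro measurable_mu borel_measurable_power)
  qed
qed

lemma fc_lincomb:
  assumes v: "v \<in> L2_per L" and w: "w \<in> L2_per L"
  shows "fc L (\<lambda>x. a * v x + b * w x) k = of_real a * fc L v k + of_real b * fc L w k"
proof -
  have i: "integrable (mu L) (\<lambda>x. of_real a * of_real (v x) :: complex)" "integrable (mu L) (\<lambda>x. of_real b * of_real (w x) :: complex)"
    using L2_perD(4)[OF v] L2_perD(4)[OF w] by auto
  show ?thesis
    unfolding fc_eq_cfc of_real_add of_real_mult cfc_add[OF i] cfc_cmult ..
qed

lemma fc_cong_AE:
  assumes "AE x in lborel. v x = w x" "v \<in> L2_per L" "w \<in> L2_per L"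
  shows "fc L v k = fc L w k"
  unfolding fc_eq_cfc
proof (rule cfc_cong_AE)
  show "AE x in mu L. complex_of_real (v x) = complex_of_real (w x)"
    using AE_mu[OF assms(1)] by eventually_elim simp
qed (use L2_perD(2) assms in auto)

lemma cnj_fc: "cnj (fc L v k) = fc L v (- k)"
proof -
  have "cnj (integral\<^sup>L (mu L) (\<lambda>x. of_real (v x) * cnj (wave L (fst k) (snd k) x)))
     = integral\<^sup>L (mu L) (\<lambda>x. cnj (of_real (v x) * cnj (wave L (fst k) (snd k) x)))"
    by (rule Bochner_Integration.integral_cnj[symmetric])
  then show ?thesis
    by (simp add: fc_eq_cfc cfc_def cnj_wave)
qed

text \<open>Cauchy-Schwarz against the constant 1, from the nonnegative variance of
  \<open>|g|\<close> about its mean \<open>t\<close>.\<close>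

lemma integral_abs_le:
  fixes g :: "real \<times> real \<Rightarrow> real"
  assumes L: "L > 0" and g: "integrable (mu L) g" "integrable (mu L) (\<lambda>x. (g x)\<^sup>2)"
  shows "integral\<^sup>L (mu L) (\<lambda>x. \<bar>g x\<bar>) \<le> L * sqrt (integral\<^sup>L (mu L) (\<lambda>x. (g x)\<^sup>2))"
proof -
  interpret finite_measure "mu L" by (rule finite_measure_mu)
  define t where "t = integral\<^sup>L (mu L) (\<lambda>x. \<bar>g x\<bar>) / L\<^sup>2"
  have I: "integral\<^sup>L (mu L) (\<lambda>x. \<bar>g x\<bar>) = t * L\<^sup>2" using L by (simp add: t_def)
  have "0 \<le> integral\<^sup>L (mu L) (\<lambda>x. (\<bar>g x\<bar> - t)\<^sup>2)" by simp
  also have "\<dots> = integral\<^sup>L (mu L) (\<lambda>x. (g x)\<^sup>2 + t\<^sup>2 - 2 * t * \<bar>g x\<bar>)"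
    by (simp add: power2_diff mult_ac)
  also have "\<dots> = integral\<^sup>L (mu L) (\<lambda>x. (g x)\<^sup>2) + t\<^sup>2 * L\<^sup>2 - 2 * t * (t * L\<^sup>2)"
    using g measure_mu[OF L] by (simp add: I)
  finally have "(t * L)\<^sup>2 \<le> integral\<^sup>L (mu L) (\<lambda>x. (g x)\<^sup>2)"
    by (simp add: power2_eq_square algebra_simps)
  then have "t * L \<le> sqrt (integral\<^sup>L (mu L) (\<lambda>x. (g x)\<^sup>2))" by (rule real_le_rsqrt)
  then have "L * (t * L) \<le> L * sqrt (integral\<^sup>L (mu L) (\<lambda>x. (g x)\<^sup>2))"
    using L by (intro mult_left_mono) auto
  then show ?thesis by (simp add: I power2_eq_square mult_ac)
qed

lemma norm_fc_le:
  assumes L: "L > 0" and v: "v \<in> L2_per L"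
  shows "cmod (fc L v k) \<le> L2_norm L v / L"
proof -
  have "cmod (fc L v k) \<le> integral\<^sup>L (mu L) (\<lambda>x. \<bar>v x\<bar>) / L\<^sup>2"
    unfolding fc_eq_cfc using norm_cfc_le[OF L, of "\<lambda>x. of_real (v x)" k] L2_perD[OF v] by simp
  also have "\<dots> \<le> (L * L2_norm L v) / L\<^sup>2"
    unfolding L2_norm_def set_integral_mu
    by (intro divide_right_mono integral_abs_le L L2_perD[OF v]) simp
  finally show ?thesis using L by (simp add: power2_eq_square)
qed

text \<open>The function agrees almost everywhere with its absolutely convergent series, so it is
  essentially bounded, its powers are integrable, and one factor at a time may be replaced by the
  series.\<close>

lemma fc_cube:
  assumes L: "L > 0" and v: "v \<in> L2_per L" and c: "hb L 1 UNIV (fc L v) B"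
  shows "(\<lambda>x. v x ^ 3) \<in> L2_per L" "fc L (\<lambda>x. v x ^ 3) k = spectral.cube UNIV (-) (fc L v) k"
proof -
  interpret spectral L UNIV "(-)" by (rule spectral_UNIV[OF L])
  interpret finite_measure "mu L" by (rule finite_measure_mu)
  note V = L2_perD[OF v]
  let ?v = "\<lambda>x. complex_of_real (v x)"
  define A where "A = l1c L * B"
  have fv: "cfc L ?v = fc L v" by (simp add: fc_eq_cfc)
  have vm: "?v \<in> borel_measurable borel" and vi: "integrable (mu L) ?v" using V by auto
  have ae: "AE x in mu L. ?v x = synth L (fc L v) x"
    using AE_eq_synth[OF L vi vm] c unfolding fv .
  then have bd: "AE x in mu L. \<bar>v x\<bar> \<le> A"
  proof eventually_elim
    case (elim x)
    have "\<bar>v x\<bar> = cmod (?v x)" by simp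
    then show ?case unfolding elim A_def using norm_synth_le[OF L c, of x] by simp
  qed
  have pow: "integrable (mu L) (\<lambda>x. v x ^ n)" for n
  proof (rule integrable_const_bound)
    show "AE x in mu L. norm (v x ^ n) \<le> A ^ n"
      using bd by eventually_elim (simp add: power_abs power_mono)
    show "(\<lambda>x. v x ^ n) \<in> borel_measurable (mu L)"
      using V(2) by (intro measurable_mu) measurable
  qed
  show "(\<lambda>x. v x ^ 3) \<in> L2_per L"
  proof (rule L2_perI)
    show "periodic_fun L (\<lambda>x. v x ^ 3)" using V(1) by (simp add: periodic_fun_def)
    show "(\<lambda>x. v x ^ 3) \<in> borel_measurable borel" using V(2) by measurable
    show "integrable (mu L) (\<lambda>x. (v x ^ 3)\<^sup>2)" using pow[of 6] by (simp add: power_mult[symmetric])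
  qed
  have sq: "cfc L (\<lambda>x. of_real ((v x)\<^sup>2)) k = conv (fc L v) (fc L v) k" for k
  proof -
    have "cfc L (\<lambda>x. of_real ((v x)\<^sup>2)) k = cfc L (\<lambda>x. ?v x * synth L (fc L v) x) k"
    proof (rule cfc_cong_AE)
      show "AE x in mu L. of_real ((v x)\<^sup>2) = ?v x * synth L (fc L v) x"
        using ae by eventually_elim (metis of_real_mult power2_eq_square)
    qed (use V(2) in measurable)
    also have "\<dots> = conv (fc L v) (fc L v) k"
      by (rule cfc_mult_synth[OF L c vi, unfolded fv])
    finally show ?thesis .
  qed
  have i2: "integrable (mu L) (\<lambda>x. complex_of_real ((v x)\<^sup>2))" using pow[of 2] by (rule integrable_of_real)
  have "fc L (\<lambda>x. v x ^ 3) k = cfc L (\<lambda>x. of_real ((v x)\<^sup>2) * synth L (fc L v) x) k"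
    unfolding fc_eq_cfc[of L "\<lambda>x. v x ^ 3"]
  proof (rule cfc_cong_AE)
    show "AE x in mu L. of_real (v x ^ 3) = of_real ((v x)\<^sup>2) * synth L (fc L v) x"
      using ae
    proof eventually_elim
      case (elim x)
      show ?case unfolding elim[symmetric] by (simp add: power2_eq_square power3_eq_cube)
    qed
  qed (use V(2) in measurable)
  also have "\<dots> = conv (fc L v) (cfc L (\<lambda>x. of_real ((v x)\<^sup>2))) k"
    by (rule cfc_mult_synth[OF L c i2])
  also have "\<dots> = cube (fc L v) k"
    unfolding cube_def by (intro conv_cong refl sq) simp
  finally show "fc L (\<lambda>x. v x ^ 3) k = cube (fc L v) k" .
qed

section \<open>The coefficients of the exact solution\<close>

lemma finite_sum_sobolev_le:
  assumes L: "L > 0" and v: "v \<in> H_per L q" and S: "finite S"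
  shows "(\<Sum>k\<in>S. bw L k ^ q * (cmod (fc L v k))\<^sup>2) \<le> (H_norm L q v / L)\<^sup>2"
proof -
  have eq: "sobolev_term L q v k = bw L k ^ q * (cmod (fc L v k))\<^sup>2" for k
    by (simp add: sobolev_term_def case_prod_beta bw_def lam_def fc_def)
  have s: "sobolev_term L q v summable_on UNIV" using v by (simp add: H_per_def)
  have "(\<Sum>k\<in>S. sobolev_term L q v k) \<le> infsum (sobolev_term L q v) UNIV"
    by (rule finite_sum_le_infsum[OF s S]) (auto simp: eq)
  also have "\<dots> = (H_norm L q v / L)\<^sup>2"
    using L by (simp add: H_norm_def infsum_nonneg eq)
  finally show ?thesis by (simp add: eq)
qed

lemma H_norm_nonneg: "L > 0 \<Longrightarrow> H_norm L q v \<ge> 0"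
  by (auto simp: H_norm_def sobolev_term_def case_prod_beta intro!: mult_nonneg_nonneg infsum_nonneg)

text \<open>\<open>H_norm\<close> carries a factor \<open>L\<close>, which is divided out;
  \<open>hb\<close> counts derivatives in pairs, hence \<open>2 * r \<le> q\<close>.\<close>

lemma H_per_hb:
  assumes L: "L > 0" and v: "v \<in> H_per L q" and r: "2 * r \<le> q" and B: "H_norm L q v \<le> B"
  shows "hb L r UNIV (fc L v) (B / L)"
proof (rule wbound_le)
  show "hb L r UNIV (fc L v) (H_norm L q v / L)"
  proof (rule wbound_sq_intro)
    fix S :: "(int \<times> int) set" assume S: "finite S"
    have "(\<Sum>k\<in>S. (bw L k ^ r * cmod (fc L v k))\<^sup>2) \<le> (\<Sum>k\<in>S. bw L k ^ q * (cmod (fc L v k))\<^sup>2)"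
    proof (rule sum_mono)
      fix k
      have "bw L k ^ (r * 2) \<le> bw L k ^ q" using r by (intro power_increasing) auto
      from mult_right_mono[OF this, of "(cmod (fc L v k))\<^sup>2"]
      show "(bw L k ^ r * cmod (fc L v k))\<^sup>2 \<le> bw L k ^ q * (cmod (fc L v k))\<^sup>2"
        by (simp add: power_mult_distrib power_mult)
    qed
    also have "\<dots> \<le> (H_norm L q v / L)\<^sup>2" by (rule finite_sum_sobolev_le[OF L v S])
    finally show "(\<Sum>k\<in>S. (bw L k ^ r * cmod (fc L v k))\<^sup>2) \<le> (H_norm L q v / L)\<^sup>2" .
  qed (use H_norm_nonneg[OF L] L in simp)
  show "H_norm L q v / L \<le> B / L" using B L by (simp add: divide_right_mono)
qed

lemma H_per_L2: "v \<in> H_per L q \<Longrightarrow> v \<in> L2_per L"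
  by (simp add: H_per_def)

section \<open>Trigonometric polynomials, Riesz-Fischer and existence of the Laplacian\<close>

lemma wave_periodic:
  assumes "L > 0"
  shows "wave L l m (x + L, y) = wave L l m (x, y)" "wave L l m (x, y + L) = wave L l m (x, y)"
proof -
  have 1: "cis (a + 2 * pi * of_int n) = cis a" for a and n :: int
    by (simp add: cis_mult[symmetric] cis_multiple_2pi)
  have "freq L * (of_int l * (x + L) + of_int m * y) = freq L * (of_int l * x + of_int m * y) + 2 * pi * of_int l"
    "freq L * (of_int l * x + of_int m * (y + L)) = freq L * (of_int l * x + of_int m * y) + 2 * pi * of_int m"
    using assms by (simp_all add: freq_def field_simps)
  then show "wave L l m (x + L, y) = wave L l m (x, y)" "wave L l m (x, y + L) = wave L l m (x, y)"
    unfolding wave_def fst_conv snd_conv cis_conv_exp[symmetric] by (simp_all only: 1)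
qed

lemma integrable_trig:
  "integrable (mu L) (\<lambda>x. \<Sum>k\<in>S. c k * wave L (fst k) (snd k) x)"
  by (intro Bochner_Integration.integrable_sum integrable_mult_right integrable_wave)

lemma integral_trig_sq:
  assumes L: "L > 0" and S: "finite S"
  shows "integrable (mu L) (\<lambda>x. (cmod (\<Sum>k\<in>S. c k * wave L (fst k) (snd k) x))\<^sup>2)"
    "integral\<^sup>L (mu L) (\<lambda>x. (cmod (\<Sum>k\<in>S. c k * wave L (fst k) (snd k) x))\<^sup>2) = L\<^sup>2 * (\<Sum>k\<in>S. (cmod (c k))\<^sup>2)"
proof -
  let ?f = "\<lambda>x. \<Sum>k\<in>S. c k * wave L (fst k) (snd k) x"
  have eq: "of_real ((cmod (?f x))\<^sup>2) = (\<Sum>k\<in>S. \<Sum>l\<in>S. c k * cnj (c l) * wave L (fst (k - l)) (snd (k - l)) x)" for x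
    by (simp only: complex_norm_square cnj_sum complex_cnj_mult sum_product cnj_wave)
      (simp add: wave_mult mult_ac)
  have i: "integrable (mu L) (\<lambda>x. \<Sum>k\<in>S. \<Sum>l\<in>S. c k * cnj (c l) * wave L (fst (k - l)) (snd (k - l)) x)"
    by (intro Bochner_Integration.integrable_sum integrable_mult_right integrable_wave)
  then have "integrable (mu L) (\<lambda>x. complex_of_real ((cmod (?f x))\<^sup>2))" unfolding eq .
  from integrable_Re[OF this] show int: "integrable (mu L) (\<lambda>x. (cmod (?f x))\<^sup>2)" by simp
  have "complex_of_real (integral\<^sup>L (mu L) (\<lambda>x. (cmod (?f x))\<^sup>2)) = integral\<^sup>L (mu L) (\<lambda>x. complex_of_real ((cmod (?f x))\<^sup>2))"
    by (rule integral_complex_of_real[symmetric])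
  also have "\<dots> = (\<Sum>k\<in>S. \<Sum>l\<in>S. c k * cnj (c l) * (if k = l then of_real (L\<^sup>2) else 0))"
  proof -
    have one: "integral\<^sup>L (mu L) (\<lambda>x. c k * cnj (c l) * wave L (fst (k - l)) (snd (k - l)) x)
       = c k * cnj (c l) * (if k = l then of_real (L\<^sup>2) else 0)" for k l
      unfolding integral_mult_right_zero integral_wave[OF L] by (simp add: prod_eq_iff)
    have two: "integral\<^sup>L (mu L) (\<lambda>x. \<Sum>l\<in>S. c k * cnj (c l) * wave L (fst (k - l)) (snd (k - l)) x)
       = (\<Sum>l\<in>S. c k * cnj (c l) * (if k = l then of_real (L\<^sup>2) else 0))" for k
      unfolding one[symmetric]
      by (intro Bochner_Integration.integral_sum integrable_mult_right integrable_wave)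
    show ?thesis
      unfolding eq two[symmetric]
      by (intro Bochner_Integration.integral_sum Bochner_Integration.integrable_sum integrable_mult_right integrable_wave)
  qed
  also have "\<dots> = (\<Sum>k\<in>S. c k * cnj (c k) * of_real (L\<^sup>2))"
  proof (rule sum.cong[OF refl])
    fix k assume k: "k \<in> S"
    have "(\<Sum>l\<in>S. c k * cnj (c l) * (if k = l then of_real (L\<^sup>2) else 0))
        = (\<Sum>l\<in>S. if k = l then c k * cnj (c k) * of_real (L\<^sup>2) else 0)"
      by (intro sum.cong refl) auto
    then show "(\<Sum>l\<in>S. c k * cnj (c l) * (if k = l then of_real (L\<^sup>2) else 0)) = c k * cnj (c k) * of_real (L\<^sup>2)"
      using S k by simp
  qed
  also have "\<dots> = of_real (L\<^sup>2 * (\<Sum>k\<in>S. (cmod (c k))\<^sup>2))"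
    by (simp only: of_real_mult of_real_sum complex_norm_square sum_distrib_left mult_ac)
  finally show "integral\<^sup>L (mu L) (\<lambda>x. (cmod (?f x))\<^sup>2) = L\<^sup>2 * (\<Sum>k\<in>S. (cmod (c k))\<^sup>2)"
    by (simp only: of_real_eq_iff)
qed

lemma cfc_trig:
  assumes L: "L > 0" and S: "finite S"
  shows "cfc L (\<lambda>x. \<Sum>k\<in>S. c k * wave L (fst k) (snd k) x) l = (if l \<in> S then c l else 0)"
  using S
proof (induction S)
  case empty
  then show ?case by (simp add: cfc_def)
next
  case (insert k S)
  have 1: "cfc L (\<lambda>x. 1 * wave L (fst k) (snd k) x) l = (if l = k then 1 else 0)"
    unfolding cfc_wave_mult cfc_one[OF L] by simp
  have "cfc L (\<lambda>x. \<Sum>k\<in>insert k S. c k * wave L (fst k) (snd k) x) l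
      = cfc L (\<lambda>x. c k * wave L (fst k) (snd k) x) l + cfc L (\<lambda>x. \<Sum>k\<in>S. c k * wave L (fst k) (snd k) x) l"
    using insert.hyps by (simp add: cfc_add integrable_trig integrable_wave)
  then show ?case
    using insert 1 by (auto simp: cfc_cmult)
qed

text \<open>Needed because \<open>laplacian\<close> is a choice: it is meaningful only once some
  function has the prescribed coefficients. Conjugate symmetry of \<open>c\<close> makes the
  constructed function real, and a pointwise construction makes it Borel and exactly
  periodic.\<close>

lemma riesz_fischer:
  assumes L: "L > 0" and c: "hb L 0 UNIV c B" and sym: "\<And>k. c (- k) = cnj (c k)"
  shows "\<exists>w\<in>L2_per L. \<forall>k. fc L w k = c k"
proof -
  \<comment> \<open>These squares are symmetric under negation, so each partial sum is real.\<close>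
  define Sq where "Sq n = {- int n..int n} \<times> {- int n..int n}" for n
  have fin: "finite (Sq n)" for n by (simp add: Sq_def)
  have Sq_mono: "Sq m \<subseteq> Sq n" if "m \<le> n" for m n using that by (auto simp: Sq_def)
  define P where "P n x = (\<Sum>k\<in>Sq n. c k * wave L (fst k) (snd k) x)" for n x
  define p where "p n x = Re (P n x)" for n x
  have Pp: "of_real (p n x) = P n x" for n x
  proof -
    have "cnj (P n x) = (\<Sum>k\<in>Sq n. c (- k) * wave L (fst (- k)) (snd (- k)) x)"
      by (simp add: P_def cnj_wave sym)
    also have "\<dots> = P n x"
      unfolding P_def by (rule sum.reindex_bij_witness[of _ uminus uminus]) (auto simp: Sq_def)
    finally show ?thesis unfolding p_def by (simp add: complex_eq_iff)
  qed
  have Pm [measurable]: "P n \<in> borel_measurable borel" for n unfolding P_def[abs_def] by measurable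
  have pm [measurable]: "p n \<in> borel_measurable borel" for n unfolding p_def[abs_def] by measurable
  define \<sigma> where "\<sigma> n = (\<Sum>k\<in>Sq n. (cmod (c k))\<^sup>2)" for n
  have \<sigma>B: "\<sigma> n \<le> B\<^sup>2" for n
    using wbound_sum_le_sq[OF c fin[of n]] by (simp add: \<sigma>_def)
  have \<sigma>_mono: "incseq \<sigma>"
    unfolding incseq_def \<sigma>_def by (intro allI impI sum_mono2 fin Sq_mono) auto
  obtain s where "\<sigma> \<longlonglongrightarrow> s" using incseq_convergent[OF \<sigma>_mono, of "B\<^sup>2"] \<sigma>B by blast
  then have "Cauchy \<sigma>" by (rule LIMSEQ_imp_Cauchy)
  then have "\<exists>N. \<forall>n\<ge>N. \<sigma> n - \<sigma> N < (1/4) ^ i" for i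
    unfolding Cauchy_def dist_real_def by (metis abs_less_iff order_refl zero_less_divide_1_iff zero_less_numeral zero_less_power)
  then obtain N where N: "\<And>i n. n \<ge> N i \<Longrightarrow> \<sigma> n - \<sigma> (N i) < (1/4) ^ i" by metis
  \<comment> \<open>The sum over the \<open>N j\<close> makes \<open>r i\<close> nondecreasing and
    at least \<open>N i\<close>; the summand \<open>i\<close> lets the squares exhaust the
    lattice.\<close>
  define r where "r i = i + (\<Sum>j\<le>i. N j)" for i
  have rN: "N i \<le> r i" for i unfolding r_def by (rule trans_le_add2, rule member_le_sum) auto
  have r_mono: "r i \<le> r (Suc i)" for i by (simp add: r_def)
  have r_ge: "i \<le> r i" for i by (simp add: r_def)
  have tail: "\<sigma> (r (Suc i)) - \<sigma> (r i) \<le> (1/4) ^ i" for i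
  proof -
    have "N i \<le> r (Suc i)" using rN[of i] r_mono[of i] by simp
    then have "\<sigma> (r (Suc i)) - \<sigma> (N i) < (1/4) ^ i" by (rule N)
    moreover have "\<sigma> (N i) \<le> \<sigma> (r i)" using \<sigma>_mono rN by (auto simp: incseq_def)
    ultimately show ?thesis by linarith
  qed
  define g where "g i x = p (r (Suc i)) x - p (r i) x" for i x
  have gm [measurable]: "g i \<in> borel_measurable borel" for i unfolding g_def[abs_def] by measurable
  have gP: "of_real (g i x) = (\<Sum>k\<in>Sq (r (Suc i)) - Sq (r i). c k * wave L (fst k) (snd k) x)" for i x
    unfolding g_def of_real_diff Pp P_def
    by (subst sum_diff[OF fin Sq_mono[OF r_mono]]) simp
  have gc: "\<bar>g i x\<bar> = cmod (\<Sum>k\<in>Sq (r (Suc i)) - Sq (r i). c k * wave L (fst k) (snd k) x)" for i x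
    unfolding gP[symmetric] by simp
  have fin': "finite (Sq (r (Suc i)) - Sq (r i))" for i using fin by blast
  have g2: "integrable (mu L) (\<lambda>x. (g i x)\<^sup>2)" "integral\<^sup>L (mu L) (\<lambda>x. (g i x)\<^sup>2) \<le> L\<^sup>2 * (1/4) ^ i" for i
  proof -
    have e: "(g i x)\<^sup>2 = (cmod (\<Sum>k\<in>Sq (r (Suc i)) - Sq (r i). c k * wave L (fst k) (snd k) x))\<^sup>2" for x
      unfolding gc[symmetric] by simp
    show "integrable (mu L) (\<lambda>x. (g i x)\<^sup>2)" unfolding e by (rule integral_trig_sq(1)[OF L fin'])
    have "integral\<^sup>L (mu L) (\<lambda>x. (g i x)\<^sup>2) = L\<^sup>2 * (\<sigma> (r (Suc i)) - \<sigma> (r i))"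
      unfolding e integral_trig_sq(2)[OF L fin'] \<sigma>_def
      by (subst sum_diff[OF fin Sq_mono[OF r_mono]]) simp
    also have "\<dots> \<le> L\<^sup>2 * (1/4) ^ i" by (intro mult_left_mono tail) simp
    finally show "integral\<^sup>L (mu L) (\<lambda>x. (g i x)\<^sup>2) \<le> L\<^sup>2 * (1/4) ^ i" .
  qed
  have g1: "integrable (mu L) (g i)" for i
  proof -
    have e: "g i = (\<lambda>x. Re (\<Sum>k\<in>Sq (r (Suc i)) - Sq (r i). c k * wave L (fst k) (snd k) x))"
      by (rule ext) (simp only: gP[symmetric] Re_complex_of_real)
    show ?thesis unfolding e by (rule integrable_Re[OF integrable_trig])
  qed
  \<comment> \<open>Increments with squared \<open>L^2\<close> norm of order
    \<open>(1/4) ^ i\<close> have \<open>L^1\<close> norm of order \<open>(1/2) ^ i\<close>. This is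
    summable and forces convergence almost everywhere.\<close>
  have gi: "integral\<^sup>L (mu L) (\<lambda>x. \<bar>g i x\<bar>) \<le> L\<^sup>2 * (1/2) ^ i" for i
  proof -
    have "integral\<^sup>L (mu L) (\<lambda>x. \<bar>g i x\<bar>) \<le> L * sqrt (integral\<^sup>L (mu L) (\<lambda>x. (g i x)\<^sup>2))"
      by (rule integral_abs_le[OF L g1 g2(1)])
    also have "\<dots> \<le> L * sqrt (L\<^sup>2 * (1/4) ^ i)"
      using L by (intro mult_left_mono real_sqrt_le_mono g2(2)) auto
    also have "sqrt (L\<^sup>2 * (1/4) ^ i) = L * (1/2) ^ i"
    proof -
      have "L\<^sup>2 * (1/4) ^ i = (L * (1/2) ^ i)\<^sup>2"
        by (simp add: power_mult_distrib power_mult[symmetric] mult.commute[of i 2]) (simp add: power_mult power2_eq_square)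
      then show ?thesis using L by simp
    qed
    finally show ?thesis by (simp add: power2_eq_square)
  qed
  have sg: "summable (\<lambda>i. L\<^sup>2 * (1/2 :: real) ^ i)" by (intro summable_mult summable_geometric) simp
  have sI: "summable (\<lambda>i. integral\<^sup>L (mu L) (\<lambda>x. \<bar>g i x\<bar>))"
    by (rule summable_comparison_test'[OF sg, of 0]) (use gi in auto)
  have ae: "AE x in mu L. summable (\<lambda>i. \<bar>g i x\<bar>)"
  proof -
    have "(\<integral>\<^sup>+x. (\<Sum>i. ennreal \<bar>g i x\<bar>) \<partial>mu L) = (\<Sum>i. \<integral>\<^sup>+x. ennreal \<bar>g i x\<bar> \<partial>mu L)"
      by (rule nn_integral_suminf) (intro measurable_mu, measurable)
    also have "\<dots> = (\<Sum>i. ennreal (integral\<^sup>L (mu L) (\<lambda>x. \<bar>g i x\<bar>)))"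
      using g1 by (intro suminf_cong nn_integral_eq_integral) auto
    also have "\<dots> = ennreal (\<Sum>i. integral\<^sup>L (mu L) (\<lambda>x. \<bar>g i x\<bar>))"
      by (rule suminf_ennreal2[OF _ sI]) simp
    finally have "(\<integral>\<^sup>+x. (\<Sum>i. ennreal \<bar>g i x\<bar>) \<partial>mu L) \<noteq> \<infinity>" by simp
    moreover have "(\<lambda>x. \<Sum>i. ennreal \<bar>g i x\<bar>) \<in> borel_measurable (mu L)"
      by (intro measurable_mu) measurable
    ultimately have "AE x in mu L. (\<Sum>i. ennreal \<bar>g i x\<bar>) \<noteq> \<infinity>"
      by (intro nn_integral_PInf_AE) auto
    then show ?thesis
      by eventually_elim (auto intro: summable_suminf_not_top)
  qed
  \<comment> \<open>The series is written down also at points where it diverges, so \<open>w\<close>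
    is total and inherits measurability and periodicity from the increments.\<close>
  define w where "w x = p (r 0) x + (\<Sum>i. g i x)" for x
  have wm [measurable]: "w \<in> borel_measurable borel" unfolding w_def[abs_def] by measurable
  have lim: "AE x in mu L. (\<lambda>n. p (r n) x) \<longlonglongrightarrow> w x"
    using ae
  proof eventually_elim
    case (elim x)
    then have "summable (\<lambda>i. g i x)" by (rule summable_rabs_cancel)
    then have "(\<lambda>n. \<Sum>i<n. g i x) \<longlonglongrightarrow> (\<Sum>i. g i x)" by (rule summable_LIMSEQ)
    moreover have "(\<Sum>i<n. g i x) = p (r n) x - p (r 0) x" for n
      unfolding g_def by (rule sum_lessThan_telescope)
    ultimately have "(\<lambda>n. p (r n) x - p (r 0) x) \<longlonglongrightarrow> (\<Sum>i. g i x)" by simp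
    from tendsto_add[OF tendsto_const[of "p (r 0) x"] this] show ?case by (simp add: w_def)
  qed
  have per: "periodic_fun L w"
  proof -
    have "p n (x + L, y) = p n (x, y)" "p n (x, y + L) = p n (x, y)" for n x y
      by (simp_all add: p_def P_def wave_periodic[OF L])
    then show ?thesis by (simp add: periodic_fun_def w_def g_def)
  qed
  \<comment> \<open>Fatou's lemma along the subsequence, whose squares have integrals bounded by
    \<open>L\<^sup>2 * B\<^sup>2\<close>.\<close>
  have w2: "integrable (mu L) (\<lambda>x. (w x)\<^sup>2)"
  proof (rule integrableI_bounded)
    have p2: "(\<integral>\<^sup>+x. ennreal ((p n x)\<^sup>2) \<partial>mu L) \<le> ennreal (L\<^sup>2 * B\<^sup>2)" for n
    proof -
      have e: "(p n x)\<^sup>2 = (cmod (\<Sum>k\<in>Sq n. c k * wave L (fst k) (snd k) x))\<^sup>2" for x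
        unfolding P_def[symmetric] Pp[symmetric] by simp
      have "(\<integral>\<^sup>+x. ennreal ((p n x)\<^sup>2) \<partial>mu L) = ennreal (L\<^sup>2 * \<sigma> n)"
        unfolding e \<sigma>_def integral_trig_sq(2)[OF L fin, symmetric]
        by (rule nn_integral_eq_integral[OF integral_trig_sq(1)[OF L fin]]) auto
      then show ?thesis using \<sigma>B[of n] by (simp add: ennreal_leI mult_left_mono)
    qed
    have "(\<integral>\<^sup>+x. ennreal (norm ((w x)\<^sup>2)) \<partial>mu L) = (\<integral>\<^sup>+x. liminf (\<lambda>n. ennreal ((p (r n) x)\<^sup>2)) \<partial>mu L)"
    proof (rule nn_integral_cong_AE)
      show "AE x in mu L. ennreal (norm ((w x)\<^sup>2)) = liminf (\<lambda>n. ennreal ((p (r n) x)\<^sup>2))"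
        using lim
      proof eventually_elim
        case (elim x)
        have "(\<lambda>n. ennreal ((p (r n) x)\<^sup>2)) \<longlonglongrightarrow> ennreal ((w x)\<^sup>2)"
          by (intro tendsto_ennrealI tendsto_power elim)
        from lim_imp_Liminf[OF _ this] show ?case by simp
      qed
    qed
    also have "\<dots> \<le> liminf (\<lambda>n. \<integral>\<^sup>+x. ennreal ((p (r n) x)\<^sup>2) \<partial>mu L)"
      by (rule nn_integral_liminf) (intro measurable_mu, measurable)
    also have "\<dots> \<le> liminf (\<lambda>n::nat. ennreal (L\<^sup>2 * B\<^sup>2))"
      by (intro Liminf_mono always_eventually allI p2)
    also have "\<dots> = ennreal (L\<^sup>2 * B\<^sup>2)" by (simp add: Liminf_const)
    also have "\<dots> < \<infinity>" by simp
    finally show "(\<integral>\<^sup>+x. ennreal (norm ((w x)\<^sup>2)) \<partial>mu L) < \<infinity>" .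
  qed (intro measurable_mu, measurable)
  have wL2: "w \<in> L2_per L" by (rule L2_perI[OF per wm w2])
  have "fc L w k = c k" for k
  proof -
    let ?e = "\<lambda>x. cnj (wave L (fst k) (snd k) x)"
    define h where "h i x = of_real (g i x) * ?e x" for i x
    have hn: "cmod (h i x) = \<bar>g i x\<bar>" for i x by (simp add: h_def norm_mult)
    have hi: "integrable (mu L) (h i)" for i
      unfolding h_def by (intro cfc_integrable integrable_of_real g1)
    have hs: "(\<lambda>i. integral\<^sup>L (mu L) (h i)) sums (\<integral>x. (\<Sum>i. h i x) \<partial>mu L)"
      by (rule sums_integral[OF hi]) (use ae sI in \<open>simp_all add: hn\<close>)
    have cP: "cfc L (\<lambda>x. of_real (p n x)) k = (if k \<in> Sq n then c k else 0)" for n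
      unfolding Pp P_def by (rule cfc_trig[OF L fin])
    have pint: "integrable (mu L) (\<lambda>x. complex_of_real (p n x))" for n
      unfolding Pp P_def by (rule integrable_trig)
    have cg: "integral\<^sup>L (mu L) (h i) = of_real (L\<^sup>2) * cfc L (\<lambda>x. of_real (p (r (Suc i)) x)) k
        - of_real (L\<^sup>2) * cfc L (\<lambda>x. of_real (p (r i) x)) k" for i
    proof -
      have "integral\<^sup>L (mu L) (h i) = integral\<^sup>L (mu L) (\<lambda>x. of_real (p (r (Suc i)) x) * ?e x) - integral\<^sup>L (mu L) (\<lambda>x. of_real (p (r i) x) * ?e x)"
        unfolding h_def g_def of_real_diff left_diff_distrib
        by (intro Bochner_Integration.integral_diff cfc_integrable pint)
      then show ?thesis using L by (simp add: cfc_def)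
    qed
    have ev: "(\<lambda>n. of_real (L\<^sup>2) * cfc L (\<lambda>x. of_real (p (r n) x)) k) \<longlonglongrightarrow> of_real (L\<^sup>2) * c k"
    proof (rule tendsto_eventually)
      define n0 where "n0 = nat \<bar>fst k\<bar> + nat \<bar>snd k\<bar>"
      have "k \<in> Sq (r n)" if "n \<ge> n0" for n
      proof -
        have "int n0 \<le> int (r n)" using that r_ge[of n] by simp
        then have "\<bar>fst k\<bar> \<le> int (r n)" "\<bar>snd k\<bar> \<le> int (r n)" unfolding n0_def by simp_all
        then show ?thesis by (auto simp: Sq_def mem_Times_iff abs_le_iff)
      qed
      then show "\<forall>\<^sub>F n in sequentially. of_real (L\<^sup>2) * cfc L (\<lambda>x. of_real (p (r n) x)) k = of_real (L\<^sup>2) * c k"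
        unfolding cP eventually_sequentially by (intro exI[of _ n0]) auto
    qed
    have "(\<lambda>i. integral\<^sup>L (mu L) (h i)) sums (of_real (L\<^sup>2) * c k - of_real (L\<^sup>2) * cfc L (\<lambda>x. of_real (p (r 0) x)) k)"
      unfolding cg by (rule telescope_sums[OF ev])
    with hs have H: "(\<integral>x. (\<Sum>i. h i x) \<partial>mu L) = of_real (L\<^sup>2) * c k - of_real (L\<^sup>2) * cfc L (\<lambda>x. of_real (p (r 0) x)) k"
      by (rule sums_unique2)
    have Hi: "integrable (mu L) (\<lambda>x. \<Sum>i. h i x)"
      by (rule integrable_suminf[OF hi]) (use ae sI in \<open>simp_all add: hn\<close>)
    have "integral\<^sup>L (mu L) (\<lambda>x. of_real (w x) * ?e x) = integral\<^sup>L (mu L) (\<lambda>x. of_real (p (r 0) x) * ?e x + (\<Sum>i. h i x))"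
    proof (rule integral_cong_AE)
      show "AE x in mu L. of_real (w x) * ?e x = of_real (p (r 0) x) * ?e x + (\<Sum>i. h i x)"
        using ae
      proof eventually_elim
        case (elim x)
        then have s: "summable (\<lambda>i. g i x)" by (rule summable_rabs_cancel)
        have "(\<Sum>i. h i x) = of_real (\<Sum>i. g i x) * ?e x"
          unfolding h_def suminf_of_real[OF s] by (rule suminf_mult2[symmetric, OF summable_of_real[OF s]])
        then show ?case by (simp add: w_def distrib_right)
      qed
      show "(\<lambda>x. of_real (w x) * ?e x) \<in> borel_measurable (mu L)"
        unfolding cnj_wave by (intro measurable_mu) measurable
      show "(\<lambda>x. of_real (p (r 0) x) * ?e x + (\<Sum>i. h i x)) \<in> borel_measurable (mu L)"
        by (intro borel_measurable_add borel_measurable_integrable[OF Hi]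
          borel_measurable_integrable[OF cfc_integrable[OF pint]])
    qed
    also have "\<dots> = integral\<^sup>L (mu L) (\<lambda>x. of_real (p (r 0) x) * ?e x) + (\<integral>x. (\<Sum>i. h i x) \<partial>mu L)"
      by (rule Bochner_Integration.integral_add[OF cfc_integrable[OF pint] Hi])
    also have "\<dots> = of_real (L\<^sup>2) * c k"
      unfolding H using L by (simp add: cfc_def)
    finally show ?thesis using L by (simp add: fc_eq_cfc cfc_def)
  qed
  then show ?thesis using wL2 by blast
qed

text \<open>\<open>riesz_fischer\<close> supplies a candidate, so the choice made in
  \<open>laplacian\<close> satisfies \<open>is_laplacian\<close>.\<close>

lemma laplacian_exists:
  assumes L: "L > 0" and v: "v \<in> L2_per L" and b: "hb L 0 UNIV (\<lambda>k. of_real (lam L k) * fc L v k) B"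
  shows "laplacian L v \<in> L2_per L" "fc L (laplacian L v) k = - of_real (lam L k) * fc L v k"
proof -
  have "hb L 0 UNIV (\<lambda>k. - of_real (lam L k) * fc L v k) B"
    by (rule wbound_mono[OF b order_refl]) auto
  moreover have "- of_real (lam L (- k)) * fc L v (- k) = cnj (- of_real (lam L k) * fc L v k)" for k
    by (simp add: cnj_fc lam_def)
  ultimately obtain w where w: "w \<in> L2_per L" "\<And>k. fc L w k = - of_real (lam L k) * fc L v k"
    using riesz_fischer[OF L] by blast
  have "is_laplacian L v w"
    unfolding is_laplacian_def
  proof (intro conjI allI v w(1))
    fix l m
    show "fourier_coeff L w l m = - of_real ((freq L)\<^sup>2 * (of_int l ^ 2 + of_int m ^ 2)) * fourier_coeff L v l m"
      using w(2)[of "(l, m)"] by (simp add: fc_def lam_def)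
  qed
  then have l: "is_laplacian L v (laplacian L v)"
    unfolding laplacian_def by (rule someI[of "is_laplacian L v"])
  then show "laplacian L v \<in> L2_per L" by (simp add: is_laplacian_def)
  show "fc L (laplacian L v) k = - of_real (lam L k) * fc L v k"
    using l by (simp add: is_laplacian_def fc_def lam_def)
qed

lemma hb_lam2:
  assumes "hb L (Suc (Suc r)) K c B"
  shows "hb L r K (\<lambda>k. of_real (lam L k) * (of_real (lam L k) * c k)) B"
  by (rule hb_lam[OF hb_lam[OF assms]])

text \<open>
  The common form of the right-hand side of a stage and of the Cahn--Hilliard equation, as
  \<open>L_\<kappa> v - f_\<kappa>(u)\<close> becomes \<open>- \<epsilon>\<^sup>2 \<Delta> v + \<kappa> v - (\<kappa> + 1) u + u\<^sup>3\<close>.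
\<close>

lemma rhs_coeffs:
  assumes L: "L > 0" and u: "u \<in> H_per L 4" and v: "v \<in> H_per L 4"
    and w: "w = (\<lambda>x. - \<epsilon>\<^sup>2 * laplacian L (\<lambda>x. (u x + v x) / 2) x + \<kappa> * ((u x + v x) / 2) - (\<kappa> + 1) * u x + u x ^ 3)"
  shows "laplacian L w \<in> L2_per L"
    "fc L (laplacian L w) k = spectral.rhs L UNIV (-) \<epsilon> \<kappa> (fc L u) (fc L v) k"
proof -
  interpret spectral L UNIV "(-)" by (rule spectral_UNIV[OF L])
  define B where "B = max (H_norm L 4 u) (H_norm L 4 v) / L"
  have hu: "hb L 2 UNIV (fc L u) B" and hv: "hb L 2 UNIV (fc L v) B"
    unfolding B_def by (rule H_per_hb[OF L u]; simp) (rule H_per_hb[OF L v]; simp)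
  have hu1: "hb L 1 UNIV (fc L u) B" by (rule hb_lower[OF hu]) simp
  note u2 = H_per_L2[OF u] and v2 = H_per_L2[OF v]
  define a where "a = (\<lambda>x. 1/2 * u x + 1/2 * v x)"
  have a_eq: "(\<lambda>x. (u x + v x) / 2) = a" by (auto simp: a_def)
  have a2: "a \<in> L2_per L" unfolding a_def by (rule L2_per_lincomb[OF u2 v2])
  have fa: "fc L a k = (fc L u k + fc L v k) / 2" for k
    unfolding a_def fc_lincomb[OF u2 v2] by simp
  have ha: "hb L 2 UNIV (fc L a) B"
  proof -
    have "hb L 2 UNIV (\<lambda>k. (1/2) * (fc L u k + fc L v k)) (cmod (1/2) * (B + B))"
      by (intro wbound_scale wbound_add hu hv) simp
    then show ?thesis by (rule wbound_mono) (auto simp: fa)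
  qed
  have la: "laplacian L a \<in> L2_per L" "fc L (laplacian L a) k = - of_real (lam L k) * fc L a k" for k
  proof -
    have h: "hb L 0 UNIV (\<lambda>k. of_real (lam L k) * fc L a k) B"
      by (rule hb_lam) (rule hb_lower[OF ha], simp)
    show "laplacian L a \<in> L2_per L" "fc L (laplacian L a) k = - of_real (lam L k) * fc L a k"
      by (rule laplacian_exists[OF L a2 h])+
  qed
  note c3 = fc_cube[OF L u2 hu1]
  define w1 where "w1 = (\<lambda>x. - \<epsilon>\<^sup>2 * laplacian L a x + \<kappa> * a x)"
  define w2 where "w2 = (\<lambda>x. - (\<kappa> + 1) * u x + 1 * u x ^ 3)"
  have w_eq: "w = (\<lambda>x. 1 * w1 x + 1 * w2 x)" unfolding w a_eq w1_def w2_def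
    by (rule ext) (simp add: a_def add_divide_distrib algebra_simps)
  have w1: "w1 \<in> L2_per L" unfolding w1_def by (rule L2_per_lincomb[OF la(1) a2])
  have w2: "w2 \<in> L2_per L" unfolding w2_def by (rule L2_per_lincomb[OF u2 c3(1)])
  have wL2: "w \<in> L2_per L" unfolding w_eq by (rule L2_per_lincomb[OF w1 w2])
  have fw: "fc L w k = of_real (\<epsilon>\<^sup>2 * lam L k + \<kappa>) * ((fc L u k + fc L v k) / 2) - of_real (\<kappa> + 1) * fc L u k + cube (fc L u) k" for k
  proof -
    have "fc L w k = fc L w1 k + fc L w2 k" unfolding w_eq fc_lincomb[OF w1 w2] by simp
    also have "fc L w1 k = of_real (\<epsilon>\<^sup>2 * lam L k + \<kappa>) * fc L a k"
      unfolding w1_def fc_lincomb[OF la(1) a2] la(2) by (simp add: algebra_simps)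
    also have "fc L w2 k = - of_real (\<kappa> + 1) * fc L u k + cube (fc L u) k"
      unfolding w2_def fc_lincomb[OF u2 c3(1)] c3(2) by simp
    finally show ?thesis unfolding fa by (simp add: algebra_simps)
  qed
  have hw: "hb L 0 UNIV (\<lambda>k. of_real (lam L k) * fc L w k)
     (cmod (of_real (\<epsilon>\<^sup>2)) * B + cmod (of_real \<kappa>) * B + cmod (of_real (- (\<kappa> + 1))) * B + (conv_const L 1)\<^sup>2 * B ^ 3)"
  proof -
    have h2: "hb L 0 UNIV (\<lambda>k. of_real (lam L k) * (of_real (lam L k) * fc L a k)) B"
      by (rule hb_lam2) (rule hb_lower[OF ha], simp)
    have h1: "hb L 0 UNIV (\<lambda>k. of_real (lam L k) * fc L a k) B"
      by (rule hb_lam) (rule hb_lower[OF ha], simp)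
    have h0: "hb L 0 UNIV (\<lambda>k. of_real (lam L k) * fc L u k) B"
      by (rule hb_lam) (rule hb_lower[OF hu], simp)
    have h3: "hb L 0 UNIV (\<lambda>k. of_real (lam L k) * cube (fc L u) k) ((conv_const L 1)\<^sup>2 * B ^ 3)"
      by (rule hb_lam) (use cube_hb[OF order_refl hu1] in simp)
    have "hb L 0 UNIV (\<lambda>k. of_real (\<epsilon>\<^sup>2) * (of_real (lam L k) * (of_real (lam L k) * fc L a k))
        + of_real \<kappa> * (of_real (lam L k) * fc L a k)
        + of_real (- (\<kappa> + 1)) * (of_real (lam L k) * fc L u k) + of_real (lam L k) * cube (fc L u) k)
     (cmod (of_real (\<epsilon>\<^sup>2)) * B + cmod (of_real \<kappa>) * B + cmod (of_real (- (\<kappa> + 1))) * B + (conv_const L 1)\<^sup>2 * B ^ 3)"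
      by (intro wbound_add wbound_scale h0 h1 h2 h3) auto
    then show ?thesis
      by (rule wbound_cong[THEN iffD1, rotated]) (simp add: fw fa[symmetric] algebra_simps)
  qed
  note lw = laplacian_exists[OF L wL2 hw]
  show "laplacian L w \<in> L2_per L" by (rule lw)
  show "fc L (laplacian L w) k = rhs \<epsilon> \<kappa> (fc L u) (fc L v) k"
    unfolding lw(2) fw rhs_def ..
qed

section \<open>Time derivatives of coefficients and Taylor remainders\<close>

lemma fc_diff:
  assumes "v \<in> L2_per L" "w \<in> L2_per L"
  shows "(\<lambda>x. v x - w x) \<in> L2_per L" "fc L (\<lambda>x. v x - w x) k = fc L v k - fc L w k"
  using L2_per_lincomb[OF assms, of 1 "-1"] fc_lincomb[OF assms, of 1 "-1" k] by simp_all

text \<open>A coefficient is a linear functional on \<open>L^2\<close> of norm at most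
  \<open>1 / L\<close>, so limits of difference quotients pass to it.\<close>

lemma time_derivative_coeff:
  assumes L: "L > 0" and d: "L2_has_time_derivative L f g t S" and t: "t \<in> S"
  shows "((\<lambda>s. (fc L (f s) k - fc L (f t) k) / of_real (s - t)) \<longlongrightarrow> fc L g k) (at t within S)"
proof -
  have g: "g \<in> L2_per L" and f: "\<And>s. s \<in> S \<Longrightarrow> f s \<in> L2_per L"
    and lim: "((\<lambda>s. L2_norm L (\<lambda>x. (f s x - f t x) / (s - t) - g x)) \<longlongrightarrow> 0) (at t within S)"
    using d by (auto simp: L2_has_time_derivative_def)
  have lim': "((\<lambda>s. L2_norm L (\<lambda>x. (f s x - f t x) / (s - t) - g x) / L) \<longlongrightarrow> 0) (at t within S)"
    using tendsto_divide[OF lim tendsto_const[of L]] L by simp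
  have "((\<lambda>s. (fc L (f s) k - fc L (f t) k) / of_real (s - t) - fc L g k) \<longlongrightarrow> 0) (at t within S)"
  proof (rule Lim_null_comparison[OF _ lim'])
    have le: "cmod ((fc L (f s) k - fc L (f t) k) / of_real (s - t) - fc L g k)
        \<le> L2_norm L (\<lambda>x. (f s x - f t x) / (s - t) - g x) / L" if s: "s \<in> S" for s
    proof -
      define q where "q = (\<lambda>x. 1 / (s - t) * f s x + (- (1 / (s - t))) * f t x)"
      have q: "q \<in> L2_per L" unfolding q_def by (rule L2_per_lincomb[OF f[OF s] f[OF t]])
      have eq: "(\<lambda>x. (f s x - f t x) / (s - t) - g x) = (\<lambda>x. q x - g x)"
        by (auto simp: q_def diff_divide_distrib)
      have "fc L q k = (fc L (f s) k - fc L (f t) k) / of_real (s - t)"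
        unfolding q_def fc_lincomb[OF f[OF s] f[OF t]] by (simp add: diff_divide_distrib)
      then have "fc L (\<lambda>x. q x - g x) k = (fc L (f s) k - fc L (f t) k) / of_real (s - t) - fc L g k"
        unfolding fc_diff(2)[OF q g] by simp
      then show ?thesis
        unfolding eq using norm_fc_le[OF L fc_diff(1)[OF q g], of k] by simp
    qed
    then show "\<forall>\<^sub>F s in at t within S. cmod ((fc L (f s) k - fc L (f t) k) / of_real (s - t) - fc L g k)
        \<le> L2_norm L (\<lambda>x. (f s x - f t x) / (s - t) - g x) / L"
      by (auto simp: eventually_at_filter)
  qed
  then show ?thesis by (simp only: LIM_zero_iff)
qed

text \<open>Prepares the scalar real Taylor theorem: the free factor \<open>z\<close> produces every
  real-linear functional of a coefficient.\<close>

lemma time_derivative_coeff_real: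
  assumes L: "L > 0" and d: "L2_has_time_derivative L f g t S" and t: "t \<in> S"
  shows "((\<lambda>s. Re (z * fc L (f s) k)) has_real_derivative Re (z * fc L g k)) (at t within S)"
  unfolding has_field_derivative_iff
proof -
  have "((\<lambda>s. Re (z * ((fc L (f s) k - fc L (f t) k) / of_real (s - t)))) \<longlongrightarrow> Re (z * fc L g k)) (at t within S)"
    by (intro tendsto_intros time_derivative_coeff[OF assms])
  moreover have "Re (z * ((fc L (f s) k - fc L (f t) k) / of_real (s - t)))
     = (Re (z * fc L (f s) k) - Re (z * fc L (f t) k)) / (s - t)" for s
    by (simp only: times_divide_eq_right Re_divide_of_real right_diff_distrib minus_complex.simps)
  ultimately show "((\<lambda>s. (Re (z * fc L (f s) k) - Re (z * fc L (f t) k)) / (s - t)) \<longlongrightarrow> Re (z * fc L g k)) (at t within S)"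
    by (simp only:)
qed

text \<open>
  Taylor's theorem in a weighted \<open>\<ell>\<^sup>2\<close> space: the scalar theorem is applied to the inner product with
  the remainder itself.
\<close>

lemma taylor_remainder_open:
  fixes \<phi> \<psi> \<omega> :: "real \<Rightarrow> 'k \<Rightarrow> complex"
  assumes d1: "\<And>t k z. t \<in> {0<..<T} \<Longrightarrow> ((\<lambda>s. Re (z * \<phi> s k)) has_real_derivative Re (z * \<psi> t k)) (at t)"
    and d2: "\<And>t k z. t \<in> {0<..<T} \<Longrightarrow> ((\<lambda>s. Re (z * \<psi> s k)) has_real_derivative Re (z * \<omega> t k)) (at t)"
    and \<omega>: "\<And>t. t \<in> {0<..<T} \<Longrightarrow> wbound w K (\<omega> t) C"
    and b: "b \<in> {0<..<T}" and t: "t \<in> {0<..<T}"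
  shows "wbound w K (\<lambda>k. \<phi> t k - \<phi> b k - of_real (t - b) * \<psi> b k) (C / 2 * (t - b)\<^sup>2)"
proof (cases "t = b")
  case True
  then show ?thesis by (simp add: wbound_def L2_set_def)
next
  case False
  define \<rho> where "\<rho> k = \<phi> t k - \<phi> b k - of_real (t - b) * \<psi> b k" for k
  have C0: "C \<ge> 0" using wbound_nonneg[OF \<omega>[OF b]] .
  show ?thesis
  proof (rule wboundI)
    fix S assume S: "finite S" "S \<subseteq> K"
    define R where "R = L2_set (\<lambda>k. w k * cmod (\<rho> k)) S"
    \<comment> \<open>Applied to the remainder itself, this functional gives
      \<open>R\<^sup>2\<close>, while Cauchy-Schwarz bounds its second derivative along the path by
      \<open>R * C\<close>; one factor \<open>R\<close> cancels at the end.\<close>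
    define G where "G f = (\<Sum>k\<in>S. Re (of_real ((w k)\<^sup>2) * cnj (\<rho> k) * f k))" for f
    define diff where "diff n s = G (if n = 0 then \<phi> s else if n = 1 then \<psi> s else \<omega> s)" for n :: nat and s
    have D: "\<forall>m s. m < 2 \<and> min t b \<le> s \<and> s \<le> max t b \<longrightarrow> DERIV (diff m) s :> diff (Suc m) s"
    proof (intro allI impI)
      fix m :: nat and s assume a: "m < 2 \<and> min t b \<le> s \<and> s \<le> max t b"
      then have s: "s \<in> {0<..<T}" using t b by (auto simp: min_def max_def split: if_splits)
      have "DERIV (\<lambda>s. G (\<phi> s)) s :> G (\<psi> s)" "DERIV (\<lambda>s. G (\<psi> s)) s :> G (\<omega> s)"
        unfolding G_def by (intro DERIV_sum d1[OF s] d2[OF s])+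
      moreover from a have "m = 0 \<or> m = 1" by linarith
      ultimately show "DERIV (diff m) s :> diff (Suc m) s"
        unfolding diff_def by auto
    qed
    obtain \<xi> where \<xi>: "if t < b then t < \<xi> \<and> \<xi> < b else b < \<xi> \<and> \<xi> < t"
      and tay: "diff 0 t = (\<Sum>m<2. (diff m b / fact m) * (t - b) ^ m) + (diff 2 \<xi> / fact 2) * (t - b) ^ 2"
      using Taylor[of 2 diff "diff 0" "min t b" "max t b" b t, OF _ refl D] False by (auto split: if_splits)
    have \<xi>T: "\<xi> \<in> {0<..<T}" using \<xi> t b by (auto split: if_splits)
    have "R\<^sup>2 = (\<Sum>k\<in>S. (w k)\<^sup>2 * (cmod (\<rho> k))\<^sup>2)"
      by (simp add: R_def L2_set_def sum_nonneg power_mult_distrib)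
    also have "\<dots> = (\<Sum>k\<in>S. Re (of_real ((w k)\<^sup>2) * cnj (\<rho> k) * \<rho> k))"
    proof (rule sum.cong[OF refl])
      fix k
      have "of_real ((w k)\<^sup>2) * cnj (\<rho> k) * \<rho> k = of_real ((w k)\<^sup>2 * (cmod (\<rho> k))\<^sup>2)"
        by (simp only: of_real_mult complex_norm_square mult_ac)
      then show "(w k)\<^sup>2 * (cmod (\<rho> k))\<^sup>2 = Re (of_real ((w k)\<^sup>2) * cnj (\<rho> k) * \<rho> k)"
        by (simp only: Re_complex_of_real)
    qed
    also have "\<dots> = diff 0 t - diff 0 b - (t - b) * diff 1 b"
    proof -
      have "Re (x * \<rho> k) = Re (x * \<phi> t k) - Re (x * \<phi> b k) - (t - b) * Re (x * \<psi> b k)" for x k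
        unfolding \<rho>_def by (simp add: algebra_simps)
      note eq = this
      have d: "diff 0 s = G (\<phi> s)" "diff 1 s = G (\<psi> s)" for s
        by (simp_all add: diff_def)
      show ?thesis
        unfolding d G_def eq sum_subtractf sum_distrib_left[symmetric] ..
    qed
    also have "\<dots> = diff 2 \<xi> / 2 * (t - b)\<^sup>2"
      using tay by (simp add: numeral_2_eq_2)
    also have "\<dots> \<le> (R * C) / 2 * (t - b)\<^sup>2"
    proof (intro mult_right_mono divide_right_mono)
      have "diff 2 \<xi> = (\<Sum>k\<in>S. Re (of_real ((w k)\<^sup>2) * cnj (\<rho> k) * \<omega> \<xi> k))" by (simp add: diff_def G_def)
      also have "\<dots> \<le> (\<Sum>k\<in>S. \<bar>w k * cmod (\<rho> k)\<bar> * \<bar>w k * cmod (\<omega> \<xi> k)\<bar>)"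
      proof (rule sum_mono)
        fix k
        have "Re (of_real ((w k)\<^sup>2) * cnj (\<rho> k) * \<omega> \<xi> k) \<le> cmod (of_real ((w k)\<^sup>2) * cnj (\<rho> k) * \<omega> \<xi> k)"
          by (rule complex_Re_le_cmod)
        also have "\<dots> = \<bar>w k * cmod (\<rho> k)\<bar> * \<bar>w k * cmod (\<omega> \<xi> k)\<bar>"
          by (simp add: norm_mult abs_mult power2_eq_square mult_ac)
        finally show "Re (of_real ((w k)\<^sup>2) * cnj (\<rho> k) * \<omega> \<xi> k) \<le> \<bar>w k * cmod (\<rho> k)\<bar> * \<bar>w k * cmod (\<omega> \<xi> k)\<bar>" .
      qed
      also have "\<dots> \<le> R * L2_set (\<lambda>k. w k * cmod (\<omega> \<xi> k)) S"
        unfolding R_def by (rule L2_set_mult_ineq)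
      also have "\<dots> \<le> R * C"
        using wboundD[OF \<omega>[OF \<xi>T] S] by (intro mult_left_mono) (auto simp: R_def L2_set_nonneg)
      finally show "diff 2 \<xi> \<le> R * C" .
    qed auto
    finally have "R * R \<le> R * (C / 2 * (t - b)\<^sup>2)" by (simp add: power2_eq_square mult_ac)
    then have "R \<le> C / 2 * (t - b)\<^sup>2"
      using C0 by (cases "R = 0") (auto simp: R_def L2_set_nonneg mult_le_cancel_left less_le)
    then show "L2_set (\<lambda>k. w k * cmod (\<phi> t k - \<phi> b k - of_real (t - b) * \<psi> b k)) S \<le> C / 2 * (t - b)\<^sup>2"
      by (simp add: R_def \<rho>_def)
  qed
qed

text \<open>Derivatives exist on the open interval, so the endpoint 0 is reached by continuity while
  the expansion point \<open>b\<close> stays inside.\<close>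

lemma taylor_remainder:
  fixes \<phi> \<psi> \<omega> :: "real \<Rightarrow> 'k \<Rightarrow> complex"
  assumes d1: "\<And>t k z. t \<in> {0<..<T} \<Longrightarrow> ((\<lambda>s. Re (z * \<phi> s k)) has_real_derivative Re (z * \<psi> t k)) (at t)"
    and d2: "\<And>t k z. t \<in> {0<..<T} \<Longrightarrow> ((\<lambda>s. Re (z * \<psi> s k)) has_real_derivative Re (z * \<omega> t k)) (at t)"
    and \<omega>: "\<And>t. t \<in> {0<..<T} \<Longrightarrow> wbound w K (\<omega> t) C"
    and cont: "\<And>k. ((\<lambda>s. \<phi> s k) \<longlongrightarrow> \<phi> 0 k) (at_right 0)"
    and b: "b \<in> {0<..<T}" and t: "t \<in> {0..<T}"
  shows "wbound w K (\<lambda>k. \<phi> t k - \<phi> b k - of_real (t - b) * \<psi> b k) (C / 2 * (t - b)\<^sup>2)"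
proof (cases "t = 0")
  case False
  then show ?thesis using t by (intro taylor_remainder_open[OF d1 d2 \<omega> b]) auto
next
  case True
  have T: "T > 0" using t by simp
  show ?thesis
  proof (rule wboundI)
    fix S assume S: "finite S" "S \<subseteq> K"
    have "((\<lambda>s. L2_set (\<lambda>k. w k * cmod (\<phi> s k - \<phi> b k - of_real (s - b) * \<psi> b k)) S)
        \<longlongrightarrow> L2_set (\<lambda>k. w k * cmod (\<phi> 0 k - \<phi> b k - of_real (0 - b) * \<psi> b k)) S) (at_right 0)"
      by (intro tendsto_L2_set tendsto_intros cont)
    moreover have "((\<lambda>s. C / 2 * (s - b)\<^sup>2) \<longlongrightarrow> C / 2 * (0 - b)\<^sup>2) (at_right 0)"
      by (intro tendsto_intros)
    moreover have "\<forall>\<^sub>F s in at_right 0. L2_set (\<lambda>k. w k * cmod (\<phi> s k - \<phi> b k - of_real (s - b) * \<psi> b k)) S \<le> C / 2 * (s - b)\<^sup>2"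
    proof -
      have "\<forall>\<^sub>F s in at_right 0. s \<in> {0<..<T}" using T by (rule eventually_at_right_real)
      then show ?thesis
        by eventually_elim (use wboundD[OF taylor_remainder_open[OF d1 d2 \<omega> b] S] in blast)
    qed
    ultimately show "L2_set (\<lambda>k. w k * cmod (\<phi> t k - \<phi> b k - of_real (t - b) * \<psi> b k)) S \<le> C / 2 * (t - b)\<^sup>2"
      unfolding True by (intro tendsto_le[OF trivial_limit_at_right_real]) 
  qed
qed

section \<open>The coefficients of the numerical solutions\<close>

text \<open>The biharmonic term costs two orders, which fixes order 2 for the differences; the cube
  is controlled at order 1, where the radius \<open>R\<close> is taken.\<close>

lemma (in spectral) rhs_diff_hb:
  assumes \<kappa>: "\<kappa> \<ge> 0" and c: "hb L 1 K c R" and c': "hb L 1 K c' R"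
    and e: "hb L 2 K (\<lambda>k. c k - c' k) B" and e': "hb L 2 K (\<lambda>k. d k - d' k) B"
  shows "hb L 0 K (\<lambda>k. rhs \<epsilon> \<kappa> c d k - rhs \<epsilon> \<kappa> c' d' k) ((\<epsilon>\<^sup>2 + 2 * \<kappa> + 1 + 3 * (conv_const L 1)\<^sup>2 * R\<^sup>2) * B)"
proof -
  define a where "a k = (c k - c' k + (d k - d' k)) / 2" for k
  have a: "hb L 2 K a B"
  proof -
    have "hb L 2 K (\<lambda>k. (1/2) * (c k - c' k + (d k - d' k))) (cmod (1/2) * (B + B))"
      by (intro wbound_scale wbound_add e e') simp
    then show ?thesis by (rule wbound_mono) (auto simp: a_def)
  qed
  have e1: "hb L 1 K (\<lambda>k. c k - c' k) B" by (rule hb_lower[OF e]) simp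
  have h2: "hb L 0 K (\<lambda>k. of_real (lam L k) * (of_real (lam L k) * a k)) B"
    by (rule hb_lam2) (rule hb_lower[OF a], simp)
  have h1: "hb L 0 K (\<lambda>k. of_real (lam L k) * a k) B"
    by (rule hb_lam) (rule hb_lower[OF a], simp)
  have h0: "hb L 0 K (\<lambda>k. of_real (lam L k) * (c k - c' k)) B"
    by (rule hb_lam) (rule hb_lower[OF e], simp)
  have h3: "hb L 0 K (\<lambda>k. of_real (lam L k) * (cube c k - cube c' k)) (3 * (conv_const L 1)\<^sup>2 * R\<^sup>2 * B)"
    by (rule hb_lam) (use cube_diff_hb[OF order_refl c c' e1] in simp)
  have "hb L 0 K (\<lambda>k. of_real (- (\<epsilon>\<^sup>2)) * (of_real (lam L k) * (of_real (lam L k) * a k))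
      + of_real (- \<kappa>) * (of_real (lam L k) * a k)
      + of_real (\<kappa> + 1) * (of_real (lam L k) * (c k - c' k))
      + of_real (- 1) * (of_real (lam L k) * (cube c k - cube c' k)))
     (cmod (of_real (- (\<epsilon>\<^sup>2))) * B + cmod (of_real (- \<kappa>)) * B + cmod (of_real (\<kappa> + 1)) * B
      + cmod (of_real (- 1)) * (3 * (conv_const L 1)\<^sup>2 * R\<^sup>2 * B))"
    by (intro wbound_add wbound_scale h0 h1 h2 h3) auto
  moreover have "cmod (of_real (- (\<epsilon>\<^sup>2))) * B + cmod (of_real (- \<kappa>)) * B + cmod (of_real (\<kappa> + 1)) * B
      + cmod (of_real (- 1)) * (3 * (conv_const L 1)\<^sup>2 * R\<^sup>2 * B)
     = (\<epsilon>\<^sup>2 + 2 * \<kappa> + 1 + 3 * (conv_const L 1)\<^sup>2 * R\<^sup>2) * B"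
    unfolding norm_of_real using \<kappa> by (simp add: algebra_simps)
  ultimately have "hb L 0 K (\<lambda>k. of_real (- (\<epsilon>\<^sup>2)) * (of_real (lam L k) * (of_real (lam L k) * a k))
      + of_real (- \<kappa>) * (of_real (lam L k) * a k)
      + of_real (\<kappa> + 1) * (of_real (lam L k) * (c k - c' k))
      + of_real (- 1) * (of_real (lam L k) * (cube c k - cube c' k)))
     ((\<epsilon>\<^sup>2 + 2 * \<kappa> + 1 + 3 * (conv_const L 1)\<^sup>2 * R\<^sup>2) * B)" by simp
  then show ?thesis
    by (rule wbound_cong[THEN iffD1, rotated]) (simp add: rhs_def a_def field_simps)
qed

text \<open>The linear parts have the same symbol on the window and on the lattice, so only the
  cubes differ.\<close>

lemma (in aliasing) rhs_aliasing:
  assumes c: "hb L 2 UNIV c R"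
  shows "hb L 0 K (\<lambda>k. full.rhs \<epsilon> \<kappa> c d k - rhs \<epsilon> \<kappa> c d k)
    (2 * conv_const L 1 * (conv_const L 1 + conv_const L 2) * R ^ 3 / \<rho>)"
proof -
  have "hb L 0 K (\<lambda>k. of_real (lam L k) * (cube c k - full.cube c k))
    (2 * conv_const L 1 * (conv_const L 1 + conv_const L 2) * R ^ 3 / \<rho>)"
    by (rule hb_lam) (use cube_aliasing[OF c] in simp)
  then show ?thesis
    by (rule wbound_cong[THEN iffD1, rotated]) (simp add: rhs_def full.rhs_def algebra_simps)
qed

section \<open>Coefficients of the discrete initial datum and of the grid scheme\<close>

context periodic_grid
begin

lemma wave2_uminus: "wave2 (- k) i j = cnj (wave2 k i j)"
  by (simp add: wave2_def cnj_wave)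

lemma rep_uminus: "x \<in> modes M \<Longrightarrow> rep (- x) = - x \<or> x = - (int M div 2) \<and> rep (- x) = x"
proof (cases "- x \<in> modes M")
  case False
  assume x: "x \<in> modes M"
  then have "x = - (int M div 2)" using False by (auto simp: modes_iff)
  then have "- x - x = int M" using half_M by simp
  then have "rep (- x) = x" by (intro rep_eqI x) simp
  then show ?thesis using \<open>x = - (int M div 2)\<close> by simp
qed (simp add: rep_id)

text \<open>Taking the real part averages the coefficient at \<open>l\<close> with the conjugate of
  the one at \<open>m l\<close>, the representative of \<open>-l\<close>. This matters only if a
  component of \<open>l\<close> is \<open>-M / 2\<close>; there the weight is at least
  \<open>rhoM\<close>, and one order is traded for \<open>1 / rhoM\<close>.\<close>

lemma dft2_P_M_grid:
  assumes v: "hb L 2 UNIV (fc L v) B"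
  shows "hb L 1 modes2 (\<lambda>k. dft2 (P_M_grid L M v) k - fc L v k) (B / rhoM)"
proof -
  let ?\<phi> = "fc L v"
  define m where "m l = (rep (- fst l), rep (- snd l))" for l
  have m_in: "m l \<in> modes2" for l by (simp add: m_def modes2_def rep_in)
  have PM: "P_M L M v (grid_point L M i j) = (\<Sum>k\<in>modes2. ?\<phi> k * wave2 k i j)" for i j
    unfolding P_M_def sum_modes2 fc_def wave2_def ..
  have val: "of_real (P_M_grid L M v i j) = ((\<Sum>k\<in>modes2. ?\<phi> k * wave2 k i j)
       + (\<Sum>k\<in>modes2. cnj (?\<phi> k) * wave2 (- k) i j)) / 2" for i j
  proof -
    have "of_real (Re z) = (z + cnj z) / 2" for z by (simp add: complex_eq_iff)
    then show ?thesis
      unfolding P_M_grid_def PM by (simp only: cnj_sum complex_cnj_mult wave2_uminus)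
  qed
  have d: "dft2 (P_M_grid L M v) l = (?\<phi> l + cnj (?\<phi> (m l))) / 2" if l: "l \<in> modes2" for l
  proof -
    let ?S = "\<lambda>f. (\<Sum>i=1..int M. \<Sum>j=1..int M. f i j * cnj (wave2 l i j)) / of_nat (M\<^sup>2)"
    have "dft2 (P_M_grid L M v) l = (?S (\<lambda>i j. \<Sum>k\<in>modes2. ?\<phi> k * wave2 k i j)
        + ?S (\<lambda>i j. \<Sum>k\<in>modes2. cnj (?\<phi> k) * wave2 (- k) i j)) / 2"
      unfolding dft2_eq val times_divide_eq_left distrib_right sum.distrib sum_divide_distrib[symmetric]
        add_divide_distrib[symmetric] by simp
    also have "?S (\<lambda>i j. \<Sum>k\<in>modes2. ?\<phi> k * wave2 k i j) = (\<Sum>k\<in>modes2. if k = l then ?\<phi> k else 0)"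
      unfolding sum_grid_synth[where g = "\<lambda>k. k"]
      using l by (intro sum.cong refl) (auto simp: modes2_def modes_cong_iff prod_eq_iff)
    also have "?S (\<lambda>i j. \<Sum>k\<in>modes2. cnj (?\<phi> k) * wave2 (- k) i j) = (\<Sum>k\<in>modes2. if k = m l then cnj (?\<phi> k) else 0)"
      unfolding sum_grid_synth[where g = uminus]
    proof (rule sum.cong[OF refl])
      fix k assume k: "k \<in> modes2"
      have e: "int M dvd - x - y \<longleftrightarrow> x = rep (- y)" if "x \<in> modes M" for x y
      proof -
        have c: "- x - y = - y - x" by simp
        show ?thesis unfolding c using rep_eqI[OF that, of "- y"] rep_dvd[of "- y"] by auto
      qed
      show "(if int M dvd fst (- k) - fst l \<and> int M dvd snd (- k) - snd l then cnj (?\<phi> k) else 0)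
          = (if k = m l then cnj (?\<phi> k) else 0)"
        using k e[of "fst k" "fst l"] e[of "snd k" "snd l"] by (auto simp: m_def modes2_def prod_eq_iff)
    qed
    finally show ?thesis using l m_in[of l] by simp
  qed
  have bw_m: "bw L (m l) = bw L l" if "l \<in> modes2" for l
    using rep_uminus[of "fst l"] rep_uminus[of "snd l"] that by (auto simp: m_def modes2_def bw_def lam_def)
  have inj: "inj_on (\<lambda>l. - m l) modes2"
    by (rule inj_onI)
      (auto simp: m_def modes2_def prod_eq_iff intro: rep_inj'[of _ _ 0, simplified])
  have hm: "hb L 2 modes2 (\<lambda>l. ?\<phi> (- m l)) B"
  proof (rule wboundI)
    fix S assume S: "finite S" "S \<subseteq> modes2"
    have "bw L l = bw L (- m l)" if "l \<in> S" for l
    proof -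
      have "bw L (- k) = bw L k" for k by (simp add: bw_def lam_def)
      then show ?thesis using bw_m[of l] that S by auto
    qed
    then have "L2_set (\<lambda>l. bw L l ^ 2 * cmod (?\<phi> (- m l))) S = L2_set (\<lambda>l. bw L (- m l) ^ 2 * cmod (?\<phi> (- m l))) S"
      by (intro L2_set_cong) auto
    also have "\<dots> = L2_set (\<lambda>k. bw L k ^ 2 * cmod (?\<phi> k)) ((\<lambda>l. - m l) ` S)"
      using inj_on_subset[OF inj S(2)] by (simp add: L2_set_def sum.reindex)
    also have "\<dots> \<le> B" using S by (intro wboundD[OF v]) auto
    finally show "L2_set (\<lambda>l. bw L l ^ 2 * cmod (?\<phi> (- m l))) S \<le> B" .
  qed
  have "hb L 2 modes2 (\<lambda>l. of_real (1 / (2 * rhoM)) * (?\<phi> (- m l) - ?\<phi> l)) (cmod (of_real (1 / (2 * rhoM))) * (B + B))"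
    by (intro wbound_scale wbound_diff hm wbound_subset[OF v]) auto
  then show ?thesis
  proof (rule wbound_mono)
    show "cmod (of_real (1 / (2 * rhoM))) * (B + B) \<le> B / rhoM"
      unfolding norm_of_real using rhoM_pos by simp
  next
    fix l assume l: "l \<in> modes2"
    have diff: "dft2 (P_M_grid L M v) l - ?\<phi> l = (?\<phi> (- m l) - ?\<phi> l) / 2"
      unfolding d[OF l] cnj_fc by (simp add: field_simps)
    show "bw L l ^ 1 * cmod (dft2 (P_M_grid L M v) l - ?\<phi> l) \<le> (bw L l)\<^sup>2 * cmod (of_real (1 / (2 * rhoM)) * (?\<phi> (- m l) - ?\<phi> l))"
    proof (cases "m l = - l")
      case False
      have "int M \<le> 4 * \<bar>fst l\<bar> \<or> int M \<le> 4 * \<bar>snd l\<bar>"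
      proof -
        have "fst l = - (int M div 2) \<or> snd l = - (int M div 2)"
          using False l rep_uminus[of "fst l"] rep_uminus[of "snd l"]
          by (auto simp: m_def modes2_def prod_eq_iff)
        then show ?thesis using half_M by auto
      qed
      then have "rhoM \<le> bw L l" unfolding rhoM_def by (rule bw_ge)
      then have "1 * (bw L l * cmod (?\<phi> (- m l) - ?\<phi> l)) \<le> (bw L l / rhoM) * (bw L l * cmod (?\<phi> (- m l) - ?\<phi> l))"
        using rhoM_pos by (intro mult_right_mono) auto
      then show ?thesis
        unfolding diff norm_mult norm_divide norm_of_real using rhoM_pos by (simp add: power2_eq_square)
    qed (simp add: diff)
  qed simp
qed

lemma dft2_stage_rhs_h:
  assumes V: "V j \<in> grid_fun M" and k: "k \<in> modes2"
  shows "dft2 (stage_rhs_h L M \<epsilon> \<kappa> V j) k = rhs \<epsilon> \<kappa> (dft2 (V j)) (dft2 (V (j + 1))) k"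
proof -
  define av where "av = (\<lambda>i l. 1 / 2 * (V j i l + V (j + 1) i l))"
  have a: "dft2 av k = (dft2 (V j) k + dft2 (V (j + 1)) k) / 2"
    unfolding av_def dft2_cmult dft2_add by simp
  have av: "(\<lambda>i l. (V j i l + V (j + 1) i l) / 2) = av"
    by (intro ext) (simp add: av_def)
  have "(\<lambda>i l. L_stab_h L M \<epsilon> \<kappa> av i l - f_stab \<kappa> (V j i l))
     = (\<lambda>i l. (- \<epsilon>\<^sup>2 * lap_h L M av i l + \<kappa> * av i l) - ((\<kappa> + 1) * V j i l - V j i l ^ 3))"
    by (intro ext) (simp add: L_stab_h_def f_stab_def deriv_F algebra_simps)
  then have "dft2 (stage_rhs_h L M \<epsilon> \<kappa> V j) k = - of_real (lam L k) *
      dft2 (\<lambda>i l. (- \<epsilon>\<^sup>2 * lap_h L M av i l + \<kappa> * av i l) - ((\<kappa> + 1) * V j i l - V j i l ^ 3)) k"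
    unfolding stage_rhs_h_def av dft2_lap_h[OF k] by simp
  also have "dft2 (\<lambda>i l. (- \<epsilon>\<^sup>2 * lap_h L M av i l + \<kappa> * av i l) - ((\<kappa> + 1) * V j i l - V j i l ^ 3)) k
     = (of_real (- \<epsilon>\<^sup>2) * (- of_real (lam L k) * dft2 av k) + of_real \<kappa> * dft2 av k)
       - (of_real (\<kappa> + 1) * dft2 (V j) k - cube (dft2 (V j)) k)"
    by (simp only: dft2_diff dft2_add dft2_cmult[of _ "\<lambda>i l. lap_h L M av i l"] dft2_cmult[of \<kappa>] dft2_cmult[of "\<kappa> + 1"]
      dft2_lap_h[OF k] dft2_cube[OF V k])
  finally show ?thesis
    unfolding rhs_def a[symmetric] by (simp add: algebra_simps)
qed

end

lemma L2_per_sum: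
  assumes "finite S" "\<And>q. q \<in> S \<Longrightarrow> v q \<in> L2_per L" and L: "L > 0"
  shows "(\<lambda>x. \<Sum>q\<in>S. b q * v q x) \<in> L2_per L \<and>
    (\<forall>k. fc L (\<lambda>x. \<Sum>q\<in>S. b q * v q x) k = (\<Sum>q\<in>S. of_real (b q) * fc L (v q) k))"
  using assms(1,2)
proof (induction S)
  case empty
  have "(\<lambda>x. 0) \<in> L2_per L" by (rule L2_perI) (auto simp: periodic_fun_def)
  then show ?case by (simp add: fc_eq_cfc cfc_def)
next
  case (insert q S)
  then have v: "v q \<in> L2_per L" and IH: "(\<lambda>x. \<Sum>q\<in>S. b q * v q x) \<in> L2_per L"
    "\<And>k. fc L (\<lambda>x. \<Sum>q\<in>S. b q * v q x) k = (\<Sum>q\<in>S. of_real (b q) * fc L (v q) k)" by auto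
  show ?case
    using L2_per_lincomb[OF v IH(1), of "b q" 1] fc_lincomb[OF v IH(1), of "b q" 1] insert.hyps IH(2) by simp
qed

lemma stage_rhs_coeffs:
  assumes L: "L > 0" and V: "V j \<in> H_per L 4" "V (j + 1) \<in> H_per L 4"
  shows "stage_rhs L \<epsilon> \<kappa> V j \<in> L2_per L"
    "fc L (stage_rhs L \<epsilon> \<kappa> V j) k = spectral.rhs L UNIV (-) \<epsilon> \<kappa> (fc L (V j)) (fc L (V (j + 1))) k"
proof -
  let ?w = "\<lambda>x. L_stab L \<epsilon> \<kappa> (\<lambda>y. (V j y + V (j + 1) y) / 2) x - f_stab \<kappa> (V j x)"
  have w: "?w = (\<lambda>x. - \<epsilon>\<^sup>2 * laplacian L (\<lambda>x. (V j x + V (j + 1) x) / 2) x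
      + \<kappa> * ((V j x + V (j + 1) x) / 2) - (\<kappa> + 1) * V j x + V j x ^ 3)"
    by (rule ext) (simp add: L_stab_def f_stab_def deriv_F algebra_simps)
  show "stage_rhs L \<epsilon> \<kappa> V j \<in> L2_per L"
    "fc L (stage_rhs L \<epsilon> \<kappa> V j) k = spectral.rhs L UNIV (-) \<epsilon> \<kappa> (fc L (V j)) (fc L (V (j + 1))) k"
    unfolding stage_rhs_def by (rule rhs_coeffs[OF L V w])+
qed

lemma time_discrete_coeffs:
  assumes L: "L > 0" and U: "time_discrete_solution L \<epsilon> \<kappa> s a N t \<Phi>0 U" and \<Phi>0: "\<Phi>0 \<in> L2_per L"
    and s: "s \<ge> 2" and N: "N \<ge> 1"
  shows "\<And>n i k. n \<in> {1..N} \<Longrightarrow> i \<in> {1..s - 1} \<Longrightarrow> fc L (U n (i + 1)) k = fc L (U n 1) k + of_real (tau t n) *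
        (\<Sum>j=1..i. of_real (a (i + 1) j) * spectral.rhs L UNIV (-) \<epsilon> \<kappa> (fc L (U n j)) (fc L (U n (j + 1))) k)"
    and "fc L (U 1 1) k = fc L \<Phi>0 k"
    and "\<And>n k. n \<in> {1..<N} \<Longrightarrow> fc L (U (n + 1) 1) k = fc L (U n s) k"
proof -
  have UH: "U n i \<in> H_per L 4" if "n \<in> {1..N}" "i \<in> {1..s}" for n i
    using U that by (auto simp: time_discrete_solution_def)
  have UL: "U n i \<in> L2_per L" if "n \<in> {1..N}" "i \<in> {1..s}" for n i
    using H_per_L2 UH that by blast
  show "fc L (U 1 1) k = fc L \<Phi>0 k"
    using U UL s N \<Phi>0 by (intro fc_cong_AE) (auto simp: time_discrete_solution_def)
  show "fc L (U (n + 1) 1) k = fc L (U n s) k" if "n \<in> {1..<N}" for n k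
    using U UL[of "n + 1" 1] UL[of n s] s that by (intro fc_cong_AE) (auto simp: time_discrete_solution_def)
  fix n i k assume n: "n \<in> {1..N}" and i: "i \<in> {1..s - 1}"
  have st: "stage_rhs L \<epsilon> \<kappa> (U n) j \<in> L2_per L"
    "fc L (stage_rhs L \<epsilon> \<kappa> (U n) j) k = spectral.rhs L UNIV (-) \<epsilon> \<kappa> (fc L (U n j)) (fc L (U n (j + 1))) k"
    if "j \<in> {1..i}" for j
  proof -
    have "j \<in> {1..s}" "j + 1 \<in> {1..s}" using that i s by auto
    then have "U n j \<in> H_per L 4" "U n (j + 1) \<in> H_per L 4" using UH[OF n] by blast+
    then show "stage_rhs L \<epsilon> \<kappa> (U n) j \<in> L2_per L"
      "fc L (stage_rhs L \<epsilon> \<kappa> (U n) j) k = spectral.rhs L UNIV (-) \<epsilon> \<kappa> (fc L (U n j)) (fc L (U n (j + 1))) k"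
      by (rule stage_rhs_coeffs[OF L])+
  qed
  have S: "(\<lambda>x. \<Sum>j=1..i. a (i + 1) j * stage_rhs L \<epsilon> \<kappa> (U n) j x) \<in> L2_per L"
    "fc L (\<lambda>x. \<Sum>j=1..i. a (i + 1) j * stage_rhs L \<epsilon> \<kappa> (U n) j x) k
      = (\<Sum>j=1..i. of_real (a (i + 1) j) * fc L (stage_rhs L \<epsilon> \<kappa> (U n) j) k)"
    using L2_per_sum[OF finite_atLeastAtMost st(1) L, of 1 i "\<lambda>j. j" "\<lambda>j. a (i + 1) j"] by blast+
  have U1: "U n 1 \<in> L2_per L" "U n (i + 1) \<in> L2_per L" using UL n i by auto
  have "fc L (U n (i + 1)) k = fc L (\<lambda>x. 1 * U n 1 x + tau t n * (\<Sum>j=1..i. a (i + 1) j * stage_rhs L \<epsilon> \<kappa> (U n) j x)) k"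
    using U n i U1 by (intro fc_cong_AE L2_per_lincomb[OF U1(1) S(1)]) (auto simp: time_discrete_solution_def)
  also have "\<dots> = fc L (U n 1) k + of_real (tau t n) *
        (\<Sum>j=1..i. of_real (a (i + 1) j) * spectral.rhs L UNIV (-) \<epsilon> \<kappa> (fc L (U n j)) (fc L (U n (j + 1))) k)"
    unfolding fc_lincomb[OF U1(1) S(1)] S(2) by (simp add: st(2))
  finally show "fc L (U n (i + 1)) k = fc L (U n 1) k + of_real (tau t n) *
        (\<Sum>j=1..i. of_real (a (i + 1) j) * spectral.rhs L UNIV (-) \<epsilon> \<kappa> (fc L (U n j)) (fc L (U n (j + 1))) k)" .
qed

lemma L2_norm_nonneg: "L2_norm L v \<ge> 0"
  by (simp add: L2_norm_def set_integral_mu)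

text \<open>Translates the regularity of \<open>\<Phi>\<close> into coefficients. By
  \<open>m \<ge> 1\<close> the first time derivative lies in \<open>H^4\<close>, order 2 of
  \<open>hb\<close>; the second is used in \<open>H^2\<close>. As the stabilisation cancels in
  \<open>rhs\<close> at equal arguments, \<open>\<kappa>\<close> is arbitrary.\<close>

lemma solution_coeffs:
  assumes L: "L > 0" and T: "T > 0" and ch: "cahn_hilliard_solution L \<epsilon> T \<Phi>"
    and reg: "regular_solution L T m p C0 \<Phi>" and mp: "m \<ge> 1" "p \<ge> 1"
  obtains \<psi> where
    "\<And>t. t \<in> {0..<T} \<Longrightarrow> \<Phi> t \<in> L2_per L \<and> hb L 2 UNIV (fc L (\<Phi> t)) (C0 / L)"
    "\<And>t. t \<in> {0<..<T} \<Longrightarrow> hb L 2 UNIV (\<psi> t) (C0 / L)"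
    "\<And>t k. t \<in> {0<..<T} \<Longrightarrow> \<psi> t k = spectral.rhs L UNIV (-) \<epsilon> \<kappa> (fc L (\<Phi> t)) (fc L (\<Phi> t)) k"
    "\<And>b t. b \<in> {0<..<T} \<Longrightarrow> t \<in> {0..<T} \<Longrightarrow>
      hb L 1 UNIV (\<lambda>k. fc L (\<Phi> t) k - fc L (\<Phi> b) k - of_real (t - b) * \<psi> b k) (C0 / L / 2 * (t - b)\<^sup>2)"
proof -
  obtain \<Psi> where \<Psi>: "\<Psi> 0 = \<Phi>" "\<Phi> 0 \<in> H_per L (m + 4)"
    "\<And>k t. k \<le> p \<Longrightarrow> t \<in> {0<..<T} \<Longrightarrow> L2_has_time_derivative L (\<Psi> k) (\<Psi> (Suc k) t) t {0<..<T}"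
    "\<And>k t. k \<le> 2 \<Longrightarrow> t \<in> {0<..<T} \<Longrightarrow> \<Psi> k t \<in> H_per L (m + 4 - k)"
    "\<And>t. t \<in> {0<..<T} \<Longrightarrow> H_norm L (m + 4) (\<Phi> 0) + (\<Sum>k\<le>2. H_norm L (m + 4 - k) (\<Psi> k t))
             + (\<Sum>k=3..p+1. L2_norm L (\<Psi> k t)) \<le> C0"
    using reg unfolding regular_solution_def by blast
  have sum: "H_norm L (m + 4) (\<Phi> 0) + (H_norm L (m + 4) (\<Psi> 0 t) + H_norm L (m + 3) (\<Psi> 1 t) + H_norm L (m + 2) (\<Psi> 2 t)) \<le> C0"
    if "t \<in> {0<..<T}" for t
  proof -
    have "(\<Sum>k=3..p+1. L2_norm L (\<Psi> k t)) \<ge> 0" by (intro sum_nonneg L2_norm_nonneg)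
    moreover have "(\<Sum>k\<le>2. H_norm L (m + 4 - k) (\<Psi> k t)) = H_norm L (m + 4) (\<Psi> 0 t) + H_norm L (m + 3) (\<Psi> 1 t) + H_norm L (m + 2) (\<Psi> 2 t)"
      by (simp add: numeral_2_eq_2 numeral_3_eq_3 eval_nat_numeral)
    ultimately show ?thesis using \<Psi>(5)[OF that] by linarith
  qed
  note nn = H_norm_nonneg[OF L]
  have n0: "H_norm L (m + 4) (\<Phi> 0) \<le> C0"
    using sum[of "T / 2"] nn[of "m + 4" "\<Psi> 0 (T / 2)"] nn[of "m + 3" "\<Psi> 1 (T / 2)"] nn[of "m + 2" "\<Psi> 2 (T / 2)"] T by simp
  have nt: "H_norm L (m + 4) (\<Psi> 0 t) \<le> C0" "H_norm L (m + 3) (\<Psi> 1 t) \<le> C0" "H_norm L (m + 2) (\<Psi> 2 t) \<le> C0"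
    if "t \<in> {0<..<T}" for t
    using sum[OF that] nn[of "m + 4" "\<Phi> 0"] nn[of "m + 4" "\<Psi> 0 t"] nn[of "m + 3" "\<Psi> 1 t"] nn[of "m + 2" "\<Psi> 2 t"] by linarith+
  define \<phi> where "\<phi> t = fc L (\<Phi> t)" for t
  define \<psi> where "\<psi> t = fc L (\<Psi> 1 t)" for t
  define \<omega> where "\<omega> t = fc L (\<Psi> 2 t)" for t
  have H\<phi>: "hb L 2 UNIV (\<phi> t) (C0 / L)" if "t \<in> {0..<T}" for t
  proof (cases "t = 0")
    case True
    then show ?thesis unfolding \<phi>_def using H_per_hb[OF L \<Psi>(2) _ n0, of 2] by simp
  next
    case False
    then have t: "t \<in> {0<..<T}" using that by auto
    show ?thesis unfolding \<phi>_def using H_per_hb[OF L \<Psi>(4)[OF _ t, of 0] _ , of 2] nt(1)[OF t] \<Psi>(1) by simp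
  qed
  have H\<psi>: "hb L 2 UNIV (\<psi> t) (C0 / L)" if t: "t \<in> {0<..<T}" for t
    unfolding \<psi>_def using H_per_hb[OF L \<Psi>(4)[OF _ t, of 1] _ , of 2] nt(2)[OF t] mp by (simp add: eval_nat_numeral)
  have H\<omega>: "hb L 1 UNIV (\<omega> t) (C0 / L)" if t: "t \<in> {0<..<T}" for t
    unfolding \<omega>_def using H_per_hb[OF L \<Psi>(4)[OF _ t, of 2] _ , of 1] nt(3)[OF t] mp by (simp add: eval_nat_numeral)
  have at: "at t within {0<..<T} = at t" if "t \<in> {0<..<T}" for t :: real
    using that by (intro at_within_open) auto
  have d1: "((\<lambda>s. Re (z * \<phi> s k)) has_real_derivative Re (z * \<psi> t k)) (at t)" if t: "t \<in> {0<..<T}" for t k z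
    using time_derivative_coeff_real[OF L \<Psi>(3)[OF _ t, of 0] t, of z k] \<Psi>(1)
    unfolding at[OF t] \<phi>_def \<psi>_def by simp
  have d2: "((\<lambda>s. Re (z * \<psi> s k)) has_real_derivative Re (z * \<omega> t k)) (at t)" if t: "t \<in> {0<..<T}" for t k z
    using time_derivative_coeff_real[OF L \<Psi>(3)[OF _ t, of 1] t, of z k] mp
    unfolding at[OF t] \<psi>_def \<omega>_def by (simp add: numeral_2_eq_2)
  have \<Phi>L: "\<Phi> t \<in> L2_per L" if "t \<in> {0..T}" for t
    using ch that by (auto simp: cahn_hilliard_solution_def)
  \<comment> \<open>The time derivatives live on the open interval, so continuity at 0 is taken from
    the attainment of the initial datum.\<close>
  have cont: "((\<lambda>s. \<phi> s k) \<longlongrightarrow> \<phi> 0 k) (at_right 0)" for k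
  proof -
    have l0: "((\<lambda>s. L2_norm L (\<lambda>x. \<Phi> s x - \<Phi> 0 x)) \<longlongrightarrow> 0) (at 0 within {0..T})"
      using ch by (simp add: cahn_hilliard_solution_def)
    have le: "at_right 0 \<le> at 0 within {0..T}"
      using T by (simp add: at_within_Icc_at_right)
    have "((\<lambda>s. L2_norm L (\<lambda>x. \<Phi> s x - \<Phi> 0 x) / L) \<longlongrightarrow> 0) (at_right 0)"
      using tendsto_divide[OF tendsto_mono[OF le l0] tendsto_const[of L]] L by simp
    moreover have "\<forall>\<^sub>F s in at_right 0. cmod (\<phi> s k - \<phi> 0 k) \<le> L2_norm L (\<lambda>x. \<Phi> s x - \<Phi> 0 x) / L"
    proof -
      have "\<forall>\<^sub>F s in at_right 0. s \<in> {0<..<T}" using T by (rule eventually_at_right_real)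
      then show ?thesis
      proof eventually_elim
        case (elim s)
        have v: "\<Phi> s \<in> L2_per L" "\<Phi> 0 \<in> L2_per L" using elim \<Phi>L T by auto
        show ?case unfolding \<phi>_def fc_diff(2)[OF v, symmetric] by (rule norm_fc_le[OF L fc_diff(1)[OF v]])
      qed
    qed
    ultimately have "((\<lambda>s. \<phi> s k - \<phi> 0 k) \<longlongrightarrow> 0) (at_right 0)"
      by (rule Lim_null_comparison[rotated])
    then show ?thesis by (simp only: LIM_zero_iff)
  qed
  \<comment> \<open>The derivative in the equation is relative to the closed interval, the one in
    the regularity assumption to the open one; uniqueness of limits identifies them coefficient by
    coefficient.\<close>
  have pde: "\<psi> t k = spectral.rhs L UNIV (-) \<epsilon> \<kappa> (\<phi> t) (\<phi> t) k" if t: "t \<in> {0<..<T}" for t k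
  proof -
    let ?g = "laplacian L (\<lambda>x. deriv F (\<Phi> t x) - \<epsilon>\<^sup>2 * laplacian L (\<Phi> t) x)"
    have \<Phi>4: "\<Phi> t \<in> H_per L 4" and D: "L2_has_time_derivative L \<Phi> ?g t {0..T}"
      using ch t by (auto simp: cahn_hilliard_solution_def)
    have t': "t \<in> {0..T}" using t by auto
    have "((\<lambda>s. (\<phi> s k - \<phi> t k) / of_real (s - t)) \<longlongrightarrow> fc L ?g k) (at t)"
      unfolding \<phi>_def at[OF t, symmetric]
      by (rule tendsto_within_subset[OF time_derivative_coeff[OF L D t']]) auto
    moreover have "((\<lambda>s. (\<phi> s k - \<phi> t k) / of_real (s - t)) \<longlongrightarrow> \<psi> t k) (at t)"
      using time_derivative_coeff[OF L \<Psi>(3)[OF _ t, of 0] t, of k] \<Psi>(1)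
      unfolding at[OF t] \<phi>_def \<psi>_def by simp
    ultimately have "\<psi> t k = fc L ?g k"
      using tendsto_unique[OF trivial_limit_at] by blast
    also have "\<dots> = spectral.rhs L UNIV (-) \<epsilon> \<kappa> (\<phi> t) (\<phi> t) k"
      unfolding \<phi>_def
      by (rule rhs_coeffs(2)[OF L \<Phi>4 \<Phi>4]) (rule ext, simp add: deriv_F algebra_simps)
    finally show ?thesis .
  qed
  show ?thesis
  proof (rule that[of \<psi>])
    fix b t assume bt: "b \<in> {0<..<T}" "t \<in> {0..<T}"
    show "hb L 1 UNIV (\<lambda>k. fc L (\<Phi> t) k - fc L (\<Phi> b) k - of_real (t - b) * \<psi> b k) (C0 / L / 2 * (t - b)\<^sup>2)"
      using taylor_remainder[of T \<phi> \<psi> \<omega>, OF d1 d2 H\<omega> cont bt] unfolding \<phi>_def .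
  next
    fix t assume t: "t \<in> {0..<T}"
    then show "\<Phi> t \<in> L2_per L \<and> hb L 2 UNIV (fc L (\<Phi> t)) (C0 / L)"
      using H\<phi>[OF t] \<Phi>L[of t] by (simp add: \<phi>_def)
  qed (use H\<psi> pde in \<open>auto simp: \<phi>_def\<close>)
qed

section \<open>Comparison with the reference solution\<close>

text \<open>On the full lattice nothing wraps, so any positive \<open>\<rho>\<close> is admissible;
  the comparison below thereby covers the time-discrete solution as well.\<close>

lemma aliasing_UNIV: "L > 0 \<Longrightarrow> \<rho> > 0 \<Longrightarrow> aliasing L UNIV (-) \<rho>"
  by (intro aliasing.intro aliasing_axioms.intro spectral_UNIV) auto

text \<open>
  The reference solution is affine in time on each step, so that no values of the exact solution beyond
  \<open>T\<close> enter even if an abscissa exceeds \<open>1\<close>. As derivatives are only available on the open interval,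
  the first step is expanded about its midpoint.
\<close>

definition base_time :: "(nat \<Rightarrow> real) \<Rightarrow> nat \<Rightarrow> real" where
  "base_time t n = (if n = 1 then t 1 / 2 else t (n - 1))"

definition reference ::
  "(nat \<Rightarrow> nat \<Rightarrow> real) \<Rightarrow> (real \<Rightarrow> int \<times> int \<Rightarrow> complex) \<Rightarrow> (real \<Rightarrow> int \<times> int \<Rightarrow> complex) \<Rightarrow>
   (nat \<Rightarrow> real) \<Rightarrow> nat \<Rightarrow> nat \<Rightarrow> int \<times> int \<Rightarrow> complex" where
  "reference a \<phi> \<psi> t n i k = \<phi> (base_time t n) k
     + of_real (t (n - 1) + abscissa a i * tau t n - base_time t n) * \<psi> (base_time t n) k"

definition abscissa_sum :: "nat \<Rightarrow> (nat \<Rightarrow> nat \<Rightarrow> real) \<Rightarrow> real" where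
  "abscissa_sum s a = (\<Sum>i=1..s. \<bar>abscissa a i\<bar>)"

lemma time_mesh_bounds:
  assumes m: "time_mesh T N t" and n: "n \<in> {1..N}"
  shows "tau t n \<le> max_tau t N" "0 \<le> t (n - 1)" "t n \<le> T" "base_time t n \<in> {0<..<T}"
    "\<bar>t (n - 1) - base_time t n\<bar> \<le> tau t n" "\<bar>t n - base_time t n\<bar> \<le> tau t n"
proof -
  have t: "t 0 = 0" "t N = T" "t (n - 1) < t n" using m n by (auto simp: time_mesh_def)
  show "tau t n \<le> max_tau t N" unfolding max_tau_def using n by (intro Max_ge) auto
  show 0: "0 \<le> t (n - 1)" using time_mesh_le[OF m, of 0 "n - 1"] n t by auto
  show T: "t n \<le> T" using time_mesh_le[OF m, of n N] n t by auto
  have "0 < t (n - 1)" if "n \<noteq> 1"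
  proof -
    have "t 0 < t 1" using m n by (auto simp: time_mesh_def dest!: bspec[of _ _ "1::nat"])
    moreover have "t 1 \<le> t (n - 1)" using time_mesh_le[OF m, of 1 "n - 1"] n that by auto
    ultimately show ?thesis using t by simp
  qed
  then show "base_time t n \<in> {0<..<T}" "\<bar>t (n - 1) - base_time t n\<bar> \<le> tau t n" "\<bar>t n - base_time t n\<bar> \<le> tau t n"
    using t T 0 by (auto simp: base_time_def tau_def)
qed

text \<open>The reference has constant slope \<open>\<psi> (b n)\<close> in a step, and the
  coefficients of a stage add up to its abscissa, so it solves the scheme up to the defect
  \<open>z\<close>. By the equation, \<open>z\<close> is a difference of right-hand sides over a
  time of order \<open>\<tau>\<close> plus an aliasing error; jumps between steps are Taylor
  remainders of order two.\<close>

lemma reference_comparison: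
  fixes \<phi> \<psi> :: "real \<Rightarrow> int \<times> int \<Rightarrow> complex"
  assumes L: "L > 0" and par: "\<epsilon> > 0" "\<kappa> \<ge> 0" and r: "rierk_method s a" and pd: "pos_def (D_R s a)"
    and R: "R \<ge> 0"
    and \<phi>: "\<And>t. t \<in> {0..<T} \<Longrightarrow> hb L 2 UNIV (\<phi> t) R"
    and \<psi>: "\<And>t. t \<in> {0<..<T} \<Longrightarrow> hb L 2 UNIV (\<psi> t) R"
    and pde: "\<And>t k. t \<in> {0<..<T} \<Longrightarrow> \<psi> t k = spectral.rhs L UNIV (-) \<epsilon> \<kappa> (\<phi> t) (\<phi> t) k"
    and taylor: "\<And>b t. b \<in> {0<..<T} \<Longrightarrow> t \<in> {0..<T} \<Longrightarrow>
      hb L 1 UNIV (\<lambda>k. \<phi> t k - \<phi> b k - of_real (t - b) * \<psi> b k) (R / 2 * (t - b)\<^sup>2)"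
  shows "\<exists>C>0. \<exists>E>0. \<forall>K sg \<rho> N t c. aliasing L K sg \<rho> \<longrightarrow> time_mesh T N t \<longrightarrow>
    (abscissa_sum s a + 1) * max_tau t N \<le> 1 \<longrightarrow>
    rk_stages K s a N t c (\<lambda>n j. spectral.rhs L K sg \<epsilon> \<kappa> (c n j) (c n (j + 1))) \<longrightarrow>
    (\<forall>n\<in>{1..<N}. \<forall>k\<in>K. c (n + 1) 1 k = c n s k) \<longrightarrow>
    hb L 1 K (\<lambda>k. c 1 1 k - \<phi> 0 k) (R / \<rho>) \<longrightarrow>
    C * (E * (max_tau t N + 1 / \<rho>)) \<le> 1 \<longrightarrow>
    (\<forall>n\<in>{1..N}. \<forall>i\<in>{1..s}. hb L 1 K (\<lambda>k. c n i k - reference a \<phi> \<psi> t n i k) (C * (E * (max_tau t N + 1 / \<rho>))))"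
proof -
  define A where "A = abscissa_sum s a"
  have A0: "A \<ge> 0" by (simp add: A_def abscissa_sum_def sum_nonneg)
  \<comment> \<open>\<open>Z1\<close> comes from \<open>rhs_diff_hb\<close> at radius
    \<open>2 * R\<close>, the reference moving by at most \<open>(A + 1) * \<tau> * R\<close> within
    a step; \<open>Z2\<close> is the constant of \<open>rhs_aliasing\<close> at the same
    radius.\<close>
  define Z1 where "Z1 = (\<epsilon>\<^sup>2 + 2 * \<kappa> + 1 + 3 * (conv_const L 1)\<^sup>2 * (2 * R)\<^sup>2) * ((A + 1) * R)"
  define Z2 where "Z2 = 2 * conv_const L 1 * (conv_const L 1 + conv_const L 2) * (2 * R) ^ 3"
  define E where "E = Z1 + Z2 + R + 1"
  have Z0: "Z1 \<ge> 0" "Z2 \<ge> 0"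
    unfolding Z1_def Z2_def
    by (intro mult_nonneg_nonneg add_nonneg_nonneg zero_le_power zero_le_power2 conv_const_nonneg[OF L] R A0 par
      zero_le_one zero_le_numeral)+
  have E: "E > 0" "Z1 \<le> E" "Z2 \<le> E" "R \<le> E" using Z0 R by (auto simp: E_def)
  obtain C where C: "C > 0" and stab: "\<forall>K sg N t c w z \<eta>. spectral L K sg \<longrightarrow> time_mesh T N t \<longrightarrow>
    rk_stages K s a N t c (\<lambda>n j. spectral.rhs L K sg \<epsilon> \<kappa> (c n j) (c n (j + 1))) \<longrightarrow>
    rk_stages K s a N t w (\<lambda>n j k. spectral.rhs L K sg \<epsilon> \<kappa> (w n j) (w n (j + 1)) k + z n j k) \<longrightarrow>
    (\<forall>n\<in>{1..<N}. \<forall>k\<in>K. c (n + 1) 1 k = c n s k) \<longrightarrow>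
    (\<forall>n\<in>{1..N}. \<forall>i\<in>{1..s}. hb L 1 K (w n i) (2 * R)) \<longrightarrow>
    (\<forall>n\<in>{1..N}. \<forall>j\<in>{1..s - 1}. hb L 0 K (z n j) \<eta> \<and> (\<forall>k\<in>K. lam L k = 0 \<longrightarrow> z n j k = 0)) \<longrightarrow>
    hb L 1 K (\<lambda>k. c 1 1 k - w 1 1 k) \<eta> \<longrightarrow>
    (\<forall>n\<in>{1..<N}. hb L 1 K (\<lambda>k. w n s k - w (n + 1) 1 k) (\<eta> * tau t n)) \<longrightarrow>
    C * \<eta> \<le> 1 \<longrightarrow>
    (\<forall>n\<in>{1..N}. \<forall>i\<in>{1..s}. hb L 1 K (\<lambda>k. c n i k - w n i k) (C * \<eta>))"
    using stability[OF L par r pd, of T "2 * R"] by (elim exE conjE) (rule that)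
  show ?thesis
  proof (rule exI[of _ C], rule conjI[OF C], rule exI[of _ E], rule conjI[OF E(1)], intro allI impI)
    fix K sg \<rho> N t and c :: "nat \<Rightarrow> nat \<Rightarrow> int \<times> int \<Rightarrow> complex"
    assume al: "aliasing L K sg \<rho>" and mesh: "time_mesh T N t"
      and step: "(abscissa_sum s a + 1) * max_tau t N \<le> 1"
      and scheme: "rk_stages K s a N t c (\<lambda>n j. spectral.rhs L K sg \<epsilon> \<kappa> (c n j) (c n (j + 1)))"
      and cj: "\<forall>n\<in>{1..<N}. \<forall>k\<in>K. c (n + 1) 1 k = c n s k"
      and init: "hb L 1 K (\<lambda>k. c 1 1 k - \<phi> 0 k) (R / \<rho>)"
      and small: "C * (E * (max_tau t N + 1 / \<rho>)) \<le> 1"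
    interpret aliasing L K sg \<rho> by (rule al)
    define \<tau> where "\<tau> = max_tau t N"
    define \<eta> where "\<eta> = E * (\<tau> + 1 / \<rho>)"
    define w where "w = reference a \<phi> \<psi> t"
    define b where "b n = base_time t n" for n
    define \<theta> where "\<theta> n i = t (n - 1) + abscissa a i * tau t n - b n" for n i
    define z where "z n j k = \<psi> (b n) k - rhs \<epsilon> \<kappa> (w n j) (w n (j + 1)) k" for n j k
    note B = time_mesh_bounds[OF mesh]
    have N1: "1 \<in> {1..N}" using mesh by (auto simp: time_mesh_def)
    have \<tau>0: "\<tau> > 0" using tau_pos[OF mesh N1] B(1)[OF N1] by (simp add: \<tau>_def)
    have \<tau>1: "\<tau> \<le> 1" and A\<tau>: "(A + 1) * \<tau> \<le> 1"
    proof -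
      show *: "(A + 1) * \<tau> \<le> 1" using step by (simp add: A_def \<tau>_def)
      have "1 * \<tau> \<le> (A + 1) * \<tau>" using A0 \<tau>0 by (intro mult_right_mono) auto
      then show "\<tau> \<le> 1" using * by simp
    qed
    have ts: "tau t n \<le> \<tau>" "tau t n > 0" if "n \<in> {1..N}" for n
      using B(1)[OF that] tau_pos[OF mesh that] by (auto simp: \<tau>_def)
    have bT: "b n \<in> {0<..<T}" "b n \<in> {0..<T}" if "n \<in> {1..N}" for n
      using B(4)[OF that] by (auto simp: b_def)
    have w_eq: "w n i k = \<phi> (b n) k + of_real (\<theta> n i) * \<psi> (b n) k" for n i k
      by (simp add: w_def reference_def b_def \<theta>_def)
    have \<theta>: "\<bar>\<theta> n i\<bar> \<le> (A + 1) * \<tau>" if n: "n \<in> {1..N}" and i: "i \<in> {1..s}" for n i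
    proof -
      have "\<bar>abscissa a i\<bar> \<le> A"
        unfolding A_def abscissa_sum_def using i by (intro member_le_sum) auto
      then have "\<bar>abscissa a i * tau t n\<bar> \<le> A * tau t n"
        using ts(2)[OF n] by (simp add: abs_mult mult_right_mono)
      moreover have "\<bar>t (n - 1) - b n\<bar> \<le> tau t n" using B(5)[OF n] by (simp add: b_def)
      ultimately have "\<bar>\<theta> n i\<bar> \<le> A * tau t n + tau t n" unfolding \<theta>_def by linarith
      also have "\<dots> = (A + 1) * tau t n" by (simp add: distrib_right)
      also have "\<dots> \<le> (A + 1) * \<tau>" using ts(1)[OF n] A0 by (intro mult_left_mono) auto
      finally show ?thesis .
    qed
    have \<theta>\<psi>: "hb L 2 UNIV (\<lambda>k. of_real (\<theta> n i) * \<psi> (b n) k) ((A + 1) * \<tau> * R)"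
      if n: "n \<in> {1..N}" and i: "i \<in> {1..s}" for n i
    proof (rule wbound_le[OF wbound_scale[OF \<psi>[OF bT(1)[OF n]]]])
      show "cmod (of_real (\<theta> n i)) * R \<le> (A + 1) * \<tau> * R"
        using \<theta>[OF n i] R by (simp add: mult_right_mono)
    qed
    \<comment> \<open>The restriction \<open>(A + 1) * \<tau> \<le> 1\<close> keeps the reference
      within twice the radius of the exact solution.\<close>
    have w2: "hb L 2 UNIV (w n i) (2 * R)" if n: "n \<in> {1..N}" and i: "i \<in> {1..s}" for n i
    proof -
      have "hb L 2 UNIV (\<lambda>k. \<phi> (b n) k + of_real (\<theta> n i) * \<psi> (b n) k) (R + (A + 1) * \<tau> * R)"
        by (intro wbound_add \<phi> bT(2)[OF n] \<theta>\<psi>[OF n i]) auto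
      moreover have "R + (A + 1) * \<tau> * R \<le> 2 * R"
        using mult_right_mono[OF A\<tau> R] by simp
      ultimately show ?thesis unfolding w_eq[abs_def] by (rule wbound_le)
    qed
    have \<rho>0: "1 / \<rho> > 0" using \<rho> by simp
    have "hb L 1 K (\<lambda>k. c n i k - w n i k) (C * \<eta>)" if "n \<in> {1..N}" "i \<in> {1..s}" for n i
    proof -
      have "\<forall>n\<in>{1..N}. \<forall>i\<in>{1..s}. hb L 1 K (\<lambda>k. c n i k - w n i k) (C * \<eta>)"
      proof (rule stab[THEN spec[of _ K], THEN spec[of _ sg], THEN spec[of _ N], THEN spec[of _ t], THEN spec[of _ c],
          THEN spec[of _ w], THEN spec[of _ z], THEN spec[of _ \<eta>], THEN mp, THEN mp, THEN mp, THEN mp, THEN mp,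
          THEN mp, THEN mp, THEN mp, THEN mp, THEN mp, OF spectral_axioms mesh scheme _ cj])
        show "C * \<eta> \<le> 1" using small by (simp add: \<eta>_def \<tau>_def)
        show "\<forall>n\<in>{1..N}. \<forall>i\<in>{1..s - 1}. \<forall>k\<in>K. w n (i + 1) k = w n 1 k + of_real (tau t n) *
          (\<Sum>j=1..i. of_real (a (i + 1) j) * (rhs \<epsilon> \<kappa> (w n j) (w n (j + 1)) k + z n j k))"
        proof (intro ballI)
          fix n i k
          have "(\<Sum>j=1..i. of_real (a (i + 1) j) * (rhs \<epsilon> \<kappa> (w n j) (w n (j + 1)) k + z n j k))
              = of_real (abscissa a (i + 1)) * \<psi> (b n) k"
            by (simp add: z_def abscissa_def sum_distrib_right)
          moreover have "\<theta> n (i + 1) = \<theta> n 1 + tau t n * abscissa a (i + 1)"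
            by (simp add: \<theta>_def abscissa_def)
          ultimately show "w n (i + 1) k = w n 1 k + of_real (tau t n) *
            (\<Sum>j=1..i. of_real (a (i + 1) j) * (rhs \<epsilon> \<kappa> (w n j) (w n (j + 1)) k + z n j k))"
            unfolding w_eq by (simp add: algebra_simps)
        qed
        show "\<forall>n\<in>{1..N}. \<forall>i\<in>{1..s}. hb L 1 K (w n i) (2 * R)"
        proof (intro ballI)
          fix n i assume "n \<in> {1..N}" "i \<in> {1..s}"
          from wbound_subset[OF w2[OF this] subset_UNIV]
          show "hb L 1 K (w n i) (2 * R)" by (rule hb_lower) simp
        qed
        show "\<forall>n\<in>{1..N}. \<forall>j\<in>{1..s - 1}. hb L 0 K (z n j) \<eta> \<and> (\<forall>k\<in>K. lam L k = 0 \<longrightarrow> z n j k = 0)"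
        proof (intro ballI conjI allI impI)
          fix n j assume n: "n \<in> {1..N}" and j: "j \<in> {1..s - 1}"
          have js: "j \<in> {1..s}" "j + 1 \<in> {1..s}" using j by auto
          show "z n j k = 0" if "lam L k = 0" for k
            using that by (simp add: z_def pde[OF bT(1)[OF n]] rhs_def full.rhs_def)
          have \<phi>1: "hb L 1 UNIV (\<phi> (b n)) (2 * R)"
            by (rule hb_lower[OF wbound_le[OF \<phi>[OF bT(2)[OF n]]]]) (use R in auto)
          have w1: "hb L 1 UNIV (w n j) (2 * R)"
            by (rule hb_lower[OF w2[OF n js(1)]]) simp
          have d: "hb L 2 UNIV (\<lambda>k. \<phi> (b n) k - w n i k) ((A + 1) * \<tau> * R)" if i: "i \<in> {1..s}" for i
            by (rule wbound_mono[OF \<theta>\<psi>[OF n i] order_refl]) (auto simp: w_eq)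
          have "hb L 0 UNIV (\<lambda>k. full.rhs \<epsilon> \<kappa> (\<phi> (b n)) (\<phi> (b n)) k - full.rhs \<epsilon> \<kappa> (w n j) (w n (j + 1)) k)
            ((\<epsilon>\<^sup>2 + 2 * \<kappa> + 1 + 3 * (conv_const L 1)\<^sup>2 * (2 * R)\<^sup>2) * ((A + 1) * \<tau> * R))"
            by (rule full.rhs_diff_hb[OF par(2) \<phi>1 w1 d[OF js(1)] d[OF js(2)]])
          also have "(\<epsilon>\<^sup>2 + 2 * \<kappa> + 1 + 3 * (conv_const L 1)\<^sup>2 * (2 * R)\<^sup>2) * ((A + 1) * \<tau> * R) = Z1 * \<tau>"
            by (simp add: Z1_def)
          finally have 1: "hb L 0 UNIV (\<lambda>k. full.rhs \<epsilon> \<kappa> (\<phi> (b n)) (\<phi> (b n)) k - full.rhs \<epsilon> \<kappa> (w n j) (w n (j + 1)) k) (Z1 * \<tau>)" .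
          have "hb L 0 K (\<lambda>k. full.rhs \<epsilon> \<kappa> (w n j) (w n (j + 1)) k - rhs \<epsilon> \<kappa> (w n j) (w n (j + 1)) k) (Z2 / \<rho>)"
            unfolding Z2_def by (rule rhs_aliasing[OF w2[OF n js(1)]])
          from wbound_add[OF wbound_subset[OF 1 subset_UNIV] this]
          have "hb L 0 K (z n j) (Z1 * \<tau> + Z2 / \<rho>)"
            by (simp add: z_def[abs_def] pde[OF bT(1)[OF n]])
          moreover have "Z1 * \<tau> + Z2 / \<rho> \<le> \<eta>"
          proof -
            have "Z1 * \<tau> \<le> E * \<tau>" using E \<tau>0 by (intro mult_right_mono) auto
            moreover have "Z2 * (1 / \<rho>) \<le> E * (1 / \<rho>)" using E \<rho>0 by (intro mult_right_mono) auto
            ultimately show ?thesis by (simp add: \<eta>_def distrib_left)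
          qed
          ultimately show "hb L 0 K (z n j) \<eta>" by (rule wbound_le)
        qed
        have tay: "hb L 1 K (\<lambda>k. \<phi> x k - \<phi> (b n) k - of_real (x - b n) * \<psi> (b n) k) (R / 2 * (tau t n)\<^sup>2)"
          if n: "n \<in> {1..N}" and x: "x \<in> {0..<T}" "\<bar>x - b n\<bar> \<le> tau t n" for n x
        proof (rule wbound_le[OF wbound_subset[OF taylor[OF bT(1)[OF n] x(1)] subset_UNIV]])
          have "\<bar>x - b n\<bar>\<^sup>2 \<le> (tau t n)\<^sup>2" using x(2) by (intro power_mono) auto
          then show "R / 2 * (x - b n)\<^sup>2 \<le> R / 2 * (tau t n)\<^sup>2" using R by (intro mult_left_mono) auto
        qed
        \<comment> \<open>One factor of the local step size is kept because jumps are measured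
          against \<open>\<eta> * tau t n\<close>.\<close>
        have half: "R / 2 * x\<^sup>2 \<le> R * \<tau> * x" if "0 < x" "x \<le> \<tau>" for x
        proof -
          have "R / 2 * x\<^sup>2 = R * x * (x / 2)" by (simp add: power2_eq_square)
          also have "\<dots> \<le> R * x * \<tau>" using that R by (intro mult_left_mono) auto
          finally show ?thesis by (simp add: mult_ac)
        qed
        show "hb L 1 K (\<lambda>k. c 1 1 k - w 1 1 k) \<eta>"
        proof -
          have t0: "t 0 = 0" and T: "T > 0" using mesh bT(1)[OF N1] by (auto simp: time_mesh_def)
          have "\<bar>0 - b 1\<bar> \<le> tau t 1" using B(5)[OF N1] t0 by (simp add: b_def)
          from tay[OF N1 _ this] T
          have "hb L 1 K (\<lambda>k. \<phi> 0 k - \<phi> (b 1) k - of_real (0 - b 1) * \<psi> (b 1) k) (R / 2 * (tau t 1)\<^sup>2)" by simp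
          from wbound_add[OF init this]
          have "hb L 1 K (\<lambda>k. c 1 1 k - \<phi> 0 k + (\<phi> 0 k - \<phi> (b 1) k - of_real (0 - b 1) * \<psi> (b 1) k)) (R / \<rho> + R / 2 * (tau t 1)\<^sup>2)"
            by simp
          moreover have "R / \<rho> + R / 2 * (tau t 1)\<^sup>2 \<le> \<eta>"
          proof -
            have "R * (1 / \<rho>) \<le> E * (1 / \<rho>)" using E \<rho>0 by (intro mult_right_mono) auto
            moreover have "R / 2 * (tau t 1)\<^sup>2 \<le> E * \<tau>"
            proof -
              have "R / 2 * (tau t 1)\<^sup>2 \<le> R * \<tau> * tau t 1" using ts[OF N1] by (intro half) auto
              also have "\<dots> \<le> R * \<tau> * 1" using R \<tau>0 \<tau>1 ts[OF N1] by (intro mult_left_mono) auto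
              also have "\<dots> \<le> E * \<tau>" using E \<tau>0 by (simp add: mult_right_mono)
              finally show ?thesis .
            qed
            ultimately show ?thesis by (simp add: \<eta>_def distrib_left)
          qed
          ultimately have h: "hb L 1 K (\<lambda>k. c 1 1 k - \<phi> 0 k + (\<phi> 0 k - \<phi> (b 1) k - of_real (0 - b 1) * \<psi> (b 1) k)) \<eta>"
            by (rule wbound_le)
          have "\<theta> 1 1 = 0 - b 1" by (simp add: \<theta>_def abscissa_def t0)
          then show ?thesis using h by (simp add: w_eq algebra_simps)
        qed
        show "\<forall>n\<in>{1..<N}. hb L 1 K (\<lambda>k. w n s k - w (n + 1) 1 k) (\<eta> * tau t n)"
        proof
          fix n assume n': "n \<in> {1..<N}"
          then have n: "n \<in> {1..N}" and n1: "n + 1 \<in> {1..N}" by auto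
          have tT: "t n \<in> {0..<T}"
          proof -
            have "t n < t (n + 1)" using mesh n1 by (auto simp: time_mesh_def dest!: bspec[of _ _ "Suc n"])
            moreover have "0 \<le> t n" using time_mesh_le[OF mesh, of 0 n] n mesh by (auto simp: time_mesh_def)
            ultimately show ?thesis using B(3)[OF n1] by simp
          qed
          have "hb L 1 K (\<lambda>k. \<phi> (t n) k - \<phi> (b n) k - of_real (t n - b n) * \<psi> (b n) k) (R / 2 * (tau t n)\<^sup>2)"
            using B(6)[OF n] by (intro tay[OF n tT]) (simp add: b_def)
          moreover have "R / 2 * (tau t n)\<^sup>2 \<le> \<eta> * tau t n"
          proof -
            have "R / 2 * (tau t n)\<^sup>2 \<le> R * \<tau> * tau t n" using ts[OF n] by (intro half) auto
            also have "\<dots> \<le> \<eta> * tau t n"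
            proof (rule mult_right_mono)
              have "R * \<tau> \<le> E * \<tau>" using E \<tau>0 by (intro mult_right_mono) auto
              also have "\<dots> \<le> \<eta>" using E \<rho>0 by (simp add: \<eta>_def distrib_left)
              finally show "R * \<tau> \<le> \<eta>" .
            qed (use ts[OF n] in simp)
            finally show ?thesis .
          qed
          ultimately have h: "hb L 1 K (\<lambda>k. \<phi> (t n) k - \<phi> (b n) k - of_real (t n - b n) * \<psi> (b n) k) (\<eta> * tau t n)"
            by (rule wbound_le)
          \<comment> \<open>From the second step on the base point is the left endpoint, so the next
            step starts on the exact solution and the jump is a pure Taylor remainder.\<close>
          have b1: "b (n + 1) = t n" using n by (simp add: b_def base_time_def)
          have "w (n + 1) 1 k = \<phi> (t n) k" for k
            using b1 by (simp add: w_eq \<theta>_def abscissa_def)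
          moreover have "\<theta> n s = t n - b n"
            using r by (simp add: \<theta>_def rierk_method_def tau_def)
          ultimately have "w (n + 1) 1 k - w n s k = \<phi> (t n) k - \<phi> (b n) k - of_real (t n - b n) * \<psi> (b n) k" for k
            by (simp add: w_eq)
          then have "hb L 1 K (\<lambda>k. w (n + 1) 1 k - w n s k) (\<eta> * tau t n)" using h by simp
          then show "hb L 1 K (\<lambda>k. w n s k - w (n + 1) 1 k) (\<eta> * tau t n)"
            by (simp only: wbound_minus_commute)
        qed
      qed
      then show ?thesis using that by blast
    qed
    then show "\<forall>n\<in>{1..N}. \<forall>i\<in>{1..s}. hb L 1 K (\<lambda>k. c n i k - reference a \<phi> \<psi> t n i k) (C * (E * (max_tau t N + 1 / \<rho>)))"
      by (simp add: w_def \<eta>_def \<tau>_def)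
  qed
qed

section \<open>From coefficients back to grid values, and the theorem\<close>

context periodic_grid
begin

text \<open>Since \<open>rhoM\<close> is \<open>pi^2 / (4 h^2)\<close> and
  \<open>pi \<ge> 2\<close>, the quotient is at most \<open>h^2\<close>; for
  \<open>h \<le> 1\<close> the linear bound follows and gives a threshold for \<open>h\<close>
  directly.\<close>

lemma inverse_rhoM_le:
  assumes "L / real M \<le> 1"
  shows "1 / rhoM \<le> L / real M"
proof -
  define h where "h = L / real M"
  have h: "h > 0" "h \<le> 1" using M L assms by (auto simp: h_def)
  have "rhoM = pi\<^sup>2 / 4 * (1 / h\<^sup>2)"
    using M L by (simp add: rhoM_def freq_def h_def field_simps power2_eq_square)
  moreover have "1 * (1 / h\<^sup>2) \<le> pi\<^sup>2 / 4 * (1 / h\<^sup>2)"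
  proof (rule mult_right_mono)
    have "2\<^sup>2 \<le> pi\<^sup>2" using pi_ge_two by (intro power_mono) auto
    then show "1 \<le> pi\<^sup>2 / 4" by simp
  qed (use h in simp)
  ultimately have "1 / h\<^sup>2 \<le> rhoM" by simp
  then have "1 / rhoM \<le> 1 / (1 / h\<^sup>2)"
    using h by (intro divide_left_mono mult_pos_pos rhoM_pos) auto
  also have "\<dots> = h * h" by (simp add: power2_eq_square)
  also have "\<dots> \<le> h * 1" using h by (intro mult_left_mono) auto
  finally show ?thesis by (simp add: h_def)
qed

lemma abs_le_max_norm_h:
  assumes "i \<in> {1..int M}" "j \<in> {1..int M}"
  shows "\<bar>v i j\<bar> \<le> max_norm_h M v"
  unfolding max_norm_h_def using assms
  by (intro Max_ge) (auto intro!: image_eqI[of _ _ "(i, j)"])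

lemma max_norm_h_le:
  assumes "\<And>i j. i \<in> {1..int M} \<Longrightarrow> j \<in> {1..int M} \<Longrightarrow> \<bar>v i j\<bar> \<le> B"
  shows "max_norm_h M v \<le> B"
  unfolding max_norm_h_def using assms M by (subst Max_le_iff) auto

text \<open>As \<open>u\<close> is real, the real part in \<open>P_M_grid\<close> may be taken of
  the whole difference, so the coefficients of \<open>v\<close> enter unmodified.\<close>

lemma grid_diff_P_M:
  assumes u: "u \<in> grid_fun M" and d: "hb L 1 modes2 (\<lambda>k. dft2 u k - fc L v k) B"
  shows "\<bar>u i j - P_M_grid L M v i j\<bar> \<le> l1c L * B"
proof -
  have "P_M L M v (grid_point L M i j) = (\<Sum>k\<in>modes2. fc L v k * wave2 k i j)"
    unfolding P_M_def sum_modes2 fc_def wave2_def ..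
  then have "u i j - P_M_grid L M v i j = Re (\<Sum>k\<in>modes2. (dft2 u k - fc L v k) * wave2 k i j)"
    unfolding P_M_grid_def left_diff_distrib sum_subtractf dft2_inversion[OF u, symmetric] by simp
  also have "\<bar>\<dots>\<bar> \<le> cmod (\<Sum>k\<in>modes2. (dft2 u k - fc L v k) * wave2 k i j)"
    by (rule abs_Re_le_cmod)
  also have "\<dots> \<le> (\<Sum>k\<in>modes2. cmod (dft2 u k - fc L v k))"
    by (rule order_trans[OF norm_sum]) (simp add: norm_mult wave2_def)
  also have "\<dots> \<le> l1c L * B" by (rule hb_l1[OF L d]) auto
  finally show ?thesis .
qed

lemma fully_discrete_coeffs:
  assumes u: "fully_discrete_solution L M \<epsilon> \<kappa> s a N t \<Phi>0 u" and n: "n \<in> {1..N}" and i: "i \<in> {1..s - 1}"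
    and k: "k \<in> modes2"
  shows "dft2 (u n (i + 1)) k = dft2 (u n 1) k + of_real (tau t n) *
        (\<Sum>j=1..i. of_real (a (i + 1) j) * rhs \<epsilon> \<kappa> (dft2 (u n j)) (dft2 (u n (j + 1))) k)"
proof -
  have "u n (i + 1) = (\<lambda>x y. u n 1 x y + tau t n * (\<Sum>q=1..i. a (i + 1) q * stage_rhs_h L M \<epsilon> \<kappa> (u n) q x y))"
    using u n i by (intro ext) (auto simp: fully_discrete_solution_def)
  then have "dft2 (u n (i + 1)) k = dft2 (u n 1) k + of_real (tau t n) *
      (\<Sum>q=1..i. of_real (a (i + 1) q) * dft2 (stage_rhs_h L M \<epsilon> \<kappa> (u n) q) k)"
    by (simp only: dft2_add dft2_cmult dft2_sum)
  also have "(\<Sum>q=1..i. of_real (a (i + 1) q) * dft2 (stage_rhs_h L M \<epsilon> \<kappa> (u n) q) k)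
      = (\<Sum>j=1..i. of_real (a (i + 1) j) * rhs \<epsilon> \<kappa> (dft2 (u n j)) (dft2 (u n (j + 1))) k)"
  proof (rule sum.cong[OF refl])
    fix q assume q: "q \<in> {1..i}"
    have "u n q \<in> grid_fun M" using u n i q by (auto simp: fully_discrete_solution_def)
    then show "of_real (a (i + 1) q) * dft2 (stage_rhs_h L M \<epsilon> \<kappa> (u n) q) k
        = of_real (a (i + 1) q) * rhs \<epsilon> \<kappa> (dft2 (u n q)) (dft2 (u n (q + 1))) k"
      by (simp only: dft2_stage_rhs_h[OF _ k])
  qed
  finally show ?thesis .
qed

end

theorem theorem4p2:
  fixes L \<epsilon> T \<kappa> C\<^sub>0 K\<^sub>1 K\<^sub>T K\<^sub>\<phi> :: real
    and m p s :: nat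
    and a :: "nat \<Rightarrow> nat \<Rightarrow> real"
    and \<Phi> :: "real \<Rightarrow> real \<times> real \<Rightarrow> real"
  assumes "L > 0" and "0 < \<epsilon>" and "\<epsilon> < 1" and "T > 0" and "\<kappa> \<ge> 0"
    and "m \<ge> 1" and "p \<ge> 1" and "C\<^sub>0 > 0"
    and "cahn_hilliard_solution L \<epsilon> T \<Phi>"
    and "regular_solution L T m p C\<^sub>0 \<Phi>"
    and "rierk_method s a"
    and "pos_def (D_R s a)"
    and "pos_def (the (mat_inverse (D_R s a)))"
    and "\<kappa> \<ge> (SUP \<xi>\<in>{\<xi>. \<bar>\<xi>\<bar> \<le> (K\<^sub>\<phi> + \<epsilon>\<^sup>2) / \<epsilon>\<^sup>2}. \<bar>deriv (deriv F) \<xi>\<bar>)"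
  shows "\<exists>h\<^sub>0>0. \<exists>\<tau>\<^sub>0>0. \<exists>C. \<forall>M N t U u.
     M > 0 \<longrightarrow> even M \<longrightarrow> L / real M \<le> h\<^sub>0 \<longrightarrow>
     time_mesh T N t \<longrightarrow> max_tau t N \<le> \<tau>\<^sub>0 \<longrightarrow> real N * max_tau t N \<le> K\<^sub>T * T \<longrightarrow>
     defects_bounded L \<epsilon> \<kappa> s a N t \<Phi> K\<^sub>1 \<longrightarrow>
     time_discrete_solution L \<epsilon> \<kappa> s a N t (\<Phi> 0) U \<longrightarrow>
     (\<forall>n\<in>{1..N}. \<forall>i\<in>{1..s}. max_norm_h M (P_M_grid L M (U n i)) \<le> K\<^sub>\<phi> / \<epsilon>\<^sup>2) \<longrightarrow>
     fully_discrete_solution L M \<epsilon> \<kappa> s a N t (\<Phi> 0) u \<longrightarrow>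
       (\<forall>n\<in>{1..N}. \<forall>i\<in>{1..s}. max_norm_h M (u n i) \<le> C) \<and>
       (\<forall>n\<in>{1..N}. \<forall>j\<in>{1..s-1}.
          energy_h L M \<epsilon> (u n (j + 1)) - energy_h L M \<epsilon> (u n 1)
            \<le> 1 / tau t n * (\<Sum>k=1..j.
                 inner_h L M (lap_h_inv L M (delta_stage (u n) (k + 1)))
                   (\<lambda>x y. \<Sum>l=1..k. d_R s a k l * delta_stage (u n) (l + 1) x y)))"
proof -
  define R where "R = C\<^sub>0 / L"
  have R: "R \<ge> 0" using assms(1,8) by (simp add: R_def)
  note L = assms(1) and eps = assms(2) and T = assms(4) and kap = assms(5)
    and r = assms(11) and pd = assms(12)
  have s2: "s \<ge> 2" using r by (simp add: rierk_method_def)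
  obtain \<psi> where
    \<phi>: "\<And>t. t \<in> {0..<T} \<Longrightarrow> \<Phi> t \<in> L2_per L \<and> hb L 2 UNIV (fc L (\<Phi> t)) R"
    and \<psi>: "\<And>t. t \<in> {0<..<T} \<Longrightarrow> hb L 2 UNIV (\<psi> t) R"
    and pde: "\<And>t k. t \<in> {0<..<T} \<Longrightarrow> \<psi> t k = spectral.rhs L UNIV (-) \<epsilon> \<kappa> (fc L (\<Phi> t)) (fc L (\<Phi> t)) k"
    and taylor: "\<And>b t. b \<in> {0<..<T} \<Longrightarrow> t \<in> {0..<T} \<Longrightarrow>
      hb L 1 UNIV (\<lambda>k. fc L (\<Phi> t) k - fc L (\<Phi> b) k - of_real (t - b) * \<psi> b k) (R / 2 * (t - b)\<^sup>2)"
    using solution_coeffs[OF L T assms(9,10,6,7), of \<kappa> thesis] unfolding R_def by blast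
  have \<Phi>0: "\<Phi> 0 \<in> L2_per L" "hb L 2 UNIV (fc L (\<Phi> 0)) R" using \<phi>[of 0] T by auto
  define A where "A = abscissa_sum s a + 1"
  have A: "A > 0" by (simp add: A_def abscissa_sum_def sum_nonneg add_nonneg_pos)
  define ref where "ref = reference a (\<lambda>t. fc L (\<Phi> t)) \<psi>"
  obtain C E where C: "C > 0" and E: "E > 0" and comp: "\<forall>K sg \<rho> N t c. aliasing L K sg \<rho> \<longrightarrow> time_mesh T N t \<longrightarrow>
    A * max_tau t N \<le> 1 \<longrightarrow>
    rk_stages K s a N t c (\<lambda>n j. spectral.rhs L K sg \<epsilon> \<kappa> (c n j) (c n (j + 1))) \<longrightarrow>
    (\<forall>n\<in>{1..<N}. \<forall>k\<in>K. c (n + 1) 1 k = c n s k) \<longrightarrow>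
    hb L 1 K (\<lambda>k. c 1 1 k - fc L (\<Phi> 0) k) (R / \<rho>) \<longrightarrow>
    C * (E * (max_tau t N + 1 / \<rho>)) \<le> 1 \<longrightarrow>
    (\<forall>n\<in>{1..N}. \<forall>i\<in>{1..s}. hb L 1 K (\<lambda>k. c n i k - ref t n i k) (C * (E * (max_tau t N + 1 / \<rho>))))"
    by (rule exE[OF reference_comparison[where T = T and \<phi> = "\<lambda>t. fc L (\<Phi> t)" and \<psi> = \<psi>, OF L eps kap r pd R]],
      erule conjunct2[OF \<phi>], erule \<psi>, erule pde, erule (1) taylor, elim exE conjE,
      rule that[unfolded A_def ref_def], assumption, assumption, assumption)
  \<comment> \<open>Error budget: \<open>C * \<eta> = 1 / (2 * l1c L + 1)\<close> meets the
    smallness condition of the comparison and makes two errors, multiplied by \<open>l1c L\<close>,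
    at most 1. The thresholds below give one half of \<open>\<eta> / E\<close> to the time step and
    one half to \<open>1 / rhoM\<close>.\<close>
  define \<eta> where "\<eta> = 1 / (C * (2 * l1c L + 1))"
  have l0: "l1c L \<ge> 0" by (rule l1c(1)[OF L])
  have \<eta>: "\<eta> > 0" unfolding \<eta>_def using C l0 by (intro divide_pos_pos mult_pos_pos) auto
  have C\<eta>: "C * \<eta> = 1 / (2 * l1c L + 1)" using C by (simp add: \<eta>_def)
  have C\<eta>1: "C * \<eta> \<le> 1" "l1c L * (C * \<eta> + C * \<eta>) \<le> 1"
    unfolding C\<eta> using l0 by (auto simp: field_simps)
  define h\<^sub>0 where "h\<^sub>0 = min 1 (\<eta> / (2 * E))"
  define \<tau>\<^sub>0 where "\<tau>\<^sub>0 = min (1 / A) (\<eta> / (2 * E))"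
  define B where "B = K\<^sub>\<phi> / \<epsilon>\<^sup>2 + 1"
  have B_eq: "(K\<^sub>\<phi> + \<epsilon>\<^sup>2) / \<epsilon>\<^sup>2 = B" using eps by (simp add: B_def add_divide_distrib)
  have pos: "h\<^sub>0 > 0" "\<tau>\<^sub>0 > 0" using \<eta> E A by (auto simp: h\<^sub>0_def \<tau>\<^sub>0_def)
  show ?thesis
  proof (rule exI[of _ h\<^sub>0], rule conjI[OF pos(1)], rule exI[of _ \<tau>\<^sub>0], rule conjI[OF pos(2)], rule exI[of _ B],
      intro allI impI conjI)
    fix M N t U u
    assume M: "M > 0" "even M" and h: "L / real M \<le> h\<^sub>0" and mesh: "time_mesh T N t"
      and \<tau>: "max_tau t N \<le> \<tau>\<^sub>0"
      and U: "time_discrete_solution L \<epsilon> \<kappa> s a N t (\<Phi> 0) U"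
      and UK: "\<forall>n\<in>{1..N}. \<forall>i\<in>{1..s}. max_norm_h M (P_M_grid L M (U n i)) \<le> K\<^sub>\<phi> / \<epsilon>\<^sup>2"
      and u: "fully_discrete_solution L M \<epsilon> \<kappa> s a N t (\<Phi> 0) u"
    interpret periodic_grid M L using M L by unfold_locales auto
    have N: "N \<ge> 1" using mesh by (simp add: time_mesh_def)
    have ug: "u n i \<in> grid_fun M" if "n \<in> {1..N}" "i \<in> {1..s}" for n i
      using u that by (auto simp: fully_discrete_solution_def)
    have A\<tau>: "A * max_tau t N \<le> 1"
    proof -
      have "A * max_tau t N \<le> A * (1 / A)" using \<tau> A by (intro mult_left_mono) (auto simp: \<tau>\<^sub>0_def)
      then show ?thesis using A by simp
    qed
    define e where "e = C * (E * (max_tau t N + 1 / rhoM))"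
    have e: "e \<le> C * \<eta>"
    proof -
      have "max_tau t N \<le> \<eta> / (2 * E)" using \<tau> by (simp add: \<tau>\<^sub>0_def)
      moreover have "1 / rhoM \<le> \<eta> / (2 * E)"
        using inverse_rhoM_le h by (simp add: h\<^sub>0_def)
      ultimately have "E * (max_tau t N + 1 / rhoM) \<le> E * (\<eta> / (2 * E) + \<eta> / (2 * E))"
        using E by (intro mult_left_mono add_mono) auto
      also have "\<dots> = \<eta>" using E by (simp add: field_simps)
      finally show ?thesis unfolding e_def using C by (intro mult_left_mono) auto
    qed
    have e1: "C * (E * (max_tau t N + 1 / rhoM)) \<le> 1" using e C\<eta>1(1) by (simp add: e_def)
    have Uref: "hb L 1 UNIV (\<lambda>k. fc L (U n i) k - ref t n i k) e" if "n \<in> {1..N}" "i \<in> {1..s}" for n i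
    proof -
      note tc = time_discrete_coeffs[OF L U \<Phi>0(1) s2 N]
      \<comment> \<open>\<open>U\<close> starts on \<open>\<Phi> 0\<close>, so its initial
        coefficient error is 0. The full lattice is used with the same \<open>rhoM\<close> as the
        grid, so that both comparisons give the same bound \<open>e\<close>.\<close>
      have "hb L 1 UNIV (\<lambda>k. fc L (U 1 1) k - fc L (\<Phi> 0) k) (R / rhoM)"
        using R rhoM_pos tc(2) by (simp add: wbound_def L2_set_def)
      from comp[THEN spec[of _ "UNIV"], THEN spec[of _ "(-)"], THEN spec[of _ rhoM], THEN spec[of _ N], THEN spec[of _ t],
          THEN spec[of _ "\<lambda>n i. fc L (U n i)"], THEN mp, THEN mp, THEN mp, THEN mp, THEN mp, THEN mp, THEN mp,
          OF aliasing_UNIV[OF L rhoM_pos] mesh A\<tau> _ _ this e1]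
      have "\<forall>n\<in>{1..N}. \<forall>i\<in>{1..s}. hb L 1 UNIV (\<lambda>k. fc L (U n i) k - ref t n i k) e"
        unfolding e_def using tc(1,3) by blast
      then show ?thesis using that by blast
    qed
    have uref: "hb L 1 modes2 (\<lambda>k. dft2 (u n i) k - ref t n i k) e" if "n \<in> {1..N}" "i \<in> {1..s}" for n i
    proof -
      have "u 1 1 = P_M_grid L M (\<Phi> 0)" using u by (simp add: fully_discrete_solution_def)
      then have "hb L 1 modes2 (\<lambda>k. dft2 (u 1 1) k - fc L (\<Phi> 0) k) (R / rhoM)"
        using dft2_P_M_grid[OF \<Phi>0(2)] by simp
      moreover have "\<forall>n\<in>{1..<N}. \<forall>k\<in>modes2. dft2 (u (n + 1) 1) k = dft2 (u n s) k"
        using u by (auto simp: fully_discrete_solution_def)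
      moreover have "\<forall>n\<in>{1..N}. \<forall>i\<in>{1..s - 1}. \<forall>k\<in>modes2. dft2 (u n (i + 1)) k = dft2 (u n 1) k + of_real (tau t n) *
          (\<Sum>j=1..i. of_real (a (i + 1) j) * rhs \<epsilon> \<kappa> (dft2 (u n j)) (dft2 (u n (j + 1))) k)"
        by (intro ballI fully_discrete_coeffs[OF u])
      ultimately have "\<forall>n\<in>{1..N}. \<forall>i\<in>{1..s}. hb L 1 modes2 (\<lambda>k. dft2 (u n i) k - ref t n i k) e"
        unfolding e_def by (intro comp[THEN spec[of _ "modes2"], THEN spec[of _ "sgM"], THEN spec[of _ rhoM], THEN spec[of _ N], THEN spec[of _ t],
          THEN spec[of _ "\<lambda>n i. dft2 (u n i)"], THEN mp, THEN mp, THEN mp, THEN mp, THEN mp, THEN mp, THEN mp] aliasing_modes2 mesh A\<tau> e1)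
      then show ?thesis using that by blast
    qed
    have bound: "\<bar>u n i x y\<bar> \<le> B" if n: "n \<in> {1..N}" and i: "i \<in> {1..s}" and xy: "x \<in> {1..int M}" "y \<in> {1..int M}" for n i x y
    proof -
      \<comment> \<open>The reference cancels, each solution being within \<open>e\<close> of
        it.\<close>
      have "hb L 1 modes2 (\<lambda>k. (dft2 (u n i) k - ref t n i k) - (fc L (U n i) k - ref t n i k)) (e + e)"
        by (intro wbound_diff uref[OF n i] wbound_subset[OF Uref[OF n i] subset_UNIV]) simp
      then have "hb L 1 modes2 (\<lambda>k. dft2 (u n i) k - fc L (U n i) k) (e + e)" by simp
      from grid_diff_P_M[OF ug[OF n i] this, of x y]
      have "\<bar>u n i x y - P_M_grid L M (U n i) x y\<bar> \<le> l1c L * (e + e)" .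
      also have "\<dots> \<le> l1c L * (C * \<eta> + C * \<eta>)" using e l0 by (intro mult_left_mono add_mono) auto
      also have "\<dots> \<le> 1" by (rule C\<eta>1)
      finally have "\<bar>u n i x y - P_M_grid L M (U n i) x y\<bar> \<le> 1" .
      moreover have "\<bar>P_M_grid L M (U n i) x y\<bar> \<le> K\<^sub>\<phi> / \<epsilon>\<^sup>2"
        using abs_le_max_norm_h[OF xy, of "P_M_grid L M (U n i)"] UK n i by (meson order_trans)
      ultimately show ?thesis unfolding B_def by linarith
    qed
    \<comment> \<open>\<open>K\<^sub>\<phi>\<close> is an arbitrary real, so the sign of
      \<open>B\<close> is read off from the bound just proved; it puts \<open>B\<close> itself into
      the set of the supremum.\<close>
    have "B \<ge> 0" using bound[of 1 1 1 1] N s2 M by simp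
    have \<kappa>: "3 * B\<^sup>2 - 1 \<le> \<kappa>"
    proof -
      \<comment> \<open>A real supremum dominates the values only over a bounded set, so boundedness
        is shown along with membership of the endpoint \<open>B\<close>, where \<open>F''\<close>
        equals \<open>3 B^2 - 1\<close>.\<close>
      have "\<bar>deriv (deriv F) B\<bar> \<le> (SUP \<xi>\<in>{\<xi>. \<bar>\<xi>\<bar> \<le> (K\<^sub>\<phi> + \<epsilon>\<^sup>2) / \<epsilon>\<^sup>2}. \<bar>deriv (deriv F) \<xi>\<bar>)"
      proof (rule cSUP_upper)
        show "B \<in> {\<xi>. \<bar>\<xi>\<bar> \<le> (K\<^sub>\<phi> + \<epsilon>\<^sup>2) / \<epsilon>\<^sup>2}" unfolding B_eq using \<open>B \<ge> 0\<close> by simp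
        show "bdd_above ((\<lambda>\<xi>. \<bar>deriv (deriv F) \<xi>\<bar>) ` {\<xi>. \<bar>\<xi>\<bar> \<le> (K\<^sub>\<phi> + \<epsilon>\<^sup>2) / \<epsilon>\<^sup>2})"
          unfolding B_eq
        proof (rule bdd_aboveI2)
          fix \<xi> assume "\<xi> \<in> {\<xi>. \<bar>\<xi>\<bar> \<le> B}"
          then have "\<bar>\<xi>\<bar>\<^sup>2 \<le> B\<^sup>2" by (intro power_mono) auto
          then show "\<bar>deriv (deriv F) \<xi>\<bar> \<le> 3 * B\<^sup>2 + 1" unfolding deriv_deriv_F by (simp add: abs_le_iff)
        qed
      qed
      then show ?thesis using assms(14) unfolding deriv_deriv_F by linarith
    qed
    show "\<forall>n\<in>{1..N}. \<forall>i\<in>{1..s}. max_norm_h M (u n i) \<le> B"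
      using bound by (auto intro!: max_norm_h_le)
    show "\<forall>n\<in>{1..N}. \<forall>j\<in>{1..s-1}.
          energy_h L M \<epsilon> (u n (j + 1)) - energy_h L M \<epsilon> (u n 1)
            \<le> 1 / tau t n * (\<Sum>k=1..j.
                 inner_h L M (lap_h_inv L M (delta_stage (u n) (k + 1)))
                   (\<lambda>x y. \<Sum>l=1..k. d_R s a k l * delta_stage (u n) (l + 1) x y))"
    proof (intro ballI)
      fix n j assume n: "n \<in> {1..N}" and j: "j \<in> {1..s-1}"
      show "energy_h L M \<epsilon> (u n (j + 1)) - energy_h L M \<epsilon> (u n 1)
            \<le> 1 / tau t n * (\<Sum>k=1..j.
                 inner_h L M (lap_h_inv L M (delta_stage (u n) (k + 1)))
                   (\<lambda>x y. \<Sum>l=1..k. d_R s a k l * delta_stage (u n) (l + 1) x y))"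
      proof (rule energy_law[OF r tau_pos[OF mesh n] ug[OF n] _ bound[OF n] \<kappa> j])
        show "u n (k + 1) x y = u n 1 x y + tau t n * (\<Sum>q=1..k. a (k + 1) q * stage_rhs_h L M \<epsilon> \<kappa> (u n) q x y)"
          if "k \<in> {1..s - 1}" for k x y
          using u n that by (simp add: fully_discrete_solution_def)
      qed
    qed
  qed
qed

end
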